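(* Let $K$ be an algebraically closed field and let $(k,n)$ be one of the following: $(k,n)=(2,4)$ with $\operatorname{char} K=0$; or $(k,n)=(2,6)$ with $\operatorname{char} K=0$; or $(k,n)=(2,5)$ with $\operatorname{char} K$ arbitrary. Let $d\ge 1$ be an integer. Then the normal bundle of a general rational curve of degree $d$ in the Grassmannian $G(k,n)$ over $K$ is balanced, except precisely in the following cases (that is, it is balanced if and only if none of the following holds): (i) $1<d<\min(k,n-k)$ or $\min(k,n-k)<d<\max(k,n-k)$; (ii) writing $d=kq_1+r_1$ with $0\le r_1<k$ and $d=(n-k)q_2+r_2$ with $0\le r_2<n-k$ (with $q_1,q_2,r_1,r_2$ integers), one has $d\ne 1$, $r_1\ne 0$, $r_2\ne 0$, and $q_1+q_2\le (k-r_1)(n-k-r_2)$; (iii) the characteristic of $K$ is $2$, $k=1$ or $k=n-1$, and $d\not\equiv 1 \pmod{n-2}$.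
   Context: $G(k,n)$ denotes the Grassmannian of $k$-dimensional linear subspaces of $K^n$. A rational curve of degree $d$ in $G(k,n)$ is given by a morphism $f:\mathbb{P}^1\to G(k,n)$ such that the pullback of the Plücker line bundle has degree $d$ (equivalently, $f^*S^*$ has degree $d$, where $S$ is the universal subbundle). When $f$ is unramified, its normal bundle is the vector bundle $N_{\mathbb{P}^1/G(k,n)}$ on $\mathbb{P}^1$ defined by the exact sequence $0\to T_{\mathbb{P}^1}\to f^*T_{G(k,n)}\to N_{\mathbb{P}^1/G(k,n)}\to 0$. "General" means: for all $f$ in some nonempty (dense) Zariski open subset of the irreducible space of degree $d$ morphisms $\mathbb{P}^1\to G(k,n)$. (In particular a general such $f$ is unramified.) Every vector bundle on $\mathbb{P}^1$ is isomorphic to a direct sum of line bundles $\bigoplus_i \mathcal{O}(a_i)$, with the multiset of degrees $a_i$ uniquely determined. The bundle is called balanced if $|a_i-a_j|\le 1$ for all $i,j$. *)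

theory Defs
  imports
    "HOL-Computational_Algebra.Polynomial"
    "HOL-Library.Multiset"
    "HOL-Number_Theory.Cong"
    "Jordan_Normal_Form.VS_Connect"
    "Jordan_Normal_Form.DL_Submatrix"
begin

section \<open>Binary forms and the projective line\<close>

text \<open>
  Closed points of the projective line are given by homogeneous coordinates
  \<open>(s, t) \<noteq> (0, 0)\<close>. A form of degree \<open>e\<close> in \<open>s, t\<close> is stored as the polynomial \<open>p\<close> of degree
  at most \<open>e\<close> with coefficients \<open>c\<^sub>i\<close>, standing for the sum of the \<open>c\<^sub>i s^(e - i) t^i\<close>. For
  negative \<open>e\<close> the only form is \<open>0\<close>, so \<open>forms e\<close> is the space of global sections of \<open>O(e)\<close> for
  every integer \<open>e\<close>.
\<close>

definition forms :: "int \<Rightarrow> 'a::zero poly set" where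
  "forms e = {p. p = 0 \<or> int (degree p) \<le> e}"

definition form_eval :: "nat \<Rightarrow> 'a::comm_ring_1 poly \<Rightarrow> 'a \<times> 'a \<Rightarrow> 'a" where
  "form_eval e p x = (\<Sum>i\<le>e. coeff p i * fst x ^ (e - i) * snd x ^ i)"

text \<open>The derivative at \<open>x\<close> in direction \<open>w\<close>; the truncated exponents only occur with
  coefficient \<open>0\<close>.\<close>

definition form_deriv :: "nat \<Rightarrow> 'a::comm_ring_1 poly \<Rightarrow> 'a \<times> 'a \<Rightarrow> 'a \<times> 'a \<Rightarrow> 'a" where
  "form_deriv e p x w =
     (\<Sum>i\<le>e. coeff p i *
        (of_nat (e - i) * fst x ^ (e - i - 1) * snd x ^ i * fst w +
         of_nat i * fst x ^ (e - i) * snd x ^ (i - 1) * snd w))"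

definition form_vec :: "nat \<Rightarrow> nat \<Rightarrow> (nat \<Rightarrow> 'a::comm_ring_1 poly) \<Rightarrow> 'a \<times> 'a \<Rightarrow> 'a vec" where
  "form_vec n e \<sigma> x = vec n (\<lambda>i. form_eval e (\<sigma> i) x)"

definition form_vec_deriv ::
    "nat \<Rightarrow> nat \<Rightarrow> (nat \<Rightarrow> 'a::comm_ring_1 poly) \<Rightarrow> 'a \<times> 'a \<Rightarrow> 'a \<times> 'a \<Rightarrow> 'a vec" where
  "form_vec_deriv n e \<sigma> x w = vec n (\<lambda>i. form_deriv e (\<sigma> i) x w)"


section \<open>The Grassmannian and its rational curves\<close>

definition grassmannian :: "nat \<Rightarrow> nat \<Rightarrow> 'a::field vec set set" where
  "grassmannian k n =
     {W. VectorSpace.subspace class_ring W (module_vec TYPE('a) n) \<and>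
         vectorspace.dim class_ring ((module_vec TYPE('a) n)\<lparr>carrier := W\<rparr>) = k}"

definition plucker_index :: "nat \<Rightarrow> nat \<Rightarrow> nat set set" where
  "plucker_index k n = {J. J \<subseteq> {..<n} \<and> card J = k}"

text \<open>\<open>p\<close> is a vector of homogeneous Pluecker coordinates of \<open>W\<close>: the maximal minors of a
  matrix whose rows form a basis of \<open>W\<close> (used for \<open>W\<close> of dimension \<open>k\<close>). Rescaling is absorbed
  by the choice of basis.\<close>

definition is_plucker :: "nat \<Rightarrow> nat \<Rightarrow> 'a::field vec set \<Rightarrow> (nat set \<Rightarrow> 'a) \<Rightarrow> bool" where
  "is_plucker k n W p \<longleftrightarrow>
     (\<exists>A \<in> carrier_mat k n. vec_space.row_space n A = W \<and>
        (\<forall>J \<in> plucker_index k n. p J = det (submatrix A UNIV J)))"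

text \<open>\<open>f\<close> is a morphism from the projective line to \<open>G(k,n)\<close> of degree \<open>d\<close>: its Pluecker
  coordinates are forms \<open>F J\<close> of degree \<open>d\<close>. These have no common zero, since the Pluecker
  coordinates of a \<open>k\<close>-dimensional subspace never vanish simultaneously; hence the pullback of
  the Pluecker line bundle is exactly \<open>O(d)\<close>. The value of \<open>f\<close> at \<open>(0, 0)\<close> is irrelevant.\<close>

definition rational_curve ::
    "nat \<Rightarrow> nat \<Rightarrow> nat \<Rightarrow> (nat set \<Rightarrow> 'a::field poly) \<Rightarrow> ('a \<times> 'a \<Rightarrow> 'a vec set) \<Rightarrow> bool" where
  "rational_curve k n d F f \<longleftrightarrow>
     (\<forall>J \<in> plucker_index k n. F J \<in> forms (int d)) \<and>
     (\<forall>J. J \<notin> plucker_index k n \<longrightarrow> F J = 0) \<and>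
     (\<forall>x. x \<noteq> (0, 0) \<longrightarrow>
        f x \<in> grassmannian k n \<and> is_plucker k n (f x) (\<lambda>J. form_eval d (F J) x))"

text \<open>The (cone over the) quasi-projective variety of degree \<open>d\<close> morphisms, a subset of the
  projective space with homogeneous coordinates the coefficients of the forms \<open>F J\<close>.\<close>

definition mor_space :: "nat \<Rightarrow> nat \<Rightarrow> nat \<Rightarrow> (nat set \<Rightarrow> 'a::field poly) set" where
  "mor_space k n d = {F. \<exists>f. rational_curve k n d F f}"

definition homogeneous_polyfun :: "'v set \<Rightarrow> nat \<Rightarrow> (('v \<Rightarrow> 'a::comm_ring_1) \<Rightarrow> 'a) \<Rightarrow> bool" where
  "homogeneous_polyfun V e h \<longleftrightarrow>
     (\<exists>c. h = (\<lambda>x. \<Sum>m \<in> {m. set_mset m \<subseteq> V \<and> size m = e}. c m * (\<Prod>v \<in># m. x v)))"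

definition zariski_open_mor ::
    "nat \<Rightarrow> nat \<Rightarrow> nat \<Rightarrow> (nat set \<Rightarrow> 'a::field poly) set \<Rightarrow> bool" where
  "zariski_open_mor k n d U \<longleftrightarrow>
     (\<exists>H. (\<forall>h \<in> H. \<exists>e. homogeneous_polyfun (plucker_index k n \<times> {..d}) e h) \<and>
          U = {F \<in> mor_space k n d. \<exists>h \<in> H. h (\<lambda>(J, i). coeff (F J) i) \<noteq> 0})"

definition for_general_curve ::
    "nat \<Rightarrow> nat \<Rightarrow> nat \<Rightarrow> (('a::field \<times> 'a \<Rightarrow> 'a vec set) \<Rightarrow> bool) \<Rightarrow> bool" where
  "for_general_curve k n d P \<longleftrightarrow>
     (\<exists>U. zariski_open_mor k n d U \<and> U \<noteq> {} \<and>
          (\<forall>F \<in> U. \<forall>f. rational_curve k n d F f \<longrightarrow> P f))"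


section \<open>The normal bundle\<close>

text \<open>
  Let \<open>S\<close> be the universal subbundle and \<open>Q\<close> the universal quotient bundle. The tangent bundle of
  \<open>G(k,n)\<close> is \<open>Hom(S, Q)\<close>, with fibre \<open>Hom(W, K\<^sup>n / W)\<close> at \<open>W\<close>. Elements of this fibre are
  represented by \<open>n \<times> n\<close> matrices \<open>M\<close> (restrict \<open>M\<close> to \<open>W\<close> and reduce modulo \<open>W\<close>); this
  presents \<open>f\<^sup>* T\<close> as the quotient of the trivial bundle with fibre \<open>K^(n \<times> n)\<close> by the
  matrices that map \<open>f x\<close> into itself.

  The tangent space of the projective line at \<open>x\<close> is \<open>K\<^sup>2 / Kx\<close> (up to a twist). The differential
  of \<open>f\<close> at \<open>x\<close> sends \<open>w\<close> to the homomorphism taking \<open>\<sigma>(x)\<close>, for a section \<open>\<sigma>\<close> of \<open>f\<^sup>* S\<close>, to the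
  class of the derivative of \<open>\<sigma>\<close> at \<open>x\<close> along \<open>w\<close>. It suffices to use sections of twists of
  \<open>f\<^sup>* S\<close>, that is, vectors of forms of one degree \<open>e\<close>: for large \<open>e\<close> their values span \<open>f x\<close>,
  and by Euler's formula the class depends only on \<open>w\<close> modulo \<open>Kx\<close>.
\<close>

definition sub_section ::
    "nat \<Rightarrow> ('a::field \<times> 'a \<Rightarrow> 'a vec set) \<Rightarrow> nat \<Rightarrow> (nat \<Rightarrow> 'a poly) \<Rightarrow> bool" where
  "sub_section n f e \<sigma> \<longleftrightarrow>
     (\<forall>i < n. \<sigma> i \<in> forms (int e)) \<and> (\<forall>y. y \<noteq> (0, 0) \<longrightarrow> form_vec n e \<sigma> y \<in> f y)"

definition represents_differential ::
    "nat \<Rightarrow> ('a::field \<times> 'a \<Rightarrow> 'a vec set) \<Rightarrow> 'a \<times> 'a \<Rightarrow> 'a \<times> 'a \<Rightarrow> 'a mat \<Rightarrow> bool" where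
  "represents_differential n f x w M \<longleftrightarrow>
     (\<forall>e \<sigma>. sub_section n f e \<sigma> \<longrightarrow>
        M *\<^sub>v form_vec n e \<sigma> x - form_vec_deriv n e \<sigma> x w \<in> f x)"

definition unramified :: "nat \<Rightarrow> ('a::field \<times> 'a \<Rightarrow> 'a vec set) \<Rightarrow> bool" where
  "unramified n f \<longleftrightarrow>
     (\<forall>x w. x \<noteq> (0, 0) \<longrightarrow> represents_differential n f x w (0\<^sub>m n n) \<longrightarrow>
        (\<exists>c. w = (c * fst x, c * snd x)))"

text \<open>The normal bundle, the cokernel of the differential from \<open>T\<close> of the line to \<open>f\<^sup>* T\<close>, is thus
  the quotient of the trivial bundle of \<open>n \<times> n\<close> matrices whose fibre at \<open>x\<close> is
  \<open>K^(n \<times> n) / normal_relations n f x\<close>.\<close>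

definition normal_relations ::
    "nat \<Rightarrow> ('a::field \<times> 'a \<Rightarrow> 'a vec set) \<Rightarrow> 'a \<times> 'a \<Rightarrow> 'a mat set" where
  "normal_relations n f x = {M \<in> carrier_mat n n. \<exists>w. represents_differential n f x w M}"

text \<open>
  A homomorphism from the trivial bundle of \<open>n \<times> n\<close> matrices to the direct sum of the \<open>O(a)\<close>, for
  \<open>a\<close> in the list \<open>as\<close>, is a family \<open>g\<close> of forms, \<open>g l i j\<close> being of degree \<open>as ! l\<close>. It induces an
  isomorphism from the quotient bundle with relations \<open>B\<close> iff at each closed point it is surjective
  with kernel \<open>B x\<close>.
\<close>

definition matrix_hom ::
    "nat \<Rightarrow> int list \<Rightarrow> (nat \<Rightarrow> nat \<Rightarrow> nat \<Rightarrow> 'a::field poly) \<Rightarrow> 'a \<times> 'a \<Rightarrow> 'a mat \<Rightarrow> 'a vec" where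
  "matrix_hom n as g x M =
     vec (length as)
       (\<lambda>l. \<Sum>i<n. \<Sum>j<n. form_eval (nat (as ! l)) (g l i j) x * M $$ (i, j))"

definition quotient_bundle_splits ::
    "nat \<Rightarrow> ('a::field \<times> 'a \<Rightarrow> 'a mat set) \<Rightarrow> int list \<Rightarrow> bool" where
  "quotient_bundle_splits n B as \<longleftrightarrow>
     (\<exists>g. (\<forall>l < length as. \<forall>i < n. \<forall>j < n. g l i j \<in> forms (as ! l)) \<and>
          (\<forall>x. x \<noteq> (0, 0) \<longrightarrow>
             matrix_hom n as g x ` carrier_mat n n = carrier_vec (length as) \<and>
             {M \<in> carrier_mat n n. matrix_hom n as g x M = 0\<^sub>v (length as)} = B x))"

definition balanced_normal_bundle :: "nat \<Rightarrow> ('a::field \<times> 'a \<Rightarrow> 'a vec set) \<Rightarrow> bool" where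
  "balanced_normal_bundle n f \<longleftrightarrow>
     (\<exists>as. quotient_bundle_splits n (normal_relations n f) as \<and>
           (\<forall>a \<in> set as. \<forall>b \<in> set as. \<bar>a - b\<bar> \<le> 1))"

end

theory Submission
  imports Defs "Jordan_Normal_Form.DL_Rank_Submatrix"
begin

text \<open>
  On the projective line the pullback of the universal subbundle splits, so a curve of degree \<open>d\<close> in
  \<open>G(2,n)\<close> is spanned by two vectors of forms \<open>\<sigma>\<^sub>0, \<sigma>\<^sub>1\<close> whose degrees \<open>e\<^sub>0, e\<^sub>1\<close> add up to \<open>d\<close>. Conormal
  vectors twisted by \<open>O(m)\<close> are the \<open>z\<^sub>0 \<otimes> \<sigma>\<^sub>0 + z\<^sub>1 \<otimes> \<sigma>\<^sub>1\<close> with \<open>z\<^sub>a\<close> of degree \<open>m - e\<^sub>a\<close>, orthogonal to both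
  \<open>\<sigma>\<^sub>b\<close> and with \<open>z\<^sub>0 \<sigma>\<^sub>0' + z\<^sub>1 \<sigma>\<^sub>1' = 0\<close>. Counting equations bounds the dimension of this space from
  below; if it attains the expected value for suitable \<open>m\<close>, then \<open>f\<close> is unramified and the normal
  bundle is balanced. Upper bounds for the dimension are open conditions on the Pluecker coordinates,
  so one curve for every degree suffices. It is found as a general member of a pencil whose special
  member has monomial-like tangent pairings \<open>\<zeta>\<^sub>j \<sigma>\<^sub>a'\<close> (where the \<open>\<zeta>\<^sub>j\<close> generate the vectors orthogonal to
  \<open>\<sigma>\<^sub>0, \<sigma>\<^sub>1\<close>): independence can then be read off from lowest exponents. In the exceptional cases
  \<open>n = 6\<close>, \<open>d = 3, 5\<close> every curve has an unexpected section \<open>z\<^sub>a \<otimes> \<sigma>\<^sub>a\<close>, which a balanced bundle could not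
  accommodate.
\<close>

section \<open>Homogeneous linear systems\<close>

text \<open>Write \<open>N\<close> for the normal bundle. It is given as a quotient of a trivial
  bundle of matrices, so homomorphisms from it to \<open>O(m)\<close> are visible as matrices of
  forms; these are the conormal sections, and only they are studied. \<open>N\<close> has rank
  \<open>2 * n - 5\<close> and degree \<open>n * d - 2\<close>; if it is the sum of the
  \<open>O(a)\<close>, then \<open>Hom(N, O(m))\<close> has dimension the sum of the max(0, m + 1 -
  a). Three twists decide: with \<open>a\<close> the least expected degree, twist
  \<open>a - 1\<close> must have no section, twist \<open>a\<close> as many as there are expected
  summands \<open>O(a)\<close>, and in twist \<open>a + 2\<close>, which is at least 2, ramification
  would show up as an excess. The obstacle to openness is that the two spanning vectors and their
  degrees are not functions of the Pluecker coordinates and may jump in a family. A section is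
  therefore replaced by the matrix that it represents, whose defining equations are linear in the
  Pluecker coordinates. In the examples all tangent pairings but one account for the normal degrees;
  the remaining one must have its lowest exponent equal to its maximal degree, since the degrees add
  up to \<open>n * d - 2\<close>.\<close>

definition solution_basis :: "('q \<Rightarrow> 'i \<Rightarrow> 'a::field) \<Rightarrow> 'i set \<Rightarrow> 'q set \<Rightarrow> 'i set \<Rightarrow> ('i \<Rightarrow> 'i \<Rightarrow> 'a) \<Rightarrow> bool" where
  "solution_basis A I Q Fr X \<longleftrightarrow> Fr \<subseteq> I \<and>
    (\<forall>j\<in>Fr. \<forall>i. i \<notin> I \<longrightarrow> X j i = 0) \<and>
    (\<forall>j\<in>Fr. \<forall>q\<in>Q. (\<Sum>i\<in>I. A q i * X j i) = 0) \<and>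
    (\<forall>j\<in>Fr. \<forall>j'\<in>Fr. X j j' = (if j = j' then 1 else 0)) \<and>
    (\<forall>x. (\<forall>q\<in>Q. (\<Sum>i\<in>I. A q i * x i) = 0) \<longrightarrow> (\<forall>j\<in>Fr. x j = 0) \<longrightarrow> (\<forall>i\<in>I. x i = 0))"

text \<open>Elimination, one equation at a time. \<open>Fr\<close> is the set of free variables and
  \<open>X\<close> the reduced basis indexed by it, so a solution is determined by its free
  coordinates. A new equation either holds on all of \<open>X\<close> or costs one free
  variable.\<close>

lemma homogeneous_system_solution:
  fixes A :: "'q \<Rightarrow> 'i \<Rightarrow> 'a::field"
  assumes "finite I" "finite Q"
  shows "\<exists>Fr X. solution_basis A I Q Fr X \<and> card I \<le> card Fr + card Q"
  using assms(2)
proof (induction Q rule: finite_induct)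
  case empty
  have "solution_basis A I {} I (\<lambda>j i. if j = i then 1 else 0)"
    unfolding solution_basis_def by auto
  then show ?case by auto
next
  case (insert q Q)
  then obtain Fr X where FX: "solution_basis A I Q Fr X" and cI: "card I \<le> card Fr + card Q"
    by blast
  from FX have Fr: "Fr \<subseteq> I"
    and X: "\<And>j i. j \<in> Fr \<Longrightarrow> i \<notin> I \<Longrightarrow> X j i = 0"
      "\<And>j q. j \<in> Fr \<Longrightarrow> q \<in> Q \<Longrightarrow> (\<Sum>i\<in>I. A q i * X j i) = 0"
      "\<And>j j'. j \<in> Fr \<Longrightarrow> j' \<in> Fr \<Longrightarrow> X j j' = (if j = j' then 1 else 0)"
    unfolding solution_basis_def by simp_all
  have U: "\<forall>i\<in>I. x i = 0" if "\<forall>q\<in>Q. (\<Sum>i\<in>I. A q i * x i) = 0" "\<forall>j\<in>Fr. x j = 0" for x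
    using FX that unfolding solution_basis_def by (elim conjE) (drule spec, drule mp, assumption, drule mp, assumption)
  define c where "c j = (\<Sum>i\<in>I. A q i * X j i)" for j
  have finFr: "finite Fr" using Fr assms(1) finite_subset by blast
  show ?case
  proof (cases "\<forall>j\<in>Fr. c j = 0")
    case True
    have "solution_basis A I (insert q Q) Fr X"
      unfolding solution_basis_def
    proof (intro conjI ballI allI impI)
      fix j p assume "j \<in> Fr" "p \<in> insert q Q"
      then show "(\<Sum>i\<in>I. A p i * X j i) = 0" using X(2) True c_def by auto
    next
      fix x i assume "\<forall>p\<in>insert q Q. (\<Sum>i\<in>I. A p i * x i) = 0" "\<forall>j\<in>Fr. x j = 0" "i \<in> I"
      then show "x i = 0" using U by blast
    qed (use Fr X in blast)+
    then show ?thesis using cI insert.hyps by auto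
  next
    case False
    then obtain j0 where j0: "j0 \<in> Fr" "c j0 \<noteq> 0" by blast
    \<comment> \<open>\<open>X j0\<close> violates the new equation; subtracting multiples of it
      makes the other basis vectors satisfy it, and \<open>j0\<close> stops being free.\<close>
    define Y where "Y j = (\<lambda>i. X j i - c j / c j0 * X j0 i)" for j
    have lin: "(\<Sum>i\<in>I. A p i * Y j i) = (\<Sum>i\<in>I. A p i * X j i) - c j / c j0 * (\<Sum>i\<in>I. A p i * X j0 i)" for p j
      by (simp add: Y_def right_diff_distrib sum_subtractf sum_distrib_left mult.left_commute)
    have "card Fr = Suc (card (Fr - {j0}))"
      using j0(1) finFr by (metis card_Suc_Diff1)
    then have cd: "card I \<le> card (Fr - {j0}) + card (insert q Q)"
      using cI insert.hyps by simp
    have uq: "\<forall>i\<in>I. x i = 0"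
      if x: "\<forall>p\<in>insert q Q. (\<Sum>i\<in>I. A p i * x i) = 0" "\<forall>j\<in>Fr - {j0}. x j = 0" for x
    proof -
      define y where "y i = x i - x j0 * X j0 i" for i
      have y1: "(\<Sum>i\<in>I. A p i * y i) = (\<Sum>i\<in>I. A p i * x i) - x j0 * (\<Sum>i\<in>I. A p i * X j0 i)" for p
        by (simp add: y_def right_diff_distrib sum_subtractf sum_distrib_left mult.left_commute)
      have "\<forall>i\<in>I. y i = 0"
      proof (rule U)
        show "\<forall>p\<in>Q. (\<Sum>i\<in>I. A p i * y i) = 0"
          using x(1) X(2) j0(1) by (simp add: y1)
        show "\<forall>j\<in>Fr. y j = 0"
          using x(2) X(3) j0(1) by (auto simp: y_def)
      qed
      then have "(\<Sum>i\<in>I. A q i * y i) = 0" by simp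
      then have "x j0 * c j0 = 0" using x(1) y1[of q] by (simp add: c_def)
      then have "x j0 = 0" using j0(2) by simp
      with \<open>\<forall>i\<in>I. y i = 0\<close> show ?thesis by (simp add: y_def)
    qed
    have Y: "Y j i = 0" if "j \<in> Fr" "i \<notin> I" for j i
      using X(1) j0 that by (simp add: Y_def)
    have Yq: "(\<Sum>i\<in>I. A p i * Y j i) = 0" if "j \<in> Fr" "p \<in> insert q Q" for j p
      unfolding lin using X(2) j0 that by (auto simp flip: c_def)
    have Yd: "Y j j' = (if j = j' then 1 else 0)" if "j \<in> Fr - {j0}" "j' \<in> Fr - {j0}" for j j'
      using X(3)[of j j'] X(3)[of j0 j'] j0(1) that by (auto simp: Y_def)
    have "solution_basis A I (insert q Q) (Fr - {j0}) Y"
      unfolding solution_basis_def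
    proof (intro conjI ballI allI impI)
      show "Fr - {j0} \<subseteq> I" using Fr by blast
    next
      fix x i assume "\<forall>p\<in>insert q Q. (\<Sum>i\<in>I. A p i * x i) = 0" "\<forall>j\<in>Fr - {j0}. x j = 0" "i \<in> I"
      then show "x i = 0" using uq by blast
    qed (use Y Yq Yd in auto)
    with cd show ?thesis by blast
  qed
qed

lemma underdetermined_system:
  fixes A :: "'q \<Rightarrow> 'i \<Rightarrow> 'a::field"
  assumes "finite I" "finite Q" "card Q < card I"
  obtains x where "\<forall>q\<in>Q. (\<Sum>i\<in>I. A q i * x i) = 0" "\<exists>i\<in>I. x i \<noteq> 0" "\<And>i. i \<notin> I \<Longrightarrow> x i = 0"
proof -
  obtain Fr X where FX: "solution_basis A I Q Fr X" and cI: "card I \<le> card Fr + card Q"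
    using homogeneous_system_solution[OF assms(1,2), of A] by blast
  have "Fr \<noteq> {}" using cI assms(3) by auto
  then obtain j where j: "j \<in> Fr" by blast
  show thesis
  proof (rule that[of "X j"])
    show "\<forall>q\<in>Q. (\<Sum>i\<in>I. A q i * X j i) = 0" "\<And>i. i \<notin> I \<Longrightarrow> X j i = 0"
      using FX j unfolding solution_basis_def by blast+
    show "\<exists>i\<in>I. X j i \<noteq> 0"
      using FX j by (intro bexI[of _ j]) (auto simp: solution_basis_def)
  qed
qed

text \<open>A smallest set of equations that still forces the zero solution has exactly
  \<open>card I\<close> members: with fewer there is a nonzero solution, with more the rows are
  dependent and one equation follows from the others.\<close>

lemma injective_system_square_subsystem:
  fixes A :: "'q \<Rightarrow> 'i \<Rightarrow> 'a::field"
  assumes "finite I" "finite Q"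
    and inj: "\<forall>x. (\<forall>q\<in>Q. (\<Sum>i\<in>I. A q i * x i) = 0) \<longrightarrow> (\<forall>i\<in>I. x i = 0)"
  obtains S where "S \<subseteq> Q" "card S = card I"
    "\<And>x. (\<forall>q\<in>S. (\<Sum>i\<in>I. A q i * x i) = 0) \<Longrightarrow> (\<forall>i\<in>I. x i = 0)"
proof -
  define P where "P S \<longleftrightarrow> S \<subseteq> Q \<and> (\<forall>x. (\<forall>q\<in>S. (\<Sum>i\<in>I. A q i * x i) = 0) \<longrightarrow> (\<forall>i\<in>I. x i = 0))" for S
  have "P Q" unfolding P_def using inj by blast
  then obtain S where S: "P S" and minS: "\<And>T. P T \<Longrightarrow> card S \<le> card T"
    using ex_has_least_nat[of P Q card] by blast
  have finS: "finite S" using S assms(2) finite_subset by (auto simp: P_def)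
  have 1: "card I \<le> card S"
  proof (rule ccontr)
    assume "\<not> card I \<le> card S"
    then have "card S < card I" by simp
    from underdetermined_system[OF assms(1) finS this, of A] obtain x
      where "\<forall>q\<in>S. (\<Sum>i\<in>I. A q i * x i) = 0" "\<exists>i\<in>I. x i \<noteq> 0" .
    with S show False unfolding P_def by blast
  qed
  have 2: "card S \<le> card I"
  proof (rule ccontr)
    assume "\<not> card S \<le> card I"
    then have "card I < card S" by simp
    \<comment> \<open>The transposed system is underdetermined, which yields a linear relation
      \<open>y\<close> among the equations.\<close>
    from underdetermined_system[OF finS assms(1) this, of "\<lambda>i q. A q i"] obtain y
      where y: "\<forall>i\<in>I. (\<Sum>q\<in>S. A q i * y q) = 0" "\<exists>q\<in>S. y q \<noteq> 0" .
    then obtain p where p: "p \<in> S" "y p \<noteq> 0" by blast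
    have "P (S - {p})"
      unfolding P_def
    proof (intro conjI allI impI)
      show "S - {p} \<subseteq> Q" using S by (auto simp: P_def)
      fix x assume x: "\<forall>q\<in>S - {p}. (\<Sum>i\<in>I. A q i * x i) = 0"
      have "(\<Sum>q\<in>S. y q * (\<Sum>i\<in>I. A q i * x i)) = (\<Sum>i\<in>I. (\<Sum>q\<in>S. A q i * y q) * x i)"
        unfolding sum_distrib_left sum_distrib_right by (subst sum.swap) (simp add: mult_ac)
      also have "\<dots> = 0" using y by simp
      finally have "y p * (\<Sum>i\<in>I. A p i * x i) + (\<Sum>q\<in>S - {p}. y q * (\<Sum>i\<in>I. A q i * x i)) = 0"
        using p(1) finS by (simp add: sum.remove)
      then have "(\<Sum>i\<in>I. A p i * x i) = 0" using x p(2) by simp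
      with x have "\<forall>q\<in>S. (\<Sum>i\<in>I. A q i * x i) = 0" by blast
      with S show "\<forall>i\<in>I. x i = 0" unfolding P_def by blast
    qed
    from minS[OF this] p(1) finS show False
      by (metis card_Diff1_less not_le)
  qed
  show thesis
  proof (rule that)
    show "S \<subseteq> Q" using S unfolding P_def by blast
    show "card S = card I" using 1 2 by simp
    fix x assume "\<forall>q\<in>S. (\<Sum>i\<in>I. A q i * x i) = 0"
    with S show "\<forall>i\<in>I. x i = 0" unfolding P_def by blast
  qed
qed

lemma det_nonzero_iff_injective:
  fixes B :: "nat \<Rightarrow> nat \<Rightarrow> 'a::field"
  shows "det (mat N N (\<lambda>(i, j). B i j)) \<noteq> 0 \<longleftrightarrow>
    (\<forall>x. (\<forall>i<N. (\<Sum>j<N. B i j * x j) = 0) \<longrightarrow> (\<forall>j<N. x j = 0))"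
proof -
  let ?A = "mat N N (\<lambda>(i, j). B i j)"
  have A: "?A \<in> carrier_mat N N" by simp
  have mv: "?A *\<^sub>v v = 0\<^sub>v N \<longleftrightarrow> (\<forall>i<N. (\<Sum>j<N. B i j * v $ j) = 0)" if "v \<in> carrier_vec N" for v
    using that by (auto simp: vec_eq_iff scalar_prod_def atLeast0LessThan)
  have "det ?A = 0 \<longleftrightarrow> (\<exists>v. v \<in> carrier_vec N \<and> v \<noteq> 0\<^sub>v N \<and> ?A *\<^sub>v v = 0\<^sub>v N)"
    using det_0_iff_vec_prod_zero_field[OF A] by blast
  also have "\<dots> \<longleftrightarrow> (\<exists>x. (\<forall>i<N. (\<Sum>j<N. B i j * x j) = 0) \<and> (\<exists>j<N. x j \<noteq> 0))"
  proof
    assume "\<exists>v. v \<in> carrier_vec N \<and> v \<noteq> 0\<^sub>v N \<and> ?A *\<^sub>v v = 0\<^sub>v N"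
    then obtain v where v: "v \<in> carrier_vec N" "v \<noteq> 0\<^sub>v N" "?A *\<^sub>v v = 0\<^sub>v N" by blast
    then have "\<exists>j<N. v $ j \<noteq> 0" by (auto simp: vec_eq_iff)
    with v mv show "\<exists>x. (\<forall>i<N. (\<Sum>j<N. B i j * x j) = 0) \<and> (\<exists>j<N. x j \<noteq> 0)"
      by (intro exI[of _ "\<lambda>j. v $ j"]) auto
  next
    assume "\<exists>x. (\<forall>i<N. (\<Sum>j<N. B i j * x j) = 0) \<and> (\<exists>j<N. x j \<noteq> 0)"
    then obtain x where x: "\<forall>i<N. (\<Sum>j<N. B i j * x j) = 0" "\<exists>j<N. x j \<noteq> 0" by blast
    have "?A *\<^sub>v vec N x = 0\<^sub>v N"
      using mv[of "vec N x"] x by simp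
    moreover have "vec N x \<noteq> 0\<^sub>v N"
    proof
      assume h: "vec N x = 0\<^sub>v N"
      from x obtain j where "j < N" "x j \<noteq> 0" by blast
      then show False using arg_cong[OF h, of "\<lambda>v. v $ j"] by simp
    qed
    ultimately show "\<exists>v. v \<in> carrier_vec N \<and> v \<noteq> 0\<^sub>v N \<and> ?A *\<^sub>v v = 0\<^sub>v N"
      by (intro exI[of _ "vec N x"]) auto
  qed
  finally show ?thesis by blast
qed

text \<open>A determinant certifies injectivity of a whole family of systems at once.\<close>

lemma injective_system_det:
  fixes A :: "'q \<Rightarrow> 'i \<Rightarrow> 'a::field"
  assumes "finite I" "finite Q"
    and inj: "\<forall>x. (\<forall>q\<in>Q. (\<Sum>i\<in>I. A q i * x i) = 0) \<longrightarrow> (\<forall>i\<in>I. x i = 0)"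
  shows "\<exists>s t. (\<forall>k<card I. s k \<in> Q \<and> t k \<in> I) \<and>
    det (mat (card I) (card I) (\<lambda>(k, l). A (s k) (t l))) \<noteq> 0 \<and>
    (\<forall>B x. det (mat (card I) (card I) (\<lambda>(k, l). B (s k) (t l) :: 'a)) \<noteq> 0 \<longrightarrow>
       (\<forall>q\<in>Q. (\<Sum>i\<in>I. B q i * x i) = 0) \<longrightarrow> (\<forall>i\<in>I. x i = 0))"
proof -
  obtain S where S: "S \<subseteq> Q" "card S = card I"
    and Si: "\<And>x. (\<forall>q\<in>S. (\<Sum>i\<in>I. A q i * x i) = 0) \<Longrightarrow> (\<forall>i\<in>I. x i = 0)"
    by (rule injective_system_square_subsystem[OF assms]) (rule that)
  have finS: "finite S" using S(1) assms(2) finite_subset by blast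
  obtain s where s: "bij_betw s {..<card I} S"
    using ex_bij_betw_nat_finite[OF finS] S(2) by (auto simp: atLeast0LessThan)
  obtain t where t: "bij_betw t {..<card I} I"
    using ex_bij_betw_nat_finite[OF assms(1)] by (auto simp: atLeast0LessThan)
  have sm: "(\<Sum>l<card I. B q (t l) * x (t l)) = (\<Sum>i\<in>I. B q i * x i)" for B :: "'q \<Rightarrow> 'i \<Rightarrow> 'a" and q x
    by (rule sum.reindex_bij_betw[OF t])
  have sS: "s k \<in> S" "t k \<in> I" if "k < card I" for k
    using that s t by (auto simp: bij_betw_def)
  have tI: "\<exists>l<card I. i = t l" if "i \<in> I" for i
    using that t by (auto simp: bij_betw_def)
  have key: "\<forall>i\<in>I. x i = 0"
    if d: "det (mat (card I) (card I) (\<lambda>(k, l). B (s k) (t l))) \<noteq> 0"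
      and q: "\<forall>q\<in>Q. (\<Sum>i\<in>I. B q i * x i) = 0" for B :: "'q \<Rightarrow> 'i \<Rightarrow> 'a" and x
  proof -
    have "(\<Sum>l<card I. B (s k) (t l) * x (t l)) = 0" if "k < card I" for k
      unfolding sm using sS(1)[OF that] S(1) by (intro bspec[OF q]) auto
    then have "x (t l) = 0" if "l < card I" for l
      using det_nonzero_iff_injective[THEN iffD1, OF d, rule_format, of "\<lambda>l. x (t l)", OF _ that] by simp
    then show ?thesis using tI by metis
  qed
  have "det (mat (card I) (card I) (\<lambda>(k, l). A (s k) (t l))) \<noteq> 0"
    unfolding det_nonzero_iff_injective
  proof (intro allI impI)
    fix x l assume x: "\<forall>k<card I. (\<Sum>l<card I. A (s k) (t l) * x l) = 0" and l: "l < card I"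
    define y where "y i = x (the_inv_into {..<card I} t i)" for i
    have yt: "y (t l) = x l" if "l < card I" for l
      using t that by (simp add: y_def bij_betw_def the_inv_into_f_f)
    have "(\<Sum>i\<in>I. A q i * y i) = 0" if "q \<in> S" for q
    proof -
      from that obtain k where k: "k < card I" "q = s k" using s by (auto simp: bij_betw_def)
      have "(\<Sum>i\<in>I. A q i * y i) = (\<Sum>l<card I. A (s k) (t l) * x l)"
        unfolding k(2) sm[symmetric] by (intro sum.cong) (simp_all add: yt)
      then show ?thesis using x[rule_format, OF k(1)] by simp
    qed
    then have "\<forall>i\<in>I. y i = 0" by (intro Si ballI)
    then show "x l = 0" using sS(2)[OF l] yt[OF l] by metis
  qed
  moreover have "\<forall>k<card I. s k \<in> Q \<and> t k \<in> I"
    using sS S(1) by blast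
  ultimately show ?thesis
    by (intro exI[of _ s] exI[of _ t] conjI allI impI) (blast, blast, assumption, rule key)
qed

text \<open>The minor that certifies injectivity at parameter 0 is a polynomial in the parameter
  that is nonzero at 0; \<open>Bad\<close> is its set of roots.\<close>

lemma injective_pencil:
  fixes A B :: "'q \<Rightarrow> 'i \<Rightarrow> 'a::field"
  assumes "finite I" "finite Q"
    and inj: "\<forall>x. (\<forall>q\<in>Q. (\<Sum>i\<in>I. A q i * x i) = 0) \<longrightarrow> (\<forall>i\<in>I. x i = 0)"
  shows "\<exists>Bad. finite Bad \<and> (\<forall>\<epsilon>. \<epsilon> \<notin> Bad \<longrightarrow>
    (\<forall>x. (\<forall>q\<in>Q. (\<Sum>i\<in>I. (A q i + \<epsilon> * B q i) * x i) = 0) \<longrightarrow> (\<forall>i\<in>I. x i = 0)))"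
proof -
  obtain s t where d: "det (mat (card I) (card I) (\<lambda>(k, l). A (s k) (t l))) \<noteq> 0"
    and st: "\<forall>B x. det (mat (card I) (card I) (\<lambda>(k, l). B (s k) (t l) :: 'a)) \<noteq> 0 \<longrightarrow>
       (\<forall>q\<in>Q. (\<Sum>i\<in>I. B q i * x i) = 0) \<longrightarrow> (\<forall>i\<in>I. x i = 0)"
    using injective_system_det[OF assms] by (elim exE conjE) (rule that)
  define M where "M = mat (card I) (card I) (\<lambda>(k, l). [:A (s k) (t l), B (s k) (t l):])"
  have ev: "poly (det M) \<epsilon> = det (mat (card I) (card I) (\<lambda>(k, l). A (s k) (t l) + \<epsilon> * B (s k) (t l)))" for \<epsilon>
  proof -
    interpret comm_ring_hom "\<lambda>p. poly p \<epsilon>" by unfold_locales auto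
    have "map_mat (\<lambda>p. poly p \<epsilon>) M = mat (card I) (card I) (\<lambda>(k, l). A (s k) (t l) + \<epsilon> * B (s k) (t l))"
      by (rule eq_matI) (auto simp: M_def)
    then show ?thesis using hom_det[of M] by simp
  qed
  have "poly (det M) 0 \<noteq> 0" using d ev[of 0] by simp
  then have "det M \<noteq> 0" by auto
  then have "finite {\<epsilon>. poly (det M) \<epsilon> = 0}" by (rule poly_roots_finite)
  moreover have "\<forall>i\<in>I. x i = 0"
    if "\<epsilon> \<notin> {\<epsilon>. poly (det M) \<epsilon> = 0}" "\<forall>q\<in>Q. (\<Sum>i\<in>I. (A q i + \<epsilon> * B q i) * x i) = 0" for \<epsilon> x
  proof (rule st[THEN spec, THEN spec, THEN mp, THEN mp])
    show "det (mat (card I) (card I) (\<lambda>(k, l). A (s k) (t l) + \<epsilon> * B (s k) (t l))) \<noteq> 0"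
      using that(1) ev[of \<epsilon>] by simp
  qed (rule that(2))
  ultimately show ?thesis by blast
qed

section \<open>Forms on the projective line\<close>

lemma forms_iff_coeff: "p \<in> forms e \<longleftrightarrow> (\<forall>k. e < int k \<longrightarrow> coeff p k = 0)"
proof
  assume "p \<in> forms e"
  then show "\<forall>k. e < int k \<longrightarrow> coeff p k = 0"
    by (cases "p = 0") (auto simp: forms_def intro!: coeff_eq_0)
next
  assume "\<forall>k. e < int k \<longrightarrow> coeff p k = 0"
  then show "p \<in> forms e"
    unfolding forms_def by (metis (mono_tags, lifting) leading_coeff_0_iff linorder_not_less mem_Collect_eq)
qed

lemma forms_zero [simp]: "0 \<in> forms e"
  by (simp add: forms_def)

lemma forms_coeff_eq_0: "p \<in> forms e \<Longrightarrow> e < int k \<Longrightarrow> coeff p k = 0"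
  by (simp add: forms_iff_coeff)

lemma forms_negative: "p \<in> forms e \<Longrightarrow> e < 0 \<Longrightarrow> p = 0"
  by (auto simp: forms_def)

lemma forms_int_iff: "p \<in> forms (int e) \<longleftrightarrow> degree p \<le> e"
  by (auto simp: forms_def)

lemma forms_mono: "p \<in> forms a \<Longrightarrow> a \<le> b \<Longrightarrow> p \<in> forms b"
  by (auto simp: forms_def)

lemma forms_add: "p \<in> forms e \<Longrightarrow> q \<in> forms e \<Longrightarrow> p + q \<in> forms e"
  by (simp add: forms_iff_coeff)

lemma forms_diff: "p \<in> forms e \<Longrightarrow> q \<in> forms e \<Longrightarrow> p - q \<in> forms e"
  for p :: "'a::ab_group_add poly"
  by (simp add: forms_iff_coeff)

lemma forms_minus: "p \<in> forms e \<Longrightarrow> - p \<in> forms e" for p :: "'a::ab_group_add poly"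
  by (simp add: forms_iff_coeff)

lemma forms_smult: "p \<in> forms e \<Longrightarrow> Polynomial.smult c p \<in> forms e"
  by (simp add: forms_iff_coeff)

lemma forms_sum: "(\<And>i. i \<in> I \<Longrightarrow> p i \<in> forms e) \<Longrightarrow> (\<Sum>i\<in>I. p i) \<in> forms e"
  by (simp add: forms_iff_coeff coeff_sum)

lemma forms_mult:
  assumes "p \<in> forms a" "q \<in> forms b"
  shows "p * q \<in> forms (a + b)"
proof (cases "p = 0 \<or> q = 0")
  case False
  then have "int (degree p) \<le> a" "int (degree q) \<le> b" using assms by (auto simp: forms_def)
  with degree_mult_le[of p q] show ?thesis by (auto simp: forms_def)
qed auto

lemma forms_mult': "p \<in> forms a \<Longrightarrow> q \<in> forms b \<Longrightarrow> c = a + b \<Longrightarrow> p * q \<in> forms c"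
  using forms_mult by blast

lemma forms_pderiv: "p \<in> forms e \<Longrightarrow> pderiv p \<in> forms (e - 1)"
  by (simp add: forms_iff_coeff coeff_pderiv)

text \<open>\<open>e p - X p'\<close> is the dehomogenised partial derivative in the first
  coordinate; its coefficient in degree \<open>e\<close> cancels.\<close>

lemma forms_euler:
  "p \<in> forms e \<Longrightarrow> Polynomial.smult (of_int e) p - [:0, 1:] * pderiv p \<in> forms (e - 1)"
  for p :: "'a::{comm_ring_1,semiring_no_zero_divisors} poly"
  unfolding forms_iff_coeff
proof (intro allI impI)
  fix k :: nat
  assume *: "\<forall>k. e < int k \<longrightarrow> coeff p k = 0" and k: "e - 1 < int k"
  show "coeff (Polynomial.smult (of_int e) p - [:0, 1:] * pderiv p) k = 0"
  proof (cases "e < int k")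
    case True
    then show ?thesis using * by (cases k) (auto simp: coeff_pderiv)
  next
    case False
    then have "e = int k" using k by simp
    then show ?thesis by (cases k) (auto simp: coeff_pderiv algebra_simps)
  qed
qed

lemma forms_X_mult_iff: "[:0, 1:] * q \<in> forms e \<longleftrightarrow> q \<in> forms (e - 1)"
  for q :: "'a::comm_semiring_1 poly"
  unfolding forms_iff_coeff
proof safe
  fix k assume "\<forall>k. e < int k \<longrightarrow> coeff ([:0, 1:] * q) k = 0" "e - 1 < int k"
  then show "coeff q k = 0" by (auto dest: spec[of _ "Suc k"])
next
  fix k assume "\<forall>k. e - 1 < int k \<longrightarrow> coeff q k = 0" "e < int k"
  then show "coeff ([:0, 1:] * q) k = 0" by (cases k) auto
qed

text \<open>The coefficient in the full degree is the value at the point at infinity, hence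
  multiplicative.\<close>

lemma coeff_mult_forms:
  fixes p q :: "'a::comm_semiring_1 poly"
  assumes "p \<in> forms (int a)" "q \<in> forms (int b)"
  shows "coeff (p * q) (a + b) = coeff p a * coeff q b"
proof -
  have "coeff (p * q) (a + b) = (\<Sum>i\<le>a + b. coeff p i * coeff q (a + b - i))"
    by (rule coeff_mult)
  also have "\<dots> = (\<Sum>i\<in>{a}. coeff p i * coeff q (a + b - i))"
  proof (rule sum.mono_neutral_right)
    show "\<forall>i\<in>{..a + b} - {a}. coeff p i * coeff q (a + b - i) = 0"
    proof
      fix i assume "i \<in> {..a + b} - {a}"
      then consider "i > a" | "a + b - i > b" by fastforce
      then show "coeff p i * coeff q (a + b - i) = 0"
        using assms by cases (auto simp: forms_iff_coeff)
    qed
  qed auto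
  finally show ?thesis by simp
qed

text \<open>The degree is an integer, so that statements about twists need no case distinction. In
  negative degree the only form is 0, and its value is 0 as well.\<close>

definition ev :: "int \<Rightarrow> 'a::comm_ring_1 poly \<Rightarrow> 'a \<times> 'a \<Rightarrow> 'a" where
  "ev e p x = form_eval (nat e) p x"

lemma form_eval_eq_ev: "form_eval e p x = ev (int e) p x"
  by (simp add: ev_def)

lemma ev_zero [simp]: "ev e 0 x = 0"
  by (simp add: ev_def form_eval_def)

lemma ev_add: "ev e (p + q) x = ev e p x + ev e q x"
  by (simp add: ev_def form_eval_def algebra_simps sum.distrib)

lemma ev_minus: "ev e (- p) x = - ev e p x"
  by (simp add: ev_def form_eval_def sum_negf)

lemma ev_diff: "ev e (p - q) x = ev e p x - ev e q x"
  by (simp add: ev_def form_eval_def algebra_simps sum_subtractf)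

lemma ev_smult: "ev e (Polynomial.smult c p) x = c * ev e p x"
  by (simp add: ev_def form_eval_def sum_distrib_left mult_ac)

lemma ev_sum: "ev e (\<Sum>i\<in>I. p i) x = (\<Sum>i\<in>I. ev e (p i) x)"
  by (induction I rule: infinite_finite_induct) (auto simp: ev_add)

lemma ev_affine:
  fixes p :: "'a::field poly"
  assumes "p \<in> forms e" "e \<ge> 0" "fst x \<noteq> 0"
  shows "ev e p x = fst x ^ nat e * poly p (snd x / fst x)"
proof -
  have d: "degree p \<le> nat e" using assms by (auto simp: forms_def)
  have "poly p (snd x / fst x) = (\<Sum>i\<le>nat e. coeff p i * (snd x / fst x) ^ i)"
    unfolding poly_altdef by (rule sum.mono_neutral_left) (use d in \<open>auto intro: coeff_eq_0\<close>)
  then have "fst x ^ nat e * poly p (snd x / fst x)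
      = (\<Sum>i\<le>nat e. fst x ^ nat e * (coeff p i * (snd x / fst x) ^ i))"
    by (simp add: sum_distrib_left)
  also have "\<dots> = (\<Sum>i\<le>nat e. coeff p i * fst x ^ (nat e - i) * snd x ^ i)"
  proof (rule sum.cong[OF refl])
    fix i assume "i \<in> {..nat e}"
    then have "fst x ^ nat e = fst x ^ (nat e - i) * fst x ^ i" by (simp flip: power_add)
    then show "fst x ^ nat e * (coeff p i * (snd x / fst x) ^ i) = coeff p i * fst x ^ (nat e - i) * snd x ^ i"
      using assms(3) by (simp add: power_divide field_simps)
  qed
  finally show ?thesis by (simp add: ev_def form_eval_def)
qed

lemma ev_one: "p \<in> forms e \<Longrightarrow> e \<ge> 0 \<Longrightarrow> ev e p (1, t) = poly p t" for p :: "'a::field poly"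
  using ev_affine[of p e "(1, t)"] by simp

lemma ev_infinity: "fst x = 0 \<Longrightarrow> ev e p x = snd x ^ nat e * coeff p (nat e)"
proof -
  assume "fst x = 0"
  then have "ev e p x = (\<Sum>i\<le>nat e. if i = nat e then coeff p (nat e) * snd x ^ nat e else 0)"
    unfolding ev_def form_eval_def by (intro sum.cong) (auto simp: power_0_left)
  then show ?thesis by (simp add: mult.commute)
qed

lemma ev_mult:
  fixes p q :: "'a::field poly"
  assumes "p \<in> forms a" "q \<in> forms b"
  shows "ev (a + b) (p * q) x = ev a p x * ev b q x"
proof (cases "a < 0 \<or> b < 0")
  case True
  then have "p = 0 \<or> q = 0" using assms forms_negative by blast
  then show ?thesis by auto
next
  case False
  show ?thesis
  proof (cases "fst x = 0")
    case True
    have "coeff (p * q) (nat a + nat b) = coeff p (nat a) * coeff q (nat b)"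
      using assms False by (intro coeff_mult_forms) auto
    then show ?thesis
      using True False by (simp add: ev_infinity nat_add_distrib power_add mult_ac)
  next
    case F: False
    then show ?thesis
      using False assms forms_mult[OF assms]
      by (simp add: ev_affine nat_add_distrib power_add mult_ac)
  qed
qed

lemma ev_mult': "p \<in> forms a \<Longrightarrow> q \<in> forms b \<Longrightarrow> c = a + b \<Longrightarrow> ev c (p * q) x = ev a p x * ev b q x"
  for p q :: "'a::field poly"
  using ev_mult by blast

text \<open>The linear form vanishing exactly at \<open>x\<close>, in the affine coordinate. For the
  point at infinity it is a nonzero constant, because the first homogeneous coordinate dehomogenises
  to 1.\<close>

definition point_form :: "'a::comm_ring_1 \<times> 'a \<Rightarrow> 'a poly" where
  "point_form x = [:- snd x, fst x:]"

lemma point_form_nonzero: "x \<noteq> (0, 0) \<Longrightarrow> point_form x \<noteq> 0"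
  by (cases x) (auto simp: point_form_def)

lemma ev_linear: "ev 1 [:a, b:] y = a * fst y + b * snd y"
  by (simp add: ev_def form_eval_def)

lemma forms_vanishing_at_point:
  fixes p :: "'a::field poly"
  assumes "x \<noteq> (0, 0)" "p \<in> forms e" "ev e p x = 0"
  obtains q where "q \<in> forms (e - 1)" "p = point_form x * q"
proof (cases "e < 0")
  case True
  then have "p = 0" using assms forms_negative by blast
  then show thesis using that[of 0] by simp
next
  case e: False
  show thesis
  proof (cases "fst x = 0")
    case True
    then have t: "snd x \<noteq> 0" using assms(1) by (cases x) auto
    \<comment> \<open>At infinity vanishing means that the top coefficient is 0, so \<open>p\<close>
      itself already is a form of smaller degree.\<close>
    have "coeff p (nat e) = 0" using assms(3) True t by (simp add: ev_infinity)
    then have "p \<in> forms (e - 1)"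
      using assms(2) e unfolding forms_iff_coeff
      by (metis int_nat_eq linorder_neqE_linordered_idom linorder_not_less nat_int zle_diff1_eq)
    then have "Polynomial.smult (- 1 / snd x) p \<in> forms (e - 1)" by (rule forms_smult)
    moreover have "p = point_form x * Polynomial.smult (- 1 / snd x) p"
      using True t by (simp add: point_form_def)
    ultimately show thesis by (rule that)
  next
    case False
    then have "poly p (snd x / fst x) = 0" using assms e by (simp add: ev_affine)
    then obtain q where q: "p = [:- (snd x / fst x), 1:] * q"
      using poly_eq_0_iff_dvd by (metis dvdE)
    have "q \<in> forms (e - 1)"
    proof (cases "q = 0")
      case False
      then have "degree p = Suc (degree q)" unfolding q by (subst degree_mult_eq) auto
      moreover have "p \<noteq> 0" using \<open>degree p = Suc (degree q)\<close> by auto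
      ultimately show ?thesis using assms(2) by (auto simp: forms_def)
    qed auto
    then have "Polynomial.smult (1 / fst x) q \<in> forms (e - 1)" by (rule forms_smult)
    moreover have "p = point_form x * Polynomial.smult (1 / fst x) q"
      unfolding q using False
      by (simp add: point_form_def smult_add_right smult_diff_right)
    ultimately show thesis by (rule that)
  qed
qed

text \<open>Euler's formula turns the derivative in the first coordinate into \<open>e p - X p'\<close>.\<close>

definition dv :: "int \<Rightarrow> 'a::field poly \<Rightarrow> 'a \<times> 'a \<Rightarrow> 'a \<times> 'a \<Rightarrow> 'a" where
  "dv e p x w = fst w * ev (e - 1) (Polynomial.smult (of_int e) p - [:0, 1:] * pderiv p) x + snd w * ev (e - 1) (pderiv p) x"

lemma form_deriv_eq_dv:
  fixes p :: "'a::field poly"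
  assumes "p \<in> forms (int e)"
  shows "form_deriv e p x w = dv (int e) p x w"
proof (cases e)
  case 0
  then have "degree p = 0" using assms by (auto simp: forms_def)
  then have "pderiv p = 0" by (auto elim!: degree_eq_zeroE simp: pderiv_pCons)
  then show ?thesis using 0 by (simp add: form_deriv_def dv_def)
next
  case (Suc m)
  define G where "G = Polynomial.smult (of_int (int e)) p - [:0, 1:] * pderiv p"
  have 1: "coeff G i = of_nat (e - i) * coeff p i" if "i \<le> m" for i
    using that Suc by (cases i) (auto simp: G_def coeff_pderiv of_nat_diff algebra_simps)
  have A: "(\<Sum>i\<le>e. coeff p i * (of_nat (e - i) * fst x ^ (e - i - 1) * snd x ^ i * fst w))
      = fst w * ev (int e - 1) G x"
  proof -
    have "(\<Sum>i\<le>e. coeff p i * (of_nat (e - i) * fst x ^ (e - i - 1) * snd x ^ i * fst w))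
      = (\<Sum>i\<le>m. coeff p i * (of_nat (e - i) * fst x ^ (e - i - 1) * snd x ^ i * fst w))"
      unfolding Suc by simp
    also have "\<dots> = fst w * ev (int e - 1) G x"
    proof -
      have "nat (int e - 1) = m" using Suc by simp
      then show ?thesis
        unfolding ev_def form_eval_def sum_distrib_left
        using Suc by (intro sum.cong) (auto simp: 1 mult_ac)
    qed
    finally show ?thesis .
  qed
  have B: "(\<Sum>i\<le>e. coeff p i * (of_nat i * fst x ^ (e - i) * snd x ^ (i - 1) * snd w))
      = snd w * ev (int e - 1) (pderiv p) x"
  proof -
    have "(\<Sum>i\<le>e. coeff p i * (of_nat i * fst x ^ (e - i) * snd x ^ (i - 1) * snd w))
      = (\<Sum>i\<le>m. coeff p (Suc i) * (of_nat (Suc i) * fst x ^ (e - Suc i) * snd x ^ i * snd w))"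
      unfolding Suc by (subst sum.atMost_Suc_shift) simp
    also have "\<dots> = snd w * ev (int e - 1) (pderiv p) x"
      unfolding ev_def form_eval_def sum_distrib_left
      using Suc by (intro sum.cong) (auto simp: coeff_pderiv mult_ac)
    finally show ?thesis .
  qed
  show ?thesis
    unfolding form_deriv_def dv_def G_def[symmetric] A[symmetric] B[symmetric] sum.distrib[symmetric]
    by (intro sum.cong) (auto simp: algebra_simps)
qed

lemma dv_add: "dv e (p + q) x w = dv e p x w + dv e q x w"
  by (simp add: dv_def pderiv_add ev_add ev_diff smult_add_right distrib_left right_diff_distrib del: mult_pCons_left)

lemma dv_zero [simp]: "dv e 0 x w = 0"
  by (simp add: dv_def)

lemma dv_sum: "dv e (\<Sum>i\<in>I. p i) x w = (\<Sum>i\<in>I. dv e (p i) x w)"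
  by (induction I rule: infinite_finite_induct) (auto simp: dv_add)

lemma dv_mult:
  fixes p q :: "'a::field poly"
  assumes p: "p \<in> forms a" and q: "q \<in> forms b"
  shows "dv (a + b) (p * q) x w = dv a p x w * ev b q x + ev a p x * dv b q x w"
proof -
  have 1: "Polynomial.smult (of_int (a + b)) (p * q) - [:0, 1:] * pderiv (p * q) =
      (Polynomial.smult (of_int a) p - [:0, 1:] * pderiv p) * q + p * (Polynomial.smult (of_int b) q - [:0, 1:] * pderiv q)"
    by (simp add: pderiv_mult algebra_simps smult_add_left)
  have 2: "pderiv (p * q) = pderiv p * q + p * pderiv q"
    by (simp add: pderiv_mult algebra_simps)
  have e1: "ev (a + b - 1) ((Polynomial.smult (of_int a) p - [:0, 1:] * pderiv p) * q) x
      = ev (a - 1) (Polynomial.smult (of_int a) p - [:0, 1:] * pderiv p) x * ev b q x"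
    by (rule ev_mult'[OF forms_euler[OF p] q]) simp
  have e2: "ev (a + b - 1) (p * (Polynomial.smult (of_int b) q - [:0, 1:] * pderiv q)) x
      = ev a p x * ev (b - 1) (Polynomial.smult (of_int b) q - [:0, 1:] * pderiv q) x"
    by (rule ev_mult'[OF p forms_euler[OF q]]) simp
  have e3: "ev (a + b - 1) (pderiv p * q) x = ev (a - 1) (pderiv p) x * ev b q x"
    by (rule ev_mult'[OF forms_pderiv[OF p] q]) simp
  have e4: "ev (a + b - 1) (p * pderiv q) x = ev a p x * ev (b - 1) (pderiv q) x"
    by (rule ev_mult'[OF p forms_pderiv[OF q]]) simp
  show ?thesis
    unfolding dv_def 1 unfolding 2 unfolding ev_add e1 e2 e3 e4 by (simp add: distrib_left distrib_right mult_ac)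
qed

lemma dv_scale: "dv e p x (c * fst w, c * snd w) = c * dv e p x w"
  by (simp add: dv_def algebra_simps)

lemma dv_add_direction: "dv e p x (fst v + fst w, snd v + snd w) = dv e p x v + dv e p x w"
  by (simp add: dv_def algebra_simps)

lemma dv_euler:
  fixes p :: "'a::field poly"
  assumes "p \<in> forms e"
  shows "dv e p x x = of_int e * ev e p x"
proof -
  have 1: "ev e (Polynomial.smult (of_int e) p - [:0, 1:] * pderiv p) x = fst x * ev (e - 1) (Polynomial.smult (of_int e) p - [:0, 1:] * pderiv p) x"
    using ev_mult'[of "[:1:]" 1 _ "e - 1" e x, OF _ forms_euler[OF assms]]
    by (simp add: forms_def ev_def form_eval_def)
  have 2: "ev e ([:0, 1:] * pderiv p) x = snd x * ev (e - 1) (pderiv p) x"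
    using ev_mult'[of "[:0, 1:]" 1 "pderiv p" "e - 1" e x] forms_pderiv[OF assms]
    by (simp add: forms_def ev_linear del: mult_pCons_left)
  show ?thesis
    using 1 2 unfolding dv_def by (simp add: ev_diff ev_smult algebra_simps)
qed

section \<open>Polynomials over an algebraically closed field\<close>

lemma infinite_UNIV_alg_closed: "infinite (UNIV :: 'a::alg_closed_field set)"
proof
  assume fin: "finite (UNIV :: 'a set)"
  define p :: "'a poly" where "p = (\<Prod>a\<in>UNIV. [:- a, 1:]) + 1"
  have "degree (\<Prod>a\<in>(UNIV::'a set). [:- a, 1:]) = card (UNIV :: 'a set)"
    by (subst degree_prod_eq_sum_degree) auto
  moreover have "card (UNIV :: 'a set) > 0" using fin by (simp add: card_gt_0_iff)
  ultimately have "degree p > 0"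
    unfolding p_def by (subst degree_add_eq_left) auto
  then obtain z where "poly p z = 0" using alg_closed_imp_poly_has_root by blast
  moreover have "poly (\<Prod>a\<in>(UNIV::'a set). [:- a, 1:]) z = 0"
    using fin by (auto simp: poly_prod prod_zero_iff intro!: bexI[of _ z])
  ultimately show False by (simp add: p_def)
qed

lemma poly_eq_0_if_all_0:
  fixes p :: "'a::alg_closed_field poly"
  assumes "\<And>t. poly p t = 0"
  shows "p = 0"
proof (rule ccontr)
  assume "p \<noteq> 0"
  then have "finite {t. poly p t = 0}" by (rule poly_roots_finite)
  moreover have "{t. poly p t = 0} = UNIV" using assms by auto
  ultimately show False using infinite_UNIV_alg_closed by metis
qed

text \<open>A nonzero element of least degree in the ideal of the \<open>p i\<close> divides every
  generator, so a root of it would be a common zero.\<close>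

lemma polynomial_bezout:
  fixes p :: "'i \<Rightarrow> 'a::alg_closed_field poly"
  assumes "finite I" and nz: "\<And>t. \<exists>i\<in>I. poly (p i) t \<noteq> 0"
  obtains h where "(\<Sum>i\<in>I. h i * p i) = 1"
proof -
  define J where "J g \<longleftrightarrow> g \<noteq> 0 \<and> (\<exists>h. g = (\<Sum>i\<in>I. h i * p i))" for g
  obtain i0 where i0: "i0 \<in> I" "poly (p i0) 0 \<noteq> 0" using nz by blast
  have unit: "p i = (\<Sum>j\<in>I. (if j = i then 1 else 0) * p j)" if "i \<in> I" for i
    using that assms(1) by (simp add: if_distrib[of "\<lambda>x. x * _"] cong: if_cong)
  have "J (p i0)" unfolding J_def using unit[OF i0(1)] i0(2) by auto
  then obtain g where g: "J g" and gmin: "\<And>f. J f \<Longrightarrow> degree g \<le> degree f"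
    using ex_has_least_nat[of J "p i0" degree] by blast
  obtain h where h: "g = (\<Sum>i\<in>I. h i * p i)" and g0: "g \<noteq> 0" using g unfolding J_def by blast
  have dvd: "g dvd p i" if i: "i \<in> I" for i
  proof (rule ccontr)
    assume nd: "\<not> g dvd p i"
    then have m0: "p i mod g \<noteq> 0" by (simp add: dvd_eq_mod_eq_0)
    have "p i mod g = p i - (p i div g) * g" by (simp add: minus_div_mult_eq_mod)
    also have "\<dots> = (\<Sum>j\<in>I. ((if j = i then 1 else 0) - (p i div g) * h j) * p j)"
      unfolding h by (subst (1) unit[OF i]) (simp add: left_diff_distrib sum_subtractf sum_distrib_left mult.assoc)
    finally have "J (p i mod g)"
      unfolding J_def using m0 by (intro conjI exI[of _ "\<lambda>j. (if j = i then 1 else 0) - (p i div g) * h j"])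
    from gmin[OF this] show False using degree_mod_less'[OF g0 m0] by simp
  qed
  have "degree g = 0"
  proof (rule ccontr)
    assume "degree g \<noteq> 0"
    then obtain z where z: "poly g z = 0" using alg_closed_imp_poly_has_root by blast
    have "poly (p i) z = 0" if "i \<in> I" for i
      using dvd[OF that] z by (auto elim!: dvdE)
    then show False using nz[of z] by blast
  qed
  then obtain c where c: "g = [:c:]" by (rule degree_eq_zeroE)
  with g0 have c0: "c \<noteq> 0" by auto
  have "(\<Sum>i\<in>I. ([:inverse c:] * h i) * p i) = [:inverse c:] * g"
    unfolding h sum_distrib_left by (simp only: mult.assoc)
  also have "\<dots> = 1" using c c0 by (simp add: one_pCons)
  finally show thesis by (rule that)
qed

text \<open>If the leading vectors are independent, no cancellation of top terms is possible.\<close>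

lemma combination_degree_bound:
  fixes v :: "nat \<Rightarrow> nat \<Rightarrow> 'a::field poly"
  assumes v: "\<And>l i. l < r \<Longrightarrow> i < N \<Longrightarrow> v l i \<in> forms (int (a l))"
    and lead: "\<And>b. (\<And>i. i < N \<Longrightarrow> (\<Sum>l<r. b l * coeff (v l i) (a l)) = 0) \<Longrightarrow> (\<And>l. l < r \<Longrightarrow> b l = 0)"
    and m: "\<And>i. i < N \<Longrightarrow> (\<Sum>l<r. c l * v l i) \<in> forms m"
  shows "\<forall>l<r. c l \<in> forms (m - int (a l))"
proof (rule ccontr)
  assume neg: "\<not> (\<forall>l<r. c l \<in> forms (m - int (a l)))"
  define S where "S = {degree (c l) + a l |l. l < r \<and> c l \<noteq> 0}"
  have fS: "finite S" unfolding S_def by simp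
  obtain l0 where l0: "l0 < r" "c l0 \<notin> forms (m - int (a l0))" using neg by blast
  then have c0: "c l0 \<noteq> 0" "m < int (degree (c l0) + a l0)" by (auto simp: forms_def)
  \<comment> \<open>\<open>\<mu>\<close> is the largest degree that a summand can reach; in this
    degree the coefficients of the sum are a combination of the leading vectors.\<close>
  define \<mu> where "\<mu> = Max S"
  have "degree (c l0) + a l0 \<in> S" using l0 c0 by (auto simp: S_def)
  then have mu: "m < int \<mu>" using c0(2) Max_ge[OF fS] unfolding \<mu>_def by fastforce
  have "\<mu> \<in> S" unfolding \<mu>_def using fS \<open>_ \<in> S\<close> by (intro Max_in) auto
  then obtain l1 where l1: "l1 < r" "c l1 \<noteq> 0" "\<mu> = degree (c l1) + a l1" by (auto simp: S_def)
  have le: "degree (c l) + a l \<le> \<mu>" if "l < r" "c l \<noteq> 0" for l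
    unfolding \<mu>_def by (rule Max_ge[OF fS]) (use that in \<open>auto simp: S_def\<close>)
  define b where "b l = (if c l = 0 then 0 else coeff (c l) (\<mu> - a l))" for l
  have co: "coeff (c l * v l i) \<mu> = b l * coeff (v l i) (a l)" if "l < r" "i < N" for l i
  proof (cases "c l = 0")
    case False
    have "c l \<in> forms (int (\<mu> - a l))"
      unfolding forms_int_iff using le[OF that(1) False] by linarith
    from coeff_mult_forms[OF this v[OF that]] show ?thesis
      using le[OF that(1) False] False by (simp add: b_def)
  qed (simp add: b_def)
  have "(\<Sum>l<r. b l * coeff (v l i) (a l)) = 0" if i: "i < N" for i
  proof -
    have "(\<Sum>l<r. b l * coeff (v l i) (a l)) = coeff (\<Sum>l<r. c l * v l i) \<mu>"
      using co i by (simp add: coeff_sum)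
    also have "\<dots> = 0" using m[OF i] mu by (rule forms_coeff_eq_0)
    finally show ?thesis .
  qed
  from lead[OF this l1(1)] have "b l1 = 0" .
  with l1 show False by (simp add: b_def)
qed

section \<open>Curves with a split universal subbundle\<close>

lemma sum_lessThan_2: "(\<Sum>a<2. g a) = g 0 + g (Suc 0)" for g :: "nat \<Rightarrow> 'b::comm_monoid_add"
  by (simp add: numeral_2_eq_2)

lemma all_less_2_iff: "(\<forall>a<2. P a) \<longleftrightarrow> P 0 \<and> P (Suc 0)" for P :: "nat \<Rightarrow> bool"
  by (auto simp: numeral_2_eq_2 less_Suc_eq)

definition curve_value :: "(nat \<Rightarrow> nat) \<Rightarrow> (nat \<Rightarrow> nat \<Rightarrow> 'a::field poly) \<Rightarrow> 'a \<times> 'a \<Rightarrow> nat \<Rightarrow> nat \<Rightarrow> 'a" where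
  "curve_value e \<sigma> x a i = ev (int (e a)) (\<sigma> a i) x"

definition curve_span ::
    "nat \<Rightarrow> (nat \<Rightarrow> nat) \<Rightarrow> (nat \<Rightarrow> nat \<Rightarrow> 'a::field poly) \<Rightarrow> 'a \<times> 'a \<Rightarrow> (nat \<Rightarrow> 'a) \<Rightarrow> bool" where
  "curve_span n e \<sigma> x y \<longleftrightarrow> (\<exists>c. \<forall>i<n. y i = (\<Sum>a<2. c a * curve_value e \<sigma> x a i))"

text \<open>The pullback of the universal subbundle is the direct sum of the \<open>O(- e a)\<close>, embedded by \<open>\<sigma> a\<close>.\<close>

locale split_curve =
  fixes n :: nat and e :: "nat \<Rightarrow> nat" and \<sigma> :: "nat \<Rightarrow> nat \<Rightarrow> 'a::alg_closed_field poly"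
    and f :: "'a \<times> 'a \<Rightarrow> 'a vec set"
  assumes sect: "a < 2 \<Longrightarrow> i < n \<Longrightarrow> \<sigma> a i \<in> forms (int (e a))"
    and indep: "x \<noteq> (0, 0) \<Longrightarrow> \<exists>i<n. \<exists>j<n.
      curve_value e \<sigma> x 0 i * curve_value e \<sigma> x 1 j - curve_value e \<sigma> x 0 j * curve_value e \<sigma> x 1 i \<noteq> 0"
    and f_eq: "x \<noteq> (0, 0) \<Longrightarrow> f x = {y \<in> carrier_vec n. curve_span n e \<sigma> x (\<lambda>i. y $ i)}"
begin

abbreviation S :: "'a \<times> 'a \<Rightarrow> nat \<Rightarrow> nat \<Rightarrow> 'a" where
  "S \<equiv> curve_value e \<sigma>"

abbreviation inW :: "'a \<times> 'a \<Rightarrow> (nat \<Rightarrow> 'a) \<Rightarrow> bool" where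
  "inW \<equiv> curve_span n e \<sigma>"

definition D :: "'a \<times> 'a \<Rightarrow> 'a \<times> 'a \<Rightarrow> nat \<Rightarrow> nat \<Rightarrow> 'a" where
  "D x w a i = dv (int (e a)) (\<sigma> a i) x w"

section \<open>Linear algebra in the fibre at one point\<close>

lemma inW_add: "inW x y \<Longrightarrow> inW x z \<Longrightarrow> inW x (\<lambda>i. y i + z i)"
  unfolding curve_span_def
proof (elim exE)
  fix c c' assume "\<forall>i<n. y i = (\<Sum>a<2. c a * S x a i)" "\<forall>i<n. z i = (\<Sum>a<2. c' a * S x a i)"
  then show "\<exists>c. \<forall>i<n. y i + z i = (\<Sum>a<2. c a * S x a i)"
    by (intro exI[of _ "\<lambda>a. c a + c' a"]) (simp add: sum_lessThan_2 algebra_simps)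
qed

lemma inW_scale: "inW x y \<Longrightarrow> inW x (\<lambda>i. c * y i)"
  unfolding curve_span_def
proof (elim exE)
  fix c' assume "\<forall>i<n. y i = (\<Sum>a<2. c' a * S x a i)"
  then show "\<exists>c'. \<forall>i<n. c * y i = (\<Sum>a<2. c' a * S x a i)"
    by (intro exI[of _ "\<lambda>a. c * c' a"]) (simp add: sum_lessThan_2 algebra_simps)
qed

lemma inW_diff: "inW x y \<Longrightarrow> inW x z \<Longrightarrow> inW x (\<lambda>i. y i - z i)"
  using inW_add[of x y "\<lambda>i. (- 1) * z i"] inW_scale[of x z "- 1"] by simp

lemma inW_S: "a < 2 \<Longrightarrow> inW x (S x a)"
  unfolding curve_span_def by (intro exI[of _ "\<lambda>b. if b = a then 1 else 0"]) (auto simp: sum_lessThan_2 less_2_cases_iff)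

lemma inW_zero: "inW x (\<lambda>i. 0)"
  unfolding curve_span_def by (intro exI[of _ "\<lambda>b. 0"]) simp

lemma inW_combination:
  fixes k :: nat
  assumes "\<And>a. a < k \<Longrightarrow> inW x (y a)"
  shows "inW x (\<lambda>i. \<Sum>a<k. c a * y a i)"
  using assms
proof (induction k)
  case 0
  then show ?case using inW_zero by simp
next
  case (Suc k)
  have "inW x (\<lambda>i. (\<Sum>a<k. c a * y a i) + c k * y k i)"
    by (intro inW_add inW_scale Suc) auto
  then show ?case by simp
qed

lemma inW_cong: "(\<And>i. i < n \<Longrightarrow> y i = z i) \<Longrightarrow> inW x y \<longleftrightarrow> inW x z"
  unfolding curve_span_def by simp

lemma pivot:
  assumes "x \<noteq> (0, 0)"
  obtains u v where "u < n" "v < n" "u \<noteq> v" "S x 0 u * S x 1 v - S x 0 v * S x 1 u \<noteq> 0"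
  using indep[OF assms] by force

lemma sum_two_points:
  assumes "u < n" "v < n" "u \<noteq> v"
  shows "(\<Sum>i<n. (if i = u then p else if i = v then q else 0) * g i) = p * g u + q * (g v :: 'a)"
proof -
  have "(\<Sum>i<n. (if i = u then p else if i = v then q else 0) * g i)
      = (\<Sum>i\<in>{u, v}. (if i = u then p else if i = v then q else 0) * g i)"
    by (rule sum.mono_neutral_right) (use assms in auto)
  then show ?thesis using assms by simp
qed

text \<open>Two functionals supported on the coordinates \<open>u\<close>, \<open>v\<close> of a
  nonzero minor; their entries come from Cramer's rule.\<close>

lemma dual_basis:
  assumes "x \<noteq> (0, 0)"
  obtains T where "\<forall>a<2. \<forall>b<2. (\<Sum>i<n. T a i * S x b i) = (if a = b then 1 else 0)"
proof -
  obtain u v where uv: "u < n" "v < n" "u \<noteq> v" and d: "S x 0 u * S x 1 v - S x 0 v * S x 1 u \<noteq> 0"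
    using pivot[OF assms] .
  define \<Delta> where "\<Delta> = S x 0 u * S x 1 v - S x 0 v * S x 1 u"
  define T where "T a i = (if a = 0 then (if i = u then S x 1 v / \<Delta> else if i = v then - S x 1 u / \<Delta> else 0)
      else (if i = u then - S x 0 v / \<Delta> else if i = v then S x 0 u / \<Delta> else 0))" for a :: nat and i
  have d0: "\<Delta> \<noteq> 0" using d by (simp add: \<Delta>_def)
  have "(\<Sum>i<n. T a i * S x b i) = (if a = b then 1 else 0)" if "a < 2" "b < 2" for a b
  proof -
    have T0: "(\<Sum>i<n. T 0 i * S x b i) = (S x 1 v * S x b u - S x 1 u * S x b v) / \<Delta>" for b
      unfolding T_def by (simp add: sum_two_points[OF uv] diff_divide_distrib)
    have T1: "(\<Sum>i<n. T 1 i * S x b i) = (S x 0 u * S x b v - S x 0 v * S x b u) / \<Delta>" for b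
      unfolding T_def by (simp add: sum_two_points[OF uv] diff_divide_distrib)
    from that consider "a = 0" "b = 0" | "a = 0" "b = 1" | "a = 1" "b = 0" | "a = 1" "b = 1"
      by linarith
    then show ?thesis
      by cases (use d0 in \<open>simp_all add: T0 T1 del: One_nat_def, simp_all add: \<Delta>_def algebra_simps\<close>)
  qed
  then show thesis by (intro that[of T]) blast
qed

lemma S_independent:
  assumes "x \<noteq> (0, 0)" "\<And>i. i < n \<Longrightarrow> (\<Sum>a<2. c a * S x a i) = 0" "a < 2"
  shows "c a = 0"
proof -
  obtain T where T': "\<forall>a<2. \<forall>b<2. (\<Sum>i<n. T a i * S x b i) = (if a = b then 1 else 0)"
    using dual_basis[OF assms(1)] .
  have T: "(\<Sum>i<n. T a i * S x b i) = (if a = b then 1 else 0)" if "a < 2" "b < 2" for a b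
    using T'[rule_format, OF that] .
  have "(\<Sum>i<n. T a i * (\<Sum>b<2. c b * S x b i)) = (\<Sum>b<2. c b * (\<Sum>i<n. T a i * S x b i))"
    unfolding sum_distrib_left by (subst sum.swap) (simp add: mult_ac)
  also have "\<dots> = (\<Sum>b<2. c b * (if a = b then 1 else 0))"
    using T[OF assms(3)] by (intro sum.cong) auto
  also have "\<dots> = c a" using assms(3) by (auto simp: sum_lessThan_2 less_2_cases_iff)
  finally show ?thesis using assms(2) by simp
qed

lemma inW_iff_perp:
  assumes "x \<noteq> (0, 0)"
  shows "inW x y \<longleftrightarrow> (\<forall>b. (\<forall>a<2. (\<Sum>i<n. b i * S x a i) = 0) \<longrightarrow> (\<Sum>i<n. b i * y i) = 0)"
proof
  assume "inW x y"
  then obtain c where c: "\<And>i. i < n \<Longrightarrow> y i = (\<Sum>a<2. c a * S x a i)" unfolding curve_span_def by blast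
  show "\<forall>b. (\<forall>a<2. (\<Sum>i<n. b i * S x a i) = 0) \<longrightarrow> (\<Sum>i<n. b i * y i) = 0"
  proof (intro allI impI)
    fix b assume b: "\<forall>a<2. (\<Sum>i<n. b i * S x a i) = 0"
    have "(\<Sum>i<n. b i * y i) = (\<Sum>i<n. b i * (\<Sum>a<2. c a * S x a i))"
      using c by (intro sum.cong) auto
    also have "\<dots> = (\<Sum>a<2. c a * (\<Sum>i<n. b i * S x a i))"
      unfolding sum_distrib_left by (subst sum.swap) (simp add: mult_ac)
    also have "\<dots> = 0" using b by simp
    finally show "(\<Sum>i<n. b i * y i) = 0" .
  qed
next
  assume P: "\<forall>b. (\<forall>a<2. (\<Sum>i<n. b i * S x a i) = 0) \<longrightarrow> (\<Sum>i<n. b i * y i) = 0"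
  obtain T where T': "\<forall>a<2. \<forall>b<2. (\<Sum>i<n. T a i * S x b i) = (if a = b then 1 else 0)"
    using dual_basis[OF assms] .
  have T: "(\<Sum>i<n. T a i * S x b i) = (if a = b then 1 else 0)" if "a < 2" "b < 2" for a b
    using T'[rule_format, OF that] .
  have "y k = (\<Sum>a<2. (\<Sum>i<n. T a i * y i) * S x a k)" if k: "k < n" for k
  proof -
    \<comment> \<open>The \<open>k\<close>-th coordinate of a vector minus its projection to the
      fibre defined by \<open>T\<close>. It annihilates the fibre, and its vanishing on
      \<open>y\<close> is the expansion of \<open>y k\<close>.\<close>
    define b where "b i = (if i = k then 1 else 0) - (\<Sum>a<2. S x a k * T a i)" for i
    have bz: "(\<Sum>i<n. b i * z i) = z k - (\<Sum>a<2. S x a k * (\<Sum>i<n. T a i * z i))" for z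
    proof -
      have "(\<Sum>i<n. b i * z i) = (\<Sum>i<n. (if i = k then z k else 0)) - (\<Sum>i<n. \<Sum>a<2. S x a k * (T a i * z i))"
        unfolding b_def left_diff_distrib sum_subtractf sum_distrib_right
        by (intro arg_cong2[of _ _ _ _ "(-)"] sum.cong) (auto simp: mult_ac)
      also have "(\<Sum>i<n. \<Sum>a<2. S x a k * (T a i * z i)) = (\<Sum>a<2. S x a k * (\<Sum>i<n. T a i * z i))"
        unfolding sum_distrib_left by (subst sum.swap) simp
      finally show ?thesis using k by simp
    qed
    have "\<forall>a<2. (\<Sum>i<n. b i * S x a i) = 0"
      unfolding bz by (simp add: all_less_2_iff sum_lessThan_2 T)
    from mp[OF spec[OF P] this] have "(\<Sum>i<n. b i * y i) = 0" .
    then show ?thesis unfolding bz by (simp only: right_minus_eq mult.commute)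
  qed
  then show "inW x y"
    unfolding curve_span_def by (intro exI[of _ "\<lambda>a. \<Sum>i<n. T a i * y i"] allI impI)
qed

subsection \<open>Sections of twists of the subbundle\<close>

lemma ev_at_affine: "a < 2 \<Longrightarrow> i < n \<Longrightarrow> S (1, t) a i = poly (\<sigma> a i) t"
  using sect ev_one[of "\<sigma> a i" "int (e a)" t] by (simp add: curve_value_def)

lemma S_at_infinity: "S (0, 1) a i = coeff (\<sigma> a i) (e a)"
  by (simp add: curve_value_def ev_infinity)

text \<open>Cramer's rule writes \<open>y\<close> times each minor as a combination of
  \<open>\<sigma> 0\<close> and \<open>\<sigma> 1\<close>. The minors have no common zero, so a
  Bezout combination of these identities removes the factor. The degrees of the coefficients follow
  from independence at infinity.\<close>

lemma span_factor:
  fixes y :: "nat \<Rightarrow> 'a poly"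
  assumes y: "\<And>i j k. i < n \<Longrightarrow> j < n \<Longrightarrow> k < n \<Longrightarrow>
      y i * (\<sigma> 0 j * \<sigma> 1 k - \<sigma> 0 k * \<sigma> 1 j) - y j * (\<sigma> 0 i * \<sigma> 1 k - \<sigma> 0 k * \<sigma> 1 i)
        + y k * (\<sigma> 0 i * \<sigma> 1 j - \<sigma> 0 j * \<sigma> 1 i) = 0"
    and m: "\<And>i. i < n \<Longrightarrow> y i \<in> forms m"
  obtains c where "\<forall>a<2. c a \<in> forms (m - int (e a))" "\<forall>i<n. y i = (\<Sum>a<2. c a * \<sigma> a i)"
proof -
  define I where "I = {..<n} \<times> {..<n}"
  define P where "P p = \<sigma> 0 (fst p) * \<sigma> 1 (snd p) - \<sigma> 0 (snd p) * \<sigma> 1 (fst p)" for p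
  define g where "g a p = (if a = 0 then y (fst p) * \<sigma> 1 (snd p) - y (snd p) * \<sigma> 1 (fst p)
      else \<sigma> 0 (fst p) * y (snd p) - \<sigma> 0 (snd p) * y (fst p))" for a :: nat and p
  have "\<exists>p\<in>I. poly (P p) t \<noteq> 0" for t
  proof -
    obtain i j where "i < n" "j < n" "S (1, t) 0 i * S (1, t) 1 j - S (1, t) 0 j * S (1, t) 1 i \<noteq> 0"
      using indep[of "(1, t)"] by auto
    then show ?thesis by (intro bexI[of _ "(i, j)"]) (auto simp: ev_at_affine I_def P_def)
  qed
  moreover have "finite I" by (simp add: I_def)
  ultimately obtain h where h: "(\<Sum>p\<in>I. h p * P p) = 1"
    using polynomial_bezout[of I P] by blast
  define c where "c a = (\<Sum>p\<in>I. h p * g a p)" for a :: nat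
  have yc: "y i = (\<Sum>a<2. c a * \<sigma> a i)" if i: "i < n" for i
  proof -
    have pt: "y i * P p = g 0 p * \<sigma> 0 i + g (Suc 0) p * \<sigma> 1 i" if "p \<in> I" for p
      using y[OF i, of "fst p" "snd p"] that by (auto simp: P_def g_def I_def algebra_simps)
    have "y i = y i * (\<Sum>p\<in>I. h p * P p)" using h by simp
    also have "\<dots> = (\<Sum>p\<in>I. h p * (y i * P p))" by (simp only: sum_distrib_left mult.left_commute)
    also have "\<dots> = (\<Sum>p\<in>I. h p * g 0 p * \<sigma> 0 i + h p * g (Suc 0) p * \<sigma> 1 i)"
      by (intro sum.cong refl) (simp only: pt distrib_left mult.assoc)
    also have "\<dots> = (\<Sum>a<2. c a * \<sigma> a i)"
      unfolding sum_lessThan_2 c_def sum_distrib_right sum.distrib by simp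
    finally show ?thesis .
  qed
  have "\<forall>a<2. c a \<in> forms (m - int (e a))"
  proof (rule combination_degree_bound[of 2 n \<sigma> e])
    fix b :: "nat \<Rightarrow> 'a" and a :: nat
    assume "\<And>i. i < n \<Longrightarrow> (\<Sum>a<2. b a * coeff (\<sigma> a i) (e a)) = 0" "a < 2"
    then show "b a = 0"
      by (intro S_independent[of "(0, 1)" b a]) (simp_all add: S_at_infinity)
  next
    fix i assume i: "i < n" show "(\<Sum>a<2. c a * \<sigma> a i) \<in> forms m"
      using m[OF i] unfolding yc[OF i] .
  qed (rule sect)
  then show thesis using yc by (intro that[of c]) simp_all
qed

lemma wedge_zero_if_inW:
  fixes c :: "nat \<Rightarrow> 'a" and s :: "nat \<Rightarrow> nat \<Rightarrow> 'a"
  assumes "\<And>i. i < n \<Longrightarrow> y i = (\<Sum>a<2. c a * s a i)" "i < n" "j < n" "k < n"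
  shows "y i * (s 0 j * s 1 k - s 0 k * s 1 j) - y j * (s 0 i * s 1 k - s 0 k * s 1 i)
        + y k * (s 0 i * s 1 j - s 0 j * s 1 i) = (0 :: 'a)"
  unfolding assms(1)[OF assms(2)] assms(1)[OF assms(3)] assms(1)[OF assms(4)] sum_lessThan_2
  by (simp add: algebra_simps)

text \<open>Affine points suffice: lying in the span is a polynomial identity, and
  \<open>span_factor\<close> takes care of the behaviour at infinity.\<close>

lemma section_factor:
  fixes y :: "nat \<Rightarrow> 'a poly"
  assumes y: "\<And>i. i < n \<Longrightarrow> y i \<in> forms (int m)"
    and val: "\<And>t. inW (1, t) (\<lambda>i. ev (int m) (y i) (1, t))"
  obtains c where "\<forall>a<2. c a \<in> forms (int m - int (e a))" "\<forall>i<n. y i = (\<Sum>a<2. c a * \<sigma> a i)"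
proof (rule span_factor[of y "int m"])
  fix i j k assume ijk: "i < n" "j < n" "k < n"
  show "y i * (\<sigma> 0 j * \<sigma> 1 k - \<sigma> 0 k * \<sigma> 1 j) - y j * (\<sigma> 0 i * \<sigma> 1 k - \<sigma> 0 k * \<sigma> 1 i)
        + y k * (\<sigma> 0 i * \<sigma> 1 j - \<sigma> 0 j * \<sigma> 1 i) = 0"
  proof (rule poly_eq_0_if_all_0)
    fix t
    from val obtain c where c: "\<And>i. i < n \<Longrightarrow> ev (int m) (y i) (1, t) = (\<Sum>a<2. c a * S (1, t) a i)"
      unfolding curve_span_def by blast
    have yt: "ev (int m) (y i) (1, t) = poly (y i) t" if "i < n" for i
      using y[OF that] by (simp add: ev_one)
    have sv: "S (1, t) 0 i = poly (\<sigma> 0 i) t" "S (1, t) 1 i = poly (\<sigma> 1 i) t" if "i < n" for i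
      using ev_at_affine[OF _ that] by simp_all
    show "poly (y i * (\<sigma> 0 j * \<sigma> 1 k - \<sigma> 0 k * \<sigma> 1 j) - y j * (\<sigma> 0 i * \<sigma> 1 k - \<sigma> 0 k * \<sigma> 1 i)
        + y k * (\<sigma> 0 i * \<sigma> 1 j - \<sigma> 0 j * \<sigma> 1 i)) t = 0"
      using wedge_zero_if_inW[of "\<lambda>i. ev (int m) (y i) (1, t)" c "S (1, t)", OF c ijk]
      by (simp only: yt[OF ijk(1)] yt[OF ijk(2)] yt[OF ijk(3)] sv[OF ijk(1)] sv[OF ijk(2)] sv[OF ijk(3)]
          poly_add poly_diff poly_mult)
  qed
qed (use y that in auto)

subsection \<open>The differential\<close>

text \<open>Sections of twists of the subbundle are combinations of \<open>\<sigma> 0\<close> and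
  \<open>\<sigma> 1\<close> with forms as coefficients. By the Leibniz rule the derivatives of the
  coefficients only contribute elements of the fibre, so the condition can be tested on these two
  sections.\<close>

lemma represents_differential_iff:
  assumes x: "x \<noteq> (0, 0)" and M: "M \<in> carrier_mat n n"
  shows "represents_differential n f x w M \<longleftrightarrow>
    (\<forall>a<2. inW x (\<lambda>i. (\<Sum>j<n. M $$ (i, j) * S x a j) - D x w a i))"
proof
  assume R: "represents_differential n f x w M"
  show "\<forall>a<2. inW x (\<lambda>i. (\<Sum>j<n. M $$ (i, j) * S x a j) - D x w a i)"
  proof (intro allI impI)
    fix a :: nat assume a: "a < 2"
    have "sub_section n f (e a) (\<sigma> a)"
      unfolding sub_section_def
    proof (intro conjI allI impI)
      fix i assume "i < n" then show "\<sigma> a i \<in> forms (int (e a))" using sect a by blast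
    next
      fix y :: "'a \<times> 'a" assume y: "y \<noteq> (0, 0)"
      have "inW y (\<lambda>i. form_vec n (e a) (\<sigma> a) y $ i) \<longleftrightarrow> inW y (S y a)"
        by (rule inW_cong) (simp add: form_vec_def form_eval_eq_ev curve_value_def)
      then show "form_vec n (e a) (\<sigma> a) y \<in> f y"
        using inW_S[OF a] f_eq[OF y] by (simp add: form_vec_def)
    qed
    with R have "M *\<^sub>v form_vec n (e a) (\<sigma> a) x - form_vec_deriv n (e a) (\<sigma> a) x w \<in> f x"
      unfolding represents_differential_def by blast
    then have "inW x (\<lambda>i. (M *\<^sub>v form_vec n (e a) (\<sigma> a) x - form_vec_deriv n (e a) (\<sigma> a) x w) $ i)"
      using f_eq[OF x] by simp
    then show "inW x (\<lambda>i. (\<Sum>j<n. M $$ (i, j) * S x a j) - D x w a i)"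
      by (rule iffD1[OF inW_cong, rotated])
        (use M a sect in \<open>auto simp: form_vec_def form_vec_deriv_def scalar_prod_def form_deriv_eq_dv D_def
          form_eval_eq_ev curve_value_def atLeast0LessThan intro!: sum.cong\<close>)
  qed
next
  assume R: "\<forall>a<2. inW x (\<lambda>i. (\<Sum>j<n. M $$ (i, j) * S x a j) - D x w a i)"
  show "represents_differential n f x w M"
    unfolding represents_differential_def
  proof (intro allI impI)
    fix m \<tau> assume sub: "sub_section n f m \<tau>"
    have \<tau>: "\<And>i. i < n \<Longrightarrow> \<tau> i \<in> forms (int m)" using sub by (simp add: sub_section_def)
    have val: "inW (1, t) (\<lambda>i. ev (int m) (\<tau> i) (1, t))" for t
    proof -
      have "form_vec n m \<tau> (1, t) \<in> f (1, t)" using sub by (simp add: sub_section_def)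
      then have "inW (1, t) (\<lambda>i. form_vec n m \<tau> (1, t) $ i)" using f_eq[of "(1, t)"] by simp
      then show ?thesis by (rule iffD1[OF inW_cong, rotated]) (simp add: form_vec_def form_eval_eq_ev)
    qed
    obtain c where c': "\<forall>a<2. c a \<in> forms (int m - int (e a))"
      and \<tau>c': "\<forall>i<n. \<tau> i = (\<Sum>a<2. c a * \<sigma> a i)"
      using section_factor[OF \<tau> val] .
    have c: "c a \<in> forms (int m - int (e a))" if "a < 2" for a using c' that by blast
    have \<tau>c: "\<tau> i = (\<Sum>a<2. c a * \<sigma> a i)" if "i < n" for i using \<tau>c' that by blast
    define C where "C a = ev (int m - int (e a)) (c a) x" for a
    define C' where "C' a = dv (int m - int (e a)) (c a) x w" for a
    have E: "ev (int m) (\<tau> i) x = (\<Sum>a<2. C a * S x a i)" if i: "i < n" for i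
      unfolding \<tau>c[OF i] ev_sum C_def curve_value_def
      by (intro sum.cong refl ev_mult' c sect i) auto
    have E': "form_deriv m (\<tau> i) x w = (\<Sum>a<2. C' a * S x a i + C a * D x w a i)" if i: "i < n" for i
      unfolding form_deriv_eq_dv[OF \<tau>[OF i]] unfolding \<tau>c[OF i] dv_sum C_def C'_def curve_value_def D_def
    proof (intro sum.cong refl)
      fix a :: nat assume "a \<in> {..<2}"
      then show "dv (int m) (c a * \<sigma> a i) x w = dv (int m - int (e a)) (c a) x w * ev (int (e a)) (\<sigma> a i) x +
          ev (int m - int (e a)) (c a) x * dv (int (e a)) (\<sigma> a i) x w"
        using dv_mult[OF c sect[OF _ i], of a a x w] by simp
    qed
    have inn: "inW x (\<lambda>i. (\<Sum>a<2. C a * ((\<Sum>j<n. M $$ (i, j) * S x a j) - D x w a i)) - (\<Sum>a<2. C' a * S x a i))"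
      by (rule inW_diff[OF inW_combination inW_combination], rule R[rule_format], assumption, rule inW_S)
    have val': "inW x (\<lambda>i. (M *\<^sub>v form_vec n m \<tau> x - form_vec_deriv n m \<tau> x w) $ i)"
    proof (rule iffD1[OF inW_cong inn])
      fix i assume i: "i < n"
      have "(M *\<^sub>v form_vec n m \<tau> x - form_vec_deriv n m \<tau> x w) $ i
          = (\<Sum>j<n. M $$ (i, j) * (\<Sum>a<2. C a * S x a j)) - (\<Sum>a<2. C' a * S x a i + C a * D x w a i)"
        using i M by (auto simp: form_vec_def form_vec_deriv_def scalar_prod_def E' form_eval_eq_ev E atLeast0LessThan
            intro!: sum.cong)
      also have "(\<Sum>j<n. M $$ (i, j) * (\<Sum>a<2. C a * S x a j)) = (\<Sum>a<2. C a * (\<Sum>j<n. M $$ (i, j) * S x a j))"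
        unfolding sum_distrib_left by (subst sum.swap) (simp add: mult_ac)
      finally show "(\<Sum>a<2. C a * ((\<Sum>j<n. M $$ (i, j) * S x a j) - D x w a i)) - (\<Sum>a<2. C' a * S x a i)
          = (M *\<^sub>v form_vec n m \<tau> x - form_vec_deriv n m \<tau> x w) $ i"
        by (simp add: right_diff_distrib sum_subtractf sum.distrib)
    qed
    have "M *\<^sub>v form_vec n m \<tau> x - form_vec_deriv n m \<tau> x w \<in> carrier_vec n"
      by (rule carrier_vecI) (simp add: form_vec_deriv_def)
    then show "M *\<^sub>v form_vec n m \<tau> x - form_vec_deriv n m \<tau> x w \<in> f x"
      unfolding f_eq[OF x] using val' by (intro CollectI conjI)
  qed
qed

lemma unramified_iff:
  "unramified n f \<longleftrightarrow> (\<forall>x w. x \<noteq> (0, 0) \<longrightarrow> (\<forall>a<2. inW x (D x w a)) \<longrightarrow> (\<exists>c. w = (c * fst x, c * snd x)))"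
proof -
  have rep: "represents_differential n f x w (0\<^sub>m n n) \<longleftrightarrow> (\<forall>a<2. inW x (D x w a))" if x: "x \<noteq> (0, 0)" for x w
  proof -
    have "inW x (\<lambda>i. (\<Sum>j<n. 0\<^sub>m n n $$ (i, j) * S x a j) - D x w a i) \<longleftrightarrow> inW x (D x w a)" for a
    proof -
      have "inW x (\<lambda>i. (\<Sum>j<n. 0\<^sub>m n n $$ (i, j) * S x a j) - D x w a i) \<longleftrightarrow> inW x (\<lambda>i. (- 1) * D x w a i)"
        by (rule inW_cong) simp
      also have "\<dots> \<longleftrightarrow> inW x (D x w a)"
      proof
        assume "inW x (\<lambda>i. (- 1) * D x w a i)"
        from inW_scale[OF this, of "- 1"] show "inW x (D x w a)" by simp
      qed (rule inW_scale)
      finally show ?thesis .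
    qed
    then show ?thesis by (subst represents_differential_iff[OF x]) (simp_all only: zero_carrier_mat)
  qed
  show ?thesis unfolding unramified_def by (intro all_cong1 imp_cong refl rep)
qed

subsection \<open>Conormal vectors at a point\<close>

lemma normal_relations_iff:
  assumes "x \<noteq> (0, 0)"
  shows "M \<in> normal_relations n f x \<longleftrightarrow> M \<in> carrier_mat n n \<and>
    (\<exists>w. \<forall>a<2. inW x (\<lambda>i. (\<Sum>j<n. M $$ (i, j) * S x a j) - D x w a i))"
  unfolding normal_relations_def using represents_differential_iff[OF assms] by (simp cong: conj_cong)

definition perp :: "'a \<times> 'a \<Rightarrow> (nat \<Rightarrow> 'a) \<Rightarrow> bool" where
  "perp x b \<longleftrightarrow> (\<forall>a<2. (\<Sum>i<n. b i * S x a i) = 0)"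

definition tangent_pairing :: "'a \<times> 'a \<Rightarrow> 'a \<times> 'a \<Rightarrow> (nat \<Rightarrow> nat \<Rightarrow> 'a) \<Rightarrow> 'a" where
  "tangent_pairing x w b = (\<Sum>a<2. \<Sum>i<n. b a i * D x w a i)"

text \<open>A pair \<open>b\<close> stands for the functional on matrices given by
  \<open>conormal_mat\<close>. Orthogonality to the fibre makes it a functional on the tangent space
  \<open>Hom(W, K^n / W)\<close>; the second condition makes it vanish on the image of the
  differential.\<close>

definition conormal :: "'a \<times> 'a \<Rightarrow> (nat \<Rightarrow> nat \<Rightarrow> 'a) \<Rightarrow> bool" where
  "conormal x b \<longleftrightarrow> (\<forall>a<2. perp x (b a)) \<and> (\<forall>w. tangent_pairing x w b = 0)"

lemma conormal_perp: "conormal x b \<Longrightarrow> a < 2 \<Longrightarrow> perp x (b a)"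
  by (simp add: conormal_def)

lemma conormal_tangent: "conormal x b \<Longrightarrow> tangent_pairing x w b = 0"
  unfolding conormal_def by (erule conjE) (erule allE)

definition conormal_mat :: "'a \<times> 'a \<Rightarrow> (nat \<Rightarrow> nat \<Rightarrow> 'a) \<Rightarrow> nat \<Rightarrow> nat \<Rightarrow> 'a" where
  "conormal_mat x b i j = (\<Sum>a<2. b a i * S x a j)"

lemma perp_inW:
  assumes b: "perp x b" and y: "inW x y" and x: "x \<noteq> (0, 0)"
  shows "(\<Sum>i<n. b i * y i) = 0"
proof -
  from iffD1[OF inW_iff_perp[OF x] y]
  have "(\<forall>a<2. (\<Sum>i<n. b i * S x a i) = 0) \<longrightarrow> (\<Sum>i<n. b i * y i) = 0" by (rule spec)
  then show ?thesis using b unfolding perp_def by (rule mp)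
qed

lemma inW_if_perp:
  assumes "x \<noteq> (0, 0)" "\<And>b. perp x b \<Longrightarrow> (\<Sum>i<n. b i * y i) = 0"
  shows "inW x y"
  unfolding inW_iff_perp[OF assms(1)] by (intro allI impI) (rule assms(2)[unfolded perp_def])

lemma perp_combination:
  assumes "\<And>l. l < k \<Longrightarrow> perp x (b l)"
  shows "perp x (\<lambda>i. \<Sum>l<k. c l * b l i)"
  unfolding perp_def
proof (intro allI impI)
  fix a :: nat assume a: "a < 2"
  have "(\<Sum>i<n. (\<Sum>l<k. c l * b l i) * S x a i) = (\<Sum>l<k. c l * (\<Sum>i<n. b l i * S x a i))"
    unfolding sum_distrib_left sum_distrib_right by (subst sum.swap) (simp add: mult.assoc)
  also have "\<dots> = 0" using assms a by (simp add: perp_def)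
  finally show "(\<Sum>i<n. (\<Sum>l<k. c l * b l i) * S x a i) = 0" .
qed

lemma tangent_pairing_combination:
  "tangent_pairing x w (\<lambda>a i. \<Sum>l<k. c l * b l a i) = (\<Sum>l<k. c l * tangent_pairing x w (b l))"
proof -
  have "(\<Sum>i<n. (\<Sum>l<k. c l * b l a i) * D x w a i) = (\<Sum>l<k. c l * (\<Sum>i<n. b l a i * D x w a i))" for a
    unfolding sum_distrib_left sum_distrib_right by (subst sum.swap) (simp add: mult.assoc)
  then show ?thesis
    unfolding tangent_pairing_def by (simp add: sum_lessThan_2 distrib_left sum.distrib)
qed

lemma tangent_pairing_scale:
  "tangent_pairing x (c * fst w, c * snd w) b = c * tangent_pairing x w b"
  by (simp add: tangent_pairing_def D_def dv_scale sum_distrib_left mult_ac)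

lemma tangent_pairing_add:
  "tangent_pairing x (fst v + fst w, snd v + snd w) b = tangent_pairing x v b + tangent_pairing x w b"
  by (simp add: tangent_pairing_def D_def dv_add_direction distrib_left sum.distrib)

lemma conormal_mat_combination:
  "conormal_mat x (\<lambda>a i. \<Sum>l<k. c l * b l a i) i j = (\<Sum>l<k. c l * conormal_mat x (b l) i j)"
  by (simp add: conormal_mat_def sum_lessThan_2 sum_distrib_left sum_distrib_right distrib_left sum.distrib mult_ac)

lemma conormal_mat_pairing:
  "(\<Sum>i<n. \<Sum>j<n. conormal_mat x b i j * M i j) = (\<Sum>a<2. \<Sum>i<n. b a i * (\<Sum>j<n. M i j * S x a j))"
proof -
  have "(\<Sum>j<n. conormal_mat x b i j * M i j) = (\<Sum>a<2. b a i * (\<Sum>j<n. M i j * S x a j))" for i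
    by (simp add: conormal_mat_def sum_lessThan_2 sum_distrib_left distrib_right distrib_left sum.distrib mult_ac)
  then show ?thesis by (simp add: sum_lessThan_2 sum.distrib)
qed

lemma conormal_kills_normal_relations:
  assumes x: "x \<noteq> (0, 0)" and b: "conormal x b" and M: "M \<in> normal_relations n f x"
  shows "(\<Sum>i<n. \<Sum>j<n. conormal_mat x b i j * M $$ (i, j)) = 0"
proof -
  obtain w where w: "\<forall>a<2. inW x (\<lambda>i. (\<Sum>j<n. M $$ (i, j) * S x a j) - D x w a i)"
    using M unfolding normal_relations_iff[OF x] by (elim conjE exE)
  have "(\<Sum>i<n. b a i * (\<Sum>j<n. M $$ (i, j) * S x a j)) = (\<Sum>i<n. b a i * D x w a i)" if a: "a < 2" for a
  proof -
    have "(\<Sum>i<n. b a i * ((\<Sum>j<n. M $$ (i, j) * S x a j) - D x w a i)) = 0"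
      by (rule perp_inW[OF _ w[rule_format, OF a] x]) (rule conormal_perp[OF b a])
    then show ?thesis by (simp only: right_diff_distrib sum_subtractf right_minus_eq)
  qed
  then have "(\<Sum>i<n. \<Sum>j<n. conormal_mat x b i j * M $$ (i, j)) = tangent_pairing x w b"
    unfolding conormal_mat_pairing tangent_pairing_def by (rule sum.cong[OF refl]) (simp only: lessThan_iff)
  then show ?thesis using conormal_tangent[OF b] by simp
qed

lemma perp_eq_zero_if_zero_off_pivot:
  assumes "perp x b" "u < n" "v < n" "u \<noteq> v" "S x 0 u * S x 1 v - S x 0 v * S x 1 u \<noteq> 0"
    and off: "\<And>i. i < n \<Longrightarrow> i \<noteq> u \<Longrightarrow> i \<noteq> v \<Longrightarrow> b i = 0"
  shows "i < n \<Longrightarrow> b i = 0"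
proof -
  have "(\<Sum>i<n. b i * S x a i) = b u * S x a u + b v * S x a v" for a
  proof -
    have "(\<Sum>i<n. b i * S x a i) = (\<Sum>i\<in>{u, v}. b i * S x a i)"
      by (rule sum.mono_neutral_right) (use assms in auto)
    then show ?thesis using assms by simp
  qed
  then have e: "b u * S x a u + b v * S x a v = 0" if "a < 2" for a
    using assms(1) that by (simp add: perp_def)
  have e0: "b u * S x 0 u + b v * S x 0 v = 0" and e1: "b u * S x 1 u + b v * S x 1 v = 0"
    using e[of 0] e[of 1] by simp_all
  have "b u * (S x 0 u * S x 1 v - S x 0 v * S x 1 u)
      = S x 1 v * (b u * S x 0 u + b v * S x 0 v) - S x 0 v * (b u * S x 1 u + b v * S x 1 v)"
    by (simp add: algebra_simps)
  then have u0: "b u = 0" using assms(5) unfolding e0 e1 by simp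
  have "b v * (S x 0 u * S x 1 v - S x 0 v * S x 1 u)
      = S x 0 u * (b u * S x 1 u + b v * S x 1 v) - S x 1 u * (b u * S x 0 u + b v * S x 0 v)"
    by (simp add: algebra_simps)
  then have v0: "b v = 0" using assms(5) unfolding e0 e1 by simp
  show "b i = 0" if "i < n" using u0 v0 off[OF that] by metis
qed

text \<open>The orthogonal space of \<open>W\<close> has dimension \<open>n - 2\<close>.\<close>

lemma perp_pairs_dependent:
  fixes b :: "nat \<Rightarrow> nat \<Rightarrow> nat \<Rightarrow> 'a"
  assumes x: "x \<noteq> (0, 0)" and b: "\<And>l a. l < k \<Longrightarrow> a < 2 \<Longrightarrow> perp x (b l a)" and k: "k > 2 * (n - 2)"
  shows "\<exists>c. (\<exists>l<k. c l \<noteq> 0) \<and> (\<forall>a<2. \<forall>i<n. (\<Sum>l<k. c l * b l a i) = 0)"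
proof -
  obtain u v where uv: "u < n" "v < n" "u \<noteq> v" "S x 0 u * S x 1 v - S x 0 v * S x 1 u \<noteq> 0"
    using pivot[OF x] .
  define Q where "Q = {..<2::nat} \<times> ({..<n} - {u, v})"
  have "card ({..<n} - {u, v}) = n - 2" using uv by (subst card_Diff_subset) auto
  then have cQ: "card Q = 2 * (n - 2)" unfolding Q_def by (simp add: card_cartesian_product)
  obtain c where c: "\<forall>q\<in>Q. (\<Sum>l<k. b l (fst q) (snd q) * c l) = 0" "\<exists>l\<in>{..<k}. c l \<noteq> 0"
    using underdetermined_system[of "{..<k}" Q "\<lambda>q l. b l (fst q) (snd q)"] k cQ
    by (metis Q_def card_lessThan finite_Diff finite_SigmaI finite_lessThan)
  have "(\<Sum>l<k. c l * b l a i) = 0" if a: "a < 2" and i: "i < n" for a i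
  proof (rule perp_eq_zero_if_zero_off_pivot[OF perp_combination uv _ i])
    show "perp x (b l a)" if "l < k" for l using b that a by blast
    fix j assume "j < n" "j \<noteq> u" "j \<noteq> v"
    then have "(a, j) \<in> Q" using a by (simp add: Q_def)
    from bspec[OF c(1) this] show "(\<Sum>l<k. c l * b l a j) = 0" by (simp add: mult.commute)
  qed
  then show ?thesis using c(2) by (intro exI[of _ c]) auto
qed

text \<open>Pairs of vectors orthogonal to the fibre form a space of dimension
  \<open>2 * (n - 2)\<close>, in which the \<open>2 * n - 5\<close> conormal vectors span a
  hyperplane. Two functionals vanish on it: pairing with \<open>M\<close>, and pairing with a
  tangent direction \<open>v\<close>, which is nonzero because \<open>f\<close> is unramified. The
  first is therefore a multiple of the second, and the same multiple of \<open>v\<close> is the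
  direction represented by \<open>M\<close>.\<close>

lemma normal_relations_if_killed:
  assumes unr: "unramified n f" and n: "n \<ge> 3" and x: "x \<noteq> (0, 0)"
    and b: "\<And>l. l < 2 * n - 5 \<Longrightarrow> conormal x (b l)"
    and ind: "\<forall>c. (\<forall>a<2. \<forall>i<n. (\<Sum>l<2 * n - 5. c l * b l a i) = 0) \<longrightarrow> (\<forall>l<2 * n - 5. c l = 0)"
    and M: "M \<in> carrier_mat n n"
    and kill: "\<And>l. l < 2 * n - 5 \<Longrightarrow> (\<Sum>i<n. \<Sum>j<n. conormal_mat x (b l) i j * M $$ (i, j)) = 0"
  shows "M \<in> normal_relations n f x"
proof -
  define \<phi> where "\<phi> b = (\<Sum>i<n. \<Sum>j<n. conormal_mat x b i j * M $$ (i, j))" for b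
  have \<phi>_lin: "\<phi> (\<lambda>a i. \<Sum>l<k. c l * b l a i) = (\<Sum>l<k. c l * \<phi> (b l))" for k c b
  proof -
    have "\<phi> (\<lambda>a i. \<Sum>l<k. c l * b l a i) = (\<Sum>i<n. \<Sum>j<n. \<Sum>l<k. c l * (conormal_mat x (b l) i j * M $$ (i, j)))"
      unfolding \<phi>_def conormal_mat_combination sum_distrib_right mult.assoc ..
    also have "\<dots> = (\<Sum>i<n. \<Sum>l<k. \<Sum>j<n. c l * (conormal_mat x (b l) i j * M $$ (i, j)))"
      by (intro sum.cong refl sum.swap)
    also have "\<dots> = (\<Sum>l<k. \<Sum>i<n. \<Sum>j<n. c l * (conormal_mat x (b l) i j * M $$ (i, j)))"
      by (rule sum.swap)
    finally show ?thesis unfolding \<phi>_def sum_distrib_left .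
  qed
  define v where "v = (if snd x = 0 then (0, 1) else (1, 0) :: 'a \<times> 'a)"
  have v: "\<nexists>c. v = (c * fst x, c * snd x)"
    using x by (cases x) (auto simp: v_def)
  then obtain a0 where a0: "a0 < 2" "\<not> inW x (D x v a0)"
    using unr[unfolded unramified_iff, rule_format, OF x, of v] by metis
  obtain b1 where b1: "perp x b1" "(\<Sum>i<n. b1 i * D x v a0 i) \<noteq> 0"
    using a0(2) inW_if_perp[OF x] by metis
  define b0 where "b0 a i = (if a = a0 then b1 i else 0)" for a :: nat and i
  have b0p: "perp x (b0 a)" for a
    using b1(1) by (cases "a = a0") (simp_all add: b0_def perp_def)
  define t where "t = tangent_pairing x v b0"
  have single: "tangent_pairing x w (\<lambda>a i. if a = a1 then b i else 0) = (\<Sum>i<n. b i * D x w a1 i)" if "a1 < 2" for w b a1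
    using less_2_cases[OF that] unfolding tangent_pairing_def sum_lessThan_2 by auto
  have t0: "t \<noteq> 0" using b1(2) single[OF a0(1), of v b1] by (simp add: t_def b0_def[abs_def])
  define \<kappa> where "\<kappa> = \<phi> b0 / t"
  define w where "w = (\<kappa> * fst v, \<kappa> * snd v)"
  have main: "\<phi> z = tangent_pairing x w z" if z: "\<And>a. a < 2 \<Longrightarrow> perp x (z a)" for z
  proof -
    define k where "k = 2 * n - 5"
    \<comment> \<open>One vector more than the dimension: the conormal vectors, the pair
      \<open>b0\<close> on which \<open>v\<close> is detected, and \<open>z\<close> must be
      dependent.\<close>
    define B where "B l = (if l < k then b l else if l = k then b0 else z)" for l
    have Bp: "perp x (B l a)" if "a < 2" for l a
      using b z b0p that by (auto simp: B_def conormal_def k_def)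
    have kn: "Suc (Suc k) > 2 * (n - 2)" using n by (simp add: k_def)
    have "\<exists>c. (\<exists>l<Suc (Suc k). c l \<noteq> 0) \<and> (\<forall>a<2. \<forall>i<n. (\<Sum>l<Suc (Suc k). c l * B l a i) = 0)"
      by (rule perp_pairs_dependent[OF x _ kn]) (rule Bp)
    then obtain c where "(\<exists>l<Suc (Suc k). c l \<noteq> 0) \<and> (\<forall>a<2. \<forall>i<n. (\<Sum>l<Suc (Suc k). c l * B l a i) = 0)" ..
    then have c: "\<exists>l<Suc (Suc k). c l \<noteq> 0" "\<forall>a<2. \<forall>i<n. (\<Sum>l<Suc (Suc k). c l * B l a i) = 0"
      by (rule conjunct1, rule conjunct2)
    have th0: "tangent_pairing x w b = 0" if "\<forall>a<2. \<forall>i<n. b a i = 0" for b w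
      using that by (simp add: tangent_pairing_def)
    have ph0: "\<phi> b = 0" if "\<forall>a<2. \<forall>i<n. b a i = 0" for b
      using that unfolding \<phi>_def conormal_mat_pairing by simp
    have Bk: "tangent_pairing x u (B l) = 0" "\<phi> (B l) = 0" if "l < k" for l u
      using that conormal_tangent[OF b[of l]] kill[of l] by (simp_all add: B_def k_def \<phi>_def)
    have Bk': "B k = b0" "B (Suc k) = z" by (simp_all add: B_def)
    have T: "c k * tangent_pairing x u b0 + c (Suc k) * tangent_pairing x u z = 0" for u
      using th0[OF c(2), of u] unfolding tangent_pairing_combination by (simp add: Bk Bk')
    have P: "c k * \<phi> b0 + c (Suc k) * \<phi> z = 0"
      using ph0[OF c(2)] unfolding \<phi>_lin by (simp add: Bk Bk')
    have ck: "c (Suc k) \<noteq> 0"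
    proof
      assume z0: "c (Suc k) = 0"
      then have k0: "c k = 0" using T[of v] t0 by (simp add: t_def)
      have "\<forall>a<2. \<forall>i<n. (\<Sum>l<k. c l * b l a i) = 0"
      proof (intro allI impI)
        fix a i :: nat assume "a < 2" "i < n"
        then have "(\<Sum>l<Suc (Suc k). c l * B l a i) = 0" using c(2) by blast
        then have "(\<Sum>l<k. c l * B l a i) = 0" by (simp add: z0 k0)
        then show "(\<Sum>l<k. c l * b l a i) = 0" by (simp add: B_def)
      qed
      from mp[OF spec[OF ind[folded k_def]] this] have "\<forall>l<k. c l = 0" .
      with z0 k0 c(1) show False by (auto simp: less_Suc_eq)
    qed
    have "c (Suc k) * \<phi> z = - (c k * \<phi> b0)" using P by (simp add: eq_neg_iff_add_eq_0 add.commute)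
    also have "\<dots> = \<kappa> * - (c k * tangent_pairing x v b0)" using t0 by (simp add: \<kappa>_def t_def)
    also have "- (c k * tangent_pairing x v b0) = c (Suc k) * tangent_pairing x v z"
      using T[of v] by (simp add: neg_eq_iff_add_eq_0)
    also have "\<kappa> * (c (Suc k) * tangent_pairing x v z) = c (Suc k) * tangent_pairing x w z"
      unfolding w_def tangent_pairing_scale by (simp add: mult_ac)
    finally show ?thesis using ck by simp
  qed
  have "inW x (\<lambda>i. (\<Sum>j<n. M $$ (i, j) * S x a j) - D x w a i)" if a: "a < 2" for a
  proof (rule inW_if_perp[OF x])
    fix b' assume b': "perp x b'"
    define z where "z a' i = (if a' = a then b' i else 0)" for a' :: nat and i
    have zp: "perp x (z a')" for a'
      using b' by (cases "a' = a") (simp_all add: z_def perp_def)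
    have "\<phi> z = tangent_pairing x w z"
      by (rule main) (rule zp)
    moreover have "\<phi> z = (\<Sum>i<n. b' i * (\<Sum>j<n. M $$ (i, j) * S x a j))"
    proof -
      have "\<phi> z = (\<Sum>a'<2. \<Sum>i<n. z a' i * (\<Sum>j<n. M $$ (i, j) * S x a' j))"
        unfolding \<phi>_def conormal_mat_pairing ..
      then show ?thesis using less_2_cases[OF a] by (auto simp: sum_lessThan_2 z_def)
    qed
    moreover have "tangent_pairing x w z = (\<Sum>i<n. b' i * D x w a i)"
      unfolding z_def by (rule single[OF a])
    ultimately show "(\<Sum>i<n. b' i * ((\<Sum>j<n. M $$ (i, j) * S x a j) - D x w a i)) = 0"
      by (simp add: right_diff_distrib sum_subtractf)
  qed
  then show ?thesis
    unfolding normal_relations_iff[OF x] using M by (intro conjI exI[of _ w]) auto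
qed

text \<open>Three families of test matrices. Those vanishing on the fibre put the rows of
  \<open>h\<close> into the fibre; those with image in the fibre give orthogonality of the columns;
  those sending the basis of the fibre to its derivative give the tangency condition.\<close>

lemma conormal_if_kills_normal_relations:
  assumes x: "x \<noteq> (0, 0)"
    and kill: "\<And>M. M \<in> normal_relations n f x \<Longrightarrow> (\<Sum>i<n. \<Sum>j<n. h i j * M $$ (i, j)) = 0"
  shows "\<exists>b. conormal x b \<and> (\<forall>i<n. \<forall>j<n. h i j = conormal_mat x b i j)"
proof -
  obtain T where T': "\<forall>a<2. \<forall>b<2. (\<Sum>i<n. T a i * S x b i) = (if a = b then 1 else 0)"
    using dual_basis[OF x] .
  have T: "(\<Sum>i<n. T a i * S x b i) = (if a = b then 1 else 0)" if "a < 2" "b < 2" for a b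
    using T'[rule_format, OF that] .
  have kill': "(\<Sum>i<n. \<Sum>j<n. h i j * M i j) = 0"
    if "\<And>a. a < 2 \<Longrightarrow> inW x (\<lambda>i. (\<Sum>j<n. M i j * S x a j) - D x w a i)" for M w
  proof -
    have "mat n n (\<lambda>(i, j). M i j) \<in> normal_relations n f x"
      unfolding normal_relations_iff[OF x]
    proof (intro conjI exI[of _ w] allI impI)
      fix a :: nat assume a: "a < 2"
      show "inW x (\<lambda>i. (\<Sum>j<n. mat n n (\<lambda>(i, j). M i j) $$ (i, j) * S x a j) - D x w a i)"
        by (rule iffD1[OF inW_cong that[OF a]]) (auto intro!: sum.cong)
    qed auto
    from kill[OF this] show ?thesis by simp
  qed
  have D0: "D x (0, 0) a i = 0" for a i by (simp add: D_def dv_def)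
  define b where "b a i = (\<Sum>j<n. h i j * T a j)" for a i
  have rows: "h i j = conormal_mat x b i j" if i: "i < n" and j: "j < n" for i j
  proof -
    have "inW x (h i)"
    proof (rule inW_if_perp[OF x])
      fix d assume d: "perp x d"
      have "(\<Sum>k<n. \<Sum>j<n. h k j * (if k = i then d j else 0)) = 0"
      proof (rule kill'[of _ "(0, 0)"])
        fix a :: nat assume "a < 2"
        then have "(\<Sum>j<n. (if k = i then d j else 0) * S x a j) - D x (0, 0) a k = 0" for k
          using d by (cases "k = i") (auto simp: D0 perp_def)
        then show "inW x (\<lambda>k. (\<Sum>j<n. (if k = i then d j else 0) * S x a j) - D x (0, 0) a k)"
          using inW_zero by simp
      qed
      moreover have "(\<Sum>j<n. h k j * (if k = i then d j else 0)) = (if k = i then \<Sum>j<n. h i j * d j else 0)" for k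
        by auto
      ultimately show "(\<Sum>j<n. d j * h i j) = 0" using i by (simp add: mult.commute)
    qed
    then obtain c where c: "\<forall>j<n. h i j = (\<Sum>a<2. c a * S x a j)" unfolding curve_span_def by (elim exE)
    have "b a i = c a" if a: "a < 2" for a
    proof -
      have "b a i = (\<Sum>j<n. (\<Sum>a'<2. c a' * S x a' j) * T a j)"
        unfolding b_def using c by (intro sum.cong) auto
      also have "\<dots> = (\<Sum>a'<2. c a' * (\<Sum>j<n. T a j * S x a' j))"
        unfolding sum_distrib_left sum_distrib_right by (subst sum.swap) (simp add: mult_ac)
      also have "\<dots> = c a" using T[OF a] less_2_cases[OF a] by (auto simp: sum_lessThan_2)
      finally show ?thesis .
    qed
    then show ?thesis unfolding conormal_mat_def using c j by (simp add: sum_lessThan_2)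
  qed
  have "perp x (b a)" if a: "a < 2" for a
    unfolding perp_def
  proof (intro allI impI)
    fix a' :: nat assume a': "a' < 2"
    have "(\<Sum>i<n. \<Sum>j<n. h i j * (S x a' i * T a j)) = 0"
    proof (rule kill'[of _ "(0, 0)"])
      fix c :: nat assume c: "c < 2"
      have "(\<Sum>j<n. S x a' i * T a j * S x c j) = (\<Sum>j<n. T a j * S x c j) * S x a' i" for i
        by (simp add: sum_distrib_left mult_ac)
      then show "inW x (\<lambda>i. (\<Sum>j<n. S x a' i * T a j * S x c j) - D x (0, 0) c i)"
        using inW_scale[OF inW_S[OF a']] by (simp add: D0)
    qed
    moreover have "(\<Sum>j<n. h i j * (S x a' i * T a j)) = b a i * S x a' i" for i
      by (simp add: b_def sum_distrib_left mult_ac)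
    ultimately show "(\<Sum>i<n. b a i * S x a' i) = 0" by simp
  qed
  moreover have "tangent_pairing x w b = 0" for w
  proof -
    have "(\<Sum>i<n. \<Sum>j<n. h i j * (\<Sum>a<2. D x w a i * T a j)) = 0"
    proof (rule kill'[of _ w])
      fix c :: nat assume c: "c < 2"
      have "(\<Sum>j<n. (\<Sum>a<2. D x w a i * T a j) * S x c j) = D x w c i" for i
      proof -
        have "(\<Sum>j<n. (\<Sum>a<2. D x w a i * T a j) * S x c j) = (\<Sum>a<2. D x w a i * (\<Sum>j<n. T a j * S x c j))"
          unfolding sum_distrib_left sum_distrib_right by (subst sum.swap) (simp add: mult_ac)
        also have "\<dots> = D x w c i" using T[OF _ c] less_2_cases[OF c] by (auto simp: sum_lessThan_2)
        finally show ?thesis .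
      qed
      then show "inW x (\<lambda>i. (\<Sum>j<n. (\<Sum>a<2. D x w a i * T a j) * S x c j) - D x w c i)"
        using inW_zero by simp
    qed
    moreover have "(\<Sum>j<n. h i j * (\<Sum>a<2. D x w a i * T a j)) = (\<Sum>a<2. b a i * D x w a i)" for i
      unfolding b_def sum_distrib_left sum_distrib_right by (subst sum.swap) (simp add: mult_ac)
    ultimately have "(\<Sum>i<n. \<Sum>a<2. b a i * D x w a i) = 0" by simp
    then show ?thesis unfolding tangent_pairing_def by (subst sum.swap)
  qed
  ultimately have "conormal x b" by (simp add: conormal_def)
  with rows show ?thesis by blast
qed

end

section \<open>Linear systems with polynomial unknowns\<close>

lemma card_exponents: "card {k. int k \<le> e} = nat (e + 1)" and finite_exponents: "finite {k. int k \<le> e}"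
proof -
  have "{k. int k \<le> e} = {..<nat (e + 1)}" by auto
  then show "card {k. int k \<le> e} = nat (e + 1)" "finite {k. int k \<le> e}" by simp_all
qed

definition independent_polys :: "'u set \<Rightarrow> nat \<Rightarrow> (nat \<Rightarrow> 'u \<Rightarrow> 'a::field poly) \<Rightarrow> bool" where
  "independent_polys U N B \<longleftrightarrow>
     (\<forall>c. (\<forall>u\<in>U. (\<Sum>l<N. Polynomial.smult (c l) (B l u)) = 0) \<longrightarrow> (\<forall>l<N. c l = 0))"

lemma independent_polysD:
  "independent_polys U N B \<Longrightarrow> (\<And>u. u \<in> U \<Longrightarrow> (\<Sum>l<N. Polynomial.smult (c l) (B l u)) = 0) \<Longrightarrow> l < N \<Longrightarrow> c l = 0"
  unfolding independent_polys_def by (erule allE[of _ c]) (erule impE, rule ballI, simp_all only: simp_thms)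

text \<open>Equations are imposed coefficient by coefficient, on the set \<open>K q\<close>, so that
  they can be counted and so that a single coefficient can be left out at a ramification
  point.\<close>

definition poly_solution ::
    "'u set \<Rightarrow> ('u \<Rightarrow> int) \<Rightarrow> 'q set \<Rightarrow> ('q \<Rightarrow> nat set) \<Rightarrow> ('q \<Rightarrow> 'u \<Rightarrow> 'a::field poly) \<Rightarrow> ('u \<Rightarrow> 'a poly) \<Rightarrow> bool" where
  "poly_solution U du Q K g P \<longleftrightarrow> (\<forall>u\<in>U. P u \<in> forms (du u)) \<and>
     (\<forall>q\<in>Q. \<forall>k\<in>K q. coeff (\<Sum>u\<in>U. P u * g q u) k = 0)"

text \<open>Elimination on the coefficients of the unknown polynomials. The free coefficients are
  returned as \<open>C\<close>, because semicontinuity needs \<open>N\<close> positions that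
  determine a solution.\<close>

lemma polynomial_system_solutions:
  fixes g :: "'q \<Rightarrow> 'u \<Rightarrow> 'a::field poly"
  assumes "finite U" "finite Q" "\<forall>q\<in>Q. finite (K q)"
  shows "\<exists>N B. (\<forall>l<N. poly_solution U du Q K g (B l)) \<and> independent_polys U N B \<and>
    (\<forall>P. poly_solution U du Q K g P \<longrightarrow> (\<exists>c. \<forall>u\<in>U. P u = (\<Sum>l<N. Polynomial.smult (c l) (B l u)))) \<and>
    (\<Sum>u\<in>U. nat (du u + 1)) \<le> N + (\<Sum>q\<in>Q. card (K q)) \<and>
    (\<exists>C. finite C \<and> card C = N \<and> (\<forall>P. poly_solution U du Q K g P \<longrightarrow>
      (\<forall>i\<in>C. coeff (P (fst i)) (snd i) = 0) \<longrightarrow> (\<forall>u\<in>U. P u = 0)))"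
proof -
  define I where "I = (SIGMA u:U. {k. int k \<le> du u})"
  define R where "R = (SIGMA q:Q. K q)"
  define A where "A r i = coeff (monom 1 (snd i) * g (fst r) (fst i)) (snd r)" for r :: "'q \<times> nat" and i
  define P where "P x u = (\<Sum>l\<in>{k. int k \<le> du u}. monom (x (u, l)) l)" for x :: "'u \<times> nat \<Rightarrow> 'a" and u
  have fin: "finite I" "finite R"
    unfolding I_def R_def using assms finite_exponents by (auto intro!: finite_SigmaI)
  have cI: "card I = (\<Sum>u\<in>U. nat (du u + 1))"
    unfolding I_def using assms(1) finite_exponents by (subst card_SigmaI) (auto simp: card_exponents)
  have cR: "card R = (\<Sum>q\<in>Q. card (K q))"
    unfolding R_def using assms by (subst card_SigmaI) auto
  have coeffP: "coeff (P x u) k = (if int k \<le> du u then x (u, k) else 0)" for x u k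
    unfolding P_def coeff_sum coeff_monom using finite_exponents[of "du u"]
    by (subst sum.delta) auto
  have Pforms: "P x u \<in> forms (du u)" for x u
    unfolding forms_iff_coeff coeffP by simp
  have AP: "(\<Sum>i\<in>I. A (q, k) i * x i) = coeff (\<Sum>u\<in>U. P x u * g q u) k" for q k x
  proof -
    have "(\<Sum>i\<in>I. A (q, k) i * x i) = (\<Sum>u\<in>U. \<Sum>l\<in>{k. int k \<le> du u}. A (q, k) (u, l) * x (u, l))"
      unfolding I_def using assms(1) finite_exponents by (subst sum.Sigma) auto
    also have "\<dots> = (\<Sum>u\<in>U. coeff (P x u * g q u) k)"
    proof (rule sum.cong[OF refl])
      fix u assume "u \<in> U"
      have "coeff (P x u * g q u) k = (\<Sum>l\<in>{k. int k \<le> du u}. coeff (monom (x (u, l)) l * g q u) k)"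
        unfolding P_def sum_distrib_right coeff_sum ..
      also have "\<dots> = (\<Sum>l\<in>{k. int k \<le> du u}. A (q, k) (u, l) * x (u, l))"
      proof (rule sum.cong[OF refl])
        fix l
        have "monom (x (u, l)) l = Polynomial.smult (x (u, l)) (monom 1 l)" by (simp add: smult_monom)
        then show "coeff (monom (x (u, l)) l * g q u) k = A (q, k) (u, l) * x (u, l)"
          by (simp add: A_def)
      qed
      finally show "(\<Sum>l\<in>{k. int k \<le> du u}. A (q, k) (u, l) * x (u, l)) = coeff (P x u * g q u) k" ..
    qed
    finally show ?thesis by (simp add: coeff_sum)
  qed
  have sol: "poly_solution U du Q K g (P x) \<longleftrightarrow> (\<forall>r\<in>R. (\<Sum>i\<in>I. A r i * x i) = 0)" for x
    unfolding poly_solution_def R_def by (auto simp: AP Pforms)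
  obtain Fr X where FX: "solution_basis A I R Fr X" and le: "card I \<le> card Fr + card R"
    using homogeneous_system_solution[OF fin] by blast
  have FrI: "Fr \<subseteq> I" and FX1: "\<And>j r. j \<in> Fr \<Longrightarrow> r \<in> R \<Longrightarrow> (\<Sum>i\<in>I. A r i * X j i) = 0"
    and FX2: "\<And>j j'. j \<in> Fr \<Longrightarrow> j' \<in> Fr \<Longrightarrow> X j j' = (if j = j' then 1 else 0)"
    using FX unfolding solution_basis_def by blast+
  have FX3: "\<forall>i\<in>I. x i = 0" if "\<forall>r\<in>R. (\<Sum>i\<in>I. A r i * x i) = 0" "\<forall>j\<in>Fr. x j = 0" for x
    using FX[unfolded solution_basis_def, THEN conjunct2, THEN conjunct2, THEN conjunct2, THEN conjunct2,
        THEN spec, THEN mp, OF that(1), THEN mp, OF that(2)] .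
  have fFr: "finite Fr" using FrI fin finite_subset by blast
  obtain h where h: "bij_betw h {..<card Fr} Fr"
    using ex_bij_betw_nat_finite[OF fFr] by (auto simp: atLeast0LessThan)
  have hF: "h l \<in> Fr" if "l < card Fr" for l using h that by (auto simp: bij_betw_def)
  have hinj: "h l = h l' \<longleftrightarrow> l = l'" if "l < card Fr" "l' < card Fr" for l l'
    using h that by (auto simp: bij_betw_def inj_on_def)
  define B where "B l = P (X (h l))" for l
  have comb: "coeff (\<Sum>l<N. Polynomial.smult (c l) (B l u)) k = (\<Sum>l<N. c l * X (h l) (u, k))"
    if "int k \<le> du u" for N c u k
    using that by (simp add: coeff_sum B_def coeffP)
  have "poly_solution U du Q K g (B l)" if "l < card Fr" for l
    unfolding B_def sol using FX1[OF hF[OF that]] by blast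
  moreover have "independent_polys U (card Fr) B"
    unfolding independent_polys_def
  proof (intro allI impI)
    fix c l assume z: "\<forall>u\<in>U. (\<Sum>l<card Fr. Polynomial.smult (c l) (B l u)) = 0" and l: "l < card Fr"
    obtain u k where uk: "h l = (u, k)" by (cases "h l")
    then have u: "u \<in> U" "int k \<le> du u" using hF[OF l] FrI by (auto simp: I_def)
    have "coeff (\<Sum>l'<card Fr. Polynomial.smult (c l') (B l' u)) k = (\<Sum>l'<card Fr. c l' * X (h l') (u, k))"
      by (rule comb[OF u(2)])
    then have "0 = (\<Sum>l'<card Fr. c l' * X (h l') (h l))"
      unfolding uk bspec[OF z u(1)] by simp
    also have "\<dots> = (\<Sum>l'<card Fr. if l' = l then c l' else 0)"
      using hF l hinj by (intro sum.cong) (auto simp: FX2)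
    also have "\<dots> = c l" using l by simp
    finally show "c l = 0" by simp
  qed
  moreover have "\<exists>c. \<forall>u\<in>U. p u = (\<Sum>l<card Fr. Polynomial.smult (c l) (B l u))"
    if p: "poly_solution U du Q K g p" for p
  proof -
    define x where "x i = coeff (p (fst i)) (snd i)" for i
    have Px: "P x u = p u" if "u \<in> U" for u
    proof (rule poly_eqI)
      fix k
      have "p u \<in> forms (du u)" using p that by (simp add: poly_solution_def)
      then show "coeff (P x u) k = coeff (p u) k" by (simp add: coeffP x_def forms_iff_coeff)
    qed
    have "poly_solution U du Q K g (P x)"
      using p Px unfolding poly_solution_def by (auto simp: Pforms cong: sum.cong)
    then have xs: "(\<Sum>i\<in>I. A r i * x i) = 0" if "r \<in> R" for r using that unfolding sol by (rule bspec)
    define y where "y i = x i - (\<Sum>l<card Fr. x (h l) * X (h l) i)" for i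
    have "\<forall>r\<in>R. (\<Sum>i\<in>I. A r i * y i) = 0"
    proof
      fix r assume r: "r \<in> R"
      have "(\<Sum>i\<in>I. A r i * y i) = (\<Sum>i\<in>I. A r i * x i) - (\<Sum>i\<in>I. \<Sum>l<card Fr. x (h l) * (A r i * X (h l) i))"
        unfolding y_def right_diff_distrib sum_subtractf sum_distrib_left by (simp add: mult.left_commute)
      also have "(\<Sum>i\<in>I. \<Sum>l<card Fr. x (h l) * (A r i * X (h l) i)) = (\<Sum>l<card Fr. x (h l) * (\<Sum>i\<in>I. A r i * X (h l) i))"
        unfolding sum_distrib_left by (rule sum.swap)
      also have "\<dots> = 0" using FX1[OF hF r] by simp
      finally show "(\<Sum>i\<in>I. A r i * y i) = 0" using xs[OF r] by simp
    qed
    moreover have "\<forall>j\<in>Fr. y j = 0"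
    proof
      fix j assume "j \<in> Fr"
      then obtain l where l: "l < card Fr" "j = h l" using h by (auto simp: bij_betw_def)
      have "(\<Sum>l'<card Fr. x (h l') * X (h l') (h l)) = (\<Sum>l'<card Fr. if l' = l then x (h l) else 0)"
        using hF l(1) hinj by (intro sum.cong) (auto simp: FX2)
      then show "y j = 0" using l by (simp add: y_def)
    qed
    ultimately have y0: "\<forall>i\<in>I. y i = 0" by (rule FX3)
    have "p u = (\<Sum>l<card Fr. Polynomial.smult (x (h l)) (B l u))" if u: "u \<in> U" for u
    proof (rule poly_eqI)
      fix k
      show "coeff (p u) k = coeff (\<Sum>l<card Fr. Polynomial.smult (x (h l)) (B l u)) k"
      proof (cases "int k \<le> du u")
        case True
        then have "(u, k) \<in> I" using u by (simp add: I_def)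
        then have "y (u, k) = 0" by (rule bspec[OF y0])
        then show ?thesis unfolding comb[OF True] by (simp add: y_def x_def)
      next
        case False
        have "p u \<in> forms (du u)" using p u by (simp add: poly_solution_def)
        then show ?thesis using False by (simp add: forms_iff_coeff coeff_sum B_def coeffP)
      qed
    qed
    then show ?thesis by (intro exI[of _ "\<lambda>l. x (h l)"] ballI)
  qed
  moreover have "\<forall>u\<in>U. p u = 0" if p: "poly_solution U du Q K g p" and z: "\<forall>i\<in>Fr. coeff (p (fst i)) (snd i) = 0" for p
  proof -
    define x where "x i = coeff (p (fst i)) (snd i)" for i
    have Px: "P x u = p u" if "u \<in> U" for u
    proof (rule poly_eqI)
      fix k
      have "p u \<in> forms (du u)" using p that by (simp add: poly_solution_def)
      then show "coeff (P x u) k = coeff (p u) k" by (simp add: coeffP x_def forms_iff_coeff)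
    qed
    have "poly_solution U du Q K g (P x)"
      using p Px unfolding poly_solution_def by (auto simp: Pforms cong: sum.cong)
    then have "\<forall>i\<in>I. x i = 0" unfolding sol by (rule FX3) (use z in \<open>simp add: x_def\<close>)
    then have "P x u = 0" if "u \<in> U" for u
      using that unfolding poly_eq_iff coeffP I_def by auto
    then show ?thesis using Px by simp
  qed
  ultimately show ?thesis
    using le fFr unfolding cI cR
    by (intro exI[of _ "card Fr"] exI[of _ B] exI[of _ Fr] conjI allI impI) simp_all
qed

text \<open>Each \<open>v l\<close> costs at most one member of the family: if adding
  \<open>v M\<close> creates a relation, removing an index \<open>j0\<close> that occurs in it
  restores independence, since from two relations \<open>v M\<close> could be eliminated.\<close>

lemma independent_modulo:
  fixes w :: "'j \<Rightarrow> 'q \<Rightarrow> 'a::field" and v :: "nat \<Rightarrow> 'q \<Rightarrow> 'a"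
  assumes "finite J" and ind: "\<forall>c. (\<forall>q\<in>Q. (\<Sum>j\<in>J. c j * w j q) = 0) \<longrightarrow> (\<forall>j\<in>J. c j = 0)"
  shows "\<exists>J'\<subseteq>J. card J \<le> card J' + M \<and>
    (\<forall>c d. (\<forall>q\<in>Q. (\<Sum>j\<in>J'. c j * w j q) = (\<Sum>l<M. d l * v l q)) \<longrightarrow> (\<forall>j\<in>J'. c j = 0))"
proof (induction M)
  case 0
  then show ?case using ind by (intro exI[of _ J]) simp
next
  case (Suc M)
  then obtain J' where J': "J' \<subseteq> J" "card J \<le> card J' + M"
    and IH: "\<forall>c d. (\<forall>q\<in>Q. (\<Sum>j\<in>J'. c j * w j q) = (\<Sum>l<M. d l * v l q)) \<longrightarrow> (\<forall>j\<in>J'. c j = 0)"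
    by (elim exE conjE)
  have fJ: "finite J'" using J' assms(1) finite_subset by blast
  show ?case
  proof (cases "\<forall>c d. (\<forall>q\<in>Q. (\<Sum>j\<in>J'. c j * w j q) = (\<Sum>l<Suc M. d l * v l q)) \<longrightarrow> (\<forall>j\<in>J'. c j = 0)")
    case True
    then show ?thesis using J' by (intro exI[of _ J']) simp
  next
    case False
    then obtain c d j0 where cd: "\<forall>q\<in>Q. (\<Sum>j\<in>J'. c j * w j q) = (\<Sum>l<Suc M. d l * v l q)"
      and j0: "j0 \<in> J'" "c j0 \<noteq> 0" by (simp only: not_all not_imp Set.bex_simps) (elim exE conjE, blast)
    have dM: "d M \<noteq> 0"
    proof
      assume "d M = 0"
      then have "\<forall>q\<in>Q. (\<Sum>j\<in>J'. c j * w j q) = (\<Sum>l<M. d l * v l q)" using cd by simp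
      from mp[OF spec[OF spec[OF IH]] this] j0 show False by blast
    qed
    have "\<forall>j\<in>J' - {j0}. c' j = 0" if c': "\<forall>q\<in>Q. (\<Sum>j\<in>J' - {j0}. c' j * w j q) = (\<Sum>l<Suc M. d' l * v l q)" for c' d'
    proof -
      \<comment> \<open>Subtracting \<open>t\<close> times the first relation removes the term with
        \<open>v M\<close>, so that the induction hypothesis applies.\<close>
      define t where "t = d' M / d M"
      define b where "b j = (if j = j0 then 0 else c' j) - t * c j" for j
      have "\<forall>q\<in>Q. (\<Sum>j\<in>J'. b j * w j q) = (\<Sum>l<M. (d' l - t * d l) * v l q)"
      proof
        fix q assume q: "q \<in> Q"
        have "(\<Sum>j\<in>J'. b j * w j q) = (\<Sum>j\<in>J'. (if j = j0 then 0 else c' j) * w j q) - t * (\<Sum>j\<in>J'. c j * w j q)"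
          unfolding b_def left_diff_distrib sum_subtractf sum_distrib_left mult.assoc ..
        also have "(\<Sum>j\<in>J'. (if j = j0 then 0 else c' j) * w j q) = (\<Sum>j\<in>J' - {j0}. c' j * w j q)"
          by (rule sum.mono_neutral_cong_right) (use fJ in auto)
        also have "\<dots> - t * (\<Sum>j\<in>J'. c j * w j q) = (\<Sum>l<Suc M. (d' l - t * d l) * v l q)"
          unfolding bspec[OF cd q] bspec[OF c' q] left_diff_distrib sum_subtractf sum_distrib_left mult.assoc ..
        finally show "(\<Sum>j\<in>J'. b j * w j q) = (\<Sum>l<M. (d' l - t * d l) * v l q)"
          using dM by (simp add: t_def)
      qed
      from mp[OF spec[OF spec[OF IH]] this] have b0: "\<forall>j\<in>J'. b j = 0" .
      then have "t * c j0 = 0" using j0(1) by (force simp: b_def)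
      then have t0: "t = 0" using j0(2) by simp
      show ?thesis
      proof
        fix j assume j: "j \<in> J' - {j0}"
        then have "b j = 0" by (intro bspec[OF b0]) simp
        then show "c' j = 0" using j t0 by (simp add: b_def)
      qed
    qed
    then have *: "\<forall>c d. (\<forall>q\<in>Q. (\<Sum>j\<in>J' - {j0}. c j * w j q) = (\<Sum>l<Suc M. d l * v l q)) \<longrightarrow> (\<forall>j\<in>J' - {j0}. c j = 0)"
      by (intro allI impI)
    have "card J \<le> card (J' - {j0}) + Suc M" using J' j0 fJ by (simp add: card_Diff_singleton)
    then show ?thesis using J' * by (intro exI[of _ "J' - {j0}"] conjI) (blast, assumption+)
  qed
qed

lemma poly_smult_sum: "Polynomial.smult c (\<Sum>i\<in>I. p i) = (\<Sum>i\<in>I. Polynomial.smult c (p i))"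
  by (induction I rule: infinite_finite_induct) (simp_all add: smult_add_right)

lemma ev_sum_mult:
  fixes p q :: "nat \<Rightarrow> 'a::field poly"
  assumes "\<And>i. i < k \<Longrightarrow> p i \<in> forms s" "\<And>i. i < k \<Longrightarrow> q i \<in> forms t"
  shows "(\<Sum>i<k. ev s (p i) x * ev t (q i) x) = ev (s + t) (\<Sum>i<k. p i * q i) x"
  unfolding ev_sum using assms by (intro sum.cong refl ev_mult[symmetric]) auto

context split_curve
begin

subsection \<open>Global sections of twists of the conormal bundle\<close>

definition perp_section :: "int \<Rightarrow> (nat \<Rightarrow> nat \<Rightarrow> 'a poly) \<Rightarrow> bool" where
  "perp_section m z \<longleftrightarrow> (\<forall>a<2. \<forall>i<n. z a i \<in> forms (m - int (e a))) \<and>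
     (\<forall>a<2. \<forall>a'<2. (\<Sum>i<n. z a i * \<sigma> a' i) = 0)"

definition tangent_form :: "(nat \<Rightarrow> nat \<Rightarrow> 'a poly) \<Rightarrow> 'a poly" where
  "tangent_form z = (\<Sum>a<2. \<Sum>i<n. z a i * pderiv (\<sigma> a i))"

definition conormal_section :: "int \<Rightarrow> (nat \<Rightarrow> nat \<Rightarrow> 'a poly) \<Rightarrow> bool" where
  "conormal_section m z \<longleftrightarrow> perp_section m z \<and> tangent_form z = 0"

text \<open>The tensor \<open>z 0 \<otimes> \<sigma> 0 + z 1 \<otimes> \<sigma> 1\<close> as a functional on matrices.\<close>

definition section_mat :: "(nat \<Rightarrow> nat \<Rightarrow> 'a poly) \<Rightarrow> nat \<Rightarrow> nat \<Rightarrow> 'a poly" where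
  "section_mat z i j = (\<Sum>a<2. z a i * \<sigma> a j)"

definition section_value :: "int \<Rightarrow> (nat \<Rightarrow> nat \<Rightarrow> 'a poly) \<Rightarrow> 'a \<times> 'a \<Rightarrow> nat \<Rightarrow> nat \<Rightarrow> 'a" where
  "section_value m z x a i = ev (m - int (e a)) (z a i) x"

lemma perp_section_forms: "perp_section m z \<Longrightarrow> a < 2 \<Longrightarrow> i < n \<Longrightarrow> z a i \<in> forms (m - int (e a))"
  and perp_section_perp: "perp_section m z \<Longrightarrow> a < 2 \<Longrightarrow> a' < 2 \<Longrightarrow> (\<Sum>i<n. z a i * \<sigma> a' i) = 0"
  by (simp_all add: perp_section_def)

lemma conormal_section_forms: "conormal_section m z \<Longrightarrow> a < 2 \<Longrightarrow> i < n \<Longrightarrow> z a i \<in> forms (m - int (e a))"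
  and conormal_section_perp: "conormal_section m z \<Longrightarrow> a < 2 \<Longrightarrow> a' < 2 \<Longrightarrow> (\<Sum>i<n. z a i * \<sigma> a' i) = 0"
  and conormal_section_tangent: "conormal_section m z \<Longrightarrow> (\<Sum>a<2. \<Sum>i<n. z a i * pderiv (\<sigma> a i)) = 0"
  by (simp_all add: conormal_section_def perp_section_def tangent_form_def)

lemma conormal_section_cong:
  assumes "\<And>a i. a < 2 \<Longrightarrow> i < n \<Longrightarrow> z a i = z' a i"
  shows "conormal_section m z \<longleftrightarrow> conormal_section m z'"
  unfolding conormal_section_def perp_section_def tangent_form_def using assms by simp

lemma perp_section_value:
  assumes z: "perp_section m z" and a: "a < 2"
  shows "perp x (section_value m z x a)"
  unfolding perp_def
proof (intro allI impI)
  fix a' :: nat assume a': "a' < 2"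
  have "(\<Sum>i<n. section_value m z x a i * S x a' i) = ev (m - int (e a) + int (e a')) (\<Sum>i<n. z a i * \<sigma> a' i) x"
    unfolding section_value_def curve_value_def
    by (rule ev_sum_mult) (rule perp_section_forms[OF z a] sect[OF a'], assumption)+
  then show "(\<Sum>i<n. section_value m z x a i * S x a' i) = 0"
    using perp_section_perp[OF z a a'] by simp
qed

text \<open>By Euler's formula both partial derivatives are governed by a single form of degree \<open>m - 2\<close>.\<close>

lemma tangent_form_forms_and_pairing:
  assumes z: "perp_section m z"
  shows "tangent_form z \<in> forms (m - 2)"
    and "tangent_pairing x w (section_value m z x) = (snd w * fst x - fst w * snd x) * ev (m - 2) (tangent_form z) x"
proof -
  define G where "G a i = Polynomial.smult (of_int (int (e a))) (\<sigma> a i) - [:0, 1:] * pderiv (\<sigma> a i)" for a i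
  define t1 where "t1 a = (\<Sum>i<n. z a i * G a i)" for a
  define t2 where "t2 a = (\<Sum>i<n. z a i * pderiv (\<sigma> a i))" for a
  have t12: "t1 a = - ([:0, 1:] * t2 a)" if a: "a < 2" for a
  proof -
    have "t1 a = Polynomial.smult (of_int (int (e a))) (\<Sum>i<n. z a i * \<sigma> a i) - [:0, 1:] * t2 a"
      unfolding t1_def t2_def G_def poly_smult_sum right_diff_distrib sum_subtractf sum_distrib_left
      by (simp add: mult.left_commute[of "[:0, 1:]"] del: mult_pCons_left mult_pCons_right)
    then show ?thesis using perp_section_perp[OF z a a] by simp
  qed
  have t1f: "t1 a \<in> forms (m - 1)" if a: "a < 2" for a
    unfolding t1_def G_def
    by (intro forms_sum forms_mult'[OF perp_section_forms[OF z a] forms_euler[OF sect[OF a]]]) auto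
  have A: "(\<Sum>i<n. section_value m z x a i * D x w a i) = fst w * ev (m - 1) (t1 a) x + snd w * ev (m - 1) (t2 a) x"
    if a: "a < 2" for a
  proof -
    have 1: "(\<Sum>i<n. section_value m z x a i * ev (int (e a) - 1) (G a i) x) = ev (m - 1) (t1 a) x"
      unfolding section_value_def t1_def
      using ev_sum_mult[of n "z a" "m - int (e a)" "G a" "int (e a) - 1" x] perp_section_forms[OF z a]
        forms_euler[OF sect[OF a]] by (simp add: G_def)
    have 2: "(\<Sum>i<n. section_value m z x a i * ev (int (e a) - 1) (pderiv (\<sigma> a i)) x) = ev (m - 1) (t2 a) x"
      unfolding section_value_def t2_def
      using ev_sum_mult[of n "z a" "m - int (e a)" "\<lambda>i. pderiv (\<sigma> a i)" "int (e a) - 1" x] perp_section_forms[OF z a]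
        forms_pderiv[OF sect[OF a]] by simp
    show ?thesis
      unfolding 1[symmetric] 2[symmetric] D_def dv_def G_def[symmetric] sum_distrib_left distrib_left sum.distrib
      by (simp add: mult_ac)
  qed
  have T2: "tangent_form z = t2 0 + t2 (Suc 0)"
    by (simp add: tangent_form_def sum_lessThan_2 t2_def)
  have T1: "t1 0 + t1 (Suc 0) = - ([:0, 1:] * tangent_form z)"
    unfolding T2 distrib_left using t12[of 0] t12[of 1] by (simp del: mult_pCons_left)
  have "[:0, 1:] * tangent_form z \<in> forms (m - 1)"
    using forms_minus[OF forms_add[OF t1f[of 0] t1f[of "Suc 0"]]] unfolding T1 by simp
  then show F: "tangent_form z \<in> forms (m - 2)" unfolding forms_X_mult_iff by simp
  have X: "[:0, 1 :: 'a:] \<in> forms 1" "1 \<in> (forms 1 :: 'a poly set)" by (simp_all add: forms_def)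
  have 1: "ev (m - 1) (t1 0 + t1 (Suc 0)) x = - snd x * ev (m - 2) (tangent_form z) x"
    unfolding T1 ev_minus by (subst ev_mult'[OF X(1) F]) (simp_all add: ev_linear)
  have "ev (m - 1) (1 * tangent_form z) x = ev 1 [:1, 0:] x * ev (m - 2) (tangent_form z) x"
    by (subst ev_mult'[OF X(2) F]) (simp_all add: one_pCons)
  then have 2: "ev (m - 1) (t2 0 + t2 (Suc 0)) x = fst x * ev (m - 2) (tangent_form z) x"
    unfolding ev_linear by (simp add: T2)
  show "tangent_pairing x w (section_value m z x) = (snd w * fst x - fst w * snd x) * ev (m - 2) (tangent_form z) x"
  proof -
    have lt: "(0::nat) < 2" "Suc 0 < 2" by simp_all
    have "tangent_pairing x w (section_value m z x)
        = fst w * (ev (m - 1) (t1 0) x + ev (m - 1) (t1 (Suc 0)) x) + snd w * (ev (m - 1) (t2 0) x + ev (m - 1) (t2 (Suc 0)) x)"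
      unfolding tangent_pairing_def sum_lessThan_2 A[OF lt(1)] A[OF lt(2)] by (simp add: algebra_simps)
    also have "\<dots> = (snd w * fst x - fst w * snd x) * ev (m - 2) (tangent_form z) x"
      unfolding ev_add[symmetric] 1 2 by (simp add: algebra_simps)
    finally show ?thesis .
  qed
qed

lemma conormal_section_value:
  assumes z: "conormal_section m z"
  shows "conormal x (section_value m z x)"
proof -
  have p: "perp_section m z" "tangent_form z = 0" using z by (simp_all add: conormal_section_def)
  show ?thesis
    unfolding conormal_def tangent_form_forms_and_pairing(2)[OF p(1)] p(2)
    using perp_section_value[OF p(1)] by simp
qed

lemma section_mat_forms:
  assumes z: "conormal_section m z" and "i < n" "j < n"
  shows "section_mat z i j \<in> forms m"
  unfolding section_mat_def
  by (intro forms_sum forms_mult'[OF conormal_section_forms[OF z] sect]) (use assms in auto)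

lemma ev_section_mat:
  assumes z: "conormal_section m z" and ij: "i < n" "j < n"
  shows "ev m (section_mat z i j) x = conormal_mat x (section_value m z x) i j"
  unfolding section_mat_def conormal_mat_def ev_sum section_value_def curve_value_def
  by (intro sum.cong refl ev_mult'[OF conormal_section_forms[OF z] sect]) (use ij in auto)

lemma conormal_section_combination:
  assumes z: "\<And>l. l < k \<Longrightarrow> conormal_section m (z l)"
  shows "conormal_section m (\<lambda>a i. \<Sum>l<k. Polynomial.smult (c l) (z l a i))"
  unfolding conormal_section_def perp_section_def tangent_form_def
proof (intro conjI allI impI)
  show "(\<Sum>l<k. Polynomial.smult (c l) (z l a i)) \<in> forms (m - int (e a))" if "a < 2" "i < n" for a i
    using conormal_section_forms[OF z] that by (intro forms_sum forms_smult) auto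
  show "(\<Sum>i<n. (\<Sum>l<k. Polynomial.smult (c l) (z l a i)) * \<sigma> a' i) = 0" if "a < 2" "a' < 2" for a a'
  proof -
    have "(\<Sum>i<n. (\<Sum>l<k. Polynomial.smult (c l) (z l a i)) * \<sigma> a' i) = (\<Sum>l<k. Polynomial.smult (c l) (\<Sum>i<n. z l a i * \<sigma> a' i))"
      unfolding sum_distrib_right poly_smult_sum by (subst sum.swap) simp
    then show ?thesis using conormal_section_perp[OF z] that by simp
  qed
  have "(\<Sum>i<n. (\<Sum>l<k. Polynomial.smult (c l) (z l a i)) * pderiv (\<sigma> a i))
      = (\<Sum>l<k. Polynomial.smult (c l) (\<Sum>i<n. z l a i * pderiv (\<sigma> a i)))" for a
    unfolding sum_distrib_right poly_smult_sum by (subst sum.swap) simp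
  then have "(\<Sum>a<2. \<Sum>i<n. (\<Sum>l<k. Polynomial.smult (c l) (z l a i)) * pderiv (\<sigma> a i))
      = (\<Sum>l<k. Polynomial.smult (c l) (\<Sum>a<2. \<Sum>i<n. z l a i * pderiv (\<sigma> a i)))"
    by (simp add: sum_lessThan_2 sum.distrib smult_add_right)
  then show "(\<Sum>a<2. \<Sum>i<n. (\<Sum>l<k. Polynomial.smult (c l) (z l a i)) * pderiv (\<sigma> a i)) = 0"
    using conormal_section_tangent[OF z] by simp
qed

lemma conormal_section_mult:
  assumes z: "conormal_section m z" and p: "p \<in> forms k"
  shows "conormal_section (m + k) (\<lambda>a i. p * z a i)"
  unfolding conormal_section_def perp_section_def tangent_form_def
proof (intro conjI allI impI)
  show "p * z a i \<in> forms (m + k - int (e a))" if "a < 2" "i < n" for a i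
    by (rule forms_mult'[OF p conormal_section_forms[OF z that]]) simp
  have *: "(\<Sum>i<n. p * z a i * g i) = p * (\<Sum>i<n. z a i * g i)" for a g
    by (simp add: sum_distrib_left mult.assoc)
  show "(\<Sum>i<n. p * z a i * \<sigma> a' i) = 0" if "a < 2" "a' < 2" for a a'
    unfolding * using conormal_section_perp[OF z that] by simp
  show "(\<Sum>a<2. \<Sum>i<n. p * z a i * pderiv (\<sigma> a i)) = 0"
    unfolding * using conormal_section_tangent[OF z] by (simp add: sum_lessThan_2 flip: distrib_left)
qed

lemma conormal_section_add:
  "conormal_section m y \<Longrightarrow> conormal_section m z \<Longrightarrow> conormal_section m (\<lambda>a i. y a i + z a i)"
  by (simp add: conormal_section_def perp_section_def tangent_form_def forms_add distrib_right sum.distrib flip: add.assoc)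

lemma conormal_section_cancel:
  assumes z: "conormal_section m (\<lambda>a i. p * z a i)" and p: "p \<noteq> 0"
    and f: "\<And>a i. a < 2 \<Longrightarrow> i < n \<Longrightarrow> z a i \<in> forms (m' - int (e a))"
  shows "conormal_section m' z"
  unfolding conormal_section_def perp_section_def tangent_form_def
proof (intro conjI allI impI)
  have *: "(\<Sum>i<n. p * z a i * g i) = p * (\<Sum>i<n. z a i * g i)" for a g
    by (simp add: sum_distrib_left mult.assoc)
  show "(\<Sum>i<n. z a i * \<sigma> a' i) = 0" if "a < 2" "a' < 2" for a a'
    using conormal_section_perp[OF z that] p unfolding * by simp
  have "p * (\<Sum>a<2. \<Sum>i<n. z a i * pderiv (\<sigma> a i)) = 0"
    using conormal_section_tangent[OF z] unfolding * sum_distrib_left .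
  then show "(\<Sum>a<2. \<Sum>i<n. z a i * pderiv (\<sigma> a i)) = 0" using p by simp
qed (rule f)

lemma conormal_section_vanishing:
  assumes x: "x \<noteq> (0, 0)" and z: "conormal_section m z"
    and v: "\<And>a i. a < 2 \<Longrightarrow> i < n \<Longrightarrow> section_value m z x a i = 0"
  shows "\<exists>z'. conormal_section (m - 1) z' \<and> (\<forall>a<2. \<forall>i<n. z a i = point_form x * z' a i)"
proof -
  have "\<exists>q. q \<in> forms (m - int (e a) - 1) \<and> z a i = point_form x * q" if "a < 2" "i < n" for a i
    using forms_vanishing_at_point[OF x conormal_section_forms[OF z that] v[OF that, unfolded section_value_def]] by metis
  then have "\<exists>z'. \<forall>a i. a < 2 \<longrightarrow> i < n \<longrightarrow> z' a i \<in> forms (m - int (e a) - 1) \<and> z a i = point_form x * z' a i"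
    by metis
  then obtain z' where z': "\<And>a i. a < 2 \<Longrightarrow> i < n \<Longrightarrow> z' a i \<in> forms (m - int (e a) - 1) \<and> z a i = point_form x * z' a i"
    by blast
  have "conormal_section m (\<lambda>a i. point_form x * z' a i)"
    using z conormal_section_cong[of z "\<lambda>a i. point_form x * z' a i" m] z' by blast
  then have "conormal_section (m - 1) z'"
    by (rule conormal_section_cancel) (use point_form_nonzero[OF x] z' in \<open>auto simp: algebra_simps\<close>)
  then show ?thesis using z' by blast
qed

end

text \<open>Induction on \<open>r\<close>. After correction by the dual vectors already found
  (\<open>res\<close>), row \<open>r\<close> still takes a nonzero value; otherwise it would be a
  combination of the earlier rows.\<close>

lemma surjective_if_rows_independent:
  fixes H :: "nat \<Rightarrow> 'q \<Rightarrow> 'a::field"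
  assumes "finite Q" "\<forall>c. (\<forall>q\<in>Q. (\<Sum>l<r. c l * H l q) = 0) \<longrightarrow> (\<forall>l<r. c l = 0)"
  shows "\<exists>E. \<forall>k<r. \<forall>l<r. (\<Sum>q\<in>Q. H l q * E k q) = (if l = k then 1 else 0)"
  using assms(2)
proof (induction r)
  case 0
  show ?case by simp
next
  case (Suc r)
  have ind: "\<forall>c. (\<forall>q\<in>Q. (\<Sum>l<r. c l * H l q) = 0) \<longrightarrow> (\<forall>l<r. c l = 0)"
  proof (intro allI impI)
    fix c l assume c: "\<forall>q\<in>Q. (\<Sum>l<r. c l * H l q) = 0" and l: "l < r"
    have "\<forall>q\<in>Q. (\<Sum>l<Suc r. (if l < r then c l else 0) * H l q) = 0" using c by simp
    from mp[OF spec[OF Suc.prems] this] have "(if l < r then c l else 0) = 0" using l by (metis less_Suc_eq)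
    with l show "c l = 0" by simp
  qed
  obtain E where E: "\<forall>k<r. \<forall>l<r. (\<Sum>q\<in>Q. H l q * E k q) = (if l = k then 1 else 0)"
    using Suc.IH[OF ind] by (elim exE)
  define P where "P l y = (\<Sum>q\<in>Q. H l q * y q)" for l y
  have PE: "P l (E k) = (if l = k then 1 else 0)" if "k < r" "l < r" for k l
    using E that unfolding P_def by blast
  have Plin: "P l (\<lambda>q. y q - c * z q) = P l y - c * P l z" for l y z c
    unfolding P_def right_diff_distrib sum_subtractf sum_distrib_left by (simp add: mult.left_commute)
  have Psum: "P l (\<lambda>q. y q - (\<Sum>k<r. c k * z k q)) = P l y - (\<Sum>k<r. c k * P l (z k))" for l y z c
    unfolding P_def right_diff_distrib sum_subtractf sum_distrib_left
    by (subst (2) sum.swap) (simp add: mult.left_commute)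
  define res where "res y q = y q - (\<Sum>k<r. P k y * E k q)" for y q
  have res0: "P l (res y) = 0" if "l < r" for l y
  proof -
    have "P l (res y) = P l y - (\<Sum>k<r. P k y * P l (E k))"
      unfolding res_def Psum ..
    also have "(\<Sum>k<r. P k y * P l (E k)) = (\<Sum>k<r. if l = k then P l y else 0)"
      using that by (intro sum.cong) (auto simp: PE)
    also have "\<dots> = P l y" using that by simp
    finally show ?thesis by simp
  qed
  have "\<exists>y. P r (res y) \<noteq> 0"
  proof (rule ccontr)
    assume neg: "\<nexists>y. P r (res y) \<noteq> 0"
    define c where "c l = (if l = r then 1 else - P r (E l))" for l
    have "(\<Sum>l<Suc r. c l * H l q) = 0" if q: "q \<in> Q" for q
    proof -
      define \<delta> where "\<delta> q' = (if q' = q then 1 else 0 :: 'a)" for q'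
      have P\<delta>: "P l \<delta> = H l q" for l
      proof -
        have "P l \<delta> = (\<Sum>q'\<in>Q. if q' = q then H l q else 0)"
          unfolding P_def \<delta>_def by (intro sum.cong) auto
        then show ?thesis using q assms(1) by simp
      qed
      have "P r (res \<delta>) = P r \<delta> - (\<Sum>k<r. P k \<delta> * P r (E k))"
        unfolding res_def Psum ..
      then have "H r q - (\<Sum>k<r. H k q * P r (E k)) = 0" using neg unfolding P\<delta> by simp
      then show ?thesis by (simp add: c_def sum_negf mult.commute)
    qed
    then have "\<forall>q\<in>Q. (\<Sum>l<Suc r. c l * H l q) = 0" by (rule ballI)
    from mp[OF spec[OF Suc.prems] this] have "c r = 0" by simp
    then show False by (simp add: c_def)
  qed
  then obtain y where y: "P r (res y) \<noteq> 0" ..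
  define F where "F q = res y q * inverse (P r (res y))" for q
  have PF: "P l F = P l (res y) * inverse (P r (res y))" for l
    unfolding P_def F_def sum_distrib_right mult.assoc ..
  define E' where "E' k = (if k = r then F else (\<lambda>q. E k q - P r (E k) * F q))" for k
  have "P l (E' k) = (if l = k then 1 else 0)" if "k < Suc r" "l < Suc r" for k l
    using that y res0[of l y] by (auto simp: E'_def PF Plin PE less_Suc_eq)
  then show ?case unfolding P_def by (intro exI[of _ E']) blast
qed

lemma sum_lessThan_add: "(\<Sum>l<k + m. g l) = (\<Sum>l<k. g l) + (\<Sum>l<m. g (k + l))"
  for g :: "nat \<Rightarrow> 'b::comm_monoid_add"
  by (induction m) (simp_all add: add.assoc)

context split_curve
begin

subsection \<open>Counting sections\<close>

definition independent_sections :: "nat \<Rightarrow> (nat \<Rightarrow> nat \<Rightarrow> nat \<Rightarrow> 'a poly) \<Rightarrow> bool" where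
  "independent_sections N B \<longleftrightarrow>
     (\<forall>c. (\<forall>a<2. \<forall>i<n. (\<Sum>l<N. Polynomial.smult (c l) (B l a i)) = 0) \<longrightarrow> (\<forall>l<N. c l = 0))"

definition sections_dim_le :: "int \<Rightarrow> nat \<Rightarrow> bool" where
  "sections_dim_le m \<kappa> \<longleftrightarrow>
     (\<forall>N B. (\<forall>l<N. conormal_section m (B l)) \<longrightarrow> independent_sections N B \<longrightarrow> N \<le> \<kappa>)"

lemma independent_sectionsD:
  "independent_sections N B \<Longrightarrow> \<forall>a<2. \<forall>i<n. (\<Sum>l<N. Polynomial.smult (c l) (B l a i)) = 0 \<Longrightarrow> \<forall>l<N. c l = 0"
  unfolding independent_sections_def by (erule allE, erule mp)

lemma sections_dim_leD:
  "sections_dim_le m \<kappa> \<Longrightarrow> \<forall>l<N. conormal_section m (B l) \<Longrightarrow> independent_sections N B \<Longrightarrow> N \<le> \<kappa>"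
  unfolding sections_dim_le_def by (erule allE, erule allE, erule impE, assumption, erule impE, assumption)

text \<open>The unknowns are the coefficients of the forms \<open>z a i\<close>; the equations are
  the coefficients of the four products with \<open>\<sigma> 0\<close>, \<open>\<sigma> 1\<close>
  and those coefficients of \<open>tangent_form z\<close> that lie in \<open>T\<close>.
  \<open>T\<close> is a parameter because at a ramification point fewer coefficients suffice. The
  last line is unknowns minus equations.\<close>

lemma conormal_section_basis:
  assumes T: "finite T"
      "\<forall>z. perp_section (int m) z \<longrightarrow> (\<forall>k\<in>T. coeff (tangent_form z) k = 0) \<longrightarrow> tangent_form z = 0"
    and n: "n \<ge> 2"
  shows "\<exists>N B. (\<forall>l<N. conormal_section (int m) (B l)) \<and> independent_sections N B \<and>
    (\<forall>z. conormal_section (int m) z \<longrightarrow> (\<exists>c. \<forall>a<2. \<forall>i<n. z a i = (\<Sum>l<N. Polynomial.smult (c l) (B l a i)))) \<and>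
    (int n - 2) * (2 * int m + 2) - int n * int (e 0 + e 1) \<le> int N + int (card T)"
proof -
  define U where "U = {..<2::nat} \<times> {..<n}"
  define du where "du u = int m - int (e (fst u))" for u :: "nat \<times> nat"
  define Q where "Q = insert None (Some ` ({..<2::nat} \<times> {..<2::nat}))"
  define K where "K q = (case q of None \<Rightarrow> T | Some (a, a') \<Rightarrow> if e a \<le> m then {..m - e a + e a'} else {})" for q
  define g where "g q u = (case q of None \<Rightarrow> pderiv (\<sigma> (fst u) (snd u))
      | Some (a, a') \<Rightarrow> if fst u = a then \<sigma> a' (snd u) else 0)" for q and u :: "nat \<times> nat"
  have fin: "finite U" "finite Q" "\<forall>q\<in>Q. finite (K q)"
    using T(1) by (auto simp: U_def Q_def K_def split: option.splits)
  have sumU: "(\<Sum>u\<in>U. h u) = (\<Sum>a<2. \<Sum>i<n. h (a, i))" for h :: "nat \<times> nat \<Rightarrow> 'b::comm_monoid_add"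
    unfolding U_def by (simp add: sum.cartesian_product)
  have gN: "(\<Sum>u\<in>U. P u * g None u) = tangent_form (\<lambda>a i. P (a, i))" for P
    unfolding sumU by (simp add: g_def tangent_form_def)
  have gS: "(\<Sum>u\<in>U. P u * g (Some (a, a')) u) = (\<Sum>i<n. P (a, i) * \<sigma> a' i)" if "a < 2" for P a a'
    unfolding sumU using less_2_cases[OF that] by (auto simp: g_def sum_lessThan_2)
  have sol_perp: "perp_section (int m) (\<lambda>a i. P (a, i))" if P: "poly_solution U du Q K g P" for P
    unfolding perp_section_def
  proof (intro conjI allI impI)
    show "P (a, i) \<in> forms (int m - int (e a))" if "a < 2" "i < n" for a i
      using P that unfolding poly_solution_def U_def du_def by force
    then have Pf: "P (a, i) \<in> forms (int m - int (e a))" if "a < 2" "i < n" for a i using that .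
    fix a a' :: nat assume a: "a < 2" "a' < 2"
    have f: "(\<Sum>i<n. P (a, i) * \<sigma> a' i) \<in> forms (int m - int (e a) + int (e a'))"
      by (intro forms_sum forms_mult[OF Pf[OF a(1)] sect[OF a(2)]]) auto
    show "(\<Sum>i<n. P (a, i) * \<sigma> a' i) = 0"
    proof (cases "e a \<le> m")
      case True
      show ?thesis
      proof (rule poly_eqI)
        fix k
        show "coeff (\<Sum>i<n. P (a, i) * \<sigma> a' i) k = coeff 0 k"
        proof (cases "k \<le> m - e a + e a'")
          case le: True
          have "Some (a, a') \<in> Q" "k \<in> K (Some (a, a'))" using a True le by (auto simp: Q_def K_def)
          then have "coeff (\<Sum>u\<in>U. P u * g (Some (a, a')) u) k = 0"
            using P unfolding poly_solution_def by blast
          then show ?thesis unfolding gS[OF a(1)] by simp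
        next
          case False
          have "int m - int (e a) + int (e a') < int k" using False True by linarith
          from forms_coeff_eq_0[OF f this] show ?thesis by simp
        qed
      qed
    next
      case False
      have "P (a, i) = 0" if "i < n" for i
        by (rule forms_negative[OF Pf[OF a(1) that]]) (use False in simp)
      then show ?thesis by simp
    qed
  qed
  have sol: "conormal_section (int m) (\<lambda>a i. P (a, i)) \<longleftrightarrow> poly_solution U du Q K g P" for P
  proof
    assume P: "poly_solution U du Q K g P"
    have "None \<in> Q" by (simp add: Q_def)
    then have "\<forall>k\<in>T. coeff (\<Sum>u\<in>U. P u * g None u) k = 0"
      using P unfolding poly_solution_def K_def by force
    then have "\<forall>k\<in>T. coeff (tangent_form (\<lambda>a i. P (a, i))) k = 0" unfolding gN .
    then show "conormal_section (int m) (\<lambda>a i. P (a, i))"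
      unfolding conormal_section_def using sol_perp[OF P] mp[OF mp[OF spec[OF T(2)] sol_perp[OF P]]] by (intro conjI)
  next
    assume P: "conormal_section (int m) (\<lambda>a i. P (a, i))"
    show "poly_solution U du Q K g P"
      unfolding poly_solution_def
    proof (intro conjI ballI)
      fix u assume "u \<in> U"
      then show "P u \<in> forms (du u)" using conormal_section_forms[OF P] by (auto simp: U_def du_def)
    next
      fix q k assume "q \<in> Q" "k \<in> K q"
      then consider "q = None" | a a' where "q = Some (a, a')" "a < 2" "a' < 2" by (auto simp: Q_def)
      then show "coeff (\<Sum>u\<in>U. P u * g q u) k = 0"
      proof cases
        case 1
        show ?thesis unfolding 1 gN using P by (simp add: conormal_section_def)
      next
        case 2
        show ?thesis unfolding 2(1) gS[OF 2(2)] using conormal_section_perp[OF P 2(2,3)] by simp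
      qed
    qed
  qed
  obtain N B where NB: "\<forall>l<N. poly_solution U du Q K g (B l)" "independent_polys U N B"
    "\<forall>P. poly_solution U du Q K g P \<longrightarrow> (\<exists>c. \<forall>u\<in>U. P u = (\<Sum>l<N. Polynomial.smult (c l) (B l u)))"
    and count: "(\<Sum>u\<in>U. nat (du u + 1)) \<le> N + (\<Sum>q\<in>Q. card (K q))"
    using polynomial_system_solutions[OF fin(1,2) fin(3), where du = du and g = g] by (elim exE conjE) (rule that)
  define B' where "B' l a i = B l (a, i)" for l a i
  have "\<forall>l<N. conormal_section (int m) (B' l)"
    using NB(1) unfolding sol[symmetric] B'_def[abs_def] .
  moreover have "independent_sections N B'"
    using NB(2) unfolding independent_sections_def independent_polys_def U_def B'_def by simp
  moreover have "\<exists>c. \<forall>a<2. \<forall>i<n. z a i = (\<Sum>l<N. Polynomial.smult (c l) (B' l a i))" if z: "conormal_section (int m) z" for z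
  proof -
    have "conormal_section (int m) (\<lambda>a i. (\<lambda>(a, i). z a i) (a, i))" using z by simp
    then have "poly_solution U du Q K g (\<lambda>(a, i). z a i)" unfolding sol .
    from mp[OF spec[OF NB(3)] this] obtain c where "\<forall>u\<in>U. (\<lambda>(a, i). z a i) u = (\<Sum>l<N. Polynomial.smult (c l) (B l u))" ..
    then show ?thesis unfolding U_def B'_def by (intro exI[of _ c]) auto
  qed
  moreover have "(int n - 2) * (2 * int m + 2) - int n * int (e 0 + e 1) \<le> int N + int (card T)"
  proof -
    have cU: "(\<Sum>u\<in>U. nat (du u + 1)) = n * nat (int m - int (e 0) + 1) + n * nat (int m - int (e 1) + 1)"
      unfolding sumU by (simp add: sum_lessThan_2 du_def)
    have cK: "card (K (Some (a, a'))) = (if e a \<le> m then m - e a + e a' + 1 else 0)" for a a'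
      by (simp add: K_def)
    have "(\<Sum>q\<in>Q. card (K q)) = card T + (\<Sum>q\<in>{..<2} \<times> {..<2}. card (K (Some q)))"
      unfolding Q_def by (subst sum.insert) (auto simp: K_def sum.reindex)
    also have "(\<Sum>q\<in>{..<2} \<times> {..<2}. card (K (Some q))) = (\<Sum>a<2. \<Sum>a'<2. card (K (Some (a, a'))))"
      by (simp add: sum.cartesian_product)
    also have "\<dots> = (\<Sum>a<2. if e a \<le> m then 2 * (m - e a + 1) + e 0 + e 1 else 0)"
    proof (rule sum.cong[OF refl])
      fix a
      show "(\<Sum>a'<2. card (K (Some (a, a')))) = (if e a \<le> m then 2 * (m - e a + 1) + e 0 + e 1 else 0)"
        unfolding sum_lessThan_2 cK by auto
    qed
    finally have cQ: "(\<Sum>q\<in>Q. card (K q)) = card T + (\<Sum>a<2. if e a \<le> m then 2 * (m - e a + 1) + e 0 + e 1 else 0)" .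
    \<comment> \<open>If \<open>e a > m\<close> there are neither unknowns nor equations for this
      \<open>a\<close>, while the left side is not positive.\<close>
    have each: "(int n - 2) * (int m - int (e a) + 1) - int (e 0 + e 1)
        \<le> int n * int (nat (int m - int (e a) + 1)) - int (if e a \<le> m then 2 * (m - e a + 1) + e 0 + e 1 else 0)" for a
    proof (cases "e a \<le> m")
      case True
      then have "int (nat (int m - int (e a) + 1)) = int m - int (e a) + 1" by simp
      then show ?thesis using True by (simp add: of_nat_diff algebra_simps)
    next
      case False
      then have "(int n - 2) * (int m - int (e a) + 1) \<le> 0" using n by (intro mult_nonneg_nonpos) auto
      then show ?thesis using False by simp
    qed
    define X where "X a = int (nat (int m - int (e a) + 1))" for a
    define Y where "Y a = (if e a \<le> m then 2 * (m - e a + 1) + e 0 + e 1 else 0)" for a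
    have "int (n * nat (int m - int (e 0) + 1) + n * nat (int m - int (e 1) + 1)) \<le> int (N + (card T + (Y 0 + Y 1)))"
      using count unfolding cU cQ Y_def sum_lessThan_2 One_nat_def by (simp only: of_nat_le_iff)
    then have "int n * X 0 + int n * X 1 \<le> int N + int (card T) + int (Y 0) + int (Y 1)"
      by (simp add: X_def)
    moreover have "(int n - 2) * (2 * int m + 2) - int n * int (e 0 + e 1)
        = ((int n - 2) * (int m - int (e 0) + 1) - int (e 0 + e 1)) + ((int n - 2) * (int m - int (e 1) + 1) - int (e 0 + e 1))"
      by (simp add: algebra_simps)
    ultimately show ?thesis using each[of 0] each[of 1] unfolding X_def[symmetric] Y_def[symmetric] by linarith
  qed
  ultimately show ?thesis by (intro exI[of _ N] exI[of _ B'] conjI allI impI) simp_all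
qed

lemma tangent_form_eq_zero:
  assumes z: "perp_section (int m) z" and c: "\<forall>k\<in>{..<m - 1}. coeff (tangent_form z) k = 0"
  shows "tangent_form z = 0"
proof (rule poly_eqI)
  fix k
  show "coeff (tangent_form z) k = coeff 0 k"
  proof (cases "k < m - 1")
    case False
    then have "int m - 2 < int k" by linarith
    from forms_coeff_eq_0[OF tangent_form_forms_and_pairing(1)[OF z] this] show ?thesis by simp
  qed (use c in simp)
qed

text \<open>At a ramification point the condition \<open>tangent_form z = 0\<close> costs one equation less, which
  produces more sections than allowed.\<close>

lemma unramified_if_dim_le:
  assumes n: "n \<ge> 2" and m: "m \<ge> 2" and le: "sections_dim_le (int m) \<kappa>"
    and \<kappa>: "int \<kappa> \<le> (2 * int n - 5) * (int m + 1) - int n * int (e 0 + e 1) + 2"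
  shows "unramified n f"
proof (rule ccontr)
  assume "\<not> unramified n f"
  then obtain x v where x: "x \<noteq> (0, 0)" and inn: "\<forall>a<2. inW x (D x v a)"
    and v: "\<nexists>c. v = (c * fst x, c * snd x)"
    unfolding unramified_iff by (simp only: not_all not_imp) (elim exE conjE)
  \<comment> \<open>The tangent form of every \<open>z\<close> vanishes at the ramification point
    \<open>x\<close>. The coefficient \<open>k0\<close> belongs to a monomial that does not vanish
    at \<open>x\<close>, so it is 0 as soon as all the others are.\<close>
  define k0 where "k0 = (if fst x \<noteq> 0 then 0 else m - 2)"
  define T where "T = {..<m - 1} - {k0}"
  have k0: "k0 < m - 1" using m by (cases "fst x = 0"; simp add: k0_def; linarith)
  have cT: "card T = m - 2" "finite T" using k0 by (simp_all add: T_def card_Diff_singleton)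
  have det: "snd v * fst x - fst v * snd x \<noteq> 0"
  proof
    assume d: "snd v * fst x - fst v * snd x = 0"
    show False
    proof (cases "fst x = 0")
      case True
      then have x2: "snd x \<noteq> 0" using x by (cases x) simp
      then have "fst v = 0" using d True by simp
      with x2 have "v = (snd v / snd x * fst x, snd v / snd x * snd x)" using True by (cases v) simp
      with v show False by blast
    next
      case False
      then have "v = (fst v / fst x * fst x, fst v / fst x * snd x)" using d by (cases v) (simp add: field_simps)
      with v show False by blast
    qed
  qed
  have T: "tangent_form z = 0" if z: "perp_section (int m) z" and c: "\<forall>k\<in>T. coeff (tangent_form z) k = 0" for z
  proof -
    define p where "p = coeff (tangent_form z) k0"
    have tf: "tangent_form z = monom p k0"
    proof (rule poly_eqI)
      fix k
      consider "k = k0" | "k \<in> T" | "int m - 2 < int k" unfolding T_def using m by (auto, linarith)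
      then show "coeff (tangent_form z) k = coeff (monom p k0) k"
      proof cases
        case 2
        then show ?thesis using c by (simp add: T_def)
      next
        case 3
        then show ?thesis
          using forms_coeff_eq_0[OF tangent_form_forms_and_pairing(1)[OF z] 3] k0 by simp
      qed (simp add: p_def)
    qed
    have "(\<Sum>i<n. section_value (int m) z x a i * D x v a i) = 0" if "a < 2" for a
      by (rule perp_inW[OF perp_section_value[OF z that] inn[rule_format, OF that] x])
    then have "tangent_pairing x v (section_value (int m) z x) = 0"
      unfolding tangent_pairing_def by simp
    then have 0: "ev (int m - 2) (tangent_form z) x = 0"
      unfolding tangent_form_forms_and_pairing(2)[OF z] using det by simp
    have nm: "nat (int m - 2) = m - 2" by simp
    have "p = 0"
    proof (cases "fst x = 0")
      case True
      then have "snd x \<noteq> 0" using x by (cases x) auto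
      then show ?thesis using 0 True by (simp add: ev_infinity tf nm k0_def)
    next
      case False
      then show ?thesis using 0 unfolding ev_def form_eval_def nm tf
        by (simp add: k0_def if_distrib[of "\<lambda>z. z * _"] cong: if_cong)
    qed
    then show ?thesis by (simp add: tf)
  qed
  have T': "\<forall>z. perp_section (int m) z \<longrightarrow> (\<forall>k\<in>T. coeff (tangent_form z) k = 0) \<longrightarrow> tangent_form z = 0"
    by (intro allI impI T)
  obtain N B where "\<forall>l<N. conormal_section (int m) (B l)" "independent_sections N B"
    and c: "(int n - 2) * (2 * int m + 2) - int n * int (e 0 + e 1) \<le> int N + int (card T)"
    using conormal_section_basis[OF cT(2) T' n] by (elim exE conjE)
  then have "N \<le> \<kappa>" by (intro sections_dim_leD[OF le])
  then show False using c \<kappa> m unfolding cT(1) by (simp add: of_nat_diff algebra_simps)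
qed

text \<open>The matrices \<open>section_mat (y l)\<close> are the components of the homomorphism.
  Independence at a point makes it surjective there, and the kernel is identified by
  \<open>conormal_kills_normal_relations\<close> and
  \<open>normal_relations_if_killed\<close>.\<close>

lemma splits_if_pointwise_independent:
  assumes unr: "unramified n f" and n: "n \<ge> 3" and len: "length as = 2 * n - 5"
    and nonneg: "\<And>l. l < 2 * n - 5 \<Longrightarrow> as ! l \<ge> 0"
    and y: "\<And>l. l < 2 * n - 5 \<Longrightarrow> conormal_section (as ! l) (y l)"
    and ind: "\<And>x. x \<noteq> (0, 0) \<Longrightarrow>
      \<forall>c. (\<forall>a<2. \<forall>i<n. (\<Sum>l<2 * n - 5. c l * section_value (as ! l) (y l) x a i) = 0) \<longrightarrow> (\<forall>l<2 * n - 5. c l = 0)"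
  shows "quotient_bundle_splits n (normal_relations n f) as"
proof -
  define r where "r = 2 * n - 5"
  define b where "b x l = section_value (as ! l) (y l) x" for x l
  have con: "conormal x (b x l)" if "l < r" for x l
    unfolding b_def using y that conormal_section_value unfolding r_def by blast
  have hom: "matrix_hom n as (\<lambda>l. section_mat (y l)) x M
      = vec r (\<lambda>l. \<Sum>i<n. \<Sum>j<n. conormal_mat x (b x l) i j * M $$ (i, j))" for x M
    unfolding matrix_hom_def len r_def[symmetric]
  proof (intro eq_vecI)
    fix l assume "l < dim_vec (vec r (\<lambda>l. \<Sum>i<n. \<Sum>j<n. conormal_mat x (b x l) i j * M $$ (i, j)))"
    then have l: "l < r" by simp
    have "form_eval (nat (as ! l)) (section_mat (y l) i j) x = conormal_mat x (b x l) i j" if "i < n" "j < n" for i j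
      using ev_section_mat[OF y[of l] that] nonneg[of l] l by (simp add: form_eval_eq_ev b_def r_def)
    then show "vec r (\<lambda>l. \<Sum>i<n. \<Sum>j<n. form_eval (nat (as ! l)) (section_mat (y l) i j) x * M $$ (i, j)) $ l
        = vec r (\<lambda>l. \<Sum>i<n. \<Sum>j<n. conormal_mat x (b x l) i j * M $$ (i, j)) $ l"
      using l by simp
  qed simp
  show ?thesis
    unfolding quotient_bundle_splits_def
  proof (intro exI[of _ "\<lambda>l. section_mat (y l)"] conjI allI impI)
    show "section_mat (y l) i j \<in> forms (as ! l)" if "l < length as" "i < n" "j < n" for l i j
      using section_mat_forms[OF y] that len by simp
  next
    fix x :: "'a \<times> 'a" assume x: "x \<noteq> (0, 0)"
    have indx: "\<forall>c. (\<forall>a<2. \<forall>i<n. (\<Sum>l<r. c l * b x l a i) = 0) \<longrightarrow> (\<forall>l<r. c l = 0)"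
      using ind[OF x] unfolding r_def b_def .
    define H where "H l q = conormal_mat x (b x l) (fst q) (snd q)" for l and q :: "nat \<times> nat"
    have "\<forall>c. (\<forall>q\<in>{..<n} \<times> {..<n}. (\<Sum>l<r. c l * H l q) = 0) \<longrightarrow> (\<forall>l<r. c l = 0)"
    proof (intro allI impI)
      fix c l assume c: "\<forall>q\<in>{..<n} \<times> {..<n}. (\<Sum>l<r. c l * H l q) = 0" and l: "l < r"
      have "\<forall>a<2. \<forall>i<n. (\<Sum>l<r. c l * b x l a i) = 0"
      proof (intro allI impI)
        fix a i :: nat assume a: "a < 2" and i: "i < n"
        show "(\<Sum>l<r. c l * b x l a i) = 0"
        proof (rule S_independent[OF x _ a, of "\<lambda>a. \<Sum>l<r. c l * b x l a i"])
          fix j assume "j < n"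
          then have "(i, j) \<in> {..<n} \<times> {..<n}" using i by simp
          from bspec[OF c this] have "(\<Sum>l<r. c l * conormal_mat x (b x l) i j) = 0" by (simp add: H_def)
          then have "conormal_mat x (\<lambda>a i. \<Sum>l<r. c l * b x l a i) i j = 0"
            unfolding conormal_mat_combination .
          then show "(\<Sum>a<2. (\<Sum>l<r. c l * b x l a i) * S x a j) = 0" unfolding conormal_mat_def .
        qed
      qed
      from mp[OF spec[OF indx] this] l show "c l = 0" by blast
    qed
    from surjective_if_rows_independent[OF _ this]
    obtain E where E: "\<forall>k<r. \<forall>l<r. (\<Sum>q\<in>{..<n} \<times> {..<n}. H l q * E k q) = (if l = k then 1 else 0)"
      by auto
    show "matrix_hom n as (\<lambda>l. section_mat (y l)) x ` carrier_mat n n = carrier_vec (length as)"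
    proof (intro equalityI subsetI)
      fix u assume "u \<in> matrix_hom n as (\<lambda>l. section_mat (y l)) x ` carrier_mat n n"
      then show "u \<in> carrier_vec (length as)" by (auto simp: matrix_hom_def)
    next
      fix u :: "'a vec" assume u: "u \<in> carrier_vec (length as)"
      define M where "M = mat n n (\<lambda>q. \<Sum>k<r. u $ k * E k q)"
      have "(\<Sum>i<n. \<Sum>j<n. conormal_mat x (b x l) i j * M $$ (i, j)) = u $ l" if l: "l < r" for l
      proof -
        have "(\<Sum>i<n. \<Sum>j<n. conormal_mat x (b x l) i j * M $$ (i, j))
            = (\<Sum>q\<in>{..<n} \<times> {..<n}. H l q * (\<Sum>k<r. u $ k * E k q))"
          unfolding sum.cartesian_product by (intro sum.cong) (auto simp: H_def M_def)
        also have "\<dots> = (\<Sum>k<r. u $ k * (\<Sum>q\<in>{..<n} \<times> {..<n}. H l q * E k q))"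
          unfolding sum_distrib_left by (subst sum.swap) (simp add: mult.left_commute)
        also have "\<dots> = (\<Sum>k<r. if l = k then u $ l else 0)"
          by (intro sum.cong refl) (use E l in auto)
        finally show ?thesis using l by simp
      qed
      then have "matrix_hom n as (\<lambda>l. section_mat (y l)) x M = u"
        unfolding hom using u len by (intro eq_vecI) (auto simp: r_def)
      then show "u \<in> matrix_hom n as (\<lambda>l. section_mat (y l)) x ` carrier_mat n n"
        by (intro image_eqI[of _ _ M]) (auto simp: M_def)
    qed
    show "{M \<in> carrier_mat n n. matrix_hom n as (\<lambda>l. section_mat (y l)) x M = 0\<^sub>v (length as)} = normal_relations n f x"
    proof (intro equalityI subsetI)
      fix M assume M: "M \<in> normal_relations n f x"
      then have "matrix_hom n as (\<lambda>l. section_mat (y l)) x M = 0\<^sub>v (length as)"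
        unfolding hom using conormal_kills_normal_relations[OF x con M] len by (intro eq_vecI) (auto simp: r_def)
      then show "M \<in> {M \<in> carrier_mat n n. matrix_hom n as (\<lambda>l. section_mat (y l)) x M = 0\<^sub>v (length as)}"
        using M by (simp add: normal_relations_def)
    next
      fix M assume "M \<in> {M \<in> carrier_mat n n. matrix_hom n as (\<lambda>l. section_mat (y l)) x M = 0\<^sub>v (length as)}"
      then have M: "M \<in> carrier_mat n n" and h: "matrix_hom n as (\<lambda>l. section_mat (y l)) x M = 0\<^sub>v r"
        by (simp_all add: len r_def)
      have "(\<Sum>i<n. \<Sum>j<n. conormal_mat x (b x l) i j * M $$ (i, j)) = 0" if "l < r" for l
        using arg_cong[OF h[unfolded hom], of "\<lambda>u. u $ l"] that by simp
      then show "M \<in> normal_relations n f x"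
        unfolding r_def by (intro normal_relations_if_killed[OF unr n x _ indx[unfolded r_def] M] con[unfolded r_def])
    qed
  qed
qed

lemma zero_section_if_dim_le_zero:
  assumes "sections_dim_le m 0" "conormal_section m z" "a < 2" "i < n"
  shows "z a i = 0"
proof (rule ccontr)
  assume nz: "z a i \<noteq> 0"
  have "independent_sections 1 (\<lambda>l. z)"
    unfolding independent_sections_def
  proof (intro allI impI)
    fix c :: "nat \<Rightarrow> 'a" and l :: nat
    assume "\<forall>a<2. \<forall>i<n. (\<Sum>l<1. Polynomial.smult (c l) (z a i)) = 0" and "l < 1"
    then show "c l = 0" using assms(3,4) nz by auto
  qed
  then have "(1::nat) \<le> 0" using assms(2) by (intro sections_dim_leD[OF assms(1)]) simp
  then show False by simp
qed

text \<open>A basis \<open>u\<close> of the \<open>k\<close> sections in degree \<open>a\<close> is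
  completed by \<open>r - k\<close> sections in degree \<open>a + 1\<close> that are independent
  modulo the products of \<open>u\<close> with linear forms; since degree \<open>a + 1\<close> has
  at least \<open>r + j\<close> sections and \<open>k \<le> j\<close>, there are enough of them. A
  dependence at one point gives a section vanishing there. Dividing by the point form first shows
  that the new sections do not occur in it, and then leads to degree \<open>a - 1\<close>, where
  only 0 is left.\<close>

lemma splits_if_section_bounds:
  assumes unr: "unramified n f" and n: "n \<ge> 3"
    and zero: "sections_dim_le (int a - 1) 0" and le: "sections_dim_le (int a) j" and j: "j \<le> 2 * n - 5"
    and jd: "int j = (2 * int n - 5) * (int a + 1) - int n * int (e 0 + e 1) + 2"
  shows "\<exists>k\<le>2 * n - 5. quotient_bundle_splits n (normal_relations n f) (replicate k (int a) @ replicate (2 * n - 5 - k) (int a + 1))"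
proof -
  define r where "r = 2 * n - 5"
  have basis: "\<exists>N B. (\<forall>l<N. conormal_section (int m) (B l)) \<and> independent_sections N B \<and>
    (\<forall>z. conormal_section (int m) z \<longrightarrow> (\<exists>c. \<forall>a<2. \<forall>i<n. z a i = (\<Sum>l<N. Polynomial.smult (c l) (B l a i)))) \<and>
    (int n - 2) * (2 * int m + 2) - int n * int (e 0 + e 1) \<le> int N + int (card {..<m - 1})" for m
    by (rule conormal_section_basis, simp, intro allI impI tangent_form_eq_zero, assumption+) (use n in simp)
  obtain k u where u: "\<forall>l<k. conormal_section (int a) (u l)" "independent_sections k u"
    and usp: "\<forall>z. conormal_section (int a) z \<longrightarrow> (\<exists>c. \<forall>a<2. \<forall>i<n. z a i = (\<Sum>l<k. Polynomial.smult (c l) (u l a i)))"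
    using basis[of a] by (elim exE conjE)
  obtain N w where w: "\<forall>l<N. conormal_section (int (Suc a)) (w l)" "independent_sections N w"
    and count: "(int n - 2) * (2 * int (Suc a) + 2) - int n * int (e 0 + e 1) \<le> int N + int (card {..<Suc a - 1})"
    using basis[of "Suc a"] by (elim exE conjE)
  have kj: "k \<le> j" using u by (intro sections_dim_leD[OF le])
  have Nr: "r + j \<le> N" using count jd n by (simp add: r_def algebra_simps of_nat_diff)
  define Q where "Q = {..<2::nat} \<times> {..<n} \<times> (UNIV :: nat set)"
  define cf where "cf z q = coeff (z (fst q) (fst (snd q))) (snd (snd q))" for z :: "nat \<Rightarrow> nat \<Rightarrow> 'a poly" and q :: "nat \<times> nat \<times> nat"
  have cf_eq: "(\<forall>q\<in>Q. cf y q = cf z q) \<longleftrightarrow> (\<forall>a<2. \<forall>i<n. y a i = z a i)" for y z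
    unfolding Q_def cf_def by (auto simp: poly_eq_iff)
  have cf_sum: "cf (\<lambda>a i. \<Sum>l\<in>L. Polynomial.smult (c l) (z l a i)) q = (\<Sum>l\<in>L. c l * cf (z l) q)"
    for L :: "nat set" and c z q
    by (simp add: cf_def coeff_sum)
  \<comment> \<open>\<open>1\<close> and \<open>X\<close> span the linear forms, so the
    \<open>v l\<close> span the products of linear forms with sections of degree
    \<open>a\<close>.\<close>
  define v where "v l = (if l < k then u l else (\<lambda>a i. [:0, 1:] * u (l - k) a i))" for l
  have "\<forall>c. (\<forall>q\<in>Q. (\<Sum>l\<in>{..<N}. c l * cf (w l) q) = 0) \<longrightarrow> (\<forall>l\<in>{..<N}. c l = 0)"
  proof (intro allI impI)
    fix c assume "\<forall>q\<in>Q. (\<Sum>l\<in>{..<N}. c l * cf (w l) q) = 0"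
    then have "\<forall>q\<in>Q. cf (\<lambda>a i. \<Sum>l<N. Polynomial.smult (c l) (w l a i)) q = cf (\<lambda>a i. 0) q"
      unfolding cf_sum by (simp add: cf_def)
    then have "\<forall>a<2. \<forall>i<n. (\<Sum>l<N. Polynomial.smult (c l) (w l a i)) = 0" unfolding cf_eq .
    then show "\<forall>l\<in>{..<N}. c l = 0" using w(2) unfolding independent_sections_def by auto
  qed
  from independent_modulo[OF _ this, of "2 * k" "\<lambda>l. cf (v l)"]
  obtain J where J: "J \<subseteq> {..<N}" "card {..<N} \<le> card J + 2 * k"
    and Jind: "\<forall>c d. (\<forall>q\<in>Q. (\<Sum>j\<in>J. c j * cf (w j) q) = (\<Sum>l<2 * k. d l * cf (v l) q)) \<longrightarrow> (\<forall>j\<in>J. c j = 0)"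
    by auto
  have "r - k \<le> card J" using J(2) Nr kj by simp
  then obtain J' where J': "J' \<subseteq> J" "card J' = r - k" "finite J'"
    by (rule obtain_subset_with_card_n)
  obtain h where h: "bij_betw h {..<r - k} J'"
    using ex_bij_betw_nat_finite[OF J'(3)] J'(2) by (auto simp: atLeast0LessThan)
  define as where "as = replicate k (int a) @ replicate (r - k) (int a + 1)"
  define y where "y l = (if l < k then u l else w (h (l - k)))" for l
  have kr: "k \<le> r" using kj j by (simp add: r_def)
  have as: "as ! l = (if l < k then int a else int a + 1)" if "l < r" for l
    using that by (simp add: as_def nth_append)
  have hJ: "h l \<in> J'" if "l < r - k" for l using h that by (auto simp: bij_betw_def)
  have w': "conormal_section (int a + 1) (w l)" if "l \<in> J'" for l
    using w(1) that J J' by (auto simp: add.commute)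
  have "quotient_bundle_splits n (normal_relations n f) as"
  proof (rule splits_if_pointwise_independent[OF unr n])
    show "length as = 2 * n - 5" using kr by (simp add: as_def r_def)
    show "as ! l \<ge> 0" if "l < 2 * n - 5" for l using as[of l] that by (simp add: r_def)
    show "conormal_section (as ! l) (y l)" if "l < 2 * n - 5" for l
      using that as[of l] u(1) w'[OF hJ, of "l - k"] by (auto simp: y_def r_def)
    fix x :: "'a \<times> 'a" assume x: "x \<noteq> (0, 0)"
    show "\<forall>c. (\<forall>a<2. \<forall>i<n. (\<Sum>l<2 * n - 5. c l * section_value (as ! l) (y l) x a i) = 0) \<longrightarrow> (\<forall>l<2 * n - 5. c l = 0)"
    proof (intro allI impI)
      fix c l assume c: "\<forall>a<2. \<forall>i<n. (\<Sum>l<2 * n - 5. c l * section_value (as ! l) (y l) x a i) = 0"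
        and l: "l < 2 * n - 5"
      obtain p0 p1 where lam: "p0 * fst x + p1 * snd x = 1"
      proof (cases "fst x = 0")
        case True
        then have "snd x \<noteq> 0" using x by (cases x) auto
        then show thesis using that[of 0 "1 / snd x"] by simp
      next
        case False
        then show thesis using that[of "1 / fst x" 0] by simp
      qed
      \<comment> \<open>A linear form with value 1 at \<open>x\<close>: multiplication by it moves
        sections from degree \<open>a\<close> to degree \<open>a + 1\<close> without changing their
        value at \<open>x\<close>.\<close>
      define \<Lambda> where "\<Lambda> = [:p0, p1:]"
      have \<Lambda>f: "\<Lambda> \<in> forms 1" by (simp add: \<Lambda>_def forms_def)
      have ev\<Lambda>: "ev 1 \<Lambda> x = 1" using lam by (simp add: \<Lambda>_def ev_linear)
      define U where "U a i = (\<Sum>l<k. Polynomial.smult (c l) (u l a i))" for a i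
      define c' where "c' l = c (k + l)" for l
      define W where "W a i = (\<Sum>l<r - k. Polynomial.smult (c' l) (w (h l) a i))" for a i
      have Us: "conormal_section (int a) U"
        unfolding U_def[abs_def] by (rule conormal_section_combination) (use u(1) in blast)
      have Ws: "conormal_section (int a + 1) W"
        unfolding W_def[abs_def] by (rule conormal_section_combination) (use w' hJ in blast)
      have \<Lambda>U: "conormal_section (int a + 1) (\<lambda>a i. \<Lambda> * U a i)"
        by (rule conormal_section_mult[OF Us \<Lambda>f])
      have val: "section_value (int a) U x b i + section_value (int a + 1) W x b i = 0" if "b < 2" "i < n" for b i
      proof -
        have "section_value (int a) U x b i + section_value (int a + 1) W x b i
            = (\<Sum>l<k. c l * section_value (int a) (u l) x b i) + (\<Sum>l<r - k. c (k + l) * section_value (int a + 1) (w (h l)) x b i)"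
          by (simp add: section_value_def U_def W_def c'_def ev_sum ev_smult)
        also have "\<dots> = (\<Sum>l<k. c l * section_value (as ! l) (y l) x b i) + (\<Sum>l<r - k. c (k + l) * section_value (as ! (k + l)) (y (k + l)) x b i)"
          by (intro arg_cong2[of _ _ _ _ "(+)"] sum.cong refl) (use as kr in \<open>auto simp: y_def\<close>)
        also have "\<dots> = (\<Sum>l<k + (r - k). c l * section_value (as ! l) (y l) x b i)"
          by (rule sum_lessThan_add[symmetric])
        also have "k + (r - k) = 2 * n - 5" using kr by (simp add: r_def)
        also have "(\<Sum>l<2 * n - 5. c l * section_value (as ! l) (y l) x b i) = 0" using c that by blast
        finally show ?thesis .
      qed
      have "\<exists>z'. conormal_section (int a + 1 - 1) z' \<and> (\<forall>b<2. \<forall>i<n. \<Lambda> * U b i + W b i = point_form x * z' b i)"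
      proof (rule conormal_section_vanishing[OF x conormal_section_add[OF \<Lambda>U Ws]])
        fix b i :: nat assume bi: "b < 2" "i < n"
        have "section_value (int a + 1) (\<lambda>a i. \<Lambda> * U a i + W a i) x b i = section_value (int a) U x b i + section_value (int a + 1) W x b i"
          unfolding section_value_def ev_add
          using ev_mult'[OF \<Lambda>f conormal_section_forms[OF Us bi], of "int a + 1 - int (e b)" x] by (simp add: ev\<Lambda>)
        then show "section_value (int a + 1) (\<lambda>a i. \<Lambda> * U a i + W a i) x b i = 0" using val[OF bi] by simp
      qed
      then obtain z' where z': "conormal_section (int a) z'" "\<forall>b<2. \<forall>i<n. \<Lambda> * U b i + W b i = point_form x * z' b i"
        by auto
      obtain g where g: "\<forall>b<2. \<forall>i<n. z' b i = (\<Sum>l<k. Polynomial.smult (g l) (u l b i))"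
        using mp[OF spec[OF usp] z'(1)] ..
      \<comment> \<open>The coefficients of \<open>point_form x * z' - \<Lambda> * U\<close>, which
        equals \<open>W\<close>, with respect to the family \<open>v\<close>.\<close>
      define d where "d l = (if l < k then - snd x * g l - p0 * c l else fst x * g (l - k) - p1 * c (l - k))" for l
      define C where "C j = c' (inv_into {..<r - k} h j)" for j
      have lin: "[:s, t:] * (\<Sum>l<k. Polynomial.smult (b l) (u l b' i))
          = (\<Sum>l<k. Polynomial.smult (s * b l) (u l b' i)) + (\<Sum>l<k. Polynomial.smult (t * b l) ([:0, 1:] * u l b' i))" for s t b b' i
      proof -
        have *: "[:s, t:] * p = Polynomial.smult s p + Polynomial.smult t ([:0, 1:] * p)" for p :: "'a poly"
          by simp
        show ?thesis
          unfolding * sum_distrib_left poly_smult_sum by (simp del: mult_pCons_left)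
      qed
      have main: "(\<Sum>j\<in>J'. Polynomial.smult (C j) (w j b i)) = (\<Sum>l<2 * k. Polynomial.smult (d l) (v l b i))" if bi: "b < 2" "i < n" for b i
      proof -
        have "(\<Sum>j\<in>J'. Polynomial.smult (C j) (w j b i)) = (\<Sum>l<r - k. Polynomial.smult (C (h l)) (w (h l) b i))"
          by (rule sum.reindex_bij_betw[OF h, symmetric])
        also have "\<dots> = W b i"
          unfolding W_def C_def using h by (intro sum.cong refl) (simp add: bij_betw_def inv_into_f_f)
        also have "\<dots> = point_form x * z' b i - \<Lambda> * U b i"
          using z'(2) bi by (simp add: eq_diff_eq add.commute)
        also have "\<dots> = ((\<Sum>l<k. Polynomial.smult (- snd x * g l) (u l b i)) + (\<Sum>l<k. Polynomial.smult (fst x * g l) ([:0, 1:] * u l b i)))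
            - ((\<Sum>l<k. Polynomial.smult (p0 * c l) (u l b i)) + (\<Sum>l<k. Polynomial.smult (p1 * c l) ([:0, 1:] * u l b i)))"
          unfolding g[rule_format, OF bi] point_form_def \<Lambda>_def U_def lin ..
        also have "\<dots> = (\<Sum>l<k. Polynomial.smult (d l) (v l b i)) + (\<Sum>l<k. Polynomial.smult (d (k + l)) (v (k + l) b i))"
          unfolding d_def v_def by (simp add: smult_diff_left sum_subtractf del: mult_pCons_left)
        also have "\<dots> = (\<Sum>l<k + k. Polynomial.smult (d l) (v l b i))"
          by (rule sum_lessThan_add[symmetric])
        finally show ?thesis by (simp add: mult_2)
      qed
      have J'ext: "(\<Sum>j\<in>J. (if j \<in> J' then C j else 0) * cf (w j) q) = (\<Sum>j\<in>J'. C j * cf (w j) q)" for q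
        by (rule sum.mono_neutral_cong_right) (use J J' in \<open>auto intro: finite_subset\<close>)
      have "\<forall>q\<in>Q. cf (\<lambda>b i. \<Sum>j\<in>J'. Polynomial.smult (C j) (w j b i)) q = cf (\<lambda>b i. \<Sum>l<2 * k. Polynomial.smult (d l) (v l b i)) q"
        unfolding cf_eq using main by blast
      then have "\<forall>q\<in>Q. (\<Sum>j\<in>J. (if j \<in> J' then C j else 0) * cf (w j) q) = (\<Sum>l<2 * k. d l * cf (v l) q)"
        unfolding cf_sum J'ext .
      from mp[OF spec[OF spec[OF Jind]] this] have CJ: "\<forall>j\<in>J. (if j \<in> J' then C j else 0) = 0" .
      have c'0: "c' l = 0" if "l < r - k" for l
      proof -
        have "h l \<in> J" "h l \<in> J'" using hJ[OF that] J' by auto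
        then have "C (h l) = 0" using bspec[OF CJ, of "h l"] by simp
        then show ?thesis using h that by (simp add: C_def bij_betw_def inv_into_f_f)
      qed
      then have W0: "W b i = 0" for b i by (simp add: W_def)
      have U0: "section_value (int a) U x b i = 0" if "b < 2" "i < n" for b i
        using val[OF that] by (simp add: section_value_def W0)
      obtain z'' where z'': "conormal_section (int a - 1) z''" "\<forall>b<2. \<forall>i<n. U b i = point_form x * z'' b i"
        using conormal_section_vanishing[OF x Us U0] by blast
      have "\<forall>b<2. \<forall>i<n. U b i = 0"
        using z''(2) zero_section_if_dim_le_zero[OF zero z''(1)] by simp
      then have "\<forall>l<k. c l = 0" unfolding U_def by (rule independent_sectionsD[OF u(2)])
      then show "c l = 0" using c'0[of "l - k"] l by (cases "l < k") (auto simp: c'_def r_def)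
    qed
  qed
  then show ?thesis using kr unfolding as_def r_def by blast
qed

text \<open>\<open>j\<close> and \<open>j + 2 * (2 * n - 5)\<close> are the Euler characteristics of
  the twists \<open>a\<close> and \<open>a + 2\<close>. The twist \<open>a + 2\<close> serves
  \<open>unramified_if_dim_le\<close>, which requires a twist of at least 2.\<close>

theorem balanced_if_section_bounds:
  assumes n: "n \<ge> 3" and zero: "sections_dim_le (int a - 1) 0" and le: "sections_dim_le (int a) j" and j: "j \<le> 2 * n - 5"
    and jd: "int j = (2 * int n - 5) * (int a + 1) - int n * int (e 0 + e 1) + 2"
    and le': "sections_dim_le (int a + 2) (j + 2 * (2 * n - 5))"
  shows "unramified n f \<and> balanced_normal_bundle n f"
proof
  show unr: "unramified n f"
  proof (rule unramified_if_dim_le)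
    show "sections_dim_le (int (a + 2)) (j + 2 * (2 * n - 5))" using le' by (simp add: add.commute)
    show "int (j + 2 * (2 * n - 5)) \<le> (2 * int n - 5) * (int (a + 2) + 1) - int n * int (e 0 + e 1) + 2"
    proof -
      have "int (2 * n - 5) = 2 * int n - 5" using n by simp
      then show ?thesis unfolding of_nat_add of_nat_mult jd by (simp add: algebra_simps)
    qed
  qed (use n in auto)
  obtain k where "quotient_bundle_splits n (normal_relations n f) (replicate k (int a) @ replicate (2 * n - 5 - k) (int a + 1))"
    using splits_if_section_bounds[OF unr n zero le j jd] by (elim exE conjE)
  moreover have "\<forall>b\<in>set (replicate k (int a) @ replicate (2 * n - 5 - k) (int a + 1)).
      \<forall>c\<in>set (replicate k (int a) @ replicate (2 * n - 5 - k) (int a + 1)). \<bar>b - c\<bar> \<le> 1"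
    by auto
  ultimately show "balanced_normal_bundle n f" unfolding balanced_normal_bundle_def by blast
qed

end

section \<open>Lines in projective space and their Pluecker coordinates\<close>

definition minor :: "(nat \<Rightarrow> nat \<Rightarrow> 'a::comm_ring_1) \<Rightarrow> nat \<Rightarrow> nat \<Rightarrow> 'a" where
  "minor s i j = s 0 i * s 1 j - s 0 j * s 1 i"

lemma minor_swap: "minor s j i = - minor s i j"
  by (simp add: minor_def)

lemma minor_same [simp]: "minor s i i = 0"
  by (simp add: minor_def)

lemma in_plucker_index_2: "J \<in> plucker_index 2 n \<longleftrightarrow> (\<exists>i j. i < j \<and> j < n \<and> J = {i, j})"
proof
  assume "J \<in> plucker_index 2 n"
  then have J: "J \<subseteq> {..<n}" "card J = 2" by (simp_all add: plucker_index_def)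
  then obtain a b where ab: "J = {a, b}" "a \<noteq> b" unfolding card_2_iff by blast
  then consider "a < b" | "b < a" by linarith
  then show "\<exists>i j. i < j \<and> j < n \<and> J = {i, j}"
  proof cases
    case 1
    then show ?thesis using ab J by (intro exI[of _ a] exI[of _ b]) auto
  next
    case 2
    then show ?thesis using ab J by (intro exI[of _ b] exI[of _ a]) auto
  qed
qed (auto simp: plucker_index_def)

lemma pick_pair: "i < j \<Longrightarrow> pick {i, j} 0 = i" "i < j \<Longrightarrow> pick {i, j} (Suc 0) = j"
proof -
  assume ij: "i < j"
  show 0: "pick {i, j} 0 = i"
    using ij by (auto intro!: Least_equality)
  show "pick {i, j} (Suc 0) = j"
    unfolding pick.simps(2) 0 using ij by (auto intro!: Least_equality)
qed

lemma det_mat_2: "det (mat 2 2 g) = g (0, 0) * g (1, 1) - g (0, 1) * g (1, 0)"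
  for g :: "nat \<times> nat \<Rightarrow> 'a::comm_ring_1"
proof -
  let ?A = "mat 2 2 g"
  have c: "cofactor ?A 0 j = (-1) ^ j * g (1, 1 - j)" if "j < 2" for j
  proof -
    have "mat_delete ?A 0 j \<in> carrier_mat 1 1" by (rule carrier_matI) (simp_all add: mat_delete_dim)
    then have "det (mat_delete ?A 0 j) = mat_delete ?A 0 j $$ (0, 0)" by (rule det_single)
    also have "\<dots> = g (1, 1 - j)" using less_2_cases[OF that] by (auto simp: mat_delete_def)
    finally show ?thesis by (simp add: cofactor_def)
  qed
  have "det ?A = (\<Sum>j<2. ?A $$ (0, j) * cofactor ?A 0 j)"
    by (rule laplace_expansion_row) simp_all
  then show ?thesis by (simp add: sum_lessThan_2 c)
qed

lemma det_submatrix_pair: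
  assumes A: "A \<in> carrier_mat 2 n" and ij: "i < j" "j < n"
  shows "det (submatrix A UNIV {i, j}) = minor (\<lambda>a k. A $$ (a, k)) i j"
proof -
  have "{k. k < n \<and> k \<in> {i, j}} = {i, j}" "{k. k < 2 \<and> k \<in> (UNIV :: nat set)} = {..<2}" using ij by auto
  then have c: "card {k. k < dim_col A \<and> k \<in> {i, j}} = 2" "card {k. k < dim_row A \<and> k \<in> UNIV} = 2"
    using A ij by simp_all
  show ?thesis
    unfolding submatrix_def c det_mat_2 pick_UNIV
    by (simp only: prod.case One_nat_def pick_pair[OF ij(1)] minor_def)
qed

lemma det_submatrix_pair_transpose:
  assumes A: "A \<in> carrier_mat n 2" and ij: "i < j" "j < n"
  shows "det (submatrix A {i, j} UNIV) = minor (\<lambda>a k. A $$ (k, a)) i j"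
proof -
  have "{k. k < n \<and> k \<in> {i, j}} = {i, j}" "{k. k < 2 \<and> k \<in> (UNIV :: nat set)} = {..<2}" using ij by auto
  then have c: "card {k. k < dim_row A \<and> k \<in> {i, j}} = 2" "card {k. k < dim_col A \<and> k \<in> UNIV} = 2"
    using A ij by simp_all
  show ?thesis
    unfolding submatrix_def c det_mat_2 pick_UNIV
    by (simp only: prod.case One_nat_def pick_pair[OF ij(1)] minor_def mult.commute)
qed

lemma row_space_2:
  fixes A :: "'a::field mat"
  assumes A: "A \<in> carrier_mat 2 n"
  shows "vec_space.row_space n A = {y \<in> carrier_vec n. \<exists>c. \<forall>i<n. y $ i = (\<Sum>a<2. c a * A $$ (a, i))}"
proof -
  interpret vec_space "TYPE('a)" n .
  have mv: "(A\<^sup>T *\<^sub>v c) $ i = (\<Sum>a<2. c $ a * A $$ (a, i))" if "i < n" "c \<in> carrier_vec 2" for c i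
    using A that by (auto simp: scalar_prod_def atLeast0LessThan mult.commute intro!: sum.cong)
  show ?thesis
    unfolding row_space_eq[OF A]
  proof (intro equalityI subsetI)
    fix w assume "w \<in> {w \<in> carrier_vec (dim_col A). \<exists>y\<in>carrier_vec (dim_row A). A\<^sup>T *\<^sub>v y = w}"
    then obtain c where c: "w \<in> carrier_vec n" "c \<in> carrier_vec 2" "A\<^sup>T *\<^sub>v c = w" using A by auto
    then show "w \<in> {y \<in> carrier_vec n. \<exists>c. \<forall>i<n. y $ i = (\<Sum>a<2. c a * A $$ (a, i))}"
      using mv by (auto intro!: exI[of _ "\<lambda>a. c $ a"])
  next
    fix w assume "w \<in> {y \<in> carrier_vec n. \<exists>c. \<forall>i<n. y $ i = (\<Sum>a<2. c a * A $$ (a, i))}"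
    then obtain c where c: "w \<in> carrier_vec n" "\<forall>i<n. w $ i = (\<Sum>a<2. c a * A $$ (a, i))" by auto
    have "A\<^sup>T *\<^sub>v vec 2 c = w"
    proof (rule eq_vecI)
      fix i assume "i < dim_vec w"
      then have i: "i < n" using c by auto
      have "(A\<^sup>T *\<^sub>v vec 2 c) $ i = (\<Sum>a<2. vec 2 c $ a * A $$ (a, i))" by (rule mv[OF i]) simp
      then show "(A\<^sup>T *\<^sub>v vec 2 c) $ i = w $ i" using c(2) i by simp
    qed (use A c in auto)
    then show "w \<in> {w \<in> carrier_vec (dim_col A). \<exists>y\<in>carrier_vec (dim_row A). A\<^sup>T *\<^sub>v y = w}"
      using c A by (auto intro!: bexI[of _ "vec 2 c"])
  qed
qed

lemma row_space_2_dim: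
  fixes A :: "'a::field mat"
  assumes A: "A \<in> carrier_mat 2 n"
  shows "vec_space.row_space n A \<in> grassmannian 2 n \<longleftrightarrow> (\<exists>i j. i < j \<and> j < n \<and> minor (\<lambda>a k. A $$ (a, k)) i j \<noteq> 0)"
proof -
  interpret vec_space "TYPE('a)" n .
  have AT: "A\<^sup>T \<in> carrier_mat n 2" using A by simp
  have eq: "row_space A = span (set (cols A\<^sup>T))"
    unfolding row_space_def by simp
  have sub: "VectorSpace.subspace class_ring (row_space A) V"
  proof -
    have "set (cols A\<^sup>T) \<subseteq> carrier_vec n" using cols_dim[of "A\<^sup>T"] unfolding carrier_matD(1)[OF AT] .
    then show ?thesis unfolding eq by (intro span_is_subspace) simp
  qed
  have "row_space A \<in> grassmannian 2 n \<longleftrightarrow> rank (A\<^sup>T) = 2"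
    unfolding grassmannian_def rank_def using sub by (simp add: eq)
  also have "\<dots> \<longleftrightarrow> (\<exists>i j. i < j \<and> j < n \<and> minor (\<lambda>a k. A $$ (a, k)) i j \<noteq> 0)"
  proof
    assume "\<exists>i j. i < j \<and> j < n \<and> minor (\<lambda>a k. A $$ (a, k)) i j \<noteq> 0"
    then obtain i j where ij: "i < j" "j < n" "minor (\<lambda>a k. A $$ (a, k)) i j \<noteq> 0" by blast
    have "minor (\<lambda>a k. A\<^sup>T $$ (k, a)) i j = minor (\<lambda>a k. A $$ (a, k)) i j"
      using A ij by (simp add: minor_def)
    then have "det (submatrix (A\<^sup>T) {i, j} UNIV) \<noteq> 0"
      unfolding det_submatrix_pair_transpose[OF AT ij(1,2)] using ij(3) by simp
    from rank_gt_minor[OF AT this] have "card {j. j < (2::nat)} \<le> rank (A\<^sup>T)" by simp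
    then show "rank (A\<^sup>T) = 2" using rank_le_nc[OF AT] by simp
  next
    assume r: "rank (A\<^sup>T) = 2"
    show "\<exists>i j. i < j \<and> j < n \<and> minor (\<lambda>a k. A $$ (a, k)) i j \<noteq> 0"
    proof (rule ccontr)
      assume neg: "\<nexists>i j. i < j \<and> j < n \<and> minor (\<lambda>a k. A $$ (a, k)) i j \<noteq> 0"
      have z: "minor (\<lambda>a k. A $$ (a, k)) i j = 0" if "i < n" "j < n" for i j
      proof (cases i j rule: linorder_cases)
        case less
        then show ?thesis using neg that by blast
      next
        case greater
        then have "minor (\<lambda>a k. A $$ (a, k)) j i = 0" using neg that by blast
        then show ?thesis using minor_swap[of "\<lambda>a k. A $$ (a, k)" i j] by simp
      qed simp
      \<comment> \<open>When all minors vanish, the matrix is a column times a row, read off from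
        any nonzero entry.\<close>
      have "\<exists>f g. \<forall>r<n. \<forall>c<2. A\<^sup>T $$ (r, c) = f r * g c"
      proof (cases "\<exists>k<n. \<exists>c<2. A $$ (c, k) \<noteq> 0")
        case False
        then show ?thesis using A by (intro exI[of _ "\<lambda>_. 0"]) auto
      next
        case True
        then obtain k c0 where k: "k < n" "c0 < 2" "A $$ (c0, k) \<noteq> 0" by blast
        have "A $$ (c, i) = A $$ (c0, i) / A $$ (c0, k) * A $$ (c, k)" if "i < n" "c < 2" for i c
        proof -
          have "A $$ (0, i) * A $$ (1, k) = A $$ (0, k) * A $$ (1, i)"
            using z[OF that(1) k(1)] by (simp add: minor_def)
          then show ?thesis
            using k(3) less_2_cases[OF k(2)] less_2_cases[OF that(2)] by (auto simp: field_simps)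
        qed
        then show ?thesis using A
          by (intro exI[of _ "\<lambda>i. A $$ (c0, i) / A $$ (c0, k)"] exI[of _ "\<lambda>c. A $$ (c, k)"]) auto
      qed
      then obtain f g where "\<forall>r<n. \<forall>c<2. A\<^sup>T $$ (r, c) = f r * g c" by (elim exE)
      then have "rank (A\<^sup>T) \<le> 1" using AT by (intro rank_le_1_product_entries[OF AT, of f g]) auto
      then show False using r by simp
    qed
  qed
  finally show ?thesis .
qed

definition span2 :: "nat \<Rightarrow> (nat \<Rightarrow> nat \<Rightarrow> 'a::field) \<Rightarrow> (nat \<Rightarrow> 'a) \<Rightarrow> bool" where
  "span2 n s y \<longleftrightarrow> (\<exists>c. \<forall>i<n. y i = (\<Sum>a<2. c a * s a i))"

lemma plucker_point:
  fixes W :: "'a::field vec set"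
  assumes "W \<in> grassmannian 2 n" "is_plucker 2 n W p"
  shows "\<exists>s. (\<forall>i j. i < j \<longrightarrow> j < n \<longrightarrow> p {i, j} = minor s i j) \<and> (\<exists>i j. i < j \<and> j < n \<and> minor s i j \<noteq> 0) \<and>
    W = {y \<in> carrier_vec n. span2 n s (\<lambda>i. y $ i)}"
proof -
  obtain A where A: "A \<in> carrier_mat 2 n" "vec_space.row_space n A = W"
    and p: "\<forall>J\<in>plucker_index 2 n. p J = det (submatrix A UNIV J)"
    using assms(2) unfolding is_plucker_def by blast
  have "p {i, j} = minor (\<lambda>a k. A $$ (a, k)) i j" if "i < j" "j < n" for i j
  proof -
    have "{i, j} \<in> plucker_index 2 n" unfolding in_plucker_index_2 using that by blast
    with p show ?thesis using det_submatrix_pair[OF A(1) that] by simp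
  qed
  then show ?thesis
    using row_space_2[OF A(1)] row_space_2_dim[OF A(1)] assms(1) A(2)
    by (intro exI[of _ "\<lambda>a k. A $$ (a, k)"]) (simp add: span2_def)
qed

lemma plucker_point_of_span:
  fixes s :: "nat \<Rightarrow> nat \<Rightarrow> 'a::field"
  assumes "i < j" "j < n" "minor s i j \<noteq> 0"
    and p: "\<And>i j. i < j \<Longrightarrow> j < n \<Longrightarrow> p {i, j} = minor s i j"
  defines "W \<equiv> {y \<in> carrier_vec n. span2 n s (\<lambda>i. y $ i)}"
  shows "W \<in> grassmannian 2 n \<and> is_plucker 2 n W p"
proof -
  define A where "A = mat 2 n (\<lambda>(a, i). s a i)"
  have A: "A \<in> carrier_mat 2 n" by (simp add: A_def)
  have m: "minor (\<lambda>a k. A $$ (a, k)) i j = minor s i j" if "i < n" "j < n" for i j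
    using that by (simp add: minor_def A_def)
  have W: "vec_space.row_space n A = W"
    unfolding row_space_2[OF A] W_def span2_def by (intro Collect_cong conj_cong refl ex_cong1) (simp add: A_def)
  have "W \<in> grassmannian 2 n"
    unfolding W[symmetric] row_space_2_dim[OF A] using assms(1-3) m[of i j] by (intro exI[of _ i] exI[of _ j]) simp
  moreover have "\<forall>J\<in>plucker_index 2 n. p J = det (submatrix A UNIV J)"
  proof
    fix J assume "J \<in> plucker_index 2 n"
    then obtain i j where ij: "i < j" "j < n" "J = {i, j}" unfolding in_plucker_index_2 by blast
    show "p J = det (submatrix A UNIV J)"
      unfolding ij(3) det_submatrix_pair[OF A ij(1,2)] p[OF ij(1,2)] using m ij by simp
  qed
  ultimately show ?thesis unfolding is_plucker_def using A W by blast
qed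

text \<open>The span depends on the minors alone. This identifies the fibre \<open>f x\<close>,
  given by some basis at each point, with the span of the polynomial vectors that have the same
  minors.\<close>

lemma span2_iff_wedge:
  fixes s :: "nat \<Rightarrow> nat \<Rightarrow> 'a::field"
  assumes "u < n" "v < n" "minor s u v \<noteq> 0"
  shows "span2 n s y \<longleftrightarrow>
    (\<forall>i<n. \<forall>j<n. \<forall>k<n. y i * minor s j k - y j * minor s i k + y k * minor s i j = 0)"
proof
  assume "span2 n s y"
  then obtain c where c: "\<forall>i<n. y i = (\<Sum>a<2. c a * s a i)" unfolding span2_def ..
  have y: "y i = c 0 * s 0 i + c 1 * s 1 i" if "i < n" for i
    using c that by (simp add: sum_lessThan_2)
  show "\<forall>i<n. \<forall>j<n. \<forall>k<n. y i * minor s j k - y j * minor s i k + y k * minor s i j = 0"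
    by (intro allI impI) (simp only: y minor_def, simp add: algebra_simps)
next
  assume w: "\<forall>i<n. \<forall>j<n. \<forall>k<n. y i * minor s j k - y j * minor s i k + y k * minor s i j = 0"
  define c where "c a = (if a = 0 then (y u * s 1 v - y v * s 1 u) / minor s u v
      else (y v * s 0 u - y u * s 0 v) / minor s u v)" for a :: nat
  have "y i = (\<Sum>a<2. c a * s a i)" if i: "i < n" for i
  proof -
    have "y i * minor s u v = y u * minor s i v - y v * minor s i u"
      using w[rule_format, OF i assms(1,2)] by (simp add: eq_diff_eq diff_add_eq)
    also have "\<dots> = (y u * s 1 v - y v * s 1 u) * s 0 i + (y v * s 0 u - y u * s 0 v) * s 1 i"
      by (simp add: minor_def algebra_simps)
    finally have "y i = ((y u * s 1 v - y v * s 1 u) * s 0 i + (y v * s 0 u - y u * s 0 v) * s 1 i) / minor s u v"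
      using assms(3) by (simp add: eq_divide_eq)
    then show ?thesis by (simp add: c_def sum_lessThan_2 add_divide_distrib)
  qed
  then show "span2 n s y" unfolding span2_def by (intro exI[of _ c] allI impI)
qed

lemma curve_span_eq_span2: "curve_span n e \<sigma> x = span2 n (curve_value e \<sigma> x)"
  by (simp add: fun_eq_iff curve_span_def span2_def)

section \<open>Splitting of the pulled back subbundle\<close>

text \<open>The Pluecker coordinates as an alternating matrix, so that the quadratic relations can
  be written for unordered indices.\<close>

definition plucker_forms :: "(nat set \<Rightarrow> 'a::comm_ring_1 poly) \<Rightarrow> nat \<Rightarrow> nat \<Rightarrow> 'a poly" where
  "plucker_forms F i j = (if i < j then F {i, j} else if j < i then - F {i, j} else 0)"

text \<open>The rank two case of the Birkhoff-Grothendieck theorem for a decomposable bivector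
  \<open>P\<close>. A nonzero vector \<open>s\<close> of least degree with zero wedge product with
  \<open>P\<close> vanishes nowhere, since a zero could be divided out. Then \<open>P\<close> is the
  wedge of \<open>s\<close> with some \<open>\<rho>\<close>; if the least degree of such a
  \<open>\<rho>\<close> were too large, its leading vector would be proportional to that of
  \<open>s\<close>, and subtracting a multiple of \<open>s\<close> would lower it.\<close>

lemma decomposable_splits:
  fixes P :: "nat \<Rightarrow> nat \<Rightarrow> 'a::alg_closed_field poly"
  assumes Pd: "\<And>i j. i < n \<Longrightarrow> j < n \<Longrightarrow> P i j \<in> forms (int d)"
    and pl: "\<And>h i j k. h < n \<Longrightarrow> i < n \<Longrightarrow> j < n \<Longrightarrow> k < n \<Longrightarrow> P h i * P j k - P h j * P i k + P h k * P i j = 0"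
    and nz: "u < n" "v < n" "P u v \<noteq> 0"
  shows "\<exists>e \<sigma>. e 0 + e 1 = d \<and> (\<forall>a<2. \<forall>i<n. \<sigma> a i \<in> forms (int (e a))) \<and> (\<forall>i<n. \<forall>j<n. P i j = minor \<sigma> i j)"
proof -
  define K where "K y \<longleftrightarrow> (\<forall>i<n. \<forall>j<n. \<forall>k<n. y i * P j k - y j * P i k + y k * P i j = 0) \<and> (\<exists>i<n. y i \<noteq> 0)" for y
  define deg where "deg e y \<longleftrightarrow> (\<forall>i<n. y i \<in> forms (int e))" for e :: nat and y :: "nat \<Rightarrow> 'a poly"
  have "K (P u)" using pl[OF nz(1)] nz unfolding K_def by blast
  moreover have "deg d (P u)" using Pd nz by (simp add: deg_def)
  ultimately have ex: "\<exists>e y. K y \<and> deg e y" by blast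
  define e0 where "e0 = (LEAST e. \<exists>y. K y \<and> deg e y)"
  obtain s where s: "K s" "deg e0 s"
    using LeastI_ex[OF ex] unfolding e0_def by blast
  have min: "e0 \<le> e" if "K y" "deg e y" for e y
    unfolding e0_def by (rule Least_le) (use that in blast)
  have nonvan: "\<exists>i<n. ev (int e0) (s i) x \<noteq> 0" if x: "x \<noteq> (0, 0)" for x
  proof (rule ccontr)
    assume "\<not> (\<exists>i<n. ev (int e0) (s i) x \<noteq> 0)"
    then have "\<forall>i. \<exists>q. i < n \<longrightarrow> q \<in> forms (int e0 - 1) \<and> s i = point_form x * q"
      using forms_vanishing_at_point[OF x, of "s _" "int e0"] s(2) unfolding deg_def by metis
    then obtain q where q: "\<And>i. i < n \<Longrightarrow> q i \<in> forms (int e0 - 1) \<and> s i = point_form x * q i" by metis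
    have Kq: "K q"
      unfolding K_def
    proof (intro conjI allI impI)
      fix i j k assume ijk: "i < n" "j < n" "k < n"
      have "point_form x * (q i * P j k - q j * P i k + q k * P i j) = s i * P j k - s j * P i k + s k * P i j"
        using q ijk by (simp add: algebra_simps)
      also have "\<dots> = 0" using s(1) ijk unfolding K_def by blast
      finally show "q i * P j k - q j * P i k + q k * P i j = 0" using point_form_nonzero[OF x] by simp
    next
      show "\<exists>i<n. q i \<noteq> 0" using s(1) q unfolding K_def by force
    qed
    show False
    proof (cases e0)
      case 0
      then have "q i = 0" if "i < n" for i using q[OF that] forms_negative[of "q i" "int e0 - 1"] by simp
      with Kq show False unfolding K_def by blast
    next
      case (Suc m)
      then have "deg m q" using q unfolding deg_def by simp
      from min[OF Kq this] Suc show False by simp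
    qed
  qed
  have "\<exists>i\<in>{..<n}. poly (s i) t \<noteq> 0" for t
    using nonvan[of "(1, t)"] s(2) by (auto simp: ev_one deg_def)
  then obtain h where h: "(\<Sum>i\<in>{..<n}. h i * s i) = 1"
    using polynomial_bezout[of "{..<n}" s] by blast
  \<comment> \<open>The contraction of \<open>P\<close> with the Bezout functional \<open>h\<close>,
    which takes the value 1 on \<open>s\<close>.\<close>
  define \<rho>0 where "\<rho>0 j = (\<Sum>i<n. h i * P i j)" for j
  define D where "D \<rho> \<longleftrightarrow> (\<forall>j<n. \<forall>k<n. P j k = s j * \<rho> k - s k * \<rho> j)" for \<rho>
  have "D \<rho>0"
    unfolding D_def
  proof (intro allI impI)
    fix j k assume jk: "j < n" "k < n"
    have "P j k = (\<Sum>i<n. h i * s i) * P j k" using h by simp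
    also have "\<dots> = (\<Sum>i<n. s j * (h i * P i k) - s k * (h i * P i j))"
      unfolding sum_distrib_right
    proof (rule sum.cong[OF refl])
      fix i assume "i \<in> {..<n}"
      then have "s i * P j k - s j * P i k + s k * P i j = 0" using s(1) jk unfolding K_def by blast
      then have "s i * P j k = s j * P i k - s k * P i j" by (simp add: algebra_simps)
      then show "h i * s i * P j k = s j * (h i * P i k) - s k * (h i * P i j)"
        by (simp add: mult.assoc right_diff_distrib mult.left_commute)
    qed
    finally show "P j k = s j * \<rho>0 k - s k * \<rho>0 j"
      by (simp add: \<rho>0_def sum_subtractf sum_distrib_left)
  qed
  moreover have "deg (\<Sum>j<n. degree (\<rho>0 j)) \<rho>0"
    unfolding deg_def forms_int_iff by (auto intro!: member_le_sum)
  ultimately have exD: "\<exists>m \<rho>. D \<rho> \<and> deg m \<rho>" by blast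
  define m where "m = (LEAST m. \<exists>\<rho>. D \<rho> \<and> deg m \<rho>)"
  obtain \<rho> where \<rho>: "D \<rho>" "deg m \<rho>" using LeastI_ex[OF exD] unfolding m_def by blast
  have minD: "m \<le> m'" if "D y" "deg m' y" for m' y
    unfolding m_def by (rule Least_le) (use that in blast)
  have K\<rho>: "K \<rho>"
    unfolding K_def
  proof (intro conjI allI impI)
    fix i j k assume ijk: "i < n" "j < n" "k < n"
    have Pjk: "P j k = s j * \<rho> k - s k * \<rho> j" "P i k = s i * \<rho> k - s k * \<rho> i" "P i j = s i * \<rho> j - s j * \<rho> i"
      using \<rho>(1) ijk unfolding D_def by blast+
    show "\<rho> i * P j k - \<rho> j * P i k + \<rho> k * P i j = 0" unfolding Pjk by (simp add: algebra_simps)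
  next
    show "\<exists>i<n. \<rho> i \<noteq> 0"
    proof (rule ccontr)
      assume "\<not> (\<exists>i<n. \<rho> i \<noteq> 0)"
      then have "P u v = 0" using \<rho>(1) nz unfolding D_def by simp
      with nz show False by simp
    qed
  qed
  \<comment> \<open>\<open>\<rho>\<close> takes part in the minimum that defines \<open>e0\<close>;
    hence the exponent \<open>m - e0\<close> used below is a true difference.\<close>
  have e0m: "e0 \<le> m" by (rule min[OF K\<rho> \<rho>(2)])
  have "e0 + m \<le> d"
  proof (rule ccontr)
    assume big: "\<not> e0 + m \<le> d"
    obtain i0 where i0: "i0 < n" "coeff (s i0) e0 \<noteq> 0"
      using nonvan[of "(0, 1)"] by (auto simp: ev_infinity)
    define c where "c = coeff (\<rho> i0) m / coeff (s i0) e0"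
    define \<rho>' where "\<rho>' j = \<rho> j - monom c (m - e0) * s j" for j
    have D': "D \<rho>'"
      using \<rho>(1) unfolding D_def \<rho>'_def by (simp add: algebra_simps)
    have top: "coeff (\<rho> j) m = c * coeff (s j) e0" if j: "j < n" for j
    proof -
      have "coeff (P i0 j) (e0 + m) = coeff (s i0) e0 * coeff (\<rho> j) m - coeff (s j) e0 * coeff (\<rho> i0) m"
        using \<rho> s(2) i0 j coeff_mult_forms[of "s i0" e0 "\<rho> j" m] coeff_mult_forms[of "s j" e0 "\<rho> i0" m]
        unfolding D_def deg_def by simp
      moreover have "coeff (P i0 j) (e0 + m) = 0" by (rule forms_coeff_eq_0[OF Pd[OF i0(1) j]]) (use big in simp)
      ultimately show ?thesis using i0 by (simp add: c_def field_simps)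
    qed
    have \<rho>'f: "\<rho>' j \<in> forms (int m - 1)" if j: "j < n" for j
      unfolding forms_iff_coeff
    proof (intro allI impI)
      fix k assume k: "int m - 1 < int k"
      have \<rho>m: "\<rho> j \<in> forms (int m)" and se: "s j \<in> forms (int e0)" using \<rho>(2) s(2) j by (auto simp: deg_def)
      have "monom c (m - e0) * s j \<in> forms (int (m - e0) + int e0)"
        by (rule forms_mult[OF _ se]) (simp add: forms_int_iff degree_monom_le)
      then have f: "monom c (m - e0) * s j \<in> forms (int m)" using e0m by (simp add: of_nat_diff)
      show "coeff (\<rho>' j) k = 0"
      proof (cases "k = m")
        case True
        have "coeff (monom c (m - e0) * s j) ((m - e0) + e0) = coeff (monom c (m - e0)) (m - e0) * coeff (s j) e0"
          by (rule coeff_mult_forms[OF _ se]) (simp add: forms_int_iff degree_monom_le)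
        then show ?thesis using True e0m top[OF j] by (simp add: \<rho>'_def)
      next
        case False
        then have "int m < int k" using k by linarith
        then show ?thesis using forms_coeff_eq_0[OF \<rho>m] forms_coeff_eq_0[OF f] by (simp add: \<rho>'_def)
      qed
    qed
    show False
    proof (cases m)
      case 0
      then have "\<rho>' j = 0" if "j < n" for j using forms_negative[OF \<rho>'f[OF that]] by simp
      then have "P u v = 0" using D' nz unfolding D_def by simp
      with nz show False by simp
    next
      case (Suc m')
      then have "deg m' \<rho>'" using \<rho>'f unfolding deg_def by simp
      from minD[OF D' this] Suc show False by simp
    qed
  qed
  define e where "e a = (if a = 0 then e0 else d - e0)" for a :: nat
  define \<sigma> where "\<sigma> a = (if a = 0 then s else \<rho>)" for a :: nat
  have "\<rho> i \<in> forms (int (d - e0))" if i: "i < n" for i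
  proof (rule forms_mono)
    show "\<rho> i \<in> forms (int m)" using \<rho>(2) i unfolding deg_def by blast
    show "int m \<le> int (d - e0)" using \<open>e0 + m \<le> d\<close> by simp
  qed
  then have "\<forall>a<2. \<forall>i<n. \<sigma> a i \<in> forms (int (e a))"
    using s(2) by (auto simp: \<sigma>_def e_def deg_def)
  moreover have "\<forall>i<n. \<forall>j<n. P i j = minor \<sigma> i j"
    using \<rho>(1) unfolding D_def by (simp add: minor_def \<sigma>_def)
  moreover have "e 0 + e 1 = d" using \<open>e0 + m \<le> d\<close> by (simp add: e_def)
  ultimately show ?thesis by (intro exI[of _ e] exI[of _ \<sigma>] conjI)
qed

lemma ev_minor:
  assumes "\<forall>a<2. \<forall>i<n. \<sigma> a i \<in> forms (int (e a))" "i < n" "j < n" "e 0 + e 1 = d"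
  shows "ev (int d) (minor \<sigma> i j) x = minor (curve_value e \<sigma> x) i j"
proof -
  have f: "\<sigma> 0 k \<in> forms (int (e 0))" "\<sigma> 1 k \<in> forms (int (e 1))" if "k < n" for k
    using assms(1) that by simp_all
  have d: "int d = int (e 0) + int (e 1)" using assms(4) by simp
  show ?thesis
    unfolding minor_def ev_diff curve_value_def
    using ev_mult'[OF f(1)[OF assms(2)] f(2)[OF assms(3)] d, of x] ev_mult'[OF f(1)[OF assms(3)] f(2)[OF assms(2)] d, of x]
    by simp
qed

text \<open>At each point the Pluecker coordinates are the minors of a basis of \<open>f x\<close>.
  So the forms satisfy the quadratic relations everywhere, \<open>decomposable_splits\<close>
  applies, and equal minors mean equal fibres.\<close>

theorem rational_curve_splits:
  fixes f :: "'a::alg_closed_field \<times> 'a \<Rightarrow> 'a vec set"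
  assumes "rational_curve 2 n d F f"
  shows "\<exists>e \<sigma>. e 0 + e 1 = d \<and> split_curve n e \<sigma> f \<and> (\<forall>i<n. \<forall>j<n. plucker_forms F i j = minor \<sigma> i j)"
proof -
  let ?P = "plucker_forms F"
  have F: "F J \<in> forms (int d)" if "J \<in> plucker_index 2 n" for J
    using assms that unfolding rational_curve_def by blast
  have Pd: "?P i j \<in> forms (int d)" if ij: "i < n" "j < n" for i j
  proof (cases i j rule: linorder_cases)
    case less
    then have "{i, j} \<in> plucker_index 2 n" using ij in_plucker_index_2 by blast
    then show ?thesis using F less by (simp add: plucker_forms_def)
  next
    case greater
    then have "{j, i} \<in> plucker_index 2 n" using ij in_plucker_index_2 by blast
    then show ?thesis using F greater by (simp add: plucker_forms_def insert_commute forms_minus)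
  qed (simp add: plucker_forms_def)
  have pt: "\<exists>s. (\<forall>i<n. \<forall>j<n. ev (int d) (?P i j) x = minor s i j) \<and> (\<exists>i j. i < j \<and> j < n \<and> minor s i j \<noteq> 0) \<and>
      f x = {y \<in> carrier_vec n. span2 n s (\<lambda>i. y $ i)}" if x: "x \<noteq> (0, 0)" for x
  proof -
    have "f x \<in> grassmannian 2 n" "is_plucker 2 n (f x) (\<lambda>J. form_eval d (F J) x)"
      using assms x unfolding rational_curve_def by blast+
    from plucker_point[OF this] obtain s where s: "\<forall>i j. i < j \<longrightarrow> j < n \<longrightarrow> form_eval d (F {i, j}) x = minor s i j"
      "\<exists>i j. i < j \<and> j < n \<and> minor s i j \<noteq> 0" "f x = {y \<in> carrier_vec n. span2 n s (\<lambda>i. y $ i)}" by blast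
    have "ev (int d) (?P i j) x = minor s i j" if ij: "i < n" "j < n" for i j
    proof (cases i j rule: linorder_cases)
      case less
      then show ?thesis using s(1) ij by (simp add: plucker_forms_def form_eval_eq_ev)
    next
      case greater
      then have "form_eval d (F {j, i}) x = minor s j i" using s(1) ij by blast
      then show ?thesis using greater minor_swap[of s j i]
        by (simp add: plucker_forms_def form_eval_eq_ev ev_minus insert_commute)
    qed (simp add: plucker_forms_def)
    with s(2,3) show ?thesis by blast
  qed
  have pl: "?P h i * ?P j k - ?P h j * ?P i k + ?P h k * ?P i j = 0" if hijk: "h < n" "i < n" "j < n" "k < n" for h i j k
  proof (rule poly_eq_0_if_all_0)
    fix t
    obtain s where s: "\<forall>i<n. \<forall>j<n. ev (int d) (?P i j) (1, t) = minor s i j" using pt[of "(1, t)"] by auto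
    have V: "poly (?P i j) t = minor s i j" if "i < n" "j < n" for i j
      using s that ev_one[OF Pd[OF that], of t] by simp
    show "poly (?P h i * ?P j k - ?P h j * ?P i k + ?P h k * ?P i j) t = 0"
      using hijk by (simp add: V) (simp add: minor_def algebra_simps)
  qed
  have "\<exists>u v. u < v \<and> v < n \<and> ?P u v \<noteq> 0"
  proof -
    from pt[of "(1, 0)"] obtain s where s: "\<forall>i<n. \<forall>j<n. ev (int d) (?P i j) (1, 0) = minor s i j"
      and "\<exists>i j. i < j \<and> j < n \<and> minor s i j \<noteq> 0" by auto
    then obtain i j where ij: "i < j" "j < n" "minor s i j \<noteq> 0" by blast
    then have "ev (int d) (?P i j) (1, 0) \<noteq> 0" using s by simp
    then have "?P i j \<noteq> 0" by auto
    then show ?thesis using ij by blast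
  qed
  then obtain u v where uv: "u < v" "v < n" "?P u v \<noteq> 0" by blast
  have un: "u < n" using uv by simp
  obtain e \<sigma> where e: "e 0 + e 1 = d" and \<sigma>f: "\<forall>a<2. \<forall>i<n. \<sigma> a i \<in> forms (int (e a))"
    and P: "\<forall>i<n. \<forall>j<n. ?P i j = minor \<sigma> i j"
  proof -
    have "\<exists>e \<sigma>. e 0 + e 1 = d \<and> (\<forall>a<2. \<forall>i<n. \<sigma> a i \<in> forms (int (e a))) \<and> (\<forall>i<n. \<forall>j<n. ?P i j = minor \<sigma> i j)"
    proof (rule decomposable_splits[of n ?P d u v])
      show "?P i j \<in> forms (int d)" if "i < n" "j < n" for i j by (rule Pd[OF that])
      show "?P h i * ?P j k - ?P h j * ?P i k + ?P h k * ?P i j = 0" if "h < n" "i < n" "j < n" "k < n" for h i j k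
        by (rule pl[OF that])
    qed (rule un uv)+
    then show thesis by (elim exE conjE) (rule that)
  qed
  have val: "minor (curve_value e \<sigma> x) i j = ev (int d) (?P i j) x" if "i < n" "j < n" for x i j
    using ev_minor[OF \<sigma>f that e, of x] P that by simp
  have "split_curve n e \<sigma> f"
  proof
    show "\<sigma> a i \<in> forms (int (e a))" if "a < 2" "i < n" for a i using \<sigma>f that by blast
    fix x :: "'a \<times> 'a" assume x: "x \<noteq> (0, 0)"
    from pt[OF x] obtain s where s: "\<forall>i<n. \<forall>j<n. ev (int d) (?P i j) x = minor s i j"
      and nz: "\<exists>i j. i < j \<and> j < n \<and> minor s i j \<noteq> 0" and fx: "f x = {y \<in> carrier_vec n. span2 n s (\<lambda>i. y $ i)}"
      by blast
    from nz obtain i j where ij: "i < j" "j < n" "minor s i j \<noteq> 0" by blast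
    have same: "minor (curve_value e \<sigma> x) i j = minor s i j" if "i < n" "j < n" for i j
      using val[OF that] s that by simp
    have i: "i < n" using ij by simp
    have nz': "minor (curve_value e \<sigma> x) i j \<noteq> 0" using same[OF i ij(2)] ij(3) by simp
    then show "\<exists>i<n. \<exists>j<n. curve_value e \<sigma> x 0 i * curve_value e \<sigma> x 1 j - curve_value e \<sigma> x 0 j * curve_value e \<sigma> x 1 i \<noteq> 0"
      using i ij(2) unfolding minor_def by blast
    have "span2 n s y \<longleftrightarrow> curve_span n e \<sigma> x y" for y
      unfolding curve_span_eq_span2 span2_iff_wedge[OF i ij(2,3)] span2_iff_wedge[OF i ij(2) nz'] by (simp add: same)
    then show "f x = {y \<in> carrier_vec n. curve_span n e \<sigma> x (\<lambda>i. y $ i)}" unfolding fx by simp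
  qed
  then show ?thesis using e P by (intro exI[of _ e] exI[of _ \<sigma>] conjI)
qed

theorem split_curve_rational:
  fixes \<sigma> :: "nat \<Rightarrow> nat \<Rightarrow> 'a::alg_closed_field poly"
  assumes \<sigma>f: "\<forall>a<2. \<forall>i<n. \<sigma> a i \<in> forms (int (e a))" and d: "e 0 + e 1 = d"
    and ind: "\<And>x. x \<noteq> (0, 0) \<Longrightarrow> \<exists>i<n. \<exists>j<n. minor (curve_value e \<sigma> x) i j \<noteq> 0"
  shows "\<exists>F f. rational_curve 2 n d F f \<and> split_curve n e \<sigma> f \<and> (\<forall>i<n. \<forall>j<n. plucker_forms F i j = minor \<sigma> i j)"
proof -
  define F where "F J = (if J \<in> plucker_index 2 n then minor \<sigma> (Min J) (Max J) else 0)" for J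
  define f where "f x = {y \<in> carrier_vec n. curve_span n e \<sigma> x (\<lambda>i. y $ i)}" for x
  have F: "F {i, j} = minor \<sigma> i j" if "i < j" "j < n" for i j
  proof -
    have "{i, j} \<in> plucker_index 2 n" using that in_plucker_index_2 by blast
    then show ?thesis using that by (simp add: F_def)
  qed
  have mf: "minor \<sigma> i j \<in> forms (int d)" if ij: "i < n" "j < n" for i j
  proof -
    have f: "\<sigma> 0 k \<in> forms (int (e 0))" "\<sigma> 1 k \<in> forms (int (e 1))" if "k < n" for k
      using \<sigma>f that by simp_all
    have d: "int d = int (e 0) + int (e 1)" using d by simp
    show ?thesis unfolding minor_def
      by (intro forms_diff forms_mult'[OF f(1)[OF ij(1)] f(2)[OF ij(2)] d] forms_mult'[OF f(1)[OF ij(2)] f(2)[OF ij(1)] d])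
  qed
  have "rational_curve 2 n d F f"
    unfolding rational_curve_def
  proof (intro conjI ballI allI impI)
    fix J assume "J \<in> plucker_index 2 n"
    then show "F J \<in> forms (int d)" using F mf in_plucker_index_2 by force
  next
    fix J assume "J \<notin> plucker_index 2 n"
    then show "F J = 0" by (simp add: F_def)
  next
    fix x :: "'a \<times> 'a" assume x: "x \<noteq> (0, 0)"
    obtain i j where ij: "i < n" "j < n" "minor (curve_value e \<sigma> x) i j \<noteq> 0" using ind[OF x] by blast
    have "\<exists>i j. i < j \<and> j < n \<and> minor (curve_value e \<sigma> x) i j \<noteq> 0"
    proof (cases i j rule: linorder_cases)
      case greater
      then show ?thesis using ij minor_swap[of "curve_value e \<sigma> x" j i] by (intro exI[of _ j] exI[of _ i]) simp
    qed (use ij in auto)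
    then obtain i j where ij: "i < j" "j < n" "minor (curve_value e \<sigma> x) i j \<noteq> 0" by blast
    have "form_eval d (F {i, j}) x = minor (curve_value e \<sigma> x) i j" if "i < j" "j < n" for i j
      using ev_minor[OF \<sigma>f _ that(2) d, of i x] that F[OF that] by (simp add: form_eval_eq_ev)
    from plucker_point_of_span[OF ij this] show "f x \<in> grassmannian 2 n" "is_plucker 2 n (f x) (\<lambda>J. form_eval d (F J) x)"
      unfolding f_def curve_span_eq_span2 by blast+
  qed
  moreover have "split_curve n e \<sigma> f"
    by standard (use \<sigma>f ind in \<open>auto simp: f_def minor_def\<close>)
  moreover have "plucker_forms F i j = minor \<sigma> i j" if "i < n" "j < n" for i j
  proof (cases i j rule: linorder_cases)
    case greater
    then have "F {j, i} = minor \<sigma> j i" using F that by blast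
    then show ?thesis using greater minor_swap[of \<sigma> j i] by (simp add: plucker_forms_def insert_commute)
  qed (use F that in \<open>auto simp: plucker_forms_def\<close>)
  ultimately show ?thesis by (intro exI[of _ F] exI[of _ f] conjI allI impI)
qed

section \<open>Homogeneous polynomial functions\<close>

lemma finite_multisets_of_size:
  assumes "finite V"
  shows "finite {m. set_mset m \<subseteq> V \<and> size m = e}"
proof (rule finite_subset)
  show "{m. set_mset m \<subseteq> V \<and> size m = e} \<subseteq> mset ` {xs. set xs \<subseteq> V \<and> length xs = e}"
  proof
    fix m assume m: "m \<in> {m. set_mset m \<subseteq> V \<and> size m = e}"
    obtain xs where xs: "mset xs = m" using ex_mset by blast
    then have "set xs = set_mset m" "length xs = size m" by auto
    then show "m \<in> mset ` {xs. set xs \<subseteq> V \<and> length xs = e}" using m xs by blast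
  qed
  show "finite (mset ` {xs. set xs \<subseteq> V \<and> length xs = e})"
    using finite_lists_length_eq[OF assms] by simp
qed

lemma homogeneous_polyfun_zero: "homogeneous_polyfun V e (\<lambda>x. 0)"
  unfolding homogeneous_polyfun_def by (intro exI[of _ "\<lambda>_. 0"]) simp

lemma homogeneous_polyfun_const: "homogeneous_polyfun V 0 (\<lambda>x. c)"
proof -
  have "{m. set_mset m \<subseteq> V \<and> size m = 0} = {{#}}" by auto
  then show ?thesis unfolding homogeneous_polyfun_def by (intro exI[of _ "\<lambda>_. c"]) simp
qed

lemma homogeneous_polyfun_add:
  assumes "homogeneous_polyfun V e g" "homogeneous_polyfun V e h"
  shows "homogeneous_polyfun V e (\<lambda>x. g x + h x)"
proof -
  obtain b c where "g = (\<lambda>x. \<Sum>m \<in> {m. set_mset m \<subseteq> V \<and> size m = e}. b m * (\<Prod>v \<in># m. x v))"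
    "h = (\<lambda>x. \<Sum>m \<in> {m. set_mset m \<subseteq> V \<and> size m = e}. c m * (\<Prod>v \<in># m. x v))"
    using assms unfolding homogeneous_polyfun_def by (elim exE)
  then show ?thesis unfolding homogeneous_polyfun_def
    by (intro exI[of _ "\<lambda>m. b m + c m"]) (simp add: distrib_right sum.distrib)
qed

lemma homogeneous_polyfun_sum:
  assumes "\<And>i. i \<in> I \<Longrightarrow> homogeneous_polyfun V e (g i)"
  shows "homogeneous_polyfun V e (\<lambda>x. \<Sum>i\<in>I. g i x)"
  using assms
proof (induction I rule: infinite_finite_induct)
  case (insert i I)
  have "homogeneous_polyfun V e (\<lambda>x. g i x + (\<Sum>i\<in>I. g i x))"
    by (intro homogeneous_polyfun_add insert) auto
  then show ?case using insert.hyps by simp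
qed (simp_all add: homogeneous_polyfun_zero)

lemma homogeneous_polyfun_mult:
  assumes V: "finite V" and "homogeneous_polyfun V d g" "homogeneous_polyfun V e h"
  shows "homogeneous_polyfun V (d + e) (\<lambda>x. g x * h x)"
proof -
  define M where "M e = {m. set_mset m \<subseteq> V \<and> size m = e}" for e
  have fM: "finite (M e)" for e unfolding M_def by (rule finite_multisets_of_size[OF V])
  obtain b c where b: "g = (\<lambda>x. \<Sum>m \<in> M d. b m * (\<Prod>v \<in># m. x v))"
    and c: "h = (\<lambda>x. \<Sum>m \<in> M e. c m * (\<Prod>v \<in># m. x v))"
    using assms(2,3) unfolding homogeneous_polyfun_def M_def by (elim exE)
  define T where "T = M d \<times> M e"
  define s where "s p = fst p + snd p" for p :: "'a multiset \<times> 'a multiset"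
  have "s ` T \<subseteq> M (d + e)" by (auto simp: s_def T_def M_def)
  note grp = sum.group[OF _ fM this]
  have "g x * h x = (\<Sum>m\<in>M (d + e). (\<Sum>p | p \<in> T \<and> s p = m. b (fst p) * c (snd p)) * (\<Prod>v \<in># m. x v))" for x
  proof -
    have "g x * h x = (\<Sum>p\<in>T. b (fst p) * (\<Prod>v \<in># fst p. x v) * (c (snd p) * (\<Prod>v \<in># snd p. x v)))"
      unfolding b c T_def sum_product sum.cartesian_product by (simp add: case_prod_unfold)
    also have "\<dots> = (\<Sum>p\<in>T. b (fst p) * c (snd p) * (\<Prod>v \<in># s p. x v))"
      by (intro sum.cong refl) (simp add: s_def mult_ac)
    also have "\<dots> = (\<Sum>m\<in>M (d + e). \<Sum>p | p \<in> T \<and> s p = m. b (fst p) * c (snd p) * (\<Prod>v \<in># s p. x v))"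
      by (rule grp[symmetric]) (simp add: T_def fM)
    finally show ?thesis by (simp add: sum_distrib_right)
  qed
  then show ?thesis
    unfolding homogeneous_polyfun_def M_def[symmetric]
    by (intro exI[of _ "\<lambda>m. \<Sum>p | p \<in> T \<and> s p = m. b (fst p) * c (snd p)"] ext)
qed

lemma homogeneous_polyfun_prod:
  assumes "finite V" "\<And>i. i < k \<Longrightarrow> homogeneous_polyfun V 1 (g i)"
  shows "homogeneous_polyfun V k (\<lambda>x. \<Prod>i<k. g i x)"
  using assms(2)
proof (induction k)
  case 0
  show ?case using homogeneous_polyfun_const[of V 1] by simp
next
  case (Suc k)
  have "homogeneous_polyfun V (k + 1) (\<lambda>x. (\<Prod>i<k. g i x) * g k x)"
    by (intro homogeneous_polyfun_mult assms(1) Suc) auto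
  then show ?case by simp
qed

lemma homogeneous_polyfun_cmult:
  "finite V \<Longrightarrow> homogeneous_polyfun V e g \<Longrightarrow> homogeneous_polyfun V e (\<lambda>x. c * g x)"
  using homogeneous_polyfun_mult[OF _ homogeneous_polyfun_const, of V e g c] by simp

lemma homogeneous_polyfun_diff:
  "finite V \<Longrightarrow> homogeneous_polyfun V e g \<Longrightarrow> homogeneous_polyfun V e h \<Longrightarrow>
    homogeneous_polyfun V e (\<lambda>x. g x - h x)"
  using homogeneous_polyfun_add[OF _ homogeneous_polyfun_cmult, of V e g h "- 1"] by simp

lemma homogeneous_polyfun_var:
  fixes V :: "'v set"
  assumes "finite V" "v \<in> V"
  shows "homogeneous_polyfun V 1 (\<lambda>x. x v :: 'a::comm_ring_1)"
proof -
  have "(\<Sum>m \<in> {m. set_mset m \<subseteq> V \<and> size m = 1}. (if m = {#v#} then 1 else 0) * (\<Prod>v \<in># m. x v)) = x v"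
    for x :: "'v \<Rightarrow> 'a"
  proof -
    have "(\<Sum>m \<in> {m. set_mset m \<subseteq> V \<and> size m = 1}. (if m = {#v#} then 1 else 0) * (\<Prod>v \<in># m. x v))
        = (\<Sum>m \<in> {m. set_mset m \<subseteq> V \<and> size m = 1}. if m = {#v#} then x v else 0)"
      by (intro sum.cong) auto
    also have "\<dots> = x v" using assms finite_multisets_of_size[OF assms(1), of 1] by (subst sum.delta) auto
    finally show ?thesis .
  qed
  then show ?thesis unfolding homogeneous_polyfun_def by (intro exI[of _ "\<lambda>m. if m = {#v#} then 1 else 0"] ext) simp
qed

lemma homogeneous_polyfun_det:
  assumes V: "finite V" and g: "\<And>i j. i < k \<Longrightarrow> j < k \<Longrightarrow> homogeneous_polyfun V 1 (g i j)"
  shows "homogeneous_polyfun V k (\<lambda>x. det (mat k k (\<lambda>(i, j). g i j x)))"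
proof -
  have "det (mat k k (\<lambda>(i, j). g i j x)) = (\<Sum>p | p permutes {0..<k}. signof p * (\<Prod>i<k. g i (p i) x))" for x
  proof -
    have "det (mat k k (\<lambda>(i, j). g i j x))
        = (\<Sum>p | p permutes {0..<k}. signof p * (\<Prod>i = 0..<k. mat k k (\<lambda>(i, j). g i j x) $$ (i, p i)))"
      by (subst det_def') auto
    also have "\<dots> = (\<Sum>p | p permutes {0..<k}. signof p * (\<Prod>i<k. g i (p i) x))"
    proof (rule sum.cong[OF refl])
      fix p assume "p \<in> {p. p permutes {0..<k}}"
      then have "p i < k" if "i < k" for i using that permutes_in_image[of p "{0..<k}" i] by auto
      then show "signof p * (\<Prod>i = 0..<k. mat k k (\<lambda>(i, j). g i j x) $$ (i, p i)) = signof p * (\<Prod>i<k. g i (p i) x)"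
        by (simp add: atLeast0LessThan)
    qed
    finally show ?thesis .
  qed
  moreover have "homogeneous_polyfun V k (\<lambda>x. \<Sum>p | p permutes {0..<k}. signof p * (\<Prod>i<k. g i (p i) x))"
  proof (intro homogeneous_polyfun_sum homogeneous_polyfun_cmult V homogeneous_polyfun_prod g)
    fix p i assume "p \<in> {p. p permutes {0..<k}}" "i < k"
    then show "p i < k" using permutes_in_image[of p "{0..<k}" i] by auto
  qed
  ultimately show ?thesis by simp
qed

section \<open>Conormal sections in terms of Pluecker coordinates\<close>

text \<open>These conditions are linear in \<open>H\<close> and in \<open>P\<close>. For \<open>P = \<sigma>\<^sub>0 \<and> \<sigma>\<^sub>1\<close> they say that the rows of \<open>H\<close>
  lie in the span of the \<open>\<sigma>\<^sub>a\<close>, that the columns are orthogonal to it, and that \<open>H\<close> kills the differential.\<close>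

definition conormal_matrix :: "nat \<Rightarrow> nat \<Rightarrow> (nat \<Rightarrow> nat \<Rightarrow> 'a::field poly) \<Rightarrow> (nat \<Rightarrow> nat \<Rightarrow> 'a poly) \<Rightarrow> bool" where
  "conormal_matrix n m P H \<longleftrightarrow>
     (\<forall>i<n. \<forall>j<n. H i j \<in> forms (int m)) \<and>
     (\<forall>i<n. \<forall>a<n. \<forall>b<n. \<forall>c<n. H i a * P b c - H i b * P a c + H i c * P a b = 0) \<and>
     (\<forall>j<n. \<forall>k<n. (\<Sum>i<n. H i j * P i k) = 0) \<and>
     (\<forall>u<n. \<forall>v<n. (\<Sum>i<n. H i u * pderiv (P i v) - H i v * pderiv (P i u)) = 0)"

context split_curve
begin

lemma minor_nonzero: "\<exists>u<n. \<exists>v<n. poly (minor \<sigma> u v) t \<noteq> 0"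
proof -
  obtain i j where ij: "i < n" "j < n" "S (1, t) 0 i * S (1, t) 1 j - S (1, t) 0 j * S (1, t) 1 i \<noteq> 0"
    using indep[of "(1, t)"] by auto
  then have "poly (minor \<sigma> i j) t \<noteq> 0" by (simp add: minor_def ev_at_affine)
  then show ?thesis using ij by blast
qed

lemma tensor_independent:
  assumes w: "\<And>j k. j < n \<Longrightarrow> k < n \<Longrightarrow> (\<Sum>a<2. \<Sum>b<2. w a b * \<sigma> a j * \<sigma> b k) = 0" and ab: "a < 2" "b < 2"
  shows "w a b = 0"
proof (rule poly_eq_0_if_all_0)
  fix t :: 'a
  have x: "(1 :: 'a, t) \<noteq> (0, 0)" by simp
  have z: "(\<Sum>b<2. poly (w a b) t * S (1, t) b k) = 0" if k: "k < n" for k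
  proof (rule S_independent[OF x _ ab(1), of "\<lambda>a. \<Sum>b<2. poly (w a b) t * S (1, t) b k"])
    fix j assume j: "j < n"
    have "(\<Sum>a<2. (\<Sum>b<2. poly (w a b) t * S (1, t) b k) * S (1, t) a j) = poly (\<Sum>a<2. \<Sum>b<2. w a b * \<sigma> a j * \<sigma> b k) t"
      using j k by (simp add: sum_lessThan_2 ev_at_affine algebra_simps)
    then show "(\<Sum>a<2. (\<Sum>b<2. poly (w a b) t * S (1, t) b k) * S (1, t) a j) = 0" unfolding w[OF j k] by simp
  qed
  show "poly (w a b) t = 0" by (rule S_independent[OF x z ab(2)])
qed

text \<open>With \<open>w a b\<close> the product of \<open>z a\<close> and
  \<open>\<sigma> b\<close>, the orthogonality condition on the matrix is a vanishing combination of
  tensors of the \<open>\<sigma> a\<close>, with entries of \<open>w\<close> as coefficients. Once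
  \<open>w = 0\<close>, the last condition reads \<open>tangent_form z\<close> times a minor, and
  some minor is nonzero.\<close>

lemma conormal_matrix_section_iff:
  assumes z: "\<forall>a<2. \<forall>i<n. z a i \<in> forms (int m - int (e a))"
  shows "conormal_matrix n m (minor \<sigma>) (section_mat z) \<longleftrightarrow> conormal_section (int m) z"
proof -
  define w where "w a b = (\<Sum>i<n. z a i * \<sigma> b i)" for a b
  define t where "t a b = (\<Sum>i<n. z a i * pderiv (\<sigma> b i))" for a b
  let ?P = "minor \<sigma>"
  have c0: "section_mat z i j \<in> forms (int m)" if "i < n" "j < n" for i j
    unfolding section_mat_def by (intro forms_sum forms_mult'[OF _ sect]) (use z that in auto)
  have c1: "section_mat z i a * ?P b c - section_mat z i b * ?P a c + section_mat z i c * ?P a b = 0" for i a b c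
    by (simp add: section_mat_def sum_lessThan_2 minor_def algebra_simps)
  have c2: "(\<Sum>i<n. section_mat z i j * ?P i k) = (\<Sum>a<2. w a 0 * \<sigma> a j) * \<sigma> 1 k - (\<Sum>a<2. w a 1 * \<sigma> a j) * \<sigma> 0 k" for j k
  proof -
    have "section_mat z i j * ?P i k = (\<Sum>a<2. z a i * \<sigma> 0 i * \<sigma> a j) * \<sigma> 1 k - (\<Sum>a<2. z a i * \<sigma> 1 i * \<sigma> a j) * \<sigma> 0 k" for i
      by (simp add: section_mat_def sum_lessThan_2 minor_def algebra_simps)
    then have "(\<Sum>i<n. section_mat z i j * ?P i k)
        = (\<Sum>i<n. \<Sum>a<2. z a i * \<sigma> 0 i * \<sigma> a j) * \<sigma> 1 k - (\<Sum>i<n. \<Sum>a<2. z a i * \<sigma> 1 i * \<sigma> a j) * \<sigma> 0 k"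
      by (simp add: sum_subtractf sum_distrib_right)
    moreover have "(\<Sum>i<n. \<Sum>a<2. z a i * \<sigma> b i * \<sigma> a j) = (\<Sum>a<2. w a b * \<sigma> a j)" for b
      unfolding w_def sum_distrib_right by (rule sum.swap)
    ultimately show ?thesis by simp
  qed
  have half: "(\<Sum>i<n. section_mat z i u * pderiv (?P i v))
      = (\<Sum>a<2. t a 0 * \<sigma> a u) * \<sigma> 1 v + (\<Sum>a<2. w a 0 * \<sigma> a u) * pderiv (\<sigma> 1 v)
        - (\<Sum>a<2. t a 1 * \<sigma> a u) * \<sigma> 0 v - (\<Sum>a<2. w a 1 * \<sigma> a u) * pderiv (\<sigma> 0 v)" for u v
  proof -
    have "section_mat z i u * pderiv (?P i v)
      = (\<Sum>a<2. z a i * pderiv (\<sigma> 0 i) * \<sigma> a u) * \<sigma> 1 v + (\<Sum>a<2. z a i * \<sigma> 0 i * \<sigma> a u) * pderiv (\<sigma> 1 v)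
        - (\<Sum>a<2. z a i * pderiv (\<sigma> 1 i) * \<sigma> a u) * \<sigma> 0 v - (\<Sum>a<2. z a i * \<sigma> 1 i * \<sigma> a u) * pderiv (\<sigma> 0 v)" for i
      by (simp add: section_mat_def sum_lessThan_2 minor_def pderiv_diff pderiv_mult algebra_simps)
    then have "(\<Sum>i<n. section_mat z i u * pderiv (?P i v))
      = (\<Sum>i<n. \<Sum>a<2. z a i * pderiv (\<sigma> 0 i) * \<sigma> a u) * \<sigma> 1 v + (\<Sum>i<n. \<Sum>a<2. z a i * \<sigma> 0 i * \<sigma> a u) * pderiv (\<sigma> 1 v)
        - (\<Sum>i<n. \<Sum>a<2. z a i * pderiv (\<sigma> 1 i) * \<sigma> a u) * \<sigma> 0 v - (\<Sum>i<n. \<Sum>a<2. z a i * \<sigma> 1 i * \<sigma> a u) * pderiv (\<sigma> 0 v)"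
      by (simp add: sum_subtractf sum.distrib sum_distrib_right)
    moreover have "(\<Sum>i<n. \<Sum>a<2. z a i * \<sigma> b i * \<sigma> a j) = (\<Sum>a<2. w a b * \<sigma> a j)"
      "(\<Sum>i<n. \<Sum>a<2. z a i * pderiv (\<sigma> b i) * \<sigma> a j) = (\<Sum>a<2. t a b * \<sigma> a j)" for b j
      unfolding w_def t_def sum_distrib_right by (rule sum.swap)+
    ultimately show ?thesis by simp
  qed
  have tf: "tangent_form z = t 0 0 + t 1 1"
    by (simp add: tangent_form_def t_def sum_lessThan_2)
  have c3: "(\<Sum>i<n. section_mat z i u * pderiv (?P i v) - section_mat z i v * pderiv (?P i u)) = tangent_form z * ?P u v"
    if w0: "\<And>a b. a < 2 \<Longrightarrow> b < 2 \<Longrightarrow> w a b = 0" for u v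
    unfolding sum_subtractf half tf using w0 by (simp add: sum_lessThan_2 minor_def algebra_simps)
  show ?thesis
  proof
    assume H: "conormal_matrix n m ?P (section_mat z)"
    define s where "s a b = (if b = 0 then - w a 1 else w a 0)" for a b :: nat
    have "(\<Sum>a<2. \<Sum>b<2. s a b * \<sigma> a j * \<sigma> b k) = 0" if "j < n" "k < n" for j k
    proof -
      have "(\<Sum>i<n. section_mat z i j * ?P i k) = 0" using H that unfolding conormal_matrix_def by blast
      then show ?thesis unfolding c2 by (simp add: s_def sum_lessThan_2 algebra_simps)
    qed
    then have s0: "s a b = 0" if "a < 2" "b < 2" for a b by (rule tensor_independent[OF _ that])
    have w0: "w a b = 0" if "a < 2" "b < 2" for a b
    proof -
      have "w a 0 = 0" using s0[OF that(1), of 1] unfolding s_def by simp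
      moreover have "w a 1 = 0" using s0[OF that(1), of 0] unfolding s_def by simp
      ultimately show ?thesis using less_2_cases[OF that(2)] by auto
    qed
    have "tangent_form z = 0"
    proof -
      obtain u v where uv: "u < n" "v < n" "poly (?P u v) 0 \<noteq> 0" using minor_nonzero by blast
      then have "tangent_form z * ?P u v = 0"
        using H c3[OF w0, of u v] unfolding conormal_matrix_def by auto
      then show ?thesis using uv by auto
    qed
    then show "conormal_section (int m) z"
      unfolding conormal_section_def perp_section_def using z w0 by (auto simp: w_def)
  next
    assume "conormal_section (int m) z"
    then have w0: "w a b = 0" if "a < 2" "b < 2" for a b using conormal_section_perp that by (simp add: w_def)
    have "tangent_form z = 0" using \<open>conormal_section (int m) z\<close> by (simp add: conormal_section_def)
    show "conormal_matrix n m ?P (section_mat z)"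
      unfolding conormal_matrix_def
    proof (intro conjI allI impI)
      show "(\<Sum>i<n. section_mat z i j * ?P i k) = 0" for j k
        unfolding c2 by (simp add: sum_lessThan_2 w0)
      show "(\<Sum>i<n. section_mat z i u * pderiv (?P i v) - section_mat z i v * pderiv (?P i u)) = 0" for u v
        using c3[OF w0, of u v] \<open>tangent_form z = 0\<close> by simp
    qed (rule c0 c1; assumption)+
  qed
qed

lemma conormal_matrix_cong:
  assumes "\<And>i j. i < n \<Longrightarrow> j < n \<Longrightarrow> H i j = H' i j" "\<And>i j. i < n \<Longrightarrow> j < n \<Longrightarrow> P i j = P' i j"
  shows "conormal_matrix n m P H \<longleftrightarrow> conormal_matrix n m P' H'"
  unfolding conormal_matrix_def using assms by simp

lemma conormal_matrix_is_section:
  assumes H: "conormal_matrix n m (minor \<sigma>) H"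
  shows "\<exists>z. conormal_section (int m) z \<and> (\<forall>i<n. \<forall>j<n. H i j = section_mat z i j)"
proof -
  have "\<exists>c. (\<forall>a<2. c a \<in> forms (int m - int (e a))) \<and> (\<forall>j<n. H i j = (\<Sum>a<2. c a * \<sigma> a j))" if i: "i < n" for i
  proof -
    show ?thesis
    proof (rule span_factor[of "H i" "int m"])
      show "H i a * (\<sigma> 0 b * \<sigma> 1 c - \<sigma> 0 c * \<sigma> 1 b) - H i b * (\<sigma> 0 a * \<sigma> 1 c - \<sigma> 0 c * \<sigma> 1 a)
        + H i c * (\<sigma> 0 a * \<sigma> 1 b - \<sigma> 0 b * \<sigma> 1 a) = 0" if "a < n" "b < n" "c < n" for a b c
        using H i that unfolding conormal_matrix_def minor_def by blast
      show "H i j \<in> forms (int m)" if "j < n" for j using H i that unfolding conormal_matrix_def by blast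
    qed (intro exI conjI)
  qed
  then have "\<forall>i. \<exists>c. i < n \<longrightarrow> (\<forall>a<2. c a \<in> forms (int m - int (e a))) \<and> (\<forall>j<n. H i j = (\<Sum>a<2. c a * \<sigma> a j))" by blast
  from choice[OF this] obtain c where c: "\<forall>i. i < n \<longrightarrow> (\<forall>a<2. c i a \<in> forms (int m - int (e a))) \<and> (\<forall>j<n. H i j = (\<Sum>a<2. c i a * \<sigma> a j))" ..
  define z where "z a i = c i a" for a i
  have z: "\<forall>a<2. \<forall>i<n. z a i \<in> forms (int m - int (e a))" using c by (simp add: z_def)
  have Hz: "H i j = section_mat z i j" if "i < n" "j < n" for i j
    using c that by (simp add: section_mat_def z_def)
  have "conormal_matrix n m (minor \<sigma>) (section_mat z)"
    using H conormal_matrix_cong[of H "section_mat z" "minor \<sigma>" "minor \<sigma>"] Hz by blast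
  then show ?thesis using Hz unfolding conormal_matrix_section_iff[OF z] by blast
qed

lemma section_mat_eq_zero:
  assumes "\<forall>i<n. \<forall>j<n. section_mat z i j = 0" "a < 2" "i < n"
  shows "z a i = 0"
proof (rule poly_eq_0_if_all_0)
  fix t
  show "poly (z a i) t = 0"
  proof (rule S_independent[OF _ _ assms(2), of "(1, t)" "\<lambda>a. poly (z a i) t"])
    fix j assume j: "j < n"
    have "(\<Sum>a<2. poly (z a i) t * S (1, t) a j) = poly (section_mat z i j) t"
      using j by (simp add: section_mat_def sum_lessThan_2 ev_at_affine)
    then show "(\<Sum>a<2. poly (z a i) t * S (1, t) a j) = 0" using assms(1,3) j by simp
  qed simp
qed

end

text \<open>The coefficient of the unknown \<open>H (fst u) (snd u)\<close> in the equation
  \<open>q\<close>. The tag \<open>t\<close> selects the wedge, the orthogonality or the tangency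
  condition of \<open>conormal_matrix\<close>.\<close>

definition conormal_equation :: "(nat \<Rightarrow> nat \<Rightarrow> 'a::field poly) \<Rightarrow> nat \<times> nat \<times> nat \<times> nat \<times> nat \<Rightarrow> nat \<times> nat \<Rightarrow> 'a poly" where
  "conormal_equation P q u = (case q of (t, i, a, b, c) \<Rightarrow>
     if t = 0 then (if fst u = i \<and> snd u = a then P b c else 0) - (if fst u = i \<and> snd u = b then P a c else 0)
       + (if fst u = i \<and> snd u = c then P a b else 0)
     else if t = 1 then (if snd u = a then P (fst u) b else 0)
     else (if snd u = a then pderiv (P (fst u) b) else 0) - (if snd u = b then pderiv (P (fst u) a) else 0))"

definition conormal_equations :: "nat \<Rightarrow> (nat \<times> nat \<times> nat \<times> nat \<times> nat) set" where
  "conormal_equations n = {..<3} \<times> {..<n} \<times> {..<n} \<times> {..<n} \<times> {..<n}"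

lemma sum_pairs_delta:
  fixes g :: "nat \<Rightarrow> nat \<Rightarrow> 'b::comm_monoid_add"
  assumes "i < n" "j < n"
  shows "(\<Sum>i'<n. \<Sum>j'<n. if i' = i \<and> j' = j then g i' j' else 0) = g i j"
proof -
  have "(\<Sum>j'<n. if i' = i \<and> j' = j then g i' j' else 0) = (if i' = i then g i j else 0)" for i'
    using assms(2) by (cases "i' = i") simp_all
  then show ?thesis using assms(1) by simp
qed

lemma conormal_matrix_iff_equations:
  fixes P :: "nat \<Rightarrow> nat \<Rightarrow> 'a::field poly"
  shows "conormal_matrix n m P H \<longleftrightarrow> (\<forall>i<n. \<forall>j<n. H i j \<in> forms (int m)) \<and>
    (\<forall>q\<in>conormal_equations n. (\<Sum>u\<in>{..<n} \<times> {..<n}. H (fst u) (snd u) * conormal_equation P q u) = 0)"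
proof -
  define E where "E q = (\<Sum>u\<in>{..<n} \<times> {..<n}. H (fst u) (snd u) * conormal_equation P q u)" for q
  have E: "E q = (\<Sum>i'<n. \<Sum>j'<n. H i' j' * conormal_equation P q (i', j'))" for q
    unfolding E_def by (simp add: sum.cartesian_product case_prod_unfold)
  have E0: "E (0, i, a, b, c) = H i a * P b c - H i b * P a c + H i c * P a b"
    if "i < n" "a < n" "b < n" "c < n" for i a b c
  proof -
    have *: "H i' j' * conormal_equation P (0, i, a, b, c) (i', j')
        = (if i' = i \<and> j' = a then H i' j' * P b c else 0) - (if i' = i \<and> j' = b then H i' j' * P a c else 0)
          + (if i' = i \<and> j' = c then H i' j' * P a b else 0)" for i' j'
      by (simp add: conormal_equation_def right_diff_distrib distrib_left)
    show ?thesis unfolding E * sum.distrib sum_subtractf using that by (simp only: sum_pairs_delta)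
  qed
  have E1: "E (1, i, a, b, c) = (\<Sum>i'<n. H i' a * P i' b)" if "a < n" for i a b c
    unfolding E using that by (simp add: conormal_equation_def if_distrib[of "\<lambda>z. _ * z"] cong: if_cong)
  have E2: "E (2, i, a, b, c) = (\<Sum>i'<n. H i' a * pderiv (P i' b) - H i' b * pderiv (P i' a))" if "a < n" "b < n" for i a b c
    unfolding E using that
    by (simp add: conormal_equation_def right_diff_distrib sum_subtractf if_distrib[of "\<lambda>z. _ * z"] cong: if_cong)
  have three: "(\<forall>t\<in>{..<3}. R t) \<longleftrightarrow> R 0 \<and> R 1 \<and> R 2" for R :: "nat \<Rightarrow> bool"
    by (auto simp: numeral_3_eq_3 numeral_2_eq_2 less_Suc_eq)
  have "(\<forall>q\<in>conormal_equations n. E q = 0) \<longleftrightarrow>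
     (\<forall>i<n. \<forall>a<n. \<forall>b<n. \<forall>c<n. E (0, i, a, b, c) = 0) \<and> (\<forall>i<n. \<forall>a<n. \<forall>b<n. \<forall>c<n. E (1, i, a, b, c) = 0) \<and>
     (\<forall>i<n. \<forall>a<n. \<forall>b<n. \<forall>c<n. E (2, i, a, b, c) = 0)"
    unfolding conormal_equations_def by (simp only: split_paired_Ball_Sigma three) (simp only: Ball_def lessThan_iff)
  also have "(\<forall>i<n. \<forall>a<n. \<forall>b<n. \<forall>c<n. E (0, i, a, b, c) = 0) \<longleftrightarrow>
      (\<forall>i<n. \<forall>a<n. \<forall>b<n. \<forall>c<n. H i a * P b c - H i b * P a c + H i c * P a b = 0)"
    by (intro all_cong1 imp_cong refl) (simp only: E0)
  also have "(\<forall>i<n. \<forall>a<n. \<forall>b<n. \<forall>c<n. E (1, i, a, b, c) = 0) \<longleftrightarrow> (\<forall>j<n. \<forall>k<n. (\<Sum>i<n. H i j * P i k) = 0)"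
  proof (intro iffI allI impI)
    fix j k assume "\<forall>i<n. \<forall>a<n. \<forall>b<n. \<forall>c<n. E (1, i, a, b, c) = 0" "j < n" "k < n"
    then have "E (1, j, j, k, k) = 0" by blast
    then show "(\<Sum>i<n. H i j * P i k) = 0" unfolding E1[OF \<open>j < n\<close>] .
  qed (simp add: E1[unfolded One_nat_def])
  also have "(\<forall>i<n. \<forall>a<n. \<forall>b<n. \<forall>c<n. E (2, i, a, b, c) = 0) \<longleftrightarrow>
      (\<forall>u<n. \<forall>v<n. (\<Sum>i<n. H i u * pderiv (P i v) - H i v * pderiv (P i u)) = 0)"
  proof (intro iffI allI impI)
    fix u v assume "\<forall>i<n. \<forall>a<n. \<forall>b<n. \<forall>c<n. E (2, i, a, b, c) = 0" "u < n" "v < n"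
    then have "E (2, u, u, v, v) = 0" by blast
    then show "(\<Sum>i<n. H i u * pderiv (P i v) - H i v * pderiv (P i u)) = 0" unfolding E2[OF \<open>u < n\<close> \<open>v < n\<close>] .
  qed (simp add: E2)
  finally show ?thesis unfolding conormal_matrix_def E_def[symmetric] by simp
qed

section \<open>Semicontinuity\<close>

lemma forms_eq_0I: "p \<in> forms e \<Longrightarrow> (\<And>k. int k \<le> e \<Longrightarrow> coeff p k = 0) \<Longrightarrow> p = 0"
  by (intro poly_eqI) (simp add: forms_iff_coeff linorder_not_le[symmetric], metis linorder_not_le)

definition linear_poly_fun :: "'v set \<Rightarrow> (('v \<Rightarrow> 'a::field) \<Rightarrow> 'a poly) \<Rightarrow> bool" where
  "linear_poly_fun V p \<longleftrightarrow> (\<forall>k. homogeneous_polyfun V 1 (\<lambda>x. coeff (p x) k))"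

lemma linear_poly_fun_zero: "linear_poly_fun V (\<lambda>x. 0)"
  by (simp add: linear_poly_fun_def homogeneous_polyfun_zero)

lemma linear_poly_fun_add:
  "linear_poly_fun V p \<Longrightarrow> linear_poly_fun V q \<Longrightarrow> linear_poly_fun V (\<lambda>x. p x + q x)"
  by (simp add: linear_poly_fun_def homogeneous_polyfun_add)

lemma linear_poly_fun_diff:
  "finite V \<Longrightarrow> linear_poly_fun V p \<Longrightarrow> linear_poly_fun V q \<Longrightarrow> linear_poly_fun V (\<lambda>x. p x - q x)"
  by (simp add: linear_poly_fun_def homogeneous_polyfun_diff)

lemma linear_poly_fun_minus:
  "finite V \<Longrightarrow> linear_poly_fun V p \<Longrightarrow> linear_poly_fun V (\<lambda>x. - p x)"
  using linear_poly_fun_diff[OF _ linear_poly_fun_zero, of V p] by simp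

lemma linear_poly_fun_pderiv:
  "finite V \<Longrightarrow> linear_poly_fun V p \<Longrightarrow> linear_poly_fun V (\<lambda>x. pderiv (p x))"
  by (simp add: linear_poly_fun_def coeff_pderiv homogeneous_polyfun_cmult del: of_nat_Suc)

lemma linear_poly_fun_mult:
  "finite V \<Longrightarrow> linear_poly_fun V p \<Longrightarrow> linear_poly_fun V (\<lambda>x. r * p x)"
  unfolding linear_poly_fun_def coeff_mult by (intro allI homogeneous_polyfun_sum homogeneous_polyfun_cmult) auto

lemma linear_poly_fun_if:
  "linear_poly_fun V p \<Longrightarrow> linear_poly_fun V q \<Longrightarrow> linear_poly_fun V (\<lambda>x. if c then p x else q x)"
  by (cases c) simp_all

lemma linear_poly_fun_plucker:
  fixes n d :: nat
  defines "V \<equiv> plucker_index 2 n \<times> {..d}"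
  assumes "a < n" "b < n"
  shows "linear_poly_fun V (\<lambda>x :: nat set \<times> nat \<Rightarrow> 'a::field. plucker_forms (\<lambda>J. \<Sum>i\<le>d. monom (x (J, i)) i) a b)"
proof -
  have fV: "finite V"
    unfolding V_def plucker_index_def by (intro finite_cartesian_product) (auto intro: finite_subset[of _ "Pow {..<n}"])
  have lin: "linear_poly_fun V (\<lambda>x :: nat set \<times> nat \<Rightarrow> 'a. \<Sum>i\<le>d. monom (x (J, i)) i)" if J: "J \<in> plucker_index 2 n" for J
    unfolding linear_poly_fun_def
  proof
    fix k
    have c: "coeff (\<Sum>i\<le>d. monom (x (J, i)) i) k = (if k \<le> d then x (J, k) else 0)" for x :: "nat set \<times> nat \<Rightarrow> 'a"
      unfolding coeff_sum coeff_monom by (subst sum.delta) auto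
    show "homogeneous_polyfun V 1 (\<lambda>x :: nat set \<times> nat \<Rightarrow> 'a. coeff (\<Sum>i\<le>d. monom (x (J, i)) i) k)"
    proof (cases "k \<le> d")
      case True
      then have "(J, k) \<in> V" using J by (simp add: V_def)
      from homogeneous_polyfun_var[OF fV this] show ?thesis unfolding c using True by simp
    qed (simp add: c homogeneous_polyfun_zero)
  qed
  have mem: "{a, b} \<in> plucker_index 2 n" if "a \<noteq> b"
    unfolding plucker_index_def using assms that by auto
  show ?thesis
    unfolding plucker_forms_def using lin[OF mem] linear_poly_fun_minus[OF fV lin[OF mem]]
    by (cases a b rule: linorder_cases) (simp_all add: linear_poly_fun_zero)
qed

lemma plucker_forms_forms:
  fixes F :: "nat set \<Rightarrow> 'a::comm_ring_1 poly"
  assumes "\<forall>J\<in>plucker_index 2 n. F J \<in> forms e" "i < n" "j < n"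
  shows "plucker_forms F i j \<in> forms e"
proof (cases "i = j")
  case False
  then have "{i, j} \<in> plucker_index 2 n" using assms(2,3) by (auto simp: plucker_index_def)
  then have "F {i, j} \<in> forms e" using assms(1) by blast
  then show ?thesis by (simp add: plucker_forms_def forms_minus)
qed (simp add: plucker_forms_def)

text \<open>More than \<open>card C\<close> independent sections would have a nontrivial combination
  whose matrix has coefficient 0 at all positions in \<open>C\<close>.\<close>

lemma section_coeff_independence:
  assumes curve: "split_curve n e \<sigma> f" and C: "finite C"
    and inj: "\<And>H. conormal_matrix n m (minor \<sigma>) H \<Longrightarrow> \<forall>c\<in>C. coeff (H (fst (fst c)) (snd (fst c))) (snd c) = 0 \<Longrightarrow>
      \<forall>i<n. \<forall>j<n. H i j = 0"
  shows "split_curve.sections_dim_le n e \<sigma> (int m) (card C)"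
proof -
  interpret split_curve n e \<sigma> f by (rule curve)
  show ?thesis
    unfolding sections_dim_le_def
  proof (intro allI impI)
    fix N B assume B: "\<forall>l<N. conormal_section (int m) (B l)" and ind: "independent_sections N B"
    show "N \<le> card C"
    proof (rule ccontr)
      assume "\<not> N \<le> card C"
      then have lt: "card C < card {..<N}" by simp
      define A where "A c l = coeff (section_mat (B l) (fst (fst c)) (snd (fst c))) (snd c)" for c :: "(nat \<times> nat) \<times> nat" and l
      obtain x where x: "\<forall>c\<in>C. (\<Sum>l\<in>{..<N}. A c l * x l) = 0" "\<exists>l\<in>{..<N}. x l \<noteq> 0"
        by (rule underdetermined_system[of "{..<N}" C A, OF finite_lessThan C lt]) (rule that)
      define z where "z a i = (\<Sum>l<N. Polynomial.smult (x l) (B l a i))" for a i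
      have zs: "conormal_section (int m) z"
        unfolding z_def[abs_def] by (rule conormal_section_combination) (use B in blast)
      have zm: "section_mat z i j = (\<Sum>l<N. Polynomial.smult (x l) (section_mat (B l) i j))" for i j
        by (simp add: section_mat_def z_def sum_lessThan_2 sum_distrib_right sum.distrib smult_add_right)
      have H: "conormal_matrix n m (minor \<sigma>) (section_mat z)"
        using zs conormal_section_forms[OF zs] by (subst conormal_matrix_section_iff) auto
      have "\<forall>c\<in>C. coeff (section_mat z (fst (fst c)) (snd (fst c))) (snd c) = 0"
        unfolding zm coeff_sum using x(1) by (simp add: A_def mult.commute)
      from section_mat_eq_zero[OF inj[OF H this]] have "\<forall>a<2. \<forall>i<n. z a i = 0" by blast
      then have "\<forall>l<N. x l = 0" unfolding z_def by (rule independent_sectionsD[OF ind])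
      then show False using x(2) by simp
    qed
  qed
qed

text \<open>At \<open>F0\<close> some set \<open>C\<close> of at most \<open>\<kappa>\<close>
  coefficient positions determines a solution matrix, so the equations are injective on the
  remaining unknowns and one of their maximal minors, \<open>h\<close>, is nonzero. Its entries are
  linear in the Pluecker coordinates. Wherever \<open>h\<close> is nonzero, the positions in
  \<open>C\<close> still determine every solution.\<close>

theorem sections_dim_le_open:
  fixes F0 :: "nat set \<Rightarrow> 'a::alg_closed_field poly"
  assumes curve: "split_curve n e0 \<sigma>0 f0" and F0: "\<And>J. J \<in> plucker_index 2 n \<Longrightarrow> F0 J \<in> forms (int d)"
    and P0: "\<forall>i<n. \<forall>j<n. plucker_forms F0 i j = minor \<sigma>0 i j"
    and le: "split_curve.sections_dim_le n e0 \<sigma>0 (int m) \<kappa>"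
  shows "\<exists>N h. homogeneous_polyfun (plucker_index 2 n \<times> {..d}) N h \<and> h (\<lambda>(J, i). coeff (F0 J) i) \<noteq> 0 \<and>
    (\<forall>F f e \<sigma>. (\<forall>J\<in>plucker_index 2 n. F J \<in> forms (int d)) \<longrightarrow> split_curve n e \<sigma> f \<longrightarrow>
       (\<forall>i<n. \<forall>j<n. plucker_forms F i j = minor \<sigma> i j) \<longrightarrow> h (\<lambda>(J, i). coeff (F J) i) \<noteq> 0 \<longrightarrow>
       split_curve.sections_dim_le n e \<sigma> (int m) \<kappa>)"
proof -
  define U where "U = {..<n} \<times> {..<n}"
  define I where "I = U \<times> {..m}"
  define Q where "Q = conormal_equations n"
  \<comment> \<open>The entries of \<open>H\<close> have degree at most \<open>m\<close> and the
    coefficients of the equations at most \<open>d\<close>, so imposing these coefficients amounts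
    to imposing the equations.\<close>
  define K where "K = {..m + d}"
  define A where "A P r i = coeff (monom 1 (snd i) * conormal_equation P (fst r) (fst i)) (snd r)"
    for P :: "nat \<Rightarrow> nat \<Rightarrow> 'a poly" and r :: "(nat \<times> nat \<times> nat \<times> nat \<times> nat) \<times> nat" and i :: "(nat \<times> nat) \<times> nat"
  have fin: "finite U" "finite Q" "finite K" "finite I"
    by (simp_all add: U_def Q_def K_def I_def conormal_equations_def)
  have ce_forms: "conormal_equation P q u \<in> forms (int d)"
    if "\<forall>i<n. \<forall>j<n. P i j \<in> forms (int d)" "q \<in> Q" "u \<in> U" for P q u
  proof -
    have "pderiv (P i j) \<in> forms (int d)" if "i < n" "j < n" for i j
      using forms_mono[OF forms_pderiv, of "P i j" "int d" "int d"] \<open>\<forall>i<n. \<forall>j<n. P i j \<in> forms (int d)\<close> that by simp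
    then show ?thesis
      using that unfolding Q_def U_def conormal_equations_def conormal_equation_def
      by (auto intro!: forms_add forms_diff forms_minus)
  qed
  have sol: "poly_solution U (\<lambda>_. int m) Q (\<lambda>_. K) (conormal_equation P) p \<longleftrightarrow> conormal_matrix n m P (\<lambda>i j. p (i, j))"
    if P: "\<forall>i<n. \<forall>j<n. P i j \<in> forms (int d)" for P p
  proof -
    have full: "(\<forall>k\<in>K. coeff (\<Sum>u\<in>U. p u * conormal_equation P q u) k = 0) \<longleftrightarrow> (\<Sum>u\<in>U. p u * conormal_equation P q u) = 0"
      if pf: "\<forall>u\<in>U. p u \<in> forms (int m)" and q: "q \<in> Q" for q
    proof
      assume z: "\<forall>k\<in>K. coeff (\<Sum>u\<in>U. p u * conormal_equation P q u) k = 0"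
      have "(\<Sum>u\<in>U. p u * conormal_equation P q u) \<in> forms (int m + int d)"
        by (intro forms_sum forms_mult ce_forms[OF P q]) (use pf in auto)
      then show "(\<Sum>u\<in>U. p u * conormal_equation P q u) = 0"
        by (rule forms_eq_0I) (rule bspec[OF z], simp add: K_def)
    qed simp
    have ps: "poly_solution U (\<lambda>_. int m) Q (\<lambda>_. K) (conormal_equation P) p \<longleftrightarrow>
        (\<forall>u\<in>U. p u \<in> forms (int m)) \<and> (\<forall>q\<in>Q. (\<Sum>u\<in>U. p u * conormal_equation P q u) = 0)"
      unfolding poly_solution_def using full by (auto cong: conj_cong)
    have fu: "(\<forall>u\<in>U. p u \<in> forms (int m)) \<longleftrightarrow> (\<forall>i<n. \<forall>j<n. p (i, j) \<in> forms (int m))"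
      by (auto simp: U_def)
    show ?thesis unfolding ps fu conormal_matrix_iff_equations by (simp add: U_def Q_def)
  qed
  have coeff_eq: "coeff (\<Sum>u\<in>U. p u * conormal_equation P q u) k = (\<Sum>i\<in>I. A P (q, k) i * coeff (p (fst i)) (snd i))"
    if pf: "\<forall>u\<in>U. p u \<in> forms (int m)" for p :: "nat \<times> nat \<Rightarrow> 'a poly" and P :: "nat \<Rightarrow> nat \<Rightarrow> 'a poly" and q k
  proof -
    have "coeff (p u * conormal_equation P q u) k = (\<Sum>l\<le>m. A P (q, k) (u, l) * coeff (p u) l)" if "u \<in> U" for u
    proof -
      have "p u = (\<Sum>l\<le>m. monom (coeff (p u) l) l)"
        using pf that by (intro poly_as_sum_of_monoms'[symmetric]) (simp add: forms_int_iff)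
      then have "p u * conormal_equation P q u = (\<Sum>l\<le>m. monom (coeff (p u) l) l) * conormal_equation P q u"
        by (rule arg_cong)
      also have "\<dots> = (\<Sum>l\<le>m. monom (coeff (p u) l) l * conormal_equation P q u)"
        by (rule sum_distrib_right)
      finally have "coeff (p u * conormal_equation P q u) k = (\<Sum>l\<le>m. coeff (monom (coeff (p u) l) l * conormal_equation P q u) k)"
        unfolding coeff_sum[symmetric] by (rule arg_cong)
      moreover have "coeff (monom (coeff (p u) l) l * conormal_equation P q u) k = A P (q, k) (u, l) * coeff (p u) l" for l
      proof -
        have "monom (coeff (p u) l) l = Polynomial.smult (coeff (p u) l) (monom 1 l)" by (simp add: smult_monom)
        then show ?thesis by (simp add: A_def mult.commute)
      qed
      ultimately show ?thesis by (simp only:)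
    qed
    then have "coeff (\<Sum>u\<in>U. p u * conormal_equation P q u) k = (\<Sum>u\<in>U. \<Sum>l\<le>m. A P (q, k) (u, l) * coeff (p u) l)"
      unfolding coeff_sum by (rule sum.cong[OF refl])
    then show ?thesis
      unfolding I_def by (simp add: sum.cartesian_product case_prod_unfold)
  qed
  have P0f: "\<forall>i<n. \<forall>j<n. plucker_forms F0 i j \<in> forms (int d)"
    using plucker_forms_forms[of n F0] F0 by blast
  have finK: "\<forall>q\<in>Q. finite K" using fin(3) by simp
  obtain N B C where NB: "\<forall>l<N. poly_solution U (\<lambda>_. int m) Q (\<lambda>_. K) (conormal_equation (plucker_forms F0)) (B l)"
    "independent_polys U N B" and C: "finite C" "card C = N"
    and Cinj: "\<forall>p. poly_solution U (\<lambda>_. int m) Q (\<lambda>_. K) (conormal_equation (plucker_forms F0)) p \<longrightarrow>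
      (\<forall>i\<in>C. coeff (p (fst i)) (snd i) = 0) \<longrightarrow> (\<forall>u\<in>U. p u = 0)"
    using polynomial_system_solutions[OF fin(1,2), of "\<lambda>_. K" "\<lambda>_. int m" "conormal_equation (plucker_forms F0)", OF finK]
    by (elim exE conjE) (rule that)
  have N\<kappa>: "N \<le> \<kappa>"
  proof -
    interpret split_curve n e0 \<sigma>0 f0 by (rule curve)
    have cong: "conormal_matrix n m (plucker_forms F0) H \<longleftrightarrow> conormal_matrix n m (minor \<sigma>0) H" for H
      by (rule conormal_matrix_cong) (use P0 in auto)
    have "\<forall>l. \<exists>z. l < N \<longrightarrow> conormal_section (int m) z \<and> (\<forall>i<n. \<forall>j<n. B l (i, j) = section_mat z i j)"
    proof
      fix l
      show "\<exists>z. l < N \<longrightarrow> conormal_section (int m) z \<and> (\<forall>i<n. \<forall>j<n. B l (i, j) = section_mat z i j)"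
      proof (cases "l < N")
        case True
        then have "conormal_matrix n m (minor \<sigma>0) (\<lambda>i j. B l (i, j))"
          using NB(1) unfolding sol[OF P0f] cong by blast
        from conormal_matrix_is_section[OF this] show ?thesis by blast
      qed simp
    qed
    from choice[OF this] obtain z where z: "\<forall>l. l < N \<longrightarrow> conormal_section (int m) (z l) \<and> (\<forall>i<n. \<forall>j<n. B l (i, j) = section_mat (z l) i j)" ..
    have "independent_sections N z"
      unfolding independent_sections_def
    proof (intro allI impI)
      fix c l assume c0: "\<forall>a<2. \<forall>i<n. (\<Sum>l<N. Polynomial.smult (c l) (z l a i)) = 0" and l: "l < N"
      have "(\<Sum>l<N. Polynomial.smult (c l) (B l (i, j))) = 0" if ij: "i < n" "j < n" for i j
      proof -
        have "(\<Sum>l<N. Polynomial.smult (c l) (B l (i, j))) = (\<Sum>l<N. Polynomial.smult (c l) (section_mat (z l) i j))"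
          using z ij by (intro sum.cong) auto
        also have "\<dots> = (\<Sum>a<2. (\<Sum>l<N. Polynomial.smult (c l) (z l a i)) * \<sigma>0 a j)"
          by (simp add: section_mat_def sum_lessThan_2 sum_distrib_right sum.distrib smult_add_right)
        also have "\<dots> = 0" using c0 ij by simp
        finally show ?thesis .
      qed
      then show "c l = 0" by (intro independent_polysD[OF NB(2) _ l]) (auto simp: U_def)
    qed
    then show ?thesis using z by (intro sections_dim_leD[OF le]) auto
  qed
  define I' where "I' = I - C"
  define R where "R = Q \<times> K"
  have fin': "finite I'" "finite R" using fin by (simp_all add: I'_def R_def)
  have "\<forall>x. (\<forall>r\<in>R. (\<Sum>i\<in>I'. A (plucker_forms F0) r i * x i) = 0) \<longrightarrow> (\<forall>i\<in>I'. x i = 0)"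
  proof (intro allI impI ballI)
    fix x j assume x: "\<forall>r\<in>R. (\<Sum>i\<in>I'. A (plucker_forms F0) r i * x i) = 0" and j: "j \<in> I'"
    define p where "p u = (\<Sum>l\<le>m. monom (if (u, l) \<in> I' then x (u, l) else 0) l)" for u
    have cp: "coeff (p u) k = (if k \<le> m \<and> (u, k) \<in> I' then x (u, k) else 0)" for u k
      unfolding p_def coeff_sum coeff_monom by (subst sum.delta) auto
    have pf: "\<forall>u\<in>U. p u \<in> forms (int m)" unfolding forms_iff_coeff cp by auto
    have "coeff (\<Sum>u\<in>U. p u * conormal_equation (plucker_forms F0) q u) k = 0" if "q \<in> Q" "k \<in> K" for q k
    proof -
      have "(\<Sum>i\<in>I. A (plucker_forms F0) (q, k) i * coeff (p (fst i)) (snd i)) = (\<Sum>i\<in>I'. A (plucker_forms F0) (q, k) i * x i)"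
        by (rule sum.mono_neutral_cong_right) (auto simp: fin cp I'_def I_def)
      also have "\<dots> = 0" by (rule bspec[OF x]) (use that in \<open>simp add: R_def\<close>)
      finally show ?thesis unfolding coeff_eq[OF pf] .
    qed
    then have "poly_solution U (\<lambda>_. int m) Q (\<lambda>_. K) (conormal_equation (plucker_forms F0)) p"
      unfolding poly_solution_def using pf by blast
    moreover have "\<forall>i\<in>C. coeff (p (fst i)) (snd i) = 0" by (auto simp: cp I'_def)
    ultimately have "\<forall>u\<in>U. p u = 0" using Cinj by (elim allE impE) assumption+
    moreover obtain u l where ul: "j = (u, l)" "u \<in> U" "l \<le> m" using j by (auto simp: I'_def I_def)
    ultimately have "coeff (p u) l = 0" by simp
    then show "x j = 0" using j ul by (simp add: cp)
  qed
  from injective_system_det[OF fin' this] obtain s t where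
    st: "\<forall>k<card I'. s k \<in> R \<and> t k \<in> I'" and d0: "det (mat (card I') (card I') (\<lambda>(k, l). A (plucker_forms F0) (s k) (t l))) \<noteq> 0"
    and dinj: "\<forall>B x. det (mat (card I') (card I') (\<lambda>(k, l). B (s k) (t l) :: 'a)) \<noteq> 0 \<longrightarrow>
       (\<forall>q\<in>R. (\<Sum>i\<in>I'. B q i * x i) = 0) \<longrightarrow> (\<forall>i\<in>I'. x i = 0)"
    by (elim exE conjE)
  \<comment> \<open>\<open>\<Phi>\<close> rebuilds the Pluecker forms from a point of the
    coefficient space, which makes the minor a function on that space.\<close>
  define \<Phi> where "\<Phi> x = plucker_forms (\<lambda>J. \<Sum>i\<le>d. monom (x (J, i)) i)" for x :: "nat set \<times> nat \<Rightarrow> 'a"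
  define h where "h x = det (mat (card I') (card I') (\<lambda>(k, l). A (\<Phi> x) (s k) (t l)))" for x
  have \<Phi>F: "\<Phi> (\<lambda>(J, i). coeff (F J) i) i j = plucker_forms F i j"
    if F: "\<forall>J\<in>plucker_index 2 n. F J \<in> forms (int d)" and ij: "i < n" "j < n" for F :: "nat set \<Rightarrow> 'a poly" and i j
  proof (cases "i = j")
    case False
    then have "F {i, j} \<in> forms (int d)" using F ij by (auto simp: plucker_index_def)
    then have "(\<Sum>k\<le>d. monom (coeff (F {i, j}) k) k) = F {i, j}"
      by (intro poly_as_sum_of_monoms') (simp add: forms_int_iff)
    then show ?thesis by (simp add: \<Phi>_def plucker_forms_def)
  qed (simp add: \<Phi>_def plucker_forms_def)
  have hF: "h (\<lambda>(J, i). coeff (F J) i) = det (mat (card I') (card I') (\<lambda>(k, l). A (plucker_forms F) (s k) (t l)))"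
    if F: "\<forall>J\<in>plucker_index 2 n. F J \<in> forms (int d)" for F
  proof -
    have "A (\<Phi> (\<lambda>(J, i). coeff (F J) i)) (s k) (t l) = A (plucker_forms F) (s k) (t l)" if kl: "k < card I'" "l < card I'" for k l
    proof -
      obtain tg i a b c k' where sk: "s k = ((tg, i, a, b, c), k')" "i < n" "a < n" "b < n" "c < n"
        using st kl(1) by (cases "s k") (force simp: R_def Q_def conormal_equations_def)
      obtain i' j' l' where tl: "t l = ((i', j'), l')" "i' < n" "j' < n"
        using st kl(2) by (cases "t l") (force simp: I'_def I_def U_def)
      show ?thesis using sk tl \<Phi>F[OF F] by (simp add: A_def conormal_equation_def)
    qed
    then show ?thesis unfolding h_def by (intro arg_cong[of _ _ det] eq_matI) auto
  qed
  have fV: "finite (plucker_index 2 n \<times> {..d})"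
    unfolding plucker_index_def by (intro finite_cartesian_product) (auto intro: finite_subset[of _ "Pow {..<n}"])
  have "homogeneous_polyfun (plucker_index 2 n \<times> {..d}) (card I') h"
    unfolding h_def[abs_def]
  proof (rule homogeneous_polyfun_det[OF fV])
    fix k l assume kl: "k < card I'" "l < card I'"
    obtain tg i a b c k' where sk: "s k = ((tg, i, a, b, c), k')" "i < n" "a < n" "b < n" "c < n"
      using st kl(1) by (cases "s k") (force simp: R_def Q_def conormal_equations_def)
    obtain i' j' l' where tl: "t l = ((i', j'), l')" "i' < n" "j' < n"
      using st kl(2) by (cases "t l") (force simp: I'_def I_def U_def)
    have lin: "linear_poly_fun (plucker_index 2 n \<times> {..d}) (\<lambda>x. \<Phi> x a b)" if "a < n" "b < n" for a b
      unfolding \<Phi>_def by (rule linear_poly_fun_plucker[OF that])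
    have "linear_poly_fun (plucker_index 2 n \<times> {..d}) (\<lambda>x. monom 1 l' * conormal_equation (\<Phi> x) (tg, i, a, b, c) (i', j'))"
      unfolding conormal_equation_def prod.case fst_conv snd_conv
      by (intro linear_poly_fun_mult linear_poly_fun_if linear_poly_fun_add linear_poly_fun_diff linear_poly_fun_zero
          linear_poly_fun_pderiv lin fV sk tl)
    then show "homogeneous_polyfun (plucker_index 2 n \<times> {..d}) 1 (\<lambda>x. A (\<Phi> x) (s k) (t l))"
      unfolding A_def sk(1) tl(1) fst_conv snd_conv linear_poly_fun_def by blast
  qed
  moreover have "h (\<lambda>(J, i). coeff (F0 J) i) \<noteq> 0" using hF[of F0] F0 d0 by simp
  moreover have "split_curve.sections_dim_le n e \<sigma> (int m) \<kappa>"
    if F: "\<forall>J\<in>plucker_index 2 n. F J \<in> forms (int d)" and cv: "split_curve n e \<sigma> f"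
      and P: "\<forall>i<n. \<forall>j<n. plucker_forms F i j = minor \<sigma> i j" and hn: "h (\<lambda>(J, i). coeff (F J) i) \<noteq> 0"
    for F :: "nat set \<Rightarrow> 'a poly" and f e \<sigma>
  proof -
    have Pf: "\<forall>i<n. \<forall>j<n. plucker_forms F i j \<in> forms (int d)"
      using plucker_forms_forms[OF F] by blast
    have "split_curve.sections_dim_le n e \<sigma> (int m) (card C)"
    proof (rule section_coeff_independence[OF cv C(1)])
      fix H assume H: "conormal_matrix n m (minor \<sigma>) H"
        and Cz: "\<forall>c\<in>C. coeff (H (fst (fst c)) (snd (fst c))) (snd c) = 0"
      have "conormal_matrix n m (plucker_forms F) H \<longleftrightarrow> conormal_matrix n m (minor \<sigma>) H"
        by (rule split_curve.conormal_matrix_cong[OF cv]) (use P in auto)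
      then have ps: "poly_solution U (\<lambda>_. int m) Q (\<lambda>_. K) (conormal_equation (plucker_forms F)) (\<lambda>(i, j). H i j)"
        unfolding sol[OF Pf] using H by simp
      define x where "x i = coeff (H (fst (fst i)) (snd (fst i))) (snd i)" for i :: "(nat \<times> nat) \<times> nat"
      have pf: "\<forall>u\<in>U. (\<lambda>(i, j). H i j) u \<in> forms (int m)" using ps by (simp add: poly_solution_def)
      have "\<forall>r\<in>R. (\<Sum>i\<in>I'. A (plucker_forms F) r i * x i) = 0"
      proof
        fix r assume "r \<in> R"
        then obtain q k where r: "r = (q, k)" "q \<in> Q" "k \<in> K" by (auto simp: R_def)
        have "0 = coeff (\<Sum>u\<in>U. (\<lambda>(i, j). H i j) u * conormal_equation (plucker_forms F) q u) k"
          using ps r unfolding poly_solution_def by simp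
        also have "\<dots> = (\<Sum>i\<in>I. A (plucker_forms F) r i * x i)"
          unfolding coeff_eq[OF pf] r(1) by (simp add: x_def case_prod_unfold)
        also have "\<dots> = (\<Sum>i\<in>I'. A (plucker_forms F) r i * x i)"
          by (rule sum.mono_neutral_right) (use Cz fin in \<open>auto simp: I'_def x_def\<close>)
        finally show "(\<Sum>i\<in>I'. A (plucker_forms F) r i * x i) = 0" by simp
      qed
      with dinj hn have x0: "\<forall>i\<in>I'. x i = 0" unfolding hF[OF F] by (elim allE impE) assumption+
      show "\<forall>i<n. \<forall>j<n. H i j = 0"
      proof (intro allI impI poly_eqI)
        fix i j k assume ij: "i < n" "j < n"
        have Hf: "H i j \<in> forms (int m)" using H ij unfolding conormal_matrix_def by blast
        consider "((i, j), k) \<in> C" | "((i, j), k) \<in> I'" | "int m < int k"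
          using ij unfolding I'_def I_def U_def by (cases "((i, j), k) \<in> C"; cases "k \<le> m") auto
        then show "coeff (H i j) k = coeff 0 k"
        proof cases
          case 1
          from bspec[OF Cz this] show ?thesis by simp
        next
          case 2
          from bspec[OF x0 this] show ?thesis by (simp add: x_def)
        next
          case 3
          from forms_coeff_eq_0[OF Hf this] show ?thesis by simp
        qed
      qed
    qed
    then show ?thesis
      using N\<kappa> unfolding C(2) split_curve.sections_dim_le_def[OF cv] by (meson le_trans)
  qed
  ultimately show ?thesis by (intro exI[of _ "card I'"] exI[of _ h] conjI allI impI)
qed

section \<open>Upper bounds for the number of sections\<close>

lemma coeff_mult_lowest:
  fixes p q :: "'a::comm_semiring_1 poly"
  assumes "\<And>t. t < a \<Longrightarrow> coeff p t = 0" "\<And>t. t < b \<Longrightarrow> coeff q t = 0"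
  shows "t < a + b \<Longrightarrow> coeff (p * q) t = 0" "coeff (p * q) (a + b) = coeff p a * coeff q b"
proof -
  assume t: "t < a + b"
  have "coeff p i * coeff q (t - i) = 0" if "i \<le> t" for i
  proof (cases "i < a")
    case False
    then have "t - i < b" using t that by linarith
    then show ?thesis using assms(2) by simp
  qed (simp add: assms(1))
  then show "coeff (p * q) t = 0" by (simp add: coeff_mult)
next
  have "coeff (p * q) (a + b) = (\<Sum>i\<in>{a}. coeff p i * coeff q (a + b - i))"
    unfolding coeff_mult
  proof (rule sum.mono_neutral_right)
    show "\<forall>i\<in>{..a + b} - {a}. coeff p i * coeff q (a + b - i) = 0"
    proof
      fix i assume "i \<in> {..a + b} - {a}"
      then consider "i < a" | "a + b - i < b" by fastforce
      then show "coeff p i * coeff q (a + b - i) = 0" using assms by cases auto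
    qed
  qed auto
  then show "coeff (p * q) (a + b) = coeff p a * coeff q b" by simp
qed

text \<open>The lowest exponents of the nonzero summands lie in disjoint intervals.\<close>

lemma graded_injective:
  fixes w \<gamma> :: "nat \<Rightarrow> 'a::field poly" and g :: "nat \<Rightarrow> nat"
  defines "\<nu> k \<equiv> \<Sum>l<k. g l"
  assumes low: "\<And>k t. k \<le> K \<Longrightarrow> k = K \<or> g k > 0 \<Longrightarrow> t < \<nu> k \<Longrightarrow> coeff (w k) t = 0"
    and lead: "\<And>k. k \<le> K \<Longrightarrow> k = K \<or> g k > 0 \<Longrightarrow> coeff (w k) (\<nu> k) \<noteq> 0"
    and kill: "\<And>k i. k < K \<Longrightarrow> g k \<le> i \<Longrightarrow> coeff (\<gamma> k) i = 0"
    and sum: "(\<Sum>k<Suc K. \<gamma> k * w k) = 0"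
  shows "k \<le> K \<Longrightarrow> \<gamma> k = 0"
proof (rule ccontr)
  assume "k \<le> K" "\<gamma> k \<noteq> 0"
  define k0 where "k0 = (LEAST k. k \<le> K \<and> \<gamma> k \<noteq> 0)"
  have k0: "k0 \<le> K" "\<gamma> k0 \<noteq> 0"
    using LeastI[of "\<lambda>k. k \<le> K \<and> \<gamma> k \<noteq> 0" k] \<open>k \<le> K\<close> \<open>\<gamma> k \<noteq> 0\<close> unfolding k0_def by auto
  have before: "\<gamma> k = 0" if "k < k0" for k
    using not_less_Least[of k "\<lambda>k. k \<le> K \<and> \<gamma> k \<noteq> 0"] that k0(1) unfolding k0_def by auto
  obtain i where "coeff (\<gamma> k0) i \<noteq> 0" using k0(2) by (auto simp: poly_eq_iff)
  define \<mu> where "\<mu> = (LEAST i. coeff (\<gamma> k0) i \<noteq> 0)"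
  have \<mu>: "coeff (\<gamma> k0) \<mu> \<noteq> 0" unfolding \<mu>_def by (rule LeastI) fact
  have \<mu>low: "coeff (\<gamma> k0) t = 0" if "t < \<mu>" for t
    using not_less_Least[of t "\<lambda>i. coeff (\<gamma> k0) i \<noteq> 0"] that unfolding \<mu>_def by auto
  have gk: "k0 = K \<or> \<mu> < g k0"
    using kill[of k0 \<mu>] \<mu> k0(1) by (meson le_neq_implies_less linorder_not_le)
  then have g0: "k0 = K \<or> g k0 > 0" by auto
  \<comment> \<open>The term \<open>k0\<close> contributes at the exponent
    \<open>\<mu> + \<nu> k0\<close>. Later nonzero terms start at \<open>\<nu> k0 + g k0\<close> or
    above, which is larger because \<open>\<mu> < g k0\<close>.\<close>
  have "coeff (\<gamma> k * w k) (\<mu> + \<nu> k0) = 0" if k: "k \<le> K" "k \<noteq> k0" for k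
  proof (cases "k < k0 \<or> \<gamma> k = 0")
    case True
    then have "\<gamma> k = 0" using before by auto
    then show ?thesis by simp
  next
    case False
    then have k': "k0 < k" "\<gamma> k \<noteq> 0" using k by auto
    have "\<mu> < g k0" using gk k' k by auto
    moreover have "\<nu> k0 + g k0 \<le> \<nu> k"
    proof -
      have "\<nu> k0 + g k0 = \<nu> (Suc k0)" by (simp add: \<nu>_def)
      also have "\<dots> \<le> \<nu> k" unfolding \<nu>_def by (rule sum_mono2) (use k' in auto)
      finally show ?thesis .
    qed
    ultimately have lt: "\<mu> + \<nu> k0 < 0 + \<nu> k" by simp
    have gk': "k = K \<or> g k > 0"
    proof (rule ccontr)
      assume "\<not> (k = K \<or> g k > 0)"
      then have "\<gamma> k = 0" using kill[of k] k(1) by (intro poly_eqI) auto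
      with k' show False by simp
    qed
    show ?thesis
      by (rule coeff_mult_lowest(1)[OF _ _ lt]) (use low[OF k(1) gk'] in auto)
  qed
  then have "coeff (\<Sum>k<Suc K. \<gamma> k * w k) (\<mu> + \<nu> k0) = (\<Sum>k\<in>{k0}. coeff (\<gamma> k * w k) (\<mu> + \<nu> k0))"
    unfolding coeff_sum by (intro sum.mono_neutral_right) (use k0(1) in auto)
  also have "\<dots> = coeff (\<gamma> k0) \<mu> * coeff (w k0) (\<nu> k0)"
    using coeff_mult_lowest(2)[OF \<mu>low low[OF k0(1) g0]] by simp
  also have "\<dots> \<noteq> 0" using \<mu> lead[OF k0(1) g0] by simp
  finally have "coeff (\<Sum>k<Suc K. \<gamma> k * w k) (\<mu> + \<nu> k0) \<noteq> 0" .
  then show False unfolding sum by simp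
qed

text \<open>Injectivity at \<open>\<epsilon> = 0\<close> is inherited by general \<open>\<epsilon>\<close>; the exponents \<open>Ex k\<close> are those of the
  unknown \<open>\<gamma> k\<close>.\<close>

lemma graded_injective_pencil:
  fixes w w' :: "nat \<Rightarrow> 'a::field poly" and Ex :: "nat \<Rightarrow> nat set"
  assumes fin: "\<And>k. k < N \<Longrightarrow> finite (Ex k)"
    and inj: "\<forall>\<gamma>. (\<forall>k<N. \<forall>i. i \<notin> Ex k \<longrightarrow> coeff (\<gamma> k) i = 0) \<longrightarrow> (\<Sum>k<N. \<gamma> k * w k) = 0 \<longrightarrow> (\<forall>k<N. \<gamma> k = 0)"
  shows "\<exists>Bad. finite Bad \<and> (\<forall>\<epsilon>. \<epsilon> \<notin> Bad \<longrightarrow>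
    (\<forall>\<gamma>. (\<forall>k<N. \<forall>i. i \<notin> Ex k \<longrightarrow> coeff (\<gamma> k) i = 0) \<longrightarrow>
       (\<Sum>k<N. \<gamma> k * (w k + Polynomial.smult \<epsilon> (w' k))) = 0 \<longrightarrow> (\<forall>k<N. \<gamma> k = 0)))"
proof -
  define I where "I = (SIGMA k:{..<N}. Ex k)"
  define p where "p x k = (\<Sum>i\<in>Ex k. monom (x (k, i)) i)" for x :: "nat \<times> nat \<Rightarrow> 'a" and k
  \<comment> \<open>Beyond \<open>T\<close> all coefficients of the sum vanish, so finitely many
    linear equations express the polynomial identity.\<close>
  define T where "T = (\<Sum>(k, i)\<in>I. i + degree (w k))"
  define A where "A u t i = coeff (monom 1 (snd i) * u (fst i)) t" for u :: "nat \<Rightarrow> 'a poly" and t and i :: "nat \<times> nat"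
  have fI: "finite I" unfolding I_def using fin by (intro finite_SigmaI) auto
  have cp: "coeff (p x k) i = (if i \<in> Ex k then x (k, i) else 0)" if "k < N" for x k i
    unfolding p_def coeff_sum coeff_monom using fin[OF that] by (subst sum.delta) auto
  have AP: "coeff (\<Sum>k<N. p x k * u k) t = (\<Sum>i\<in>I. A u t i * x i)" for x u t
  proof -
    have "coeff (p x k * u k) t = (\<Sum>i\<in>Ex k. A u t (k, i) * x (k, i))" for k
    proof -
      have "coeff (monom (x (k, i)) i * u k) t = A u t (k, i) * x (k, i)" for i
      proof -
        have "monom (x (k, i)) i = Polynomial.smult (x (k, i)) (monom 1 i)" by (simp add: smult_monom)
        then show ?thesis by (simp add: A_def mult.commute)
      qed
      then show ?thesis unfolding p_def sum_distrib_right coeff_sum by simp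
    qed
    then have "coeff (\<Sum>k<N. p x k * u k) t = (\<Sum>k<N. \<Sum>i\<in>Ex k. A u t (k, i) * x (k, i))"
      by (simp add: coeff_sum)
    also have "\<dots> = (\<Sum>i\<in>I. A u t i * x i)"
      unfolding I_def using fin by (subst sum.Sigma) (auto intro!: sum.cong)
    finally show ?thesis .
  qed
  have xp: "\<exists>x. \<forall>k<N. \<gamma> k = p x k" if "\<forall>k<N. \<forall>i. i \<notin> Ex k \<longrightarrow> coeff (\<gamma> k) i = 0" for \<gamma>
  proof (intro exI[of _ "\<lambda>(k, i). coeff (\<gamma> k) i"] allI impI poly_eqI)
    fix k i assume "k < N"
    then show "coeff (\<gamma> k) i = coeff (p (\<lambda>(k, i). coeff (\<gamma> k) i) k) i" using that by (simp add: cp)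
  qed
  have "\<forall>x. (\<forall>t\<in>{..T}. (\<Sum>i\<in>I. A w t i * x i) = 0) \<longrightarrow> (\<forall>i\<in>I. x i = 0)"
  proof (intro allI impI ballI)
    fix x j assume z: "\<forall>t\<in>{..T}. (\<Sum>i\<in>I. A w t i * x i) = 0" and j: "j \<in> I"
    have "(\<Sum>k<N. p x k * w k) = 0"
    proof (rule poly_eqI)
      fix t
      show "coeff (\<Sum>k<N. p x k * w k) t = coeff 0 t"
      proof (cases "t \<le> T")
        case True
        then show ?thesis unfolding AP using bspec[OF z, of t] by simp
      next
        case False
        have "A w t i = 0" if i: "i \<in> I" for i
        proof -
          have "snd i + degree (w (fst i)) \<le> T"
            unfolding T_def using member_le_sum[of i I "\<lambda>(k, i). i + degree (w k)"] i fI by (cases i) auto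
          then have "degree (monom 1 (snd i) * w (fst i)) < t"
            using False degree_mult_le[of "monom (1::'a) (snd i)" "w (fst i)"] degree_monom_le[of "1::'a" "snd i"]
            by linarith
          then show ?thesis unfolding A_def by (rule coeff_eq_0)
        qed
        then show ?thesis unfolding AP by simp
      qed
    qed
    moreover have "\<forall>k<N. \<forall>i. i \<notin> Ex k \<longrightarrow> coeff (p x k) i = 0" by (simp add: cp)
    ultimately have p0: "\<forall>k<N. p x k = 0" using mp[OF mp[OF spec[OF inj]]] by blast
    obtain k i where ki: "j = (k, i)" "k < N" "i \<in> Ex k" using j by (auto simp: I_def)
    then have "coeff (p x k) i = 0" using p0 by simp
    then show "x j = 0" using ki by (simp add: cp)
  qed
  from injective_pencil[OF fI _ this, of "\<lambda>t. A w' t"]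
  obtain Bad where Bad: "finite Bad" and B: "\<forall>\<epsilon>. \<epsilon> \<notin> Bad \<longrightarrow>
    (\<forall>x. (\<forall>t\<in>{..T}. (\<Sum>i\<in>I. (A w t i + \<epsilon> * A w' t i) * x i) = 0) \<longrightarrow> (\<forall>i\<in>I. x i = 0))" by auto
  have lin: "A (\<lambda>k. w k + Polynomial.smult \<epsilon> (w' k)) t i = A w t i + \<epsilon> * A w' t i" for \<epsilon> t i
    by (simp add: A_def distrib_left)
  show ?thesis
  proof (intro exI[of _ Bad] conjI Bad allI impI)
    fix \<epsilon> \<gamma> k assume \<epsilon>: "\<epsilon> \<notin> Bad" and \<gamma>: "\<forall>k<N. \<forall>i. i \<notin> Ex k \<longrightarrow> coeff (\<gamma> k) i = 0"
      and s: "(\<Sum>k<N. \<gamma> k * (w k + Polynomial.smult \<epsilon> (w' k))) = 0" and k: "k < N"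
    obtain x where x: "\<forall>k<N. \<gamma> k = p x k" using xp[OF \<gamma>] ..
    have "(\<Sum>k<N. p x k * (w k + Polynomial.smult \<epsilon> (w' k))) = 0"
      using s x by simp
    then have "(\<Sum>i\<in>I. (A w t i + \<epsilon> * A w' t i) * x i) = 0" for t
      using AP[of x "\<lambda>k. w k + Polynomial.smult \<epsilon> (w' k)" t] unfolding lin by simp
    then have "\<forall>t\<in>{..T}. (\<Sum>i\<in>I. (A w t i + \<epsilon> * A w' t i) * x i) = 0" by blast
    from mp[OF spec[OF mp[OF spec[OF B] \<epsilon>]] this] have x0: "\<forall>i\<in>I. x i = 0" .
    have "p x k = 0"
    proof (rule poly_eqI)
      fix i show "coeff (p x k) i = coeff 0 i" using x0 k by (auto simp: cp I_def)
    qed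
    then show "\<gamma> k = 0" using x k by simp
  qed
qed

context split_curve
begin

text \<open>The \<open>\<zeta> j\<close> generate the vectors orthogonal to the curve, so a section
  is a family of coefficients \<open>\<gamma>\<close> subject to one relation between the tangent
  pairings. Cutting \<open>\<gamma> k\<close> down to its first \<open>g k\<close> coefficients
  costs \<open>m + 1 - E k - g k\<close> conditions, if this is positive, for each
  \<open>k < K\<close>; the last coefficient is left untouched. If only 0 survives, the number of
  conditions bounds the dimension, as for a normal bundle with the degrees
  \<open>E k + g k\<close>.\<close>

lemma sections_dim_le_if_killed:
  fixes \<zeta> :: "nat \<Rightarrow> nat \<Rightarrow> 'a poly" and qt :: "nat \<Rightarrow> nat" and pr :: "nat \<Rightarrow> nat \<times> nat" and g :: "nat \<Rightarrow> nat"
  assumes gen: "\<And>y. (\<forall>a<2. (\<Sum>i<n. y i * \<sigma> a i) = 0) \<Longrightarrow> \<exists>\<gamma>. \<forall>i<n. y i = (\<Sum>j<c. \<gamma> j * \<zeta> j i)"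
    and deg: "\<And>j i. j < c \<Longrightarrow> i < n \<Longrightarrow> \<zeta> j i \<in> forms (int (qt j))"
    and lead: "\<And>b. (\<And>i. i < n \<Longrightarrow> (\<Sum>j<c. b j * coeff (\<zeta> j i) (qt j)) = 0) \<Longrightarrow> (\<And>j. j < c \<Longrightarrow> b j = 0)"
    and pr: "bij_betw pr {..<Suc K} ({..<2} \<times> {..<c})"
  defines "E k \<equiv> e (fst (pr k)) + qt (snd (pr k))"
  assumes inj: "\<forall>\<gamma>. (\<forall>k<Suc K. \<gamma> k \<in> forms (int m - int (E k))) \<longrightarrow> (\<forall>k<K. \<forall>i\<ge>g k. coeff (\<gamma> k) i = 0) \<longrightarrow>
      (\<Sum>k<Suc K. \<gamma> k * (\<Sum>i<n. \<zeta> (snd (pr k)) i * pderiv (\<sigma> (fst (pr k)) i))) = 0 \<longrightarrow> (\<forall>k<Suc K. \<gamma> k = 0)"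
  shows "sections_dim_le (int m) (\<Sum>k<K. nat (int m + 1 - int (E k + g k)))"
  unfolding sections_dim_le_def
proof (intro allI impI)
  fix N B assume B: "\<forall>l<N. conormal_section (int m) (B l)" and ind: "independent_sections N B"
  define \<omega> where "\<omega> a j = (\<Sum>i<n. \<zeta> j i * pderiv (\<sigma> a i))" for a j
  have dec: "\<exists>\<gamma>. (\<forall>a<2. \<forall>i<n. z a i = (\<Sum>j<c. \<gamma> a j * \<zeta> j i)) \<and>
      (\<forall>a<2. \<forall>j<c. \<gamma> a j \<in> forms (int m - int (e a) - int (qt j)))"
    if z: "conormal_section (int m) z" for z
  proof -
    have "\<exists>\<gamma>. (\<forall>i<n. z a i = (\<Sum>j<c. \<gamma> j * \<zeta> j i)) \<and> (\<forall>j<c. \<gamma> j \<in> forms (int m - int (e a) - int (qt j)))"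
      if a: "a < 2" for a
    proof -
      have "\<exists>\<gamma>. \<forall>i<n. z a i = (\<Sum>j<c. \<gamma> j * \<zeta> j i)"
        by (rule gen) (use conormal_section_perp[OF z a] in blast)
      then obtain \<gamma> where \<gamma>: "\<forall>i<n. z a i = (\<Sum>j<c. \<gamma> j * \<zeta> j i)" ..
      have "\<forall>j<c. \<gamma> j \<in> forms (int m - int (e a) - int (qt j))"
      proof (rule combination_degree_bound[of c n \<zeta> qt \<gamma>])
        show "\<zeta> j i \<in> forms (int (qt j))" if "j < c" "i < n" for j i by (rule deg[OF that])
        show "b j = 0" if "\<And>i. i < n \<Longrightarrow> (\<Sum>j<c. b j * coeff (\<zeta> j i) (qt j)) = 0" "j < c" for b j
          by (rule lead[OF that])
        show "(\<Sum>j<c. \<gamma> j * \<zeta> j i) \<in> forms (int m - int (e a))" if i: "i < n" for i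
          using conormal_section_forms[OF z a i] \<gamma> i by simp
      qed
      then show ?thesis using \<gamma> by blast
    qed
    then have "\<forall>a. \<exists>\<gamma>. a < 2 \<longrightarrow> (\<forall>i<n. z a i = (\<Sum>j<c. \<gamma> j * \<zeta> j i)) \<and> (\<forall>j<c. \<gamma> j \<in> forms (int m - int (e a) - int (qt j)))"
      by blast
    from choice[OF this] show ?thesis by blast
  qed
  have "\<forall>l. \<exists>\<gamma>. l < N \<longrightarrow> (\<forall>a<2. \<forall>i<n. B l a i = (\<Sum>j<c. \<gamma> a j * \<zeta> j i)) \<and>
      (\<forall>a<2. \<forall>j<c. \<gamma> a j \<in> forms (int m - int (e a) - int (qt j)))"
    using dec B by blast
  from choice[OF this] obtain G where G: "\<forall>l. l < N \<longrightarrow> (\<forall>a<2. \<forall>i<n. B l a i = (\<Sum>j<c. G l a j * \<zeta> j i)) \<and>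
      (\<forall>a<2. \<forall>j<c. G l a j \<in> forms (int m - int (e a) - int (qt j)))" ..
  have G1: "B l a i = (\<Sum>j<c. G l a j * \<zeta> j i)" if "l < N" "a < 2" "i < n" for l a i using G that by blast
  have G2: "G l a j \<in> forms (int m - int (e a) - int (qt j))" if "l < N" "a < 2" "j < c" for l a j using G that by blast
  define Q where "Q = (SIGMA k:{..<K}. {i. g k \<le> i \<and> int i \<le> int m - int (E k)})"
  have Qs: "{i. g k \<le> i \<and> int i \<le> int m - int (E k)} = {g k..<nat (int m - int (E k) + 1)}" for k by auto
  have fQ: "finite Q" unfolding Q_def Qs by auto
  have cQ: "card Q = (\<Sum>k<K. nat (int m + 1 - int (E k + g k)))"
  proof -
    have "nat (int m - int (E k) + 1) - g k = nat (int m + 1 - int (E k + g k))" for k by auto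
    then show ?thesis unfolding Q_def Qs by (subst card_SigmaI) auto
  qed
  show "N \<le> (\<Sum>k<K. nat (int m + 1 - int (E k + g k)))"
  proof (rule ccontr)
    assume "\<not> N \<le> (\<Sum>k<K. nat (int m + 1 - int (E k + g k)))"
    then have lt: "card Q < card {..<N}" using cQ by simp
    define A where "A q l = coeff (G l (fst (pr (fst q))) (snd (pr (fst q)))) (snd q)" for q :: "nat \<times> nat" and l
    obtain x where x: "\<forall>q\<in>Q. (\<Sum>l\<in>{..<N}. A q l * x l) = 0" "\<exists>l\<in>{..<N}. x l \<noteq> 0"
      by (rule underdetermined_system[of "{..<N}" Q A, OF finite_lessThan fQ lt]) (rule that)
    define \<gamma> where "\<gamma> a j = (\<Sum>l<N. Polynomial.smult (x l) (G l a j))" for a j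
    have zs: "conormal_section (int m) (\<lambda>a i. \<Sum>l<N. Polynomial.smult (x l) (B l a i))"
      by (rule conormal_section_combination) (use B in blast)
    have comb: "(\<Sum>l<N. Polynomial.smult (x l) (B l a i)) = (\<Sum>j<c. \<gamma> a j * \<zeta> j i)" if "a < 2" "i < n" for a i
    proof -
      have "(\<Sum>l<N. Polynomial.smult (x l) (B l a i)) = (\<Sum>l<N. \<Sum>j<c. Polynomial.smult (x l) (G l a j) * \<zeta> j i)"
        using that by (intro sum.cong refl) (simp add: G1 poly_smult_sum)
      also have "\<dots> = (\<Sum>j<c. \<gamma> a j * \<zeta> j i)"
        unfolding \<gamma>_def sum_distrib_right by (rule sum.swap)
      finally show ?thesis .
    qed
    have "(\<Sum>a<2. \<Sum>i<n. (\<Sum>j<c. \<gamma> a j * \<zeta> j i) * pderiv (\<sigma> a i)) = 0"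
      using conormal_section_tangent[OF zs] comb by simp
    moreover have "(\<Sum>i<n. (\<Sum>j<c. \<gamma> a j * \<zeta> j i) * pderiv (\<sigma> a i)) = (\<Sum>j<c. \<gamma> a j * \<omega> a j)" for a
      unfolding \<omega>_def sum_distrib_right sum_distrib_left by (subst sum.swap) (simp add: mult.assoc)
    ultimately have "(\<Sum>a<2. \<Sum>j<c. \<gamma> a j * \<omega> a j) = 0" by simp
    moreover have "(\<Sum>a<2. \<Sum>j<c. \<gamma> a j * \<omega> a j) = (\<Sum>k<Suc K. \<gamma> (fst (pr k)) (snd (pr k)) * \<omega> (fst (pr k)) (snd (pr k)))"
      unfolding sum.cartesian_product
      by (subst sum.reindex_bij_betw[OF pr, symmetric]) (simp add: case_prod_unfold)
    ultimately have 0: "(\<Sum>k<Suc K. \<gamma> (fst (pr k)) (snd (pr k)) * \<omega> (fst (pr k)) (snd (pr k))) = 0" by simp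
    have prk: "fst (pr k) < 2" "snd (pr k) < c" if "k < Suc K" for k
      using bij_betwE[OF pr] that by (auto simp: mem_Times_iff)
    have \<gamma>f: "\<gamma> (fst (pr k)) (snd (pr k)) \<in> forms (int m - int (E k))" if k: "k < Suc K" for k
    proof -
      have "G l (fst (pr k)) (snd (pr k)) \<in> forms (int m - int (E k))" if "l < N" for l
        using G2[OF that prk[OF k]] by (simp add: E_def diff_diff_eq)
      then show ?thesis unfolding \<gamma>_def by (intro forms_sum forms_smult) auto
    qed
    have kill: "coeff (\<gamma> (fst (pr k)) (snd (pr k))) i = 0" if k: "k < K" and i: "g k \<le> i" for k i
    proof (cases "int i \<le> int m - int (E k)")
      case True
      then have "(k, i) \<in> Q" using k i by (simp add: Q_def)
      from bspec[OF x(1) this] show ?thesis by (simp add: \<gamma>_def coeff_sum A_def mult.commute)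
    next
      case False
      then show ?thesis using forms_coeff_eq_0[OF \<gamma>f[of k]] k by simp
    qed
    define \<delta> where "\<delta> k = \<gamma> (fst (pr k)) (snd (pr k))" for k
    have d1: "\<forall>k<Suc K. \<delta> k \<in> forms (int m - int (E k))" using \<gamma>f unfolding \<delta>_def by blast
    have d2: "\<forall>k<K. \<forall>i\<ge>g k. coeff (\<delta> k) i = 0" using kill unfolding \<delta>_def by blast
    have d3: "(\<Sum>k<Suc K. \<delta> k * (\<Sum>i<n. \<zeta> (snd (pr k)) i * pderiv (\<sigma> (fst (pr k)) i))) = 0"
      using 0 unfolding \<delta>_def \<omega>_def .
    from mp[OF mp[OF mp[OF spec[OF inj] d1] d2] d3] have d0: "\<forall>k<Suc K. \<delta> k = 0" .
    have "\<gamma> a j = 0" if "a < 2" "j < c" for a j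
    proof -
      have "(a, j) \<in> pr ` {..<Suc K}" using pr that by (auto simp: bij_betw_def)
      then obtain k where "k < Suc K" "pr k = (a, j)" by (metis imageE lessThan_iff)
      then show ?thesis using d0 unfolding \<delta>_def by (metis fst_conv snd_conv)
    qed
    then have "\<forall>a<2. \<forall>i<n. (\<Sum>l<N. Polynomial.smult (x l) (B l a i)) = 0" using comb by simp
    from independent_sectionsD[OF ind this] x(2) show False by blast
  qed
qed

end

section \<open>A construction of curves\<close>

lemma minor_nonzero_if_independent:
  fixes s :: "nat \<Rightarrow> nat \<Rightarrow> 'a::field"
  assumes ind: "\<And>a0 a1. (\<And>i. i < n \<Longrightarrow> a0 * s 0 i + a1 * s 1 i = 0) \<Longrightarrow> a0 = 0 \<and> a1 = 0"
  shows "\<exists>i<n. \<exists>j<n. minor s i j \<noteq> 0"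
proof (rule ccontr)
  assume neg: "\<not> (\<exists>i<n. \<exists>j<n. minor s i j \<noteq> 0)"
  have m: "s 0 i * s 1 j = s 0 j * s 1 i" if "i < n" "j < n" for i j
    using neg that unfolding minor_def by (metis right_minus_eq)
  have "\<exists>i<n. s 0 i \<noteq> 0 \<or> s 1 i \<noteq> 0"
  proof (rule ccontr)
    assume "\<not> (\<exists>i<n. s 0 i \<noteq> 0 \<or> s 1 i \<noteq> 0)"
    then have "1 * s 0 i + 0 * s 1 i = 0" if "i < n" for i using that by simp
    from ind[OF this] show False by simp
  qed
  then obtain i where i: "i < n" "s 0 i \<noteq> 0 \<or> s 1 i \<noteq> 0" by blast
  have "s 1 i * s 0 j + (- s 0 i) * s 1 j = 0" if "j < n" for j
    using m[OF i(1) that] by (simp add: mult.commute)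
  from ind[OF this] i(2) show False by simp
qed

text \<open>There is a curve of degree \<open>d\<close> whose twisted conormal bundles, for the twists in \<open>Ms\<close>, have at most as
  many sections as if the normal bundle were the sum of the \<open>O(a)\<close> for \<open>a\<close> in \<open>as\<close>.\<close>

definition bounded_curve :: "'a::alg_closed_field itself \<Rightarrow> nat \<Rightarrow> nat \<Rightarrow> nat list \<Rightarrow> nat set \<Rightarrow> bool" where
  "bounded_curve T n d as Ms \<longleftrightarrow> (\<exists>F (f :: 'a \<times> 'a \<Rightarrow> 'a vec set) e \<sigma>. rational_curve 2 n d F f \<and> split_curve n e \<sigma> f \<and>
     e 0 + e 1 = d \<and> (\<forall>i<n. \<forall>j<n. plucker_forms F i j = minor \<sigma> i j) \<and>
     (\<forall>m\<in>Ms. split_curve.sections_dim_le n e \<sigma> (int m) (\<Sum>a\<leftarrow>as. nat (int m + 1 - int a))))"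

lemma bounded_curveI:
  fixes \<sigma> \<zeta> :: "nat \<Rightarrow> nat \<Rightarrow> 'a::alg_closed_field poly" and e qt g :: "nat \<Rightarrow> nat" and pr :: "nat \<Rightarrow> nat \<times> nat"
  assumes f: "\<forall>a<2. \<forall>i<n. \<sigma> a i \<in> forms (int (e a))" and d: "e 0 + e 1 = d"
    and indep: "\<And>x. x \<noteq> (0, 0) \<Longrightarrow> \<exists>i<n. \<exists>j<n. minor (curve_value e \<sigma> x) i j \<noteq> 0"
    and gen: "\<And>y. (\<forall>a<2. (\<Sum>i<n. y i * \<sigma> a i) = 0) \<Longrightarrow> \<exists>\<gamma>. \<forall>i<n. y i = (\<Sum>j<c. \<gamma> j * \<zeta> j i)"
    and deg: "\<And>j i. j < c \<Longrightarrow> i < n \<Longrightarrow> \<zeta> j i \<in> forms (int (qt j))"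
    and lead: "\<And>b j. (\<And>i. i < n \<Longrightarrow> (\<Sum>j<c. b j * coeff (\<zeta> j i) (qt j)) = 0) \<Longrightarrow> j < c \<Longrightarrow> b j = 0"
    and pr: "bij_betw pr {..<Suc K} ({..<2} \<times> {..<c})"
    and inj: "\<And>m \<gamma> k. m \<in> Ms \<Longrightarrow> \<forall>k<Suc K. \<gamma> k \<in> forms (int m - int (e (fst (pr k)) + qt (snd (pr k)))) \<Longrightarrow>
      \<forall>k<K. \<forall>i\<ge>g k. coeff (\<gamma> k) i = 0 \<Longrightarrow>
      (\<Sum>k<Suc K. \<gamma> k * (\<Sum>i<n. \<zeta> (snd (pr k)) i * pderiv (\<sigma> (fst (pr k)) i))) = 0 \<Longrightarrow> k < Suc K \<Longrightarrow> \<gamma> k = 0"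
  shows "bounded_curve TYPE('a) n d (map (\<lambda>k. e (fst (pr k)) + qt (snd (pr k)) + g k) [0..<K]) Ms"
proof -
  have "\<exists>F f. rational_curve 2 n d F f \<and> split_curve n e \<sigma> f \<and> (\<forall>i<n. \<forall>j<n. plucker_forms F i j = minor \<sigma> i j)"
    by (rule split_curve_rational[OF f d indep])
  then obtain F f where Ff: "rational_curve 2 n d F f" "split_curve n e \<sigma> f"
    "\<forall>i<n. \<forall>j<n. plucker_forms F i j = minor \<sigma> i j" by (elim exE conjE)
  have "split_curve.sections_dim_le n e \<sigma> (int m) (\<Sum>k<K. nat (int m + 1 - int (e (fst (pr k)) + qt (snd (pr k)) + g k)))"
    if m: "m \<in> Ms" for m
  proof (rule split_curve.sections_dim_le_if_killed[OF Ff(2), where \<zeta> = \<zeta> and c = c])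
    show "\<exists>\<gamma>. \<forall>i<n. z i = (\<Sum>j<c. \<gamma> j * \<zeta> j i)" if "\<forall>a<2. (\<Sum>i<n. z i * \<sigma> a i) = 0" for z
      by (rule gen[OF that])
    show "\<zeta> j i \<in> forms (int (qt j))" if "j < c" "i < n" for j i by (rule deg[OF that])
    show "b j = 0" if "\<And>i. i < n \<Longrightarrow> (\<Sum>j<c. b j * coeff (\<zeta> j i) (qt j)) = 0" "j < c" for b j
      by (rule lead[OF that])
    show "bij_betw pr {..<Suc K} ({..<2} \<times> {..<c})" by (rule pr)
    show "\<forall>\<gamma>. (\<forall>k<Suc K. \<gamma> k \<in> forms (int m - int (e (fst (pr k)) + qt (snd (pr k))))) \<longrightarrow>
      (\<forall>k<K. \<forall>i\<ge>g k. coeff (\<gamma> k) i = 0) \<longrightarrow>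
      (\<Sum>k<Suc K. \<gamma> k * (\<Sum>i<n. \<zeta> (snd (pr k)) i * pderiv (\<sigma> (fst (pr k)) i))) = 0 \<longrightarrow> (\<forall>k<Suc K. \<gamma> k = 0)"
    proof (intro allI impI)
      fix \<gamma> k
      assume 1: "\<forall>k<Suc K. \<gamma> k \<in> forms (int m - int (e (fst (pr k)) + qt (snd (pr k))))"
        and 2: "\<forall>k<K. \<forall>i\<ge>g k. coeff (\<gamma> k) i = 0"
        and 3: "(\<Sum>k<Suc K. \<gamma> k * (\<Sum>i<n. \<zeta> (snd (pr k)) i * pderiv (\<sigma> (fst (pr k)) i))) = 0" and 4: "k < Suc K"
      show "\<gamma> k = 0" by (rule inj[OF m 1 2 3 4])
    qed
  qed
  then have "\<forall>m\<in>Ms. split_curve.sections_dim_le n e \<sigma> (int m)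
      (\<Sum>a\<leftarrow>map (\<lambda>k. e (fst (pr k)) + qt (snd (pr k)) + g k) [0..<K]. nat (int m + 1 - int a))"
    by (simp add: interv_sum_list_conv_sum_set_nat atLeast0LessThan comp_def)
  then show ?thesis
    unfolding bounded_curve_def using Ff d
    by (intro exI[of _ F] exI[of _ f] exI[of _ e] exI[of _ "\<sigma>"] conjI)
qed

text \<open>
  With \<open>top p = (p\<^sub>0, p\<^sub>1, 0, \<dots>)\<close>, the curve spanned by \<open>\<tau>\<^sub>a = (L\<^sub>a, X top L\<^sub>a + \<epsilon> N1\<^sub>a)\<close> is annihilated by
  \<open>\<zeta>\<^sub>j = (- X top R\<^sub>j - \<epsilon> N2\<^sub>j, R\<^sub>j)\<close> as soon as \<open>N1 R = L N2\<close>. Such \<open>N1, N2\<close> come from \<open>v R = \<psi> y\<close>, and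
  subtracting multiples of \<open>L\<close> and \<open>R\<close> (division by \<open>\<psi>\<close>) makes their degrees small. At \<open>\<epsilon> = 0\<close> the curve
  degenerates, but the tangent pairings \<open>\<zeta>\<^sub>j \<tau>\<^sub>a'\<close> become the entries \<open>\<omega>0\<close> of the product \<open>L R\<close>.
\<close>

locale curve_data =
  fixes c M :: nat and L R :: "nat \<Rightarrow> nat \<Rightarrow> 'a::alg_closed_field poly" and v y :: "nat \<Rightarrow> 'a poly" and \<psi> :: "'a poly"
    and e q qt :: "nat \<Rightarrow> nat"
  assumes c: "c \<ge> 2" and e: "e 0 + e 1 = M" and qle: "\<And>j. j < c \<Longrightarrow> q j \<le> qt j"
    and Ldeg: "\<And>i b. i < 2 \<Longrightarrow> b < 2 \<Longrightarrow> L i b \<in> forms (int (e i))"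
    and detL: "L 0 0 * L 1 1 - L 0 1 * L 1 0 = \<psi>" and psi: "\<psi> \<in> forms (int M)" "coeff \<psi> M \<noteq> 0"
    and cop: "\<And>t. poly (L 0 0) t \<noteq> 0 \<or> poly (L 0 1) t \<noteq> 0"
    and Rdeg: "\<And>i j. i < c \<Longrightarrow> j < c \<Longrightarrow> R i j \<in> forms (int (q j))"
    and Rtop: "\<And>i j. i < 2 \<Longrightarrow> j < c \<Longrightarrow> [:0, 1:] * R i j \<in> forms (int (qt j))"
    and vR: "\<And>j. j < c \<Longrightarrow> (\<Sum>i<c. v i * R i j) = \<psi> * y j"
    and vnz: "\<And>t. \<exists>i<c. poly (v i) t \<noteq> 0"
    and vker: "\<And>z. \<psi> dvd (\<Sum>i<c. v i * z i) \<Longrightarrow> \<exists>\<gamma>. \<forall>i<c. z i = (\<Sum>j<c. \<gamma> j * R i j)"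
    and lead: "\<And>b. (\<And>i. i < 2 \<Longrightarrow> (\<Sum>j<c. b j * coeff ([:0, 1:] * R i j) (qt j)) = 0) \<Longrightarrow>
      (\<And>i. i < c \<Longrightarrow> (\<Sum>j<c. b j * coeff (R i j) (qt j)) = 0) \<Longrightarrow> (\<And>j. j < c \<Longrightarrow> b j = 0)"
begin

text \<open>The second column of the adjugate of \<open>L\<close>, so that
  \<open>L u = (0, \<psi>)\<close>.\<close>

definition u :: "nat \<Rightarrow> 'a poly" where "u b = (if b = 0 then - L 0 1 else L 0 0)"

definition C :: "nat \<Rightarrow> nat \<Rightarrow> 'a poly" where "C b j = (u b * v j) div \<psi>"

text \<open>Let \<open>B\<close> be the fractional part of the matrix \<open>u v / \<psi>\<close>,
  with entries \<open>((u b * v j) mod \<psi>) / \<psi>\<close>. Then \<open>N1\<close> is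
  \<open>L B\<close> and \<open>N2\<close> is \<open>B R\<close>. This explains
  \<open>N1 R = L N2\<close>, and since \<open>B\<close> vanishes at infinity, both have smaller
  degree than \<open>L\<close> and \<open>R\<close>.\<close>

definition N1 :: "nat \<Rightarrow> nat \<Rightarrow> 'a poly" where
  "N1 i j = (if i = 0 then 0 else v j) - (\<Sum>b<2. L i b * C b j)"

definition N2 :: "nat \<Rightarrow> nat \<Rightarrow> 'a poly" where
  "N2 b j = u b * y j - (\<Sum>i<c. C b i * R i j)"

definition topv :: "(nat \<Rightarrow> 'a poly) \<Rightarrow> nat \<Rightarrow> 'a poly" where
  "topv p j = (if j < 2 then p j else 0)"

definition \<tau> :: "'a \<Rightarrow> nat \<Rightarrow> nat \<Rightarrow> 'a poly" where
  "\<tau> \<epsilon> a i = (if i < 2 then L a i else [:0, 1:] * topv (L a) (i - 2) + Polynomial.smult \<epsilon> (N1 a (i - 2)))"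

definition \<zeta> :: "'a \<Rightarrow> nat \<Rightarrow> nat \<Rightarrow> 'a poly" where
  "\<zeta> \<epsilon> j i = (if i < 2 then - ([:0, 1:] * R i j + Polynomial.smult \<epsilon> (N2 i j)) else R (i - 2) j)"

definition \<omega>0 :: "nat \<Rightarrow> nat \<Rightarrow> 'a poly" where "\<omega>0 a j = (\<Sum>b<2. L a b * R b j)"

definition \<omega>1 :: "nat \<Rightarrow> nat \<Rightarrow> 'a poly" where
  "\<omega>1 a j = (\<Sum>i<c. R i j * pderiv (N1 a i)) - (\<Sum>b<2. N2 b j * pderiv (L a b))"

lemma psi_nonzero: "\<psi> \<noteq> 0"
  using psi(2) by auto

lemma Lu: "(\<Sum>b<2. L a b * u b) = (if a = 0 then 0 else \<psi>)" if "a < 2"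
  using less_2_cases[OF that] detL by (auto simp: sum_lessThan_2 u_def algebra_simps)

lemma rem_bound: "(u b * v j) mod \<psi> \<in> forms (int M - 1)"
proof (cases "(u b * v j) mod \<psi> = 0")
  case False
  then have "degree ((u b * v j) mod \<psi>) < degree \<psi>" using degree_mod_less' psi_nonzero by blast
  also have "\<dots> \<le> M" using psi(1) by (simp add: forms_int_iff)
  finally show ?thesis by (simp add: forms_def)
qed simp

lemma psi_cancel_forms:
  assumes "\<psi> * p \<in> forms (int M + k)"
  shows "p \<in> forms k"
proof (cases "p = 0")
  case False
  have "degree \<psi> = M"
    using psi by (intro antisym le_degree) (simp_all add: forms_int_iff)
  then have "degree (\<psi> * p) = M + degree p" using False psi_nonzero by (simp add: degree_mult_eq)
  then show ?thesis using assms False psi_nonzero by (auto simp: forms_def)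
qed simp

lemma psi_C: "\<psi> * C b j = u b * v j - (u b * v j) mod \<psi>"
  unfolding C_def by (simp add: minus_mod_eq_mult_div)

lemma N1_forms: "a < 2 \<Longrightarrow> N1 a j \<in> forms (int (e a) - 1)"
proof (rule psi_cancel_forms)
  assume a: "a < 2"
  have "\<psi> * N1 a j = (if a = 0 then 0 else \<psi>) * v j - (\<Sum>b<2. L a b * (\<psi> * C b j))"
    by (simp add: N1_def right_diff_distrib sum_distrib_left mult_ac)
  also have "\<dots> = (\<Sum>b<2. L a b * ((u b * v j) mod \<psi>))"
    unfolding Lu[OF a, symmetric] psi_C right_diff_distrib sum_subtractf sum_distrib_right by (simp add: mult_ac)
  also have "\<dots> \<in> forms (int M + (int (e a) - 1))"
    by (intro forms_sum forms_mult'[OF Ldeg[OF a] rem_bound]) auto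
  finally show "\<psi> * N1 a j \<in> forms (int M + (int (e a) - 1))" .
qed

lemma N2_forms: "j < c \<Longrightarrow> N2 b j \<in> forms (int (q j) - 1)"
proof (rule psi_cancel_forms)
  assume j: "j < c"
  have "\<psi> * N2 b j = u b * (\<psi> * y j) - (\<Sum>i<c. \<psi> * C b i * R i j)"
    by (simp add: N2_def right_diff_distrib sum_distrib_left mult_ac)
  also have "\<dots> = (\<Sum>i<c. ((u b * v i) mod \<psi>) * R i j)"
    unfolding vR[OF j, symmetric] psi_C left_diff_distrib sum_subtractf sum_distrib_left by (simp add: mult_ac)
  also have "\<dots> \<in> forms (int M + (int (q j) - 1))"
    by (intro forms_sum forms_mult'[OF rem_bound Rdeg[OF _ j]]) auto
  finally show "\<psi> * N2 b j \<in> forms (int M + (int (q j) - 1))" .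
qed

lemma N1_R: "a < 2 \<Longrightarrow> j < c \<Longrightarrow> (\<Sum>i<c. N1 a i * R i j) = (\<Sum>b<2. L a b * N2 b j)"
proof -
  assume a: "a < 2" and j: "j < c"
  have "(\<Sum>i<c. N1 a i * R i j) = (if a = 0 then 0 else \<Sum>i<c. v i * R i j) - (\<Sum>b<2. L a b * (\<Sum>i<c. C b i * R i j))"
  proof -
    have "N1 a i * R i j = (if a = 0 then 0 else v i * R i j) - (L a 0 * (C 0 i * R i j) + L a 1 * (C 1 i * R i j))" for i
      by (simp add: N1_def sum_lessThan_2 algebra_simps)
    then show ?thesis
      by (cases "a = 0") (simp_all add: sum_lessThan_2 sum_subtractf sum.distrib sum_distrib_left sum_negf)
  qed
  also have "(if a = 0 then 0 else \<Sum>i<c. v i * R i j) = (\<Sum>b<2. L a b * u b) * y j"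
    unfolding Lu[OF a] vR[OF j] by simp
  finally show ?thesis
    by (simp add: N2_def sum_lessThan_2 right_diff_distrib distrib_right algebra_simps)
qed

lemma sum_2_plus: "(\<Sum>i<2 + c. g i) = (\<Sum>b<2. g b) + (\<Sum>i<c. g (2 + i))" for g :: "nat \<Rightarrow> 'b::comm_monoid_add"
  by (rule sum_lessThan_add)

lemma sum_top: "(\<Sum>i<c. topv p i * g i) = (\<Sum>b<2. p b * g b)"
proof -
  have "(\<Sum>i<c. topv p i * g i) = (\<Sum>i\<in>{..<2}. p i * g i)"
    by (rule sum.mono_neutral_cong_right) (use c in \<open>auto simp: topv_def\<close>)
  then show ?thesis .
qed

lemma tau_forms: "a < 2 \<Longrightarrow> i < 2 + c \<Longrightarrow> \<tau> \<epsilon> a i \<in> forms (int (e a + 1))"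
proof -
  assume a: "a < 2" and "i < 2 + c"
  have "L a i \<in> forms (int (e a + 1))" if "i < 2" by (rule forms_mono[OF Ldeg[OF a that]]) simp
  moreover have "[:0, 1:] * topv (L a) j \<in> forms (int (e a + 1))" for j
    unfolding forms_X_mult_iff topv_def using Ldeg[OF a] by simp
  moreover have "Polynomial.smult \<epsilon> (N1 a j) \<in> forms (int (e a + 1))" for j
    by (intro forms_smult forms_mono[OF N1_forms[OF a]]) simp
  ultimately show ?thesis unfolding \<tau>_def by (auto intro: forms_add)
qed

lemma zeta_forms: "j < c \<Longrightarrow> i < 2 + c \<Longrightarrow> \<zeta> \<epsilon> j i \<in> forms (int (qt j))"
proof -
  assume j: "j < c" and i: "i < 2 + c"
  have "Polynomial.smult \<epsilon> (N2 i j) \<in> forms (int (qt j))"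
    by (intro forms_smult forms_mono[OF N2_forms[OF j]]) (use qle[OF j] in simp)
  moreover have "R (i - 2) j \<in> forms (int (qt j))" if "\<not> i < 2"
    by (rule forms_mono[OF Rdeg[OF _ j]]) (use qle[OF j] i that in auto)
  ultimately show ?thesis
    unfolding \<zeta>_def using forms_minus[OF forms_add[OF Rtop[OF _ j, of i]], of "Polynomial.smult \<epsilon> (N2 i j)"]
    by (cases "i < 2") simp_all
qed

lemma tau_zeta_perp:
  assumes a: "a < 2" and j: "j < c"
  shows "(\<Sum>i<2 + c. \<zeta> \<epsilon> j i * \<tau> \<epsilon> a i) = 0"
proof -
  have z: "\<zeta> \<epsilon> j (2 + i) * \<tau> \<epsilon> a (2 + i) = [:0, 1:] * (topv (L a) i * R i j) + Polynomial.smult \<epsilon> (N1 a i * R i j)" for i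
    unfolding \<zeta>_def \<tau>_def by (simp add: distrib_left mult_ac del: mult_pCons_left mult_pCons_right)
  have "(\<Sum>i<c. \<zeta> \<epsilon> j (2 + i) * \<tau> \<epsilon> a (2 + i))
      = [:0, 1:] * (\<Sum>b<2. L a b * R b j) + Polynomial.smult \<epsilon> (\<Sum>b<2. L a b * N2 b j)"
    unfolding z sum.distrib sum_distrib_left[symmetric] poly_smult_sum[symmetric] sum_top N1_R[OF a j] ..
  then show ?thesis
    unfolding sum_2_plus by (simp add: \<zeta>_def \<tau>_def sum_lessThan_2 smult_add_right algebra_simps)
qed

text \<open>At \<open>\<epsilon> = 0\<close> only the derivative of the explicit factor
  \<open>X\<close> survives: the terms with \<open>pderiv (L a b)\<close> from the first two
  coordinates cancel those from the remaining ones.\<close>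

lemma tau_zeta_tangent:
  assumes a: "a < 2" and j: "j < c"
  shows "(\<Sum>i<2 + c. \<zeta> \<epsilon> j i * pderiv (\<tau> \<epsilon> a i)) = \<omega>0 a j + Polynomial.smult \<epsilon> (\<omega>1 a j)"
proof -
  have X: "pderiv ([:0, 1:] * p) = p + [:0, 1:] * pderiv p" for p :: "'a poly"
    by (simp add: pderiv_mult pderiv_pCons)
  have pt: "pderiv (topv p i) = topv (\<lambda>b. pderiv (p b)) i" for p i
    by (simp add: topv_def)
  have "(\<Sum>i<c. \<zeta> \<epsilon> j (2 + i) * pderiv (\<tau> \<epsilon> a (2 + i)))
      = (\<Sum>i<c. topv (L a) i * R i j) + [:0, 1:] * (\<Sum>i<c. topv (\<lambda>b. pderiv (L a b)) i * R i j)
        + Polynomial.smult \<epsilon> (\<Sum>i<c. R i j * pderiv (N1 a i))"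
  proof -
    have z: "\<zeta> \<epsilon> j (2 + i) = R i j" "\<tau> \<epsilon> a (2 + i) = [:0, 1:] * topv (L a) i + Polynomial.smult \<epsilon> (N1 a i)" for i
      by (simp_all add: \<zeta>_def \<tau>_def)
    have "\<zeta> \<epsilon> j (2 + i) * pderiv (\<tau> \<epsilon> a (2 + i)) = topv (L a) i * R i j
        + [:0, 1:] * (topv (\<lambda>b. pderiv (L a b)) i * R i j) + Polynomial.smult \<epsilon> (R i j * pderiv (N1 a i))" for i
      unfolding z pderiv_add X pderiv_smult pt by (simp add: distrib_left mult_ac del: mult_pCons_left mult_pCons_right)
    then show ?thesis by (simp only: sum.distrib sum_distrib_left poly_smult_sum)
  qed
  moreover have "(\<Sum>b<2. \<zeta> \<epsilon> j b * pderiv (\<tau> \<epsilon> a b))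
      = - [:0, 1:] * (\<Sum>b<2. pderiv (L a b) * R b j) - Polynomial.smult \<epsilon> (\<Sum>b<2. N2 b j * pderiv (L a b))"
    by (simp add: \<zeta>_def \<tau>_def sum_lessThan_2 smult_add_right algebra_simps)
  ultimately show ?thesis
    unfolding sum_2_plus sum_top \<omega>0_def \<omega>1_def by (simp add: smult_diff_right)
qed

text \<open>Orthogonality says \<open>L a' = (0, - \<epsilon> V)\<close> for the corrected first two
  coordinates \<open>a'\<close> of \<open>z\<close>. The entries of the first row of
  \<open>L\<close> have no common zero, so \<open>a'\<close> is a multiple \<open>h\<close> of
  \<open>u\<close>, and the second row gives \<open>\<psi> h = - \<epsilon> V\<close>. As
  \<open>\<epsilon>\<close> is nonzero, \<open>\<psi>\<close> divides \<open>V\<close>, and the last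
  \<open>c\<close> coordinates are a combination of the columns of \<open>R\<close>. What then
  remains lives in the first two coordinates and is killed by the nonzero determinant of
  \<open>L\<close>.\<close>

lemma zeta_generates:
  assumes \<epsilon>: "\<epsilon> \<noteq> 0" and z: "\<forall>a<2. (\<Sum>i<2 + c. z i * \<tau> \<epsilon> a i) = 0"
  shows "\<exists>\<gamma>. \<forall>i<2 + c. z i = (\<Sum>j<c. \<gamma> j * \<zeta> \<epsilon> j i)"
proof -
  let ?X = "[:0, 1 :: 'a:]"
  define V where "V = (\<Sum>i<c. v i * z (2 + i))"
  define a' where "a' b = z b + ?X * z (2 + b) - Polynomial.smult \<epsilon> (\<Sum>i<c. C b i * z (2 + i))" for b
  have La': "(\<Sum>b<2. L a b * a' b) = - (if a = 0 then 0 else Polynomial.smult \<epsilon> V)" if a: "a < 2" for a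
  proof -
    have t: "\<tau> \<epsilon> a b = L a b" if "b < 2" for b using that by (simp add: \<tau>_def)
    have t': "z (2 + i) * \<tau> \<epsilon> a (2 + i) = ?X * (topv (L a) i * z (2 + i)) + Polynomial.smult \<epsilon> (z (2 + i) * N1 a i)" for i
      unfolding \<tau>_def by (simp add: distrib_left mult_ac del: mult_pCons_left mult_pCons_right)
    have n1: "(\<Sum>i<c. z (2 + i) * N1 a i) = (if a = 0 then 0 else V) - (\<Sum>b<2. L a b * (\<Sum>i<c. C b i * z (2 + i)))"
    proof -
      have "z (2 + i) * N1 a i = (if a = 0 then 0 else v i * z (2 + i)) - (L a 0 * (C 0 i * z (2 + i)) + L a 1 * (C 1 i * z (2 + i)))" for i
        by (simp add: N1_def sum_lessThan_2 algebra_simps)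
      then show ?thesis
        by (cases "a = 0") (simp_all add: V_def sum_lessThan_2 sum_subtractf sum.distrib sum_distrib_left sum_negf)
    qed
    have "0 = (\<Sum>i<2 + c. z i * \<tau> \<epsilon> a i)" using z a by simp
    also have "\<dots> = (\<Sum>b<2. z b * L a b) + (\<Sum>i<c. ?X * (topv (L a) i * z (2 + i)) + Polynomial.smult \<epsilon> (z (2 + i) * N1 a i))"
      unfolding sum_2_plus t' by (simp add: t)
    also have "\<dots> = (\<Sum>b<2. z b * L a b) + ?X * (\<Sum>b<2. L a b * z (2 + b)) + Polynomial.smult \<epsilon> (\<Sum>i<c. z (2 + i) * N1 a i)"
      unfolding sum.distrib sum_distrib_left[symmetric] poly_smult_sum[symmetric] sum_top by (simp only: add.assoc)
    also have "\<dots> = (\<Sum>b<2. L a b * a' b) + (if a = 0 then 0 else Polynomial.smult \<epsilon> V)"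
      unfolding n1 a'_def
      by (simp add: sum_lessThan_2 smult_diff_right smult_add_right algebra_simps del: mult_pCons_left mult_pCons_right)
    finally show ?thesis by (simp add: eq_neg_iff_add_eq_0)
  qed
  have E0: "L 0 0 * a' 0 + L 0 1 * a' 1 = 0" and E1: "L 1 0 * a' 0 + L 1 1 * a' 1 = - Polynomial.smult \<epsilon> V"
    using La'[of 0] La'[of 1] by (simp_all add: sum_lessThan_2)
  have "\<exists>b\<in>{0, 1}. poly (L 0 b) t \<noteq> 0" for t using cop[of t] by auto
  then obtain p where p: "(\<Sum>b\<in>{0, 1}. p b * L 0 b) = 1"
    using polynomial_bezout[of "{0, 1 :: nat}" "L 0"] by blast
  then have p: "p 0 * L 0 0 + p 1 * L 0 1 = 1" by simp
  define h where "h = p 0 * a' 1 - p 1 * a' 0"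
  have "a' 0 = (p 0 * L 0 0 + p 1 * L 0 1) * a' 0" using p by simp
  also have "\<dots> = p 0 * (L 0 0 * a' 0 + L 0 1 * a' 1) - h * L 0 1" by (simp add: h_def algebra_simps)
  finally have a0: "a' 0 = - h * L 0 1" using E0 by simp
  have "a' 1 = (p 0 * L 0 0 + p 1 * L 0 1) * a' 1" using p by simp
  also have "\<dots> = h * L 0 0 + p 1 * (L 0 0 * a' 0 + L 0 1 * a' 1)" by (simp add: h_def algebra_simps)
  finally have a1: "a' 1 = h * L 0 0" using E0 by simp
  have "\<psi> * h = L 1 0 * a' 0 + L 1 1 * a' 1" unfolding a0 a1 detL[symmetric] by (simp add: algebra_simps)
  then have "V = Polynomial.smult (- 1 / \<epsilon>) (\<psi> * h)" using E1 \<epsilon> by simp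
  then have "V = \<psi> * Polynomial.smult (- 1 / \<epsilon>) h" by simp
  then have "\<psi> dvd V" by (rule dvdI)
  from vker[OF this[unfolded V_def]] obtain \<gamma> where \<gamma>: "\<forall>i<c. z (2 + i) = (\<Sum>j<c. \<gamma> j * R i j)" ..
  define w where "w i = z i - (\<Sum>j<c. \<gamma> j * \<zeta> \<epsilon> j i)" for i
  have w2: "w (2 + i) = 0" if "i < c" for i using \<gamma> that by (simp add: w_def \<zeta>_def)
  have wL: "(\<Sum>b<2. w b * L a b) = 0" if a: "a < 2" for a
  proof -
    have "(\<Sum>i<2 + c. w i * \<tau> \<epsilon> a i) = (\<Sum>b<2. w b * L a b)"
      unfolding sum_2_plus using w2 by (simp add: \<tau>_def)
    moreover have "(\<Sum>i<2 + c. w i * \<tau> \<epsilon> a i) = (\<Sum>i<2 + c. z i * \<tau> \<epsilon> a i) - (\<Sum>j<c. \<gamma> j * (\<Sum>i<2 + c. \<zeta> \<epsilon> j i * \<tau> \<epsilon> a i))"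
      unfolding w_def left_diff_distrib sum_subtractf sum_distrib_right sum_distrib_left
      by (subst (2) sum.swap) (simp only: mult.assoc)
    ultimately show ?thesis using z a tau_zeta_perp[OF a] by simp
  qed
  have W0: "w 0 * L 0 0 + w 1 * L 0 1 = 0" and W1: "w 0 * L 1 0 + w 1 * L 1 1 = 0"
    using wL[of 0] wL[of 1] by (simp_all add: sum_lessThan_2)
  have "\<psi> * w 0 = L 1 1 * (w 0 * L 0 0 + w 1 * L 0 1) - L 0 1 * (w 0 * L 1 0 + w 1 * L 1 1)"
    "\<psi> * w 1 = L 0 0 * (w 0 * L 1 0 + w 1 * L 1 1) - L 1 0 * (w 0 * L 0 0 + w 1 * L 0 1)"
    unfolding detL[symmetric] by (simp_all add: algebra_simps)
  then have "w 0 = 0" "w 1 = 0" unfolding W0 W1 using psi_nonzero by simp_all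
  then have w01: "w b = 0" if "b < 2" for b using less_2_cases[OF that] by auto
  have "w i = 0" if "i < 2 + c" for i
  proof (cases "i < 2")
    case False
    then have "i = 2 + (i - 2)" "i - 2 < c" using that by auto
    then show ?thesis using w2 by metis
  qed (rule w01)
  then have "\<forall>i<2 + c. z i = (\<Sum>j<c. \<gamma> j * \<zeta> \<epsilon> j i)" by (simp add: w_def)
  then show ?thesis by (intro exI[of _ \<gamma>])
qed

lemma zeta_lead:
  assumes "\<And>i. i < 2 + c \<Longrightarrow> (\<Sum>j<c. b j * coeff (\<zeta> \<epsilon> j i) (qt j)) = 0" "j < c"
  shows "b j = 0"
proof (rule lead[OF _ _ assms(2)])
  fix i assume i: "i < c"
  show "(\<Sum>j<c. b j * coeff (R i j) (qt j)) = 0"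
    using assms(1)[of "2 + i"] i by (simp add: \<zeta>_def)
next
  fix i :: nat assume i: "i < 2"
  have N: "coeff (N2 i j) (qt j) = 0" if "j < c" for j
    by (rule forms_coeff_eq_0[OF N2_forms[OF that]]) (use qle[OF that] in simp)
  have "(\<Sum>j<c. b j * coeff (\<zeta> \<epsilon> j i) (qt j)) = - (\<Sum>j<c. b j * coeff ([:0, 1:] * R i j) (qt j))"
    unfolding sum_negf[symmetric]
    by (rule sum.cong[OF refl]) (use i N in \<open>simp add: \<zeta>_def del: mult_pCons_left\<close>)
  then show "(\<Sum>j<c. b j * coeff ([:0, 1:] * R i j) (qt j)) = 0"
    using assms(1)[of i] i by simp
qed

text \<open>A relation between the two values at a finite point kills the rows of \<open>L\<close>
  and, as \<open>\<epsilon>\<close> is nonzero, those of \<open>N1\<close>. Modulo \<open>L\<close>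
  the matrix \<open>N1\<close> is \<open>(0, v)\<close>, so the second coefficient is 0, and then
  the first, because \<open>L 0 0\<close> and \<open>L 0 1\<close> have no common zero. At infinity
  the coordinates 2 and 3 carry the top coefficients of \<open>L\<close>, whose determinant is that
  of \<open>\<psi>\<close>.\<close>

lemma tau_independent:
  assumes \<epsilon>: "\<epsilon> \<noteq> 0" and x: "x \<noteq> (0, 0)"
  shows "\<exists>i<2 + c. \<exists>j<2 + c. minor (curve_value (\<lambda>a. e a + 1) (\<tau> \<epsilon>) x) i j \<noteq> 0"
proof (rule minor_nonzero_if_independent)
  fix a0 a1
  assume dep: "\<And>i. i < 2 + c \<Longrightarrow> a0 * curve_value (\<lambda>a. e a + 1) (\<tau> \<epsilon>) x 0 i + a1 * curve_value (\<lambda>a. e a + 1) (\<tau> \<epsilon>) x 1 i = 0"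
  show "a0 = 0 \<and> a1 = 0"
  proof (cases "fst x = 0")
    case False
    define t where "t = snd x / fst x"
    define A0 where "A0 = a0 * fst x ^ (e 0 + 1)"
    define A1 where "A1 = a1 * fst x ^ (e 1 + 1)"
    have cv: "curve_value (\<lambda>a. e a + 1) (\<tau> \<epsilon>) x a i = fst x ^ (e a + 1) * poly (\<tau> \<epsilon> a i) t" if "a < 2" "i < 2 + c" for a i
      unfolding curve_value_def t_def using ev_affine[OF tau_forms[OF that] of_nat_0_le_iff False, of \<epsilon>]
      unfolding nat_int .
    have dep': "A0 * poly (\<tau> \<epsilon> 0 i) t + A1 * poly (\<tau> \<epsilon> 1 i) t = 0" if "i < 2 + c" for i
      using dep[OF that] cv[of 0 i] cv[of 1 i] that by (simp add: A0_def A1_def mult.assoc)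
    have L0: "A0 * poly (L 0 b) t + A1 * poly (L 1 b) t = 0" if "b < 2" for b
      using dep'[of b] that by (simp add: \<tau>_def)
    have N: "A0 * poly (N1 0 j) t + A1 * poly (N1 1 j) t = 0" if j: "j < c" for j
    proof -
      have "A0 * poly (topv (L 0) j) t + A1 * poly (topv (L 1) j) t = 0"
        using L0[of j] by (simp add: topv_def)
      moreover have "A0 * poly (\<tau> \<epsilon> 0 (2 + j)) t + A1 * poly (\<tau> \<epsilon> 1 (2 + j)) t
          = t * (A0 * poly (topv (L 0) j) t + A1 * poly (topv (L 1) j) t) + \<epsilon> * (A0 * poly (N1 0 j) t + A1 * poly (N1 1 j) t)"
        by (simp add: \<tau>_def algebra_simps)
      ultimately show ?thesis using dep'[of "2 + j"] j \<epsilon> by simp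
    qed
    obtain j where j: "j < c" "poly (v j) t \<noteq> 0" using vnz by blast
    have "A0 * poly (N1 0 j) t + A1 * poly (N1 1 j) t
        = A1 * poly (v j) t - (A0 * poly (L 0 0) t + A1 * poly (L 1 0) t) * poly (C 0 j) t
          - (A0 * poly (L 0 1) t + A1 * poly (L 1 1) t) * poly (C 1 j) t"
      by (simp add: N1_def sum_lessThan_2 algebra_simps)
    then have "A1 * poly (v j) t = 0" using N[OF j(1)] L0[of 0] L0[of 1] by simp
    then have A1: "A1 = 0" using j by simp
    then have "A0 = 0" using L0[of 0] L0[of 1] cop[of t] by auto
    with A1 show ?thesis using False by (simp add: A0_def A1_def)
  next
    case True
    then have s: "snd x \<noteq> 0" using x by (cases x) auto
    define A0 where "A0 = a0 * snd x ^ (e 0 + 1)"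
    define A1 where "A1 = a1 * snd x ^ (e 1 + 1)"
    have cv: "curve_value (\<lambda>a. e a + 1) (\<tau> \<epsilon>) x a (2 + b) = snd x ^ (e a + 1) * coeff (L a b) (e a)" if "a < 2" "b < 2" for a b
    proof -
      have "coeff (N1 a b) (e a + 1) = 0" by (rule forms_coeff_eq_0[OF N1_forms[OF that(1)]]) simp
      then have "coeff (\<tau> \<epsilon> a (2 + b)) (e a + 1) = coeff (L a b) (e a)"
        using that by (simp add: \<tau>_def topv_def)
      then show ?thesis unfolding curve_value_def using ev_infinity[OF True, of "int (e a + 1)"] by (simp only: nat_int)
    qed
    have dep': "A0 * coeff (L 0 b) (e 0) + A1 * coeff (L 1 b) (e 1) = 0" if "b < 2" for b
      using dep[of "2 + b"] cv[of 0 b] cv[of 1 b] that c by (simp add: A0_def A1_def mult.assoc)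
    have "coeff \<psi> M = coeff (L 0 0) (e 0) * coeff (L 1 1) (e 1) - coeff (L 0 1) (e 0) * coeff (L 1 0) (e 1)"
      unfolding detL[symmetric] e[symmetric] coeff_diff
      using coeff_mult_forms[OF Ldeg[of 0 0] Ldeg[of 1 1]] coeff_mult_forms[OF Ldeg[of 0 1] Ldeg[of 1 0]] by simp
    then have d: "coeff (L 0 0) (e 0) * coeff (L 1 1) (e 1) - coeff (L 0 1) (e 0) * coeff (L 1 0) (e 1) \<noteq> 0"
      using psi(2) by simp
    have D: "A0 * coeff (L 0 0) (e 0) + A1 * coeff (L 1 0) (e 1) = 0" "A0 * coeff (L 0 1) (e 0) + A1 * coeff (L 1 1) (e 1) = 0"
      using dep'[of 0] dep'[of 1] by simp_all
    have "A0 * (coeff (L 0 0) (e 0) * coeff (L 1 1) (e 1) - coeff (L 0 1) (e 0) * coeff (L 1 0) (e 1))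
      = coeff (L 1 1) (e 1) * (A0 * coeff (L 0 0) (e 0) + A1 * coeff (L 1 0) (e 1))
        - coeff (L 1 0) (e 1) * (A0 * coeff (L 0 1) (e 0) + A1 * coeff (L 1 1) (e 1))"
      by (simp add: algebra_simps)
    then have A0: "A0 = 0" unfolding D using d by simp
    have "A1 * (coeff (L 0 0) (e 0) * coeff (L 1 1) (e 1) - coeff (L 0 1) (e 0) * coeff (L 1 0) (e 1))
      = coeff (L 0 0) (e 0) * (A0 * coeff (L 0 1) (e 0) + A1 * coeff (L 1 1) (e 1))
        - coeff (L 0 1) (e 0) * (A0 * coeff (L 0 0) (e 0) + A1 * coeff (L 1 0) (e 1))"
      by (simp add: algebra_simps)
    then have "A1 = 0" unfolding D using d by simp
    with A0 show ?thesis using s by (simp add: A0_def A1_def)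
  qed
qed

end

text \<open>The grading argument concerns only the pairings and so can be run at
  \<open>\<epsilon> = 0\<close>, where the curve itself degenerates. Each twist in \<open>Ms\<close>
  excludes finitely many values of \<open>\<epsilon>\<close>; a nonzero value outside all of them
  gives the curve.\<close>

lemma (in curve_data) exists_bounded_curve:
  fixes g :: "nat \<Rightarrow> nat"
  assumes pr: "bij_betw pr {..<Suc K} ({..<2} \<times> {..<c})" and Ms: "finite Ms"
    and low: "\<And>k t. k \<le> K \<Longrightarrow> k = K \<or> g k > 0 \<Longrightarrow> t < (\<Sum>l<k. g l) \<Longrightarrow> coeff (\<omega>0 (fst (pr k)) (snd (pr k))) t = 0"
    and low': "\<And>k. k \<le> K \<Longrightarrow> k = K \<or> g k > 0 \<Longrightarrow> coeff (\<omega>0 (fst (pr k)) (snd (pr k))) (\<Sum>l<k. g l) \<noteq> 0"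
  shows "bounded_curve TYPE('a) (2 + c) (M + 2) (map (\<lambda>k. e (fst (pr k)) + 1 + qt (snd (pr k)) + g k) [0..<K]) Ms"
proof -
  define E where "E k = e (fst (pr k)) + 1 + qt (snd (pr k))" for k
  define Ex where "Ex m k = {i. int i \<le> int m - int (E k) \<and> (k < K \<longrightarrow> i < g k)}" for m k
  define w0 where "w0 k = \<omega>0 (fst (pr k)) (snd (pr k))" for k
  define w1 where "w1 k = \<omega>1 (fst (pr k)) (snd (pr k))" for k
  have inj0: "\<forall>\<gamma>. (\<forall>k<Suc K. \<forall>i. i \<notin> Ex m k \<longrightarrow> coeff (\<gamma> k) i = 0) \<longrightarrow> (\<Sum>k<Suc K. \<gamma> k * w0 k) = 0 \<longrightarrow> (\<forall>k<Suc K. \<gamma> k = 0)" for m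
  proof (intro allI impI)
    fix \<gamma> k assume \<gamma>: "\<forall>k<Suc K. \<forall>i. i \<notin> Ex m k \<longrightarrow> coeff (\<gamma> k) i = 0" and s: "(\<Sum>k<Suc K. \<gamma> k * w0 k) = 0" and k: "k < Suc K"
    show "\<gamma> k = 0"
    proof (rule graded_injective[of K g w0 \<gamma>])
      show "coeff (w0 k) t = 0" if "k \<le> K" "k = K \<or> g k > 0" "t < (\<Sum>l<k. g l)" for k t
        unfolding w0_def by (rule low[OF that])
      show "coeff (w0 k) (\<Sum>l<k. g l) \<noteq> 0" if "k \<le> K" "k = K \<or> g k > 0" for k
        unfolding w0_def by (rule low'[OF that])
      show "coeff (\<gamma> k) i = 0" if "k < K" "g k \<le> i" for k i
        using \<gamma> that by (auto simp: Ex_def)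
    qed (use s k in auto)
  qed
  have fEx: "finite (Ex m k)" for m k
    by (rule finite_subset[of _ "{..m}"]) (auto simp: Ex_def)
  have "\<forall>m. \<exists>Bad. finite Bad \<and> (\<forall>\<epsilon>. \<epsilon> \<notin> Bad \<longrightarrow>
    (\<forall>\<gamma>. (\<forall>k<Suc K. \<forall>i. i \<notin> Ex m k \<longrightarrow> coeff (\<gamma> k) i = 0) \<longrightarrow>
       (\<Sum>k<Suc K. \<gamma> k * (w0 k + Polynomial.smult \<epsilon> (w1 k))) = 0 \<longrightarrow> (\<forall>k<Suc K. \<gamma> k = 0)))"
    by (intro allI graded_injective_pencil fEx inj0)
  from choice[OF this] obtain Bad where Bad: "\<forall>m. finite (Bad m) \<and> (\<forall>\<epsilon>. \<epsilon> \<notin> Bad m \<longrightarrow>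
    (\<forall>\<gamma>. (\<forall>k<Suc K. \<forall>i. i \<notin> Ex m k \<longrightarrow> coeff (\<gamma> k) i = 0) \<longrightarrow>
       (\<Sum>k<Suc K. \<gamma> k * (w0 k + Polynomial.smult \<epsilon> (w1 k))) = 0 \<longrightarrow> (\<forall>k<Suc K. \<gamma> k = 0)))" ..
  have "finite (insert 0 (\<Union>m\<in>Ms. Bad m))" using Ms Bad by auto
  then obtain \<epsilon> where \<epsilon>: "\<epsilon> \<noteq> 0" "\<And>m. m \<in> Ms \<Longrightarrow> \<epsilon> \<notin> Bad m"
    using ex_new_if_finite[OF infinite_UNIV_alg_closed] by blast
  have prk: "fst (pr k) < 2" "snd (pr k) < c" if "k < Suc K" for k
    using bij_betwE[OF pr] that by (auto simp: mem_Times_iff)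
  show ?thesis
  proof (rule bounded_curveI[where \<sigma> = "\<tau> \<epsilon>" and \<zeta> = "\<zeta> \<epsilon>" and c = c])
    show "\<forall>a<2. \<forall>i<2 + c. \<tau> \<epsilon> a i \<in> forms (int (e a + 1))" by (intro allI impI tau_forms)
    show "e 0 + 1 + (e 1 + 1) = M + 2" using e by simp
    show "\<exists>i<2 + c. \<exists>j<2 + c. minor (curve_value (\<lambda>a. e a + 1) (\<tau> \<epsilon>) x) i j \<noteq> 0" if "x \<noteq> (0, 0)" for x
      by (rule tau_independent[OF \<epsilon>(1) that])
    show "\<exists>\<gamma>. \<forall>i<2 + c. z i = (\<Sum>j<c. \<gamma> j * \<zeta> \<epsilon> j i)" if "\<forall>a<2. (\<Sum>i<2 + c. z i * \<tau> \<epsilon> a i) = 0" for z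
      by (rule zeta_generates[OF \<epsilon>(1) that])
    show "\<zeta> \<epsilon> j i \<in> forms (int (qt j))" if "j < c" "i < 2 + c" for j i by (rule zeta_forms[OF that])
    show "b j = 0" if "\<And>i. i < 2 + c \<Longrightarrow> (\<Sum>j<c. b j * coeff (\<zeta> \<epsilon> j i) (qt j)) = 0" "j < c" for b j
      by (rule zeta_lead[OF that])
    show "bij_betw pr {..<Suc K} ({..<2} \<times> {..<c})" by (rule pr)
    fix m \<gamma> k
    assume m: "m \<in> Ms" and d1: "\<forall>k<Suc K. \<gamma> k \<in> forms (int m - int (e (fst (pr k)) + 1 + qt (snd (pr k))))"
      and d2: "\<forall>k<K. \<forall>i\<ge>g k. coeff (\<gamma> k) i = 0"
      and d3: "(\<Sum>k<Suc K. \<gamma> k * (\<Sum>i<2 + c. \<zeta> \<epsilon> (snd (pr k)) i * pderiv (\<tau> \<epsilon> (fst (pr k)) i))) = 0" and k: "k < Suc K"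
    have "(\<Sum>k<Suc K. \<gamma> k * (\<Sum>i<2 + c. \<zeta> \<epsilon> (snd (pr k)) i * pderiv (\<tau> \<epsilon> (fst (pr k)) i)))
        = (\<Sum>k<Suc K. \<gamma> k * (w0 k + Polynomial.smult \<epsilon> (w1 k)))"
      by (rule sum.cong[OF refl]) (simp only: lessThan_iff tau_zeta_tangent[OF prk] w0_def w1_def)
    then have s: "(\<Sum>k<Suc K. \<gamma> k * (w0 k + Polynomial.smult \<epsilon> (w1 k))) = 0" using d3 by (simp only:)
    have kill: "\<forall>k<Suc K. \<forall>i. i \<notin> Ex m k \<longrightarrow> coeff (\<gamma> k) i = 0"
    proof (intro allI impI)
      fix k i assume k: "k < Suc K" and i: "i \<notin> Ex m k"
      then consider "int m - int (E k) < int i" | "k < K" "g k \<le> i" unfolding Ex_def by force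
      then show "coeff (\<gamma> k) i = 0"
      proof cases
        case 1
        have "\<gamma> k \<in> forms (int m - int (E k))" using d1 k by (simp add: E_def)
        then show ?thesis using 1 by (rule forms_coeff_eq_0)
      next
        case 2
        then show ?thesis using d2 by blast
      qed
    qed
    from mp[OF mp[OF spec[OF mp[OF spec[OF conjunct2[OF spec[OF Bad]]] \<epsilon>(2)[OF m]]] kill] s] k
    show "\<gamma> k = 0" by blast
  qed
qed

section \<open>Balanced examples\<close>

lemma ev_monom: "k \<le> e \<Longrightarrow> ev (int e) (monom 1 k) x = fst x ^ (e - k) * snd x ^ k"
  by (simp add: ev_def form_eval_def if_distrib[of "\<lambda>z. z * _"] sum.delta cong: if_cong)

lemma bij_betw_nth_snoc:
  assumes "distinct ps" "p \<notin> set ps" "insert p (set ps) = A"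
  shows "bij_betw (\<lambda>k. (ps @ [p]) ! k) {..<Suc (length ps)} A"
  by (rule bij_betw_nth) (use assms in auto)

text \<open>The lines that join corresponding points of a line and of the curve
  \<open>(1 : x^k : ... : x^(k r))\<close> in complementary subspaces. The tangent pairing at
  \<open>(0, 0)\<close> is the constant 1, so its coefficient is determined by the others, and the
  normal degrees are the numbers \<open>e a + qt j\<close> of the other pairs.\<close>

lemma monomial_curve:
  fixes c k r :: nat and ps :: "(nat \<times> nat) list"
  assumes c: "c \<ge> 2" and k: "k \<ge> 1" and r: "r < c"
    and ps: "distinct ps" "(0, 0) \<notin> set ps" "insert (0, 0) (set ps) = {..<2} \<times> {..<c}"
  shows "bounded_curve TYPE('a::alg_closed_field) (2 + c) (1 + k * r)
    (map (\<lambda>(a, j). (if a = 0 then 1 else k * r) + (if j = 0 then 1 else if j \<le> r then k else 0)) ps) Ms"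
proof -
  define e where "e a = (if a = 0 then 1 else k * r)" for a :: nat
  define qt where "qt j = (if j = 0 then 1 else if j \<le> r then k else 0)" for j :: nat
  define \<sigma> :: "nat \<Rightarrow> nat \<Rightarrow> 'a poly" where
    "\<sigma> a i = (if a = 0 then if i < 2 then monom 1 i else 0
      else if 2 \<le> i \<and> i \<le> 2 + r then monom 1 (k * (i - 2)) else 0)" for a i
  define \<zeta> :: "nat \<Rightarrow> nat \<Rightarrow> 'a poly" where
    "\<zeta> j i = (if j = 0 then if i = 0 then - monom 1 1 else if i = 1 then 1 else 0
      else (if i = 2 + j then 1 else 0) - (if j \<le> r \<and> i = 1 + j then monom 1 k else 0))" for j i
  define pr where "pr = (\<lambda>l. (ps @ [(0, 0)]) ! l)"
  have "bounded_curve TYPE('a) (2 + c) (1 + k * r) (map (\<lambda>l. e (fst (pr l)) + qt (snd (pr l)) + 0) [0..<length ps]) Ms"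
  proof (rule bounded_curveI[where \<sigma> = \<sigma> and \<zeta> = \<zeta> and c = c])
    show "\<forall>a<2. \<forall>i<2 + c. \<sigma> a i \<in> forms (int (e a))"
      by (auto simp: \<sigma>_def e_def forms_int_iff degree_monom_eq)
    show "e 0 + e 1 = 1 + k * r" by (simp add: e_def)
    show "\<exists>i<2 + c. \<exists>j<2 + c. minor (curve_value e \<sigma> x) i j \<noteq> 0" if x: "x \<noteq> (0, 0)" for x
    proof (rule minor_nonzero_if_independent)
      fix a0 a1
      assume dep: "\<And>i. i < 2 + c \<Longrightarrow> a0 * curve_value e \<sigma> x 0 i + a1 * curve_value e \<sigma> x 1 i = 0"
      have v0: "curve_value e \<sigma> x 0 i = fst x ^ (1 - i) * snd x ^ i" "curve_value e \<sigma> x 1 i = 0" if "i < 2" for i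
        using that ev_monom[of i 1 x] by (simp_all add: curve_value_def \<sigma>_def e_def)
      have v1: "curve_value e \<sigma> x 1 (2 + i) = fst x ^ (k * r - k * i) * snd x ^ (k * i)" "curve_value e \<sigma> x 0 (2 + i) = 0" if "i \<le> r" for i
        using that ev_monom[of "k * i" "k * r" x] by (simp_all add: curve_value_def \<sigma>_def e_def)
      show "a0 = 0 \<and> a1 = 0"
        using dep[of 0] dep[of 1] dep[of 2] dep[of "2 + r"] v0[of 0] v0[of 1] v1[of 0] v1[of r] c r x
        by (cases x) auto
    qed
    show "\<exists>\<gamma>. \<forall>i<2 + c. z i = (\<Sum>j<c. \<gamma> j * \<zeta> j i)" if z: "\<forall>a<2. (\<Sum>i<2 + c. z i * \<sigma> a i) = 0" for z
    proof -
      \<comment> \<open>Horner-like partial sums: \<open>\<zeta> j\<close> has the entry 1 at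
        position \<open>2 + j\<close> and \<open>- x^k\<close> at position \<open>1 + j\<close>, so
        the coefficients must satisfy
        \<open>\<gamma> j = z (2 + j) + x^k * \<gamma> (Suc j)\<close>.\<close>
      define \<gamma> where "\<gamma> j = (if j = 0 then z 1 else if j \<le> r then \<Sum>i=j..r. monom 1 (k * (i - j)) * z (2 + i) else z (2 + j))" for j
      have "(\<Sum>i<2. z i * \<sigma> 0 i) + (\<Sum>i<c. z (2 + i) * \<sigma> 0 (2 + i)) = 0"
        using z sum_lessThan_add[of "\<lambda>i. z i * \<sigma> 0 i" 2 c] by simp
      then have z0: "z 0 = - monom 1 1 * z 1"
        by (simp add: sum_lessThan_2 \<sigma>_def eq_neg_iff_add_eq_0 mult.commute)
      have "(\<Sum>i<2. z i * \<sigma> 1 i) + (\<Sum>i<c. z (2 + i) * \<sigma> 1 (2 + i)) = 0"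
        using z sum_lessThan_add[of "\<lambda>i. z i * \<sigma> 1 i" 2 c] by simp
      then have "(\<Sum>i<c. if i \<le> r then monom 1 (k * i) * z (2 + i) else 0) = 0"
        by (simp add: sum_lessThan_2 \<sigma>_def if_distrib mult.commute cong: if_cong)
      moreover have "{i. i < c \<and> i \<le> r} = {0..r}" using r by auto
      ultimately have z1: "(\<Sum>i=0..r. monom 1 (k * i) * z (2 + i)) = 0"
        by (simp add: sum.If_cases Int_def)
      have step: "(\<Sum>i=j..r. monom 1 (k * (i - j)) * z (2 + i))
          = z (2 + j) + (if Suc j \<le> r then monom 1 k * \<gamma> (Suc j) else 0)" if "j \<le> r" for j
      proof -
        have "(\<Sum>i=j..r. monom 1 (k * (i - j)) * z (2 + i))
            = z (2 + j) + (\<Sum>i=Suc j..r. monom 1 (k * (i - j)) * z (2 + i))"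
          using that by (simp add: sum.atLeast_Suc_atMost)
        also have "(\<Sum>i=Suc j..r. monom 1 (k * (i - j)) * z (2 + i)) = (\<Sum>i=Suc j..r. monom 1 k * (monom 1 (k * (i - Suc j)) * z (2 + i)))"
        proof (rule sum.cong[OF refl])
          fix i assume "i \<in> {Suc j..r}"
          then have "k * (i - j) = k + k * (i - Suc j)" by (simp add: Suc_diff_Suc[symmetric] flip: mult_Suc_right)
          then show "monom 1 (k * (i - j)) * z (2 + i) = monom 1 k * (monom 1 (k * (i - Suc j)) * z (2 + i))"
            by (simp add: mult_monom flip: mult.assoc)
        qed
        finally show ?thesis by (simp add: \<gamma>_def sum_distrib_left)
      qed
      have "z i = (\<Sum>j<c. \<gamma> j * \<zeta> j i)" if i: "i < 2 + c" for i
      proof -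
        have sum: "(\<Sum>j<c. \<gamma> j * \<zeta> j i) = (if i = 0 then - monom 1 1 * \<gamma> 0 else if i = 1 then \<gamma> 0
            else (if 3 \<le> i then \<gamma> (i - 2) else 0) - (if i - 1 \<le> r then monom 1 k * \<gamma> (i - 1) else 0))"
        proof -
          have "(\<Sum>j<c. \<gamma> j * \<zeta> j i) = (\<Sum>j<c. if j = 0 then \<gamma> 0 * \<zeta> 0 i else 0)
             + (\<Sum>j<c. if j = i - 2 then if 3 \<le> i then \<gamma> (i - 2) else 0 else 0)
             - (\<Sum>j<c. if j = i - 1 then if 2 \<le> i \<and> i - 1 \<le> r then monom 1 k * \<gamma> (i - 1) else 0 else 0)"
            unfolding sum.distrib[symmetric] sum_subtractf[symmetric]
            by (rule sum.cong[OF refl]) (auto simp: \<zeta>_def)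
          then show ?thesis using c i r by (auto simp: \<zeta>_def)
        qed
        consider "i = 0" | "i = 1" | "i = 2" | l where "i = 2 + l" "l \<ge> 1"
          by (metis One_nat_def Suc_1 add_Suc_shift le_add1 nat.exhaust plus_1_eq_Suc)
        then show ?thesis
        proof cases
          case 3
          have "z 2 + (if Suc 0 \<le> r then monom 1 k * \<gamma> (Suc 0) else 0) = 0"
            using step[OF le0, unfolded diff_zero z1] by simp
          then have "z 2 = - (if Suc 0 \<le> r then monom 1 k * \<gamma> (Suc 0) else 0)" by (simp only: eq_neg_iff_add_eq_0)
          then show ?thesis using sum unfolding 3 by simp
        next
          case 4
          have "\<gamma> l = z (2 + l) + (if Suc l \<le> r then monom 1 k * \<gamma> (Suc l) else 0)"
            using step[of l] 4(2) by (simp add: \<gamma>_def[of l])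
          then show ?thesis using 4 sum by simp
        qed (use z0 sum in \<open>simp_all add: \<gamma>_def[of 0]\<close>)
      qed
      then show ?thesis by blast
    qed
    show "\<zeta> j i \<in> forms (int (qt j))" if "j < c" "i < 2 + c" for j i
      unfolding \<zeta>_def qt_def by (auto intro!: forms_diff forms_minus simp: forms_int_iff degree_monom_eq)
    show "b j = 0" if "\<And>i. i < 2 + c \<Longrightarrow> (\<Sum>j<c. b j * coeff (\<zeta> j i) (qt j)) = 0" "j < c" for b j
    proof -
      define i where "i = (if j = 0 then 0 else if j \<le> r then 1 + j else 2 + j)"
      have "(\<Sum>j<c. b j * coeff (\<zeta> j i) (qt j)) = (\<Sum>l<c. if l = j then if j \<le> r then - b j else b j else 0)"
        by (rule sum.cong[OF refl]) (use k in \<open>auto simp: \<zeta>_def qt_def i_def\<close>)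
      then show ?thesis using that(1)[of i] that(2) by (auto simp: i_def split: if_splits)
    qed
    show "bij_betw pr {..<Suc (length ps)} ({..<2} \<times> {..<c})"
      unfolding pr_def by (rule bij_betw_nth_snoc[OF ps])
    fix m \<gamma> l
    assume kill: "\<forall>l<length ps. \<forall>i\<ge>0. coeff (\<gamma> l) i = 0"
      and s: "(\<Sum>l<Suc (length ps). \<gamma> l * (\<Sum>i<2 + c. \<zeta> (snd (pr l)) i * pderiv (\<sigma> (fst (pr l)) i))) = 0"
      and l: "l < Suc (length ps)"
    \<comment> \<open>All gaps are 0, so every coefficient except the last one is killed
      entirely.\<close>
    have 0: "\<gamma> l = 0" if "l < length ps" for l using kill that by (simp add: poly_eq_iff)
    have "(\<Sum>i<2 + c. \<zeta> 0 i * pderiv (\<sigma> 0 i)) = (\<Sum>i\<in>{1}. \<zeta> 0 i * pderiv (\<sigma> 0 i))"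
      by (rule sum.mono_neutral_right) (auto simp: \<zeta>_def \<sigma>_def)
    also have "\<dots> = 1" by (simp add: \<zeta>_def \<sigma>_def monom_Suc pderiv_pCons)
    finally have "\<gamma> (length ps) = 0" using s by (simp add: 0 pr_def)
    then show "\<gamma> l = 0" using l 0 by (cases "l = length ps") auto
  qed
  moreover have "map (\<lambda>l. e (fst (pr l)) + qt (snd (pr l)) + 0) [0..<length ps]
      = map (\<lambda>(a, j). (if a = 0 then 1 else k * r) + (if j = 0 then 1 else if j \<le> r then k else 0)) ps"
    by (rule nth_equalityI) (auto simp: pr_def nth_append e_def qt_def case_prod_unfold)
  ultimately show ?thesis by simp
qed

section \<open>Lowest exponents and graded lists of pairs\<close>

definition lowest :: "'a::zero poly \<Rightarrow> nat \<Rightarrow> bool" where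
  "lowest p k \<longleftrightarrow> (\<forall>t<k. coeff p t = 0) \<and> coeff p k \<noteq> 0"

lemma lowest_monom: "lowest (monom 1 k :: 'a::zero_neq_one poly) k"
  by (simp add: lowest_def)

lemma lowest_mult: "lowest p a \<Longrightarrow> lowest r b \<Longrightarrow> lowest (p * r) (a + b)" for p r :: "'a::idom poly"
  unfolding lowest_def using coeff_mult_lowest[of a p b r] by auto

lemma lowest_0: "lowest p 0 \<longleftrightarrow> poly p 0 \<noteq> 0"
  by (simp add: lowest_def poly_0_coeff_0)

text \<open>The pairs \<open>ps\<close> are listed by lowest exponent \<open>\<nu>\<close>, the gaps being \<open>gs\<close>; where the gap is \<open>0\<close> the
  coefficient polynomial is killed, so that the exponent is irrelevant.\<close>

fun graded_by :: "('b \<Rightarrow> nat) \<Rightarrow> nat \<Rightarrow> 'b list \<Rightarrow> nat list \<Rightarrow> bool" where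
  "graded_by \<nu> s [p] [] \<longleftrightarrow> \<nu> p = s"
| "graded_by \<nu> s (p # ps) (g # gs) \<longleftrightarrow> (g > 0 \<longrightarrow> \<nu> p = s) \<and> graded_by \<nu> (s + g) ps gs"
| "graded_by \<nu> s _ _ \<longleftrightarrow> False"

lemma graded_byD:
  "graded_by \<nu> s ps gs \<Longrightarrow> length ps = Suc (length gs) \<and>
    (\<forall>k\<le>length gs. k = length gs \<or> gs ! k > 0 \<longrightarrow> \<nu> (ps ! k) = s + (\<Sum>l<k. gs ! l))"
proof (induction \<nu> s ps gs rule: graded_by.induct)
  case (2 \<nu> s p ps g gs)
  then have IH: "length ps = Suc (length gs)"
    "\<And>k. k \<le> length gs \<Longrightarrow> k = length gs \<or> gs ! k > 0 \<Longrightarrow> \<nu> (ps ! k) = s + g + (\<Sum>l<k. gs ! l)" by auto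
  have "\<nu> ((p # ps) ! k) = s + (\<Sum>l<k. (g # gs) ! l)"
    if "k \<le> length (g # gs)" "k = length (g # gs) \<or> (g # gs) ! k > 0" for k
  proof (cases k)
    case 0
    then show ?thesis using that 2(2) by auto
  next
    case (Suc k')
    then show ?thesis using that IH(2)[of k'] by (simp add: sum.lessThan_Suc_shift del: sum.lessThan_Suc)
  qed
  then show ?case using IH(1) by simp
qed auto

text \<open>The last pair in \<open>ps\<close> contributes no normal degree: its coefficient is the
  one that is never truncated. The lowest exponent of its pairing is the sum of all gaps.\<close>

lemma (in curve_data) bounded_curve_if_graded:
  assumes ps: "distinct ps" "set ps = {..<2} \<times> {..<c}"
    and low: "\<And>a j. a < 2 \<Longrightarrow> j < c \<Longrightarrow> lowest (\<omega>0 a j) (\<nu> (a, j))"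
    and gr: "graded_by \<nu> 0 ps gs" and Ms: "finite Ms"
  shows "bounded_curve TYPE('a) (2 + c) (M + 2) (map2 (\<lambda>(a, j) g. e a + 1 + qt j + g) ps gs) Ms"
proof -
  note gr' = graded_byD[OF gr]
  have len: "length ps = Suc (length gs)" using conjunct1[OF gr'] .
  have \<nu>: "\<nu> (ps ! k) = (\<Sum>l<k. gs ! l)" if "k \<le> length gs" "k = length gs \<or> gs ! k > 0" for k
    using mp[OF mp[OF spec[OF conjunct2[OF gr']] that(1)] that(2)] by simp
  have mem: "fst (ps ! k) < 2" "snd (ps ! k) < c" if "k \<le> length gs" for k
  proof -
    have "ps ! k \<in> {..<2} \<times> {..<c}" unfolding ps(2)[symmetric] by (rule nth_mem) (simp add: len that le_imp_less_Suc)
    then show "fst (ps ! k) < 2" "snd (ps ! k) < c" by (simp_all add: mem_Times_iff)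
  qed
  have low': "lowest (\<omega>0 (fst (ps ! k)) (snd (ps ! k))) (\<Sum>l<k. gs ! l)" if "k \<le> length gs" "k = length gs \<or> gs ! k > 0" for k
    using low[OF mem[OF that(1)]] \<nu>[OF that] by simp
  have "bounded_curve TYPE('a) (2 + c) (M + 2)
      (map (\<lambda>k. e (fst (ps ! k)) + 1 + qt (snd (ps ! k)) + gs ! k) [0..<length gs]) Ms"
  proof (rule exists_bounded_curve[where g = "\<lambda>k. gs ! k" and pr = "\<lambda>k. ps ! k"])
    show "bij_betw ((!) ps) {..<Suc (length gs)} ({..<2} \<times> {..<c})"
      by (rule bij_betw_nth) (use ps len in auto)
  qed (use low' Ms in \<open>auto simp: lowest_def\<close>)
  moreover have "map (\<lambda>k. e (fst (ps ! k)) + 1 + qt (snd (ps ! k)) + gs ! k) [0..<length gs]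
      = map2 (\<lambda>(a, j) g. e a + 1 + qt j + g) ps gs"
    by (rule nth_equalityI) (use len in \<open>auto simp: case_prod_unfold\<close>)
  ultimately show ?thesis by simp
qed

section \<open>Explicit matrices for n = 5, 4 and 6\<close>

lemma sum_lessThan_3: "(\<Sum>i<3. f i) = f 0 + f 1 + f 2" for f :: "nat \<Rightarrow> 'b::comm_monoid_add"
  by (simp add: numeral_3_eq_3 numeral_2_eq_2 lessThan_Suc add_ac)

lemma sum_lessThan_4: "(\<Sum>i<4. f i) = f 0 + f 1 + f 2 + f 3" for f :: "nat \<Rightarrow> 'b::comm_monoid_add"
  by (simp add: eval_nat_numeral lessThan_Suc add_ac)

lemma less_3_cases: "i < 3 \<Longrightarrow> i = 0 \<or> i = 1 \<or> i = 2" for i :: nat by auto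

lemma less_4_cases: "i < 4 \<Longrightarrow> i = 0 \<or> i = 1 \<or> i = 2 \<or> i = 3" for i :: nat by auto

lemma forms_monom: "int k \<le> e \<Longrightarrow> monom a k \<in> forms e"
  using degree_monom_le[of a k] by (simp add: forms_def)

lemma forms_one: "0 \<le> e \<Longrightarrow> 1 \<in> forms e"
  by (simp add: forms_def)

text \<open>Here \<open>\<psi>\<close> is a pure power of \<open>X\<close>, equal up to sign to the
  determinant of \<open>R\<close>, and each of the six pairings has lowest coefficient 1. Nothing
  can cancel, so the construction works in every characteristic.\<close>

lemma bounded_curve_5:
  assumes e01: "e0 \<ge> 1" "e0 + e1 = 1 + q1 + q2" and Ms: "finite Ms" and le: "q1 \<le> q2" "q2 \<le> e1"
  shows "bounded_curve TYPE('a::alg_closed_field) 5 (e0 + e1 + 2)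
    [e0 + q1 + 2, e0 + q2 + 2, e0 + e1 + 2, e1 + q1 + 2, e1 + q2 + 2] Ms"
proof -
  let ?x = "monom (1 :: 'a)"
  define L where "L = (\<lambda>i j. [[1 + ?x e0, 1], [?x e1, ?x e1]] ! i ! j)"
  define R where "R = (\<lambda>i j. [[1, ?x q1, 0], [0, 0, ?x q2], [- ?x 1, 0, 1]] ! i ! j)"
  define v where "v = (\<lambda>i. [- ?x (1 + q2), 1, - ?x q2] ! i)"
  define y where "y = (\<lambda>i. [0, -1, 0 :: 'a poly] ! i)"
  define e where "e = (\<lambda>a. [e0, e1] ! a)"
  define q where "q = (\<lambda>j. [1, q1, q2] ! j)"
  define qt where "qt = (\<lambda>j. [1, q1 + 1, q2 + 1] ! j)"
  \<comment> \<open>The lowest exponents of the entries of the product of \<open>L\<close> and the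
    first two rows of \<open>R\<close>.\<close>
  define \<nu> where "\<nu> = (\<lambda>(a, j). [[0, q1, q2], [e1, e1 + q1, e1 + q2]] ! a ! j)"
  note defs = L_def R_def v_def y_def e_def q_def qt_def
  interpret curve_data 3 "e0 + e1" L R v y "?x (e0 + e1)" e q qt
  proof
    show "(3::nat) \<ge> 2" "e 0 + e 1 = e0 + e1" by (simp_all add: e_def)
    show "q j \<le> qt j" if "j < 3" for j using less_3_cases[OF that] by (auto simp: defs)
    show "L i b \<in> forms (int (e i))" if "i < 2" "b < 2" for i b
      using less_2_cases[OF that(1)] less_2_cases[OF that(2)]
      by (auto simp: defs intro!: forms_add forms_monom forms_one)
    show "L 0 0 * L 1 1 - L 0 1 * L 1 0 = ?x (e0 + e1)" by (simp add: defs distrib_right mult_monom)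
    show "?x (e0 + e1) \<in> forms (int (e0 + e1))" "coeff (?x (e0 + e1)) (e0 + e1) \<noteq> 0" by (simp_all add: forms_monom)
    show "poly (L 0 0) t \<noteq> 0 \<or> poly (L 0 1) t \<noteq> 0" for t by (simp add: defs)
    show "R i j \<in> forms (int (q j))" if "i < 3" "j < 3" for i j
      using less_3_cases[OF that(1)] less_3_cases[OF that(2)]
      by (auto simp: defs forms_int_iff degree_monom_eq)
    show "[:0, 1:] * R i j \<in> forms (int (qt j))" if "i < 2" "j < 3" for i j
      using less_2_cases[OF that(1)] less_3_cases[OF that(2)]
      by (auto simp: defs forms_X_mult_iff forms_monom forms_one simp del: mult_pCons_left mult_pCons_right)
    show "(\<Sum>i<3. v i * R i j) = ?x (e0 + e1) * y j" if "j < 3" for j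
      using less_3_cases[OF that] e01 by (auto simp: defs sum_lessThan_3 mult_monom ac_simps)
    show "\<exists>i<3. poly (v i) t \<noteq> 0" for t by (rule exI[of _ 1]) (simp add: defs)
    show "\<exists>\<gamma>. \<forall>i<3. z i = (\<Sum>j<3. \<gamma> j * R i j)" if dvd: "?x (e0 + e1) dvd (\<Sum>i<3. v i * z i)" for z
    proof -
      obtain h where h: "(\<Sum>i<3. v i * z i) = ?x (e0 + e1) * h" using dvd unfolding dvd_def by blast
      have M: "?x (e0 + e1) = ?x q2 * (?x 1 * ?x q1)" unfolding mult_monom e01(2) by (simp add: ac_simps)
      have x: "?x (1 + q2) = ?x q2 * ?x 1" by (simp add: mult_monom)
      have "z 1 = ?x (1 + q2) * z 0 + ?x q2 * z 2 + ?x (e0 + e1) * h"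
        unfolding h[symmetric] by (simp add: sum_lessThan_3 v_def)
      then have z1: "z 1 = ?x q2 * (?x 1 * z 0 + z 2 + ?x 1 * ?x q1 * h)"
        unfolding M x by (simp add: algebra_simps)
      define \<gamma> where "\<gamma> = (\<lambda>j. [z 0 + ?x q1 * h, - h, ?x 1 * z 0 + z 2 + ?x 1 * ?x q1 * h] ! j)"
      have "z i = (\<Sum>j<3. \<gamma> j * R i j)" if "i < 3" for i
        using less_3_cases[OF that] z1 by (auto simp: sum_lessThan_3 \<gamma>_def R_def algebra_simps)
      then show ?thesis by blast
    qed
    show "b j = 0" if top: "\<And>i. i < 2 \<Longrightarrow> (\<Sum>j<3. b j * coeff ([:0, 1:] * R i j) (qt j)) = 0"
      and rest: "\<And>i. i < 3 \<Longrightarrow> (\<Sum>j<3. b j * coeff (R i j) (qt j)) = 0" and j: "j < 3" for b j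
    proof -
      have "b 0 = 0" using rest[of 2] by (simp add: sum_lessThan_3 defs)
      moreover have "b 0 + b 1 = 0" using top[of 0] by (simp add: sum_lessThan_3 defs)
      moreover have "b 2 = 0" using top[of 1] by (simp add: sum_lessThan_3 defs)
      ultimately show ?thesis using less_3_cases[OF j] by auto
    qed
  qed
  let ?ps = "[(0, 0), (0, 1), (0, 2), (1, 0), (1, 1), (1, 2)] :: (nat \<times> nat) list"
  have "bounded_curve TYPE('a) (2 + 3) (e0 + e1 + 2) (map2 (\<lambda>(a, j) g. e a + 1 + qt j + g) ?ps [q1, q2 - q1, e1 - q2, q1, q2 - q1]) Ms"
  proof (rule bounded_curve_if_graded[where \<nu> = \<nu>])
    show "set ?ps = {..<2} \<times> {..<3}" by (auto simp: less_Suc_eq eval_nat_numeral)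
    show "lowest (\<omega>0 a j) (\<nu> (a, j))" if "a < 2" "j < 3" for a j
    proof -
      have l: "lowest (1 + ?x e0) 0" using e01 by (simp add: lowest_0 poly_monom power_0_left)
      show ?thesis
        unfolding \<omega>0_def using less_2_cases[OF that(1)] less_3_cases[OF that(2)] l lowest_mult[OF l lowest_monom, of q1]
        by (auto simp: sum_lessThan_2 L_def R_def \<nu>_def mult_monom lowest_monom)
    qed
    show "graded_by \<nu> 0 ?ps [q1, q2 - q1, e1 - q2, q1, q2 - q1]" using le by (auto simp: \<nu>_def)
  qed (use Ms in simp_all)
  then show ?thesis using le by (simp add: e_def qt_def add_ac)
qed


lemma dvd_mult_cancel_if_no_common_zero:
  fixes p r z :: "'a::alg_closed_field poly"
  assumes "\<And>t. poly p t \<noteq> 0 \<or> poly r t \<noteq> 0" "p dvd r * z"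
  shows "p dvd z"
proof -
  have "\<exists>i\<in>{0, 1 :: nat}. poly (if i = 0 then p else r) t \<noteq> 0" for t using assms(1)[of t] by auto
  then obtain h where "(\<Sum>i\<in>{0, 1 :: nat}. h i * (if i = 0 then p else r)) = 1"
    using polynomial_bezout[of "{0, 1 :: nat}" "\<lambda>i. if i = 0 then p else r"] by blast
  then have h: "h 0 * p + h 1 * r = 1" by simp
  have "z = (h 0 * p + h 1 * r) * z" unfolding h by simp
  also have "\<dots> = p * (h 0 * z) + h 1 * (r * z)" by (simp add: algebra_simps)
  finally have "z = p * (h 0 * z) + h 1 * (r * z)" .
  then show ?thesis using assms(2) by (metis dvd_add dvd_mult dvd_triv_left)
qed

text \<open>\<open>R\<close> is diagonal with coprime entries. The corner \<open>L 0 0\<close>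
  contains the extra monomial that makes up for the product of the off-diagonal entries, so that the
  determinant of \<open>L\<close> is \<open>\<psi>\<close>. Its constant term is 2 when
  \<open>p + q' = e1\<close>, whence the restriction on the characteristic.\<close>

lemma bounded_curve_4:
  assumes e01: "e0 \<ge> 1" "p \<le> e0" "q' \<le> e1" "e1 \<le> p + q'" "p + q' \<le> e0 + e1" "p \<le> e1" "q' \<le> p + e1"
    and char: "CHAR('a) = 0" and Ms: "finite Ms"
  shows "bounded_curve TYPE('a::alg_closed_field) 4 (e0 + e1 + 2)
    [2 * e0 + 2 + q', e0 + 2 * e1 + 2 + p - q', e0 + 2 * e1 + 2 - p] Ms"
proof -
  let ?x = "monom (1 :: 'a)"
  define L where "L = (\<lambda>i j. [[1 + ?x e0 + ?x (p + q' - e1), ?x p], [?x q', ?x e1]] ! i ! j)"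
  define R where "R = (\<lambda>i j. [[1 + ?x e0, 0], [0, ?x e1]] ! i ! j)"
  define v where "v = (\<lambda>i. [?x e1, 1 + ?x e0] ! i)"
  define y where "y = (\<lambda>i. [1, 1 :: 'a poly] ! i)"
  define e where "e = (\<lambda>a. [e0, e1] ! a)"
  define q where "q = e"
  define qt where "qt = (\<lambda>j. e j + 1)"
  define \<nu> where "\<nu> = (\<lambda>(a, j). [[0, p + e1], [q', 2 * e1]] ! a ! j)"
  define \<psi> where "\<psi> = ?x e1 * (1 + ?x e0)"
  note defs = L_def R_def v_def y_def e_def q_def qt_def \<psi>_def
  have two: "(2 :: 'a) \<noteq> 0" using char of_nat_eq_0_iff_char_dvd[of 2, where 'a = 'a] by simp
  have L00: "poly (1 + ?x e0 + ?x (p + q' - e1)) 0 \<noteq> 0"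
    using e01(1) two by (cases "p + q' - e1") (simp_all add: poly_monom power_0_left)
  interpret curve_data 2 "e0 + e1" L R v y \<psi> e q qt
  proof
    show "(2::nat) \<ge> 2" "e 0 + e 1 = e0 + e1" by (simp_all add: e_def)
    show "q j \<le> qt j" if "j < 2" for j using less_2_cases[OF that] by (auto simp: defs)
    show "L i b \<in> forms (int (e i))" if "i < 2" "b < 2" for i b
      using less_2_cases[OF that(1)] less_2_cases[OF that(2)] e01
      by (auto simp: defs intro!: forms_add forms_monom forms_one)
    have "?x (p + q' - e1) * ?x e1 = ?x (p + q')" using e01 by (simp add: mult_monom)
    then show "L 0 0 * L 1 1 - L 0 1 * L 1 0 = \<psi>" by (simp add: defs mult_monom algebra_simps)
    show "\<psi> \<in> forms (int (e0 + e1))" "coeff \<psi> (e0 + e1) \<noteq> 0"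
      using e01 by (auto simp: \<psi>_def distrib_left mult_monom intro!: forms_add forms_monom)
    show "poly (L 0 0) t \<noteq> 0 \<or> poly (L 0 1) t \<noteq> 0" for t
      using L00 by (cases "t = 0") (auto simp: L_def poly_monom)
    show "R i j \<in> forms (int (q j))" if "i < 2" "j < 2" for i j
      using less_2_cases[OF that(1)] less_2_cases[OF that(2)]
      by (auto simp: defs intro!: forms_add forms_monom forms_one)
    show "[:0, 1:] * R i j \<in> forms (int (qt j))" if "i < 2" "j < 2" for i j
      using less_2_cases[OF that(1)] less_2_cases[OF that(2)]
      by (auto simp: defs forms_X_mult_iff intro!: forms_add forms_monom forms_one simp del: mult_pCons_left mult_pCons_right)
    show "(\<Sum>i<2. v i * R i j) = \<psi> * y j" if "j < 2" for j
      using less_2_cases[OF that] by (auto simp: defs sum_lessThan_2 ac_simps)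
    show "\<exists>i<2. poly (v i) t \<noteq> 0" for t
    proof (cases "t = 0")
      case True
      then show ?thesis using e01(1) by (intro exI[of _ 1]) (simp add: v_def poly_monom power_0_left)
    qed (intro exI[of _ 0], simp add: v_def poly_monom)
    show "\<exists>\<gamma>. \<forall>i<2. z i = (\<Sum>j<2. \<gamma> j * R i j)" if dvd: "\<psi> dvd (\<Sum>i<2. v i * z i)" for z
    proof -
      let ?s = "?x e1 * z 0 + (1 + ?x e0) * z 1"
      have s: "\<psi> dvd ?s" using dvd by (simp add: sum_lessThan_2 v_def)
      have "1 + ?x e0 dvd ?s" "?x e1 dvd ?s"
        by (rule dvd_trans[OF _ s], simp add: \<psi>_def)+
      then have "1 + ?x e0 dvd ?x e1 * z 0" "?x e1 dvd (1 + ?x e0) * z 1"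
        by (simp_all add: dvd_add_left_iff dvd_add_right_iff)
      moreover have nz: "poly (1 + ?x e0) t \<noteq> 0 \<or> poly (?x e1) t \<noteq> 0" for t
        using e01(1) by (cases "t = 0") (simp_all add: poly_monom power_0_left)
      ultimately have "1 + ?x e0 dvd z 0" "?x e1 dvd z 1"
        using dvd_mult_cancel_if_no_common_zero[of "1 + ?x e0" "?x e1" "z 0"]
          dvd_mult_cancel_if_no_common_zero[of "?x e1" "1 + ?x e0" "z 1"] nz by blast+
      then obtain g0 g1 where g: "z 0 = (1 + ?x e0) * g0" "z 1 = ?x e1 * g1" unfolding dvd_def by blast
      have "z i = (\<Sum>j<2. [g0, g1] ! j * R i j)" if "i < 2" for i
        using less_2_cases[OF that] g by (auto simp: sum_lessThan_2 R_def)
      then show ?thesis by (intro exI[of _ "\<lambda>j. [g0, g1] ! j"]) blast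
    qed
    show "b j = 0" if top: "\<And>i. i < 2 \<Longrightarrow> (\<Sum>j<2. b j * coeff ([:0, 1:] * R i j) (qt j)) = 0" and j: "j < 2" for b j
      using top[of 0] top[of 1] less_2_cases[OF j] e01(1) by (auto simp: sum_lessThan_2 defs coeff_pCons split: nat.splits)
  qed
  let ?ps = "[(0, 0), (1, 0), (0, 1), (1, 1)] :: (nat \<times> nat) list"
  have "bounded_curve TYPE('a) (2 + 2) (e0 + e1 + 2) (map2 (\<lambda>(a, j) g. e a + 1 + qt j + g) ?ps [q', p + e1 - q', e1 - p]) Ms"
  proof (rule bounded_curve_if_graded[where \<nu> = \<nu>])
    show "set ?ps = {..<2} \<times> {..<2}" by (auto simp: less_Suc_eq eval_nat_numeral)
    show "lowest (\<omega>0 a j) (\<nu> (a, j))" if "a < 2" "j < 2" for a j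
    proof -
      have Y: "lowest (1 + ?x e0) 0" using e01 by (simp add: lowest_0 poly_monom power_0_left)
      have L: "lowest (1 + ?x e0 + ?x (p + q' - e1)) 0" using L00 by (simp add: lowest_0)
      show ?thesis
        unfolding \<omega>0_def using less_2_cases[OF that(1)] less_2_cases[OF that(2)] lowest_mult[OF L Y] lowest_mult[OF lowest_monom Y, of q']
          lowest_monom[of "p + e1", where 'a = 'a] lowest_monom[of "2 * e1", where 'a = 'a]
        by (auto simp: sum_lessThan_2 L_def R_def \<nu>_def mult_monom mult_2)
    qed
    show "graded_by \<nu> 0 ?ps [q', p + e1 - q', e1 - p]" using e01 by (auto simp: \<nu>_def)
  qed (use Ms in simp_all)
  moreover have "map2 (\<lambda>(a, j) g. e a + 1 + qt j + g) ?ps [q', p + e1 - q', e1 - p]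
      = [2 * e0 + 2 + q', e0 + 2 * e1 + 2 + p - q', e0 + 2 * e1 + 2 - p]"
    using e01 by (auto simp: e_def qt_def)
  ultimately show ?thesis by simp
qed

text \<open>The polynomials \<open>l\<close>, \<open>Y\<close> and \<open>Z\<close> are sums of
  monomials, so in characteristic 0 no coefficient cancels. The binomials \<open>Y\<close> and
  \<open>Z\<close> have lowest exponents \<open>\<alpha>\<close> and \<open>\<beta>\<close> below
  their degrees, which gives the freedom needed to balance. The alternative
  \<open>q0 + \<alpha> + \<beta> = e1\<close> or \<open>p + q' = e1\<close> says that
  \<open>l\<close> has a nonzero constant term.\<close>

lemma bounded_curve_6:
  fixes e0 e1 q0 q1 q2 q3 p q' \<alpha> \<beta> :: nat and ps :: "(nat \<times> nat) list"
  defines "\<nu> \<equiv> (\<lambda>(a, j). [[0, \<alpha>, p + \<beta>, p + q3], [q', q' + \<alpha>, e1 + \<beta>, e1 + q3]] ! a ! j)"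
  assumes q: "q0 \<ge> 1" "\<alpha> \<le> q1" "\<beta> < q2" "q0 + q1 + q2 + q3 = e0 + e1"
    and pq: "e1 \<le> q0 + \<alpha> + \<beta>" "e1 \<le> p + q'" "q0 + \<alpha> + \<beta> = e1 \<or> p + q' = e1" "p \<le> e0" "q' \<le> e1" "p + q' \<le> e0 + e1"
    and char: "CHAR('a) = 0" and Ms: "finite Ms"
    and ps: "distinct ps" "set ps = {..<2} \<times> {..<4}" "graded_by \<nu> 0 ps gs"
  shows "bounded_curve TYPE('a::alg_closed_field) 6 (e0 + e1 + 2)
    (map2 (\<lambda>(a, j) g. [e0, e1] ! a + 1 + [q0, q1 + 1, q2, q3 + 1] ! j + g) ps gs) Ms"
proof -
  let ?x = "monom (1 :: 'a)"
  define Y where "Y = ?x \<alpha> + ?x q1"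
  define Z where "Z = ?x \<beta> + ?x (q2 + q3)"
  define \<psi> where "\<psi> = ?x q0 * Y * Z"
  \<comment> \<open>The corner of \<open>L\<close> is forced by the determinant:
    \<open>l * x^e1 = \<psi> + x^(p + q')\<close>.\<close>
  define l where "l = ?x (q0 + \<alpha> + \<beta> - e1) + ?x (q0 + \<alpha> + (q2 + q3) - e1) + ?x (q0 + q1 + \<beta> - e1)
    + ?x (q0 + q1 + (q2 + q3) - e1) + ?x (p + q' - e1)"
  define L where "L = (\<lambda>i j. [[l, ?x p], [?x q', ?x e1]] ! i ! j)"
  define R where "R = (\<lambda>i j. [[1, Y, 0, 0], [0, 0, ?x \<beta>, ?x q3], [- ?x q0, 0, 1, 0], [0, 0, - ?x q2, 1]] ! i ! j)"
  define v where "v = (\<lambda>i. [?x q0 * Z, -1, Z, ?x q3] ! i)"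
  define y where "y = (\<lambda>i. [0, 1, 0, 0 :: 'a poly] ! i)"
  define e where "e = (\<lambda>a. [e0, e1] ! a)"
  define qs where "qs = (\<lambda>j. [q0, q1, q2, q3] ! j)"
  define qt where "qt = (\<lambda>j. [q0, q1 + 1, q2, q3 + 1] ! j)"
  note defs = L_def R_def v_def y_def e_def qs_def qt_def
  have nat0: "of_nat k \<noteq> (0 :: 'a)" if "k \<noteq> 0" for k
    using char that of_nat_eq_0_iff_char_dvd[of k, where 'a = 'a] by simp
  have psi: "\<psi> = ?x (q0 + \<alpha> + \<beta>) + ?x (q0 + \<alpha> + (q2 + q3)) + ?x (q0 + q1 + \<beta>) + ?x (q0 + q1 + (q2 + q3))"
    by (simp add: \<psi>_def Y_def Z_def algebra_simps mult_monom)
  have l: "l * ?x e1 = \<psi> + ?x (p + q')"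
    unfolding psi l_def using q pq by (simp add: distrib_right mult_monom)
  have l0: "poly l 0 \<noteq> 0"
  proof -
    have x0: "poly (?x k) 0 = of_nat (if k = 0 then 1 else 0)" for k by (simp add: poly_monom power_0_left)
    show ?thesis unfolding l_def poly_add x0 of_nat_add[symmetric] using pq(3) by (intro nat0) auto
  qed
  have Y: "lowest Y \<alpha>"
  proof -
    have "coeff Y \<alpha> = of_nat (if \<alpha> = q1 then 2 else 1)" by (simp add: Y_def)
    then have "coeff Y \<alpha> \<noteq> 0" using nat0[of 2] by simp
    then show ?thesis using q(2) by (simp add: lowest_def Y_def)
  qed
  interpret curve_data 4 "e0 + e1" L R v y \<psi> e qs qt
  proof
    show "(4::nat) \<ge> 2" "e 0 + e 1 = e0 + e1" by (simp_all add: e_def)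
    show "qs j \<le> qt j" if "j < 4" for j using less_4_cases[OF that] by (auto simp: defs)
    show "L i b \<in> forms (int (e i))" if "i < 2" "b < 2" for i b
      using less_2_cases[OF that(1)] less_2_cases[OF that(2)] q pq
      by (auto simp: defs l_def intro!: forms_add forms_monom forms_one)
    show "L 0 0 * L 1 1 - L 0 1 * L 1 0 = \<psi>" by (simp add: L_def l mult_monom)
    show "\<psi> \<in> forms (int (e0 + e1))"
      unfolding psi using q by (intro forms_add forms_monom) auto
    have xM: "coeff (?x k) M = of_nat (if k = M then 1 else 0)" for k M by simp
    show "coeff \<psi> (e0 + e1) \<noteq> 0"
      unfolding psi coeff_add xM of_nat_add[symmetric] using q by (intro nat0) auto
    show "poly (L 0 0) t \<noteq> 0 \<or> poly (L 0 1) t \<noteq> 0" for t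
      using l0 by (cases "t = 0") (auto simp: L_def poly_monom)
    show "R i j \<in> forms (int (qs j))" if "i < 4" "j < 4" for i j
      using less_4_cases[OF that(1)] less_4_cases[OF that(2)] q
      by (auto simp: defs Y_def intro!: forms_add forms_monom forms_one forms_minus)
    show "[:0, 1:] * R i j \<in> forms (int (qt j))" if "i < 2" "j < 4" for i j
      using less_2_cases[OF that(1)] less_4_cases[OF that(2)] q
      by (auto simp: defs Y_def forms_X_mult_iff intro!: forms_add forms_monom forms_one simp del: mult_pCons_left mult_pCons_right)
    show "(\<Sum>i<4. v i * R i j) = \<psi> * y j" if "j < 4" for j
      using less_4_cases[OF that] by (auto simp: defs sum_lessThan_4 \<psi>_def Z_def mult_monom algebra_simps)
    show "\<exists>i<4. poly (v i) t \<noteq> 0" for t by (rule exI[of _ 1]) (simp add: v_def)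
    show "\<exists>\<gamma>. \<forall>i<4. z i = (\<Sum>j<4. \<gamma> j * R i j)" if dvd: "\<psi> dvd (\<Sum>i<4. v i * z i)" for z
    proof -
      obtain h where h: "(\<Sum>i<4. v i * z i) = \<psi> * h" using dvd unfolding dvd_def by blast
      have z1: "z 1 = ?x q0 * Z * z 0 + Z * z 2 + ?x q3 * z 3 - \<psi> * h"
        unfolding h[symmetric] by (simp add: sum_lessThan_4 v_def)
      define g0 where "g0 = z 0 - Y * h"
      define g2 where "g2 = z 2 + ?x q0 * g0"
      define \<gamma> where "\<gamma> = (\<lambda>j. [g0, h, g2, z 3 + ?x q2 * g2] ! j)"
      have "?x \<beta> * g2 + ?x q3 * (z 3 + ?x q2 * g2) = Z * g2 + ?x q3 * z 3"
        by (simp add: Z_def algebra_simps mult_monom flip: mult.assoc)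
      also have "\<dots> = z 1" unfolding z1 \<psi>_def g2_def g0_def by (simp add: algebra_simps)
      finally have "z 1 = ?x \<beta> * g2 + ?x q3 * (z 3 + ?x q2 * g2)" ..
      then have "z i = (\<Sum>j<4. \<gamma> j * R i j)" if "i < 4" for i
        using less_4_cases[OF that] by (auto simp: sum_lessThan_4 \<gamma>_def R_def g0_def g2_def algebra_simps)
      then show ?thesis by blast
    qed
    show "b j = 0" if top: "\<And>i. i < 2 \<Longrightarrow> (\<Sum>j<4. b j * coeff ([:0, 1:] * R i j) (qt j)) = 0"
      and rest: "\<And>i. i < 4 \<Longrightarrow> (\<Sum>j<4. b j * coeff (R i j) (qt j)) = 0" and j: "j < 4" for b j
    proof -
      have b0: "b 0 = 0" using rest[of 2] q by (simp add: sum_lessThan_4 defs)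
      have b2: "b 2 = 0" using rest[of 3] by (simp add: sum_lessThan_4 defs)
      have "coeff Y q1 = of_nat (if \<alpha> = q1 then 2 else 1)" by (simp add: Y_def)
      then have "coeff Y q1 \<noteq> 0" using nat0[of 2] by simp
      then have "b 1 = 0" using top[of 0] b0 by (simp add: sum_lessThan_4 defs)
      moreover have "b 3 = 0" using top[of 1] b2 by (simp add: sum_lessThan_4 defs)
      ultimately show ?thesis using b0 b2 less_4_cases[OF j] by auto
    qed
  qed
  have "bounded_curve TYPE('a) (2 + 4) (e0 + e1 + 2) (map2 (\<lambda>(a, j) g. e a + 1 + qt j + g) ps gs) Ms"
  proof (rule bounded_curve_if_graded[OF ps(1,2) _ ps(3) Ms])
    show "lowest (\<omega>0 a j) (\<nu> (a, j))" if "a < 2" "j < 4" for a j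
    proof -
      have "lowest l 0" using l0 by (simp add: lowest_0)
      then show ?thesis
        unfolding \<omega>0_def
        using less_2_cases[OF that(1)] less_4_cases[OF that(2)] lowest_mult[OF \<open>lowest l 0\<close> Y] lowest_mult[OF lowest_monom Y, of q']
        by (auto simp: sum_lessThan_2 L_def R_def \<nu>_def mult_monom lowest_monom)
    qed
  qed
  then show ?thesis by (simp add: e_def qt_def)
qed

text \<open>The normal bundle has rank \<open>2 * n - 5\<close> and degree
  \<open>n * d - 2\<close>.\<close>

definition balanced_degrees :: "nat \<Rightarrow> nat \<Rightarrow> nat list \<Rightarrow> bool" where
  "balanced_degrees n d as \<longleftrightarrow> length as = 2 * n - 5 \<and> sum_list as + 2 = n * d \<and> (\<forall>x\<in>set as. \<forall>y\<in>set as. x \<le> y + 1)"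

definition balanced_example :: "'a::alg_closed_field itself \<Rightarrow> nat \<Rightarrow> nat \<Rightarrow> bool" where
  "balanced_example T n d \<longleftrightarrow> (\<exists>as. balanced_degrees n d as \<and> (\<forall>Ms. finite Ms \<longrightarrow> bounded_curve T n d as Ms))"

lemma balanced_exampleI:
  "(\<And>Ms. finite Ms \<Longrightarrow> bounded_curve T n d as Ms) \<Longrightarrow> balanced_degrees n d as \<Longrightarrow> balanced_example T n d"
  unfolding balanced_example_def by blast

text \<open>
  The parameters were found by a computer search. Increasing \<open>u\<close> by one raises \<open>d\<close> by \<open>14\<close> and all degrees
  by \<open>12\<close>.
\<close>

lemma balanced_example_6_even:
  fixes u e0 e1 q0 q1 q2 q3 p q' \<alpha> \<beta> g0 g1 g2 g3 g4 g5 g6 :: nat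
  assumes tab: "(e0, e1, q0, q1, q2, q3, p, q', \<alpha>, \<beta>, g0, g1, g2, g3, g4, g5, g6) \<in>
     {(3, 3, 2, 1, 2, 1, 1, 2, 1, 0, 1, 0, 1, 0, 1, 0, 1),
      (4, 4, 3, 1, 2, 2, 1, 3, 1, 1, 1, 1, 1, 0, 1, 1, 1),
      (5, 5, 3, 2, 3, 2, 1, 4, 1, 1, 1, 1, 1, 1, 1, 1, 1),
      (6, 6, 2, 3, 4, 3, 1, 5, 2, 2, 2, 1, 1, 1, 2, 1, 1),
      (7, 7, 1, 4, 5, 4, 1, 6, 4, 3, 4, 0, 1, 1, 4, 0, 1),
      (8, 8, 2, 4, 5, 5, 1, 7, 4, 4, 4, 1, 1, 1, 4, 1, 1),
      (9, 9, 3, 5, 6, 4, 2, 7, 4, 3, 4, 1, 1, 1, 4, 1, 1)}"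
    and char: "CHAR('a::alg_closed_field) = 0"
  shows "balanced_example TYPE('a) 6 (e0 + e1 + 14 * u + 2)"
proof (rule balanced_exampleI)
  let ?ps = "[(0, 0), (0, 1), (0, 2), (0, 3), (1, 0), (1, 1), (1, 2), (1, 3)] :: (nat \<times> nat) list"
  let ?gs = "[g0 + 5 * u, g1, g2, g3 + u, g4 + 5 * u, g5, g6]"
  let ?as = "map2 (\<lambda>(a, j) g. [e0 + 7 * u, e1 + 7 * u] ! a + 1 + [q0, q1 + 5 * u + 1, q2 + 5 * u, q3 + 4 * u + 1] ! j + g) ?ps ?gs"
  show "bounded_curve TYPE('a) 6 (e0 + e1 + 14 * u + 2) ?as Ms" if Ms: "finite Ms" for Ms
  proof -
    have "bounded_curve TYPE('a) 6 ((e0 + 7 * u) + (e1 + 7 * u) + 2) ?as Ms"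
    proof (rule bounded_curve_6[where ?e0.0 = "e0 + 7 * u" and ?e1.0 = "e1 + 7 * u" and ?q0.0 = "q0" and ?q1.0 = "q1 + 5 * u" and ?q2.0 = "q2 + 5 * u" and ?q3.0 = "q3 + 4 * u" and p = "p + u" and q' = "q' + 6 * u" and \<alpha> = "\<alpha> + 5 * u" and \<beta> = "\<beta> + 4 * u"])
      show "set ?ps = {..<2} \<times> {..<4}" by (auto simp: less_Suc_eq eval_nat_numeral)
    qed (use tab char Ms in \<open>auto simp del: One_nat_def\<close>)
    then show ?thesis by (simp add: add_ac)
  qed
  show "balanced_degrees 6 (e0 + e1 + 14 * u + 2) ?as" using tab by (auto simp: balanced_degrees_def)
qed

lemma balanced_example_6_odd:
  fixes u e0 e1 q0 q1 q2 q3 p q' \<alpha> \<beta> g0 g1 g2 g3 g4 g5 g6 :: nat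
  assumes tab: "(e0, e1, q0, q1, q2, q3, p, q', \<alpha>, \<beta>, g0, g1, g2, g3, g4, g5, g6) \<in>
     {(2, 3, 1, 1, 2, 1, 1, 3, 1, 1, 1, 1, 0, 1, 1, 0, 0),
      (3, 4, 2, 1, 2, 2, 1, 4, 1, 1, 1, 1, 1, 1, 1, 0, 1),
      (4, 5, 2, 2, 3, 2, 2, 5, 2, 1, 2, 1, 1, 1, 1, 1, 0),
      (5, 6, 3, 2, 3, 3, 2, 6, 2, 1, 2, 1, 2, 1, 1, 1, 1),
      (6, 7, 2, 3, 4, 4, 2, 7, 3, 2, 3, 1, 2, 1, 2, 1, 1),
      (7, 8, 3, 3, 5, 4, 3, 8, 3, 2, 3, 2, 2, 1, 2, 1, 1),
      (8, 9, 4, 4, 5, 4, 3, 9, 3, 2, 3, 2, 2, 2, 2, 1, 1)}"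
    and char: "CHAR('a::alg_closed_field) = 0"
  shows "balanced_example TYPE('a) 6 (e0 + e1 + 14 * u + 2)"
proof (rule balanced_exampleI)
  let ?ps = "[(0, 0), (0, 1), (0, 2), (0, 3), (1, 0), (1, 2), (1, 1), (1, 3)] :: (nat \<times> nat) list"
  let ?gs = "[g0 + 3 * u, g1, g2, g3 + 3 * u, g4 + 3 * u, g5, g6]"
  let ?as = "map2 (\<lambda>(a, j) g. [e0 + 7 * u, e1 + 7 * u] ! a + 1 + [q0 + 2 * u, q1 + 5 * u + 1, q2 + 5 * u, q3 + 2 * u + 1] ! j + g) ?ps ?gs"
  show "bounded_curve TYPE('a) 6 (e0 + e1 + 14 * u + 2) ?as Ms" if Ms: "finite Ms" for Ms
  proof -
    have "bounded_curve TYPE('a) 6 ((e0 + 7 * u) + (e1 + 7 * u) + 2) ?as Ms"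
    proof (rule bounded_curve_6[where ?e0.0 = "e0 + 7 * u" and ?e1.0 = "e1 + 7 * u" and ?q0.0 = "q0 + 2 * u" and ?q1.0 = "q1 + 5 * u" and ?q2.0 = "q2 + 5 * u" and ?q3.0 = "q3 + 2 * u" and p = "p + u" and q' = "q' + 6 * u" and \<alpha> = "\<alpha> + 3 * u" and \<beta> = "\<beta> + 2 * u"])
      show "set ?ps = {..<2} \<times> {..<4}" by (auto simp: less_Suc_eq eval_nat_numeral)
    qed (use tab char Ms in \<open>auto simp del: One_nat_def\<close>)
    then show ?thesis by (simp add: add_ac)
  qed
  show "balanced_degrees 6 (e0 + e1 + 14 * u + 2) ?as" using tab by (auto simp: balanced_degrees_def)
qed

lemma balanced_example_monomial:
  fixes ps :: "(nat \<times> nat) list"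
  assumes "c \<ge> 2" "k \<ge> 1" "r < c" "distinct ps" "(0, 0) \<notin> set ps" "insert (0, 0) (set ps) = {..<2} \<times> {..<c}"
    and "balanced_degrees (2 + c) (1 + k * r)
      (map (\<lambda>(a, j). (if a = 0 then 1 else k * r) + (if j = 0 then 1 else if j \<le> r then k else 0)) ps)"
  shows "balanced_example TYPE('a::alg_closed_field) (2 + c) (1 + k * r)"
  using monomial_curve[OF assms(1-6)] assms(7) by (rule balanced_exampleI)

section \<open>Examples in every degree\<close>

lemma degree_cases:
  "d \<ge> 1 \<Longrightarrow> d = 1 \<or> d = 2 \<or> d = 3 \<or> (\<exists>t\<ge>1. d = 2 * t + 2) \<or> (\<exists>t\<ge>1. d = 2 * t + 3)" for d :: nat
  by presburger

text \<open>One period adds 7 to each of \<open>e0\<close> and \<open>e1\<close> and 12 to each of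
  the seven normal degrees. The base cases of the two families are the even degrees from 8 to 20 and
  the odd degrees from 7 to 19.\<close>

lemma degree_cases_mod_14:
  "d \<ge> 1 \<Longrightarrow> d \<noteq> 3 \<Longrightarrow> d \<noteq> 5 \<Longrightarrow> d = 1 \<or> d = 2 \<or> d = 4 \<or> d = 6 \<or>
    (\<exists>u k. d = 14 * u + 2 * k + 8 \<and> k < 7) \<or> (\<exists>u k. d = 14 * u + 2 * k + 7 \<and> k < 7)" for d :: nat
  by presburger

lemma balanced_example_4:
  assumes d: "d \<ge> 1" and char: "CHAR('a) = 0"
  shows "balanced_example TYPE('a::alg_closed_field) 4 d"
proof -
  let ?ps = "[(0, 1), (1, 0), (1, 1)] :: (nat \<times> nat) list"
  have ps: "insert (0, 0) (set ?ps) = {..<2} \<times> {..<2}" by (auto simp: less_Suc_eq eval_nat_numeral)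
  consider "d = 1" | "d = 2" | "d = 3" | t where "d = 2 * t + 2" "t \<ge> 1" | t where "d = 2 * t + 3" "t \<ge> 1"
    using degree_cases[OF d] by blast
  then show ?thesis
  proof cases
    case 1
    have "balanced_example TYPE('a) (2 + 2) (1 + 1 * 0)"
      by (rule balanced_example_monomial[OF _ _ _ _ _ ps]) (auto simp: balanced_degrees_def)
    then show ?thesis using 1 by simp
  next
    case 2
    have "balanced_example TYPE('a) (2 + 2) (1 + 1 * 1)"
      by (rule balanced_example_monomial[OF _ _ _ _ _ ps]) (auto simp: balanced_degrees_def)
    then show ?thesis using 2 by (simp add: eval_nat_numeral)
  next
    case 3
    have "balanced_example TYPE('a) (2 + 2) (1 + 2 * 1)"
      by (rule balanced_example_monomial[OF _ _ _ _ _ ps]) (auto simp: balanced_degrees_def)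
    then show ?thesis using 3 by (simp add: eval_nat_numeral)
  next
    case (4 t)
    \<comment> \<open>With \<open>e0 = e1 = t\<close>, \<open>q' = w\<close> and
      \<open>p = t - w\<close> the degrees are \<open>2 * t + 2\<close> plus \<open>w\<close>,
      \<open>2 * (t - w)\<close> and \<open>w\<close>. They are balanced when \<open>w\<close> is
      the integer nearest to \<open>2 * t / 3\<close>.\<close>
    define w where "w = (2 * t + 1) div 3"
    have w: "w \<le> t" "3 * w \<le> 2 * t + 1" "2 * t + 1 < 3 * w + 3" using 4 unfolding w_def by linarith+
    define p where "p = t - w"
    have t: "t = w + p" using w by (simp add: p_def)
    show ?thesis
    proof (rule balanced_exampleI)
      fix Ms :: "nat set" assume Ms: "finite Ms"
      have "bounded_curve TYPE('a) 4 (t + t + 2) [2 * t + 2 + w, t + 2 * t + 2 + p - w, t + 2 * t + 2 - p] Ms"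
        by (rule bounded_curve_4[OF _ _ _ _ _ _ _ char Ms]) (use 4 w t in linarith)+
      moreover have "t + 2 * t + 2 + p - w = 2 * t + 2 + 2 * p" "t + 2 * t + 2 - p = 2 * t + 2 + w" "t + t + 2 = d"
        using t 4 by linarith+
      ultimately show "bounded_curve TYPE('a) 4 d [2 * t + 2 + w, 2 * t + 2 + 2 * p, 2 * t + 2 + w] Ms" by (simp only:)
    next
      show "balanced_degrees 4 d [2 * t + 2 + w, 2 * t + 2 + 2 * p, 2 * t + 2 + w]"
        using 4 w t by (simp add: balanced_degrees_def)
    qed
  next
    case (5 t)
    \<comment> \<open>Odd degree uses \<open>e0 = t\<close>, \<open>e1 = t + 1\<close>,
      \<open>q' = w + 1\<close> and \<open>p = t + 1 - w\<close>. Balance now requires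
      \<open>w\<close> to be the integer nearest to \<open>(2 * t + 1) / 3\<close>.\<close>
    define w where "w = (2 * t + 2) div 3"
    have w: "w \<ge> 1" "w \<le> t" "3 * w \<le> 2 * t + 2" "2 * t + 2 < 3 * w + 3" using 5 unfolding w_def by linarith+
    define p where "p = t + 1 - w"
    define w' where "w' = w - 1"
    have t: "w = w' + 1" "t = w' + p" using w by (simp_all add: p_def w'_def)
    show ?thesis
    proof (rule balanced_exampleI)
      fix Ms :: "nat set" assume Ms: "finite Ms"
      have "bounded_curve TYPE('a) 4 (t + (t + 1) + 2) [2 * t + 2 + (w + 1), t + 2 * (t + 1) + 2 + p - (w + 1), t + 2 * (t + 1) + 2 - p] Ms"
        by (rule bounded_curve_4[OF _ _ _ _ _ _ _ char Ms]) (use 5 w t in linarith)+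
      moreover have "t + 2 * (t + 1) + 2 + p - (w + 1) = 2 * t + 2 + 2 * p" "t + 2 * (t + 1) + 2 - p = 2 * t + 3 + w" "t + (t + 1) + 2 = d"
          "2 * t + 2 + (w + 1) = 2 * t + 3 + w"
        by (simp_all add: 5(1)) (simp_all add: t)
      ultimately show "bounded_curve TYPE('a) 4 d [2 * t + 3 + w, 2 * t + 2 + 2 * p, 2 * t + 3 + w] Ms" by (simp only:)
    next
      show "balanced_degrees 4 d [2 * t + 3 + w, 2 * t + 2 + 2 * p, 2 * t + 3 + w]"
        using 5 w t by (simp add: balanced_degrees_def)
    qed
  qed
qed

text \<open>For even \<open>d\<close> the parameters are \<open>e0 = e1 = q2 = q1 + 1\<close>, for
  odd \<open>d\<close> they are \<open>e0 = q1 = q2 = e1 - 1\<close>; then all five degrees differ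
  by at most 1. The monomial curves cover \<open>d \<le> 3\<close>.\<close>

lemma balanced_example_5:
  assumes d: "d \<ge> 1"
  shows "balanced_example TYPE('a::alg_closed_field) 5 d"
proof -
  let ?ps = "[(0, 1), (0, 2), (1, 0), (1, 1), (1, 2)] :: (nat \<times> nat) list"
  have ps: "insert (0, 0) (set ?ps) = {..<2} \<times> {..<3}" by (auto simp: less_Suc_eq eval_nat_numeral)
  consider "d = 1" | "d = 2" | "d = 3" | t where "d = 2 * t + 2" "t \<ge> 1" | t where "d = 2 * t + 3" "t \<ge> 1"
    using degree_cases[OF d] by blast
  then show ?thesis
  proof cases
    case 1
    have "balanced_example TYPE('a) (2 + 3) (1 + 1 * 0)"
      by (rule balanced_example_monomial[OF _ _ _ _ _ ps]) (auto simp: balanced_degrees_def)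
    then show ?thesis using 1 by simp
  next
    case 2
    have "balanced_example TYPE('a) (2 + 3) (1 + 1 * 1)"
      by (rule balanced_example_monomial[OF _ _ _ _ _ ps]) (auto simp: balanced_degrees_def)
    then show ?thesis using 2 by (simp add: eval_nat_numeral)
  next
    case 3
    have "balanced_example TYPE('a) (2 + 3) (1 + 1 * 2)"
      by (rule balanced_example_monomial[OF _ _ _ _ _ ps]) (auto simp: balanced_degrees_def)
    then show ?thesis using 3 by (simp add: eval_nat_numeral)
  next
    case (4 t)
    define s where "s = t - 1"
    have t: "d = (s + 1) + (s + 1) + 2" using 4 by (simp add: s_def)
    show ?thesis
    proof (rule balanced_exampleI)
      show "bounded_curve TYPE('a) 5 d [(s + 1) + s + 2, (s + 1) + (s + 1) + 2, (s + 1) + (s + 1) + 2, (s + 1) + s + 2, (s + 1) + (s + 1) + 2] Ms"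
        if "finite Ms" for Ms
        unfolding t by (rule bounded_curve_5[OF _ _ that]) simp_all
      show "balanced_degrees 5 d [(s + 1) + s + 2, (s + 1) + (s + 1) + 2, (s + 1) + (s + 1) + 2, (s + 1) + s + 2, (s + 1) + (s + 1) + 2]"
        using t by (simp add: balanced_degrees_def)
    qed
  next
    case (5 t)
    then have t: "d = t + (t + 1) + 2" by simp
    show ?thesis
    proof (rule balanced_exampleI)
      show "bounded_curve TYPE('a) 5 d [t + t + 2, t + t + 2, t + (t + 1) + 2, (t + 1) + t + 2, (t + 1) + t + 2] Ms" if "finite Ms" for Ms
        unfolding t by (rule bounded_curve_5[OF _ _ that]) (use 5 in simp_all)
      show "balanced_degrees 5 d [t + t + 2, t + t + 2, t + (t + 1) + 2, (t + 1) + t + 2, (t + 1) + t + 2]"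
        using t by (simp add: balanced_degrees_def)
    qed
  qed
qed

lemma balanced_example_6:
  assumes d: "d \<ge> 1" "d \<noteq> 3" "d \<noteq> 5" and char: "CHAR('a) = 0"
  shows "balanced_example TYPE('a::alg_closed_field) 6 d"
proof -
  let ?ps = "[(0, 1), (0, 2), (0, 3), (1, 0), (1, 1), (1, 2), (1, 3)] :: (nat \<times> nat) list"
  have ps: "insert (0, 0) (set ?ps) = {..<2} \<times> {..<4}" by (auto simp: less_Suc_eq eval_nat_numeral)
  consider "d = 1" | "d = 2" | "d = 4" | "d = 6" | u k where "d = 14 * u + 2 * k + 8" "k < 7" | u k where "d = 14 * u + 2 * k + 7" "k < 7"
    using degree_cases_mod_14[OF d] by blast
  then show ?thesis
  proof cases
    case 1
    have "balanced_example TYPE('a) (2 + 4) (1 + 1 * 0)"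
      by (rule balanced_example_monomial[OF _ _ _ _ _ ps]) (auto simp: balanced_degrees_def)
    then show ?thesis using 1 by simp
  next
    case 2
    have "balanced_example TYPE('a) (2 + 4) (1 + 1 * 1)"
      by (rule balanced_example_monomial[OF _ _ _ _ _ ps]) (auto simp: balanced_degrees_def)
    then show ?thesis using 2 by (simp add: eval_nat_numeral)
  next
    case 3
    show ?thesis unfolding 3
    proof (rule balanced_exampleI)
      let ?qs = "[(0, 0), (0, 1), (0, 2), (0, 3), (1, 0), (1, 1), (1, 2), (1, 3)] :: (nat \<times> nat) list"
      show "bounded_curve TYPE('a) 6 4 [3, 3, 3, 4, 3, 3, 3] Ms" if Ms: "finite Ms" for Ms
      proof -
        have qs: "set ?qs = {..<2} \<times> {..<4}" by (auto simp: less_Suc_eq eval_nat_numeral)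
        show ?thesis
          \<comment> \<open>The numbers instantiate \<open>q0\<close>, \<open>\<alpha>\<close>,
            \<open>q1\<close>, \<open>\<beta>\<close>, \<open>q2\<close>, \<open>q3\<close>,
            \<open>e0\<close>, \<open>e1\<close>, \<open>p\<close>, \<open>q'\<close>, in this
            order.\<close>
          using bounded_curve_6[of 1 0 0 0 1 0 1 1 0 1, OF _ _ _ _ _ _ _ _ _ _ char Ms _ qs, of "[0, 0, 0, 1, 0, 0, 0]"] by (simp add: eval_nat_numeral)
      qed
    qed (auto simp: balanced_degrees_def)
  next
    case 4
    show ?thesis unfolding 4
    proof (rule balanced_exampleI)
      let ?qs = "[(0, 1), (0, 3), (1, 1), (1, 3), (0, 0), (0, 2), (1, 0), (1, 2)] :: (nat \<times> nat) list"
      show "bounded_curve TYPE('a) 6 6 [5, 5, 5, 5, 5, 4, 5] Ms" if Ms: "finite Ms" for Ms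
      proof -
        have qs: "set ?qs = {..<2} \<times> {..<4}" by (auto simp: less_Suc_eq eval_nat_numeral)
        show ?thesis
          using bounded_curve_6[of 1 1 1 0 1 1 2 2 1 1, OF _ _ _ _ _ _ _ _ _ _ char Ms _ qs, of "[0, 0, 0, 0, 1, 0, 1]"] by (simp add: eval_nat_numeral)
      qed
    qed (auto simp: balanced_degrees_def)
  next
    case (5 u k)
    have ex: "balanced_example TYPE('a) 6 (3 + 3 + 14 * u + 2)"
      "balanced_example TYPE('a) 6 (4 + 4 + 14 * u + 2)"
      "balanced_example TYPE('a) 6 (5 + 5 + 14 * u + 2)"
      "balanced_example TYPE('a) 6 (6 + 6 + 14 * u + 2)"
      "balanced_example TYPE('a) 6 (7 + 7 + 14 * u + 2)"
      "balanced_example TYPE('a) 6 (8 + 8 + 14 * u + 2)"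
      "balanced_example TYPE('a) 6 (9 + 9 + 14 * u + 2)"
      by (rule balanced_example_6_even[OF _ char], (rule insertI1 | rule insertI2)+)+
    consider "k = 0" | "k = 1" | "k = 2" | "k = 3" | "k = 4" | "k = 5" | "k = 6" using 5(2) by linarith
    then show ?thesis by cases (use ex 5 in \<open>simp_all add: add_ac\<close>)
  next
    case (6 u k)
    have ex: "balanced_example TYPE('a) 6 (2 + 3 + 14 * u + 2)"
      "balanced_example TYPE('a) 6 (3 + 4 + 14 * u + 2)"
      "balanced_example TYPE('a) 6 (4 + 5 + 14 * u + 2)"
      "balanced_example TYPE('a) 6 (5 + 6 + 14 * u + 2)"
      "balanced_example TYPE('a) 6 (6 + 7 + 14 * u + 2)"
      "balanced_example TYPE('a) 6 (7 + 8 + 14 * u + 2)"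
      "balanced_example TYPE('a) 6 (8 + 9 + 14 * u + 2)"
      by (rule balanced_example_6_odd[OF _ char], (rule insertI1 | rule insertI2)+)+
    consider "k = 0" | "k = 1" | "k = 2" | "k = 3" | "k = 4" | "k = 5" | "k = 6" using 6(2) by linarith
    then show ?thesis by cases (use ex 6 in \<open>simp_all add: add_ac\<close>)
  qed
qed

text \<open>The degrees need not be balanced here. Being at most \<open>d\<close>, they give the
  twist \<open>d - 1\<close> exactly its Euler characteristic \<open>d + 2\<close> as bound.\<close>

lemma unbalanced_example_6:
  assumes d: "d = 3 \<or> d = 5" and char: "CHAR('a) = 0"
  shows "\<exists>as. length as = 7 \<and> sum_list as + 2 = 6 * d \<and> (\<forall>x\<in>set as. x \<le> d) \<and>
    (\<forall>Ms. finite Ms \<longrightarrow> bounded_curve TYPE('a::alg_closed_field) 6 d as Ms)"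
  using d
proof
  assume d: "d = 3"
  let ?ps = "[(0, 1), (0, 2), (0, 3), (1, 0), (1, 1), (1, 2), (1, 3)] :: (nat \<times> nat) list"
  have ps: "insert (0, 0) (set ?ps) = {..<2} \<times> {..<4}" by (auto simp: less_Suc_eq eval_nat_numeral)
  have "bounded_curve TYPE('a) 6 d [2, 2, 1, 3, 3, 3, 2] Ms" for Ms
    using monomial_curve[of 4 1 2, OF _ _ _ _ _ ps, of Ms, where 'a = 'a] by (simp add: d eval_nat_numeral)
  then show ?thesis by (intro exI[of _ "[2, 2, 1, 3, 3, 3, 2]"]) (simp add: d)
next
  assume d: "d = 5"
  let ?ps = "[(0, 0), (0, 1), (0, 3), (0, 2), (1, 0), (1, 1), (1, 3), (1, 2)] :: (nat \<times> nat) list"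
  have ps: "set ?ps = {..<2} \<times> {..<4}" by (auto simp: less_Suc_eq eval_nat_numeral)
  have "bounded_curve TYPE('a) 6 d [3, 3, 4, 5, 4, 4, 5] Ms" if Ms: "finite Ms" for Ms
    using bounded_curve_6[of 1 0 0 1 2 0 1 2 0 2, OF _ _ _ _ _ _ _ _ _ _ char Ms _ ps, of "[0, 0, 1, 1, 0, 0, 1]"]
    by (simp add: d eval_nat_numeral)
  then show ?thesis by (intro exI[of _ "[3, 3, 4, 5, 4, 4, 5]"]) (simp add: d)
qed

section \<open>General curves\<close>

lemma finite_plucker_index: "finite (plucker_index k n)"
  unfolding plucker_index_def by (rule finite_subset[of _ "Pow {..<n}"]) auto

lemma homogeneous_polyfun_finite_prod:
  assumes "finite V" "finite I" "\<forall>i\<in>I. \<exists>N. homogeneous_polyfun V N (h i)"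
  shows "\<exists>N. homogeneous_polyfun V N (\<lambda>x. \<Prod>i\<in>I. h i x)"
  using assms(2,3)
proof (induction I rule: finite_induct)
  case empty
  then show ?case using homogeneous_polyfun_const[of V 1] by auto
next
  case (insert i I)
  then obtain N N' where "homogeneous_polyfun V N (h i)" "homogeneous_polyfun V N' (\<lambda>x. \<Prod>i\<in>I. h i x)" by auto
  from homogeneous_polyfun_mult[OF assms(1) this] insert(1,2) show ?case by auto
qed

text \<open>Semicontinuity supplies, for each twist in \<open>Ms\<close>, a homogeneous polynomial
  that is nonzero at the example. The nonvanishing of their product is the open condition, and the
  example shows that it can be met.\<close>

lemma for_general_curveI:
  fixes P :: "('a::alg_closed_field \<times> 'a \<Rightarrow> 'a vec set) \<Rightarrow> bool"
  assumes ex: "bounded_curve TYPE('a) n d as Ms" and Ms: "finite Ms"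
    and P: "\<And>f e \<sigma>. split_curve n e \<sigma> f \<Longrightarrow> e 0 + e 1 = d \<Longrightarrow>
      \<forall>m\<in>Ms. split_curve.sections_dim_le n e \<sigma> (int m) (\<Sum>a\<leftarrow>as. nat (int m + 1 - int a)) \<Longrightarrow> P f"
  shows "for_general_curve 2 n d P"
proof -
  let ?V = "plucker_index 2 n \<times> {..d}"
  let ?\<kappa> = "\<lambda>m. \<Sum>a\<leftarrow>as. nat (int m + 1 - int a)"
  let ?c = "\<lambda>F :: nat set \<Rightarrow> 'a poly. \<lambda>(J, i). coeff (F J) i"
  obtain F0 f0 e0 \<sigma>0 where F0: "rational_curve 2 n d F0 (f0 :: 'a \<times> 'a \<Rightarrow> 'a vec set)" "split_curve n e0 \<sigma>0 f0"
      "\<forall>i<n. \<forall>j<n. plucker_forms F0 i j = minor \<sigma>0 i j"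
      "\<forall>m\<in>Ms. split_curve.sections_dim_le n e0 \<sigma>0 (int m) (?\<kappa> m)"
    using ex unfolding bounded_curve_def by (elim exE conjE)
  have forms: "F J \<in> forms (int d)" if "rational_curve 2 n d F f" "J \<in> plucker_index 2 n" for F J and f :: "'a \<times> 'a \<Rightarrow> 'a vec set"
    using that unfolding rational_curve_def by blast
  define good where "good m h \<longleftrightarrow> (\<forall>F f e \<sigma>. (\<forall>J\<in>plucker_index 2 n. F J \<in> forms (int d)) \<longrightarrow>
    split_curve n e \<sigma> (f :: 'a \<times> 'a \<Rightarrow> 'a vec set) \<longrightarrow> (\<forall>i<n. \<forall>j<n. plucker_forms F i j = minor \<sigma> i j) \<longrightarrow>
    h (?c F) \<noteq> 0 \<longrightarrow> split_curve.sections_dim_le n e \<sigma> (int m) (?\<kappa> m))" for m and h :: "(nat set \<times> nat \<Rightarrow> 'a) \<Rightarrow> 'a"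
  have "\<forall>m. \<exists>h. m \<in> Ms \<longrightarrow> (\<exists>N. homogeneous_polyfun ?V N h) \<and> h (?c F0) \<noteq> 0 \<and> good m h"
  proof
    fix m
    show "\<exists>h. m \<in> Ms \<longrightarrow> (\<exists>N. homogeneous_polyfun ?V N h) \<and> h (?c F0) \<noteq> 0 \<and> good m h"
    proof (cases "m \<in> Ms")
      case True
      have "\<exists>N h. homogeneous_polyfun ?V N h \<and> h (?c F0) \<noteq> 0 \<and> good m h"
        unfolding good_def
        by (rule sections_dim_le_open[OF F0(2) _ F0(3) bspec[OF F0(4) True]]) (rule forms[OF F0(1)])
      then show ?thesis by blast
    qed simp
  qed
  from choice[OF this] obtain h where h: "\<forall>m. m \<in> Ms \<longrightarrow> (\<exists>N. homogeneous_polyfun ?V N (h m)) \<and> h m (?c F0) \<noteq> 0 \<and> good m (h m)" ..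
  have h1: "\<forall>m\<in>Ms. \<exists>N. homogeneous_polyfun ?V N (h m)" using h by blast
  have h2: "\<forall>m\<in>Ms. h m (?c F0) \<noteq> 0" using h by blast
  have h3: "split_curve.sections_dim_le n e \<sigma> (int m) (?\<kappa> m)"
    if "m \<in> Ms" "rational_curve 2 n d F f" "split_curve n e \<sigma> f" "\<forall>i<n. \<forall>j<n. plucker_forms F i j = minor \<sigma> i j" "h m (?c F) \<noteq> 0"
    for m F e \<sigma> and f :: "'a \<times> 'a \<Rightarrow> 'a vec set"
  proof -
    have "good m (h m)" using h that(1) by blast
    moreover have "\<forall>J\<in>plucker_index 2 n. F J \<in> forms (int d)" using forms[OF that(2)] by (intro ballI)
    ultimately show ?thesis
      unfolding good_def using that(3-5) by blast
  qed
  define g where "g x = (\<Prod>m\<in>Ms. h m x)" for x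
  define U where "U = {F \<in> mor_space 2 n d. \<exists>h\<in>{g}. h (?c F) \<noteq> 0}"
  show ?thesis
    unfolding for_general_curve_def
  proof (intro exI conjI ballI allI impI)
    have "\<exists>N. homogeneous_polyfun ?V N g"
      unfolding g_def[abs_def] using homogeneous_polyfun_finite_prod[OF _ Ms h1] finite_plucker_index by blast
    then show "zariski_open_mor 2 n d U" unfolding zariski_open_mor_def U_def by (intro exI[of _ "{g}"]) simp
    have "g (?c F0) \<noteq> 0" using h2 Ms by (simp add: g_def)
    moreover have "F0 \<in> mor_space 2 n d" using F0(1) unfolding mor_space_def by blast
    ultimately have "F0 \<in> U" by (simp add: U_def)
    then show "U \<noteq> {}" by blast
    fix F and f :: "'a \<times> 'a \<Rightarrow> 'a vec set"
    assume F: "F \<in> U" and f: "rational_curve 2 n d F f"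
    have gF: "h m (?c F) \<noteq> 0" if "m \<in> Ms" for m
      using F that Ms by (auto simp: U_def g_def)
    from rational_curve_splits[OF f] obtain e \<sigma> where *: "e 0 + e 1 = d" "split_curve n e \<sigma> f"
      "\<forall>i<n. \<forall>j<n. plucker_forms F i j = minor \<sigma> i j" by (elim exE conjE)
    show "P f"
    proof (rule P[OF *(2,1)], rule ballI)
      show "split_curve.sections_dim_le n e \<sigma> (int m) (?\<kappa> m)" if "m \<in> Ms" for m
        by (rule h3[OF that f *(2,3) gF[OF that]])
    qed
  qed
qed

text \<open>When no degree exceeds \<open>m + 1\<close>, nothing is cut off at 0, and the dimension
  is the Euler characteristic of the twist.\<close>

lemma sum_list_nat_diff:
  "\<forall>x\<in>set as. x \<le> m + 1 \<Longrightarrow> int (\<Sum>a\<leftarrow>as. nat (int m + 1 - int a)) = int (length as) * (int m + 1) - int (sum_list as)"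
  by (induction as) (simp_all add: algebra_simps)

lemma (in split_curve) no_sections_of_negative_degree: "m < 0 \<Longrightarrow> sections_dim_le m 0"
  unfolding sections_dim_le_def
proof (intro allI impI)
  fix N B assume m: "m < 0" and B: "\<forall>l<N. conormal_section m (B l)" and ind: "independent_sections N B"
  have "B l a i = 0" if "l < N" "a < 2" "i < n" for l a i
    by (rule forms_negative[OF conormal_section_forms[OF mp[OF spec[OF B] that(1)] that(2,3)]]) (use m in simp)
  then have "\<forall>a<2. \<forall>i<n. (\<Sum>l<N. Polynomial.smult 1 (B l a i)) = 0" by simp
  from independent_sectionsD[OF ind this] show "N \<le> 0" by (cases N) auto
qed

text \<open>\<open>a\<close> is the least degree of the example and \<open>j\<close> the number of
  its occurrences. In the twists \<open>a - 1\<close>, \<open>a\<close> and \<open>a + 2\<close> the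
  bounds become 0, \<open>j\<close> and \<open>j + 2 * (2 * n - 5)\<close>, as
  \<open>balanced_if_section_bounds\<close> requires.\<close>

theorem balanced_if_example:
  assumes n: "n \<ge> 3" and ex: "balanced_example TYPE('a::alg_closed_field) n d"
  shows "for_general_curve 2 n d (\<lambda>f :: 'a \<times> 'a \<Rightarrow> 'a vec set. unramified n f \<and> balanced_normal_bundle n f)"
proof -
  obtain as where as: "balanced_degrees n d as" "\<forall>Ms. finite Ms \<longrightarrow> bounded_curve TYPE('a) n d as Ms"
    using ex unfolding balanced_example_def by blast
  have len: "length as = 2 * n - 5" and sum: "sum_list as + 2 = n * d" using as(1) by (simp_all add: balanced_degrees_def)
  then have "as \<noteq> []" using n by auto
  define a where "a = Min (set as)"
  have ain: "a \<in> set as" unfolding a_def using \<open>as \<noteq> []\<close> by (intro Min_in) auto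
  have a: "a \<le> x" "x \<le> a + 1" if "x \<in> set as" for x
    using that as(1) ain unfolding balanced_degrees_def a_def by auto
  define j where "j = (\<Sum>x\<leftarrow>as. nat (int a + 1 - int x))"
  have intl: "int (length as) = 2 * int n - 5" using len n by simp
  have sm: "int (sum_list as) = int n * int d - 2" using arg_cong[OF sum, of int] by simp
  have jd: "int j = (2 * int n - 5) * (int a + 1) - int n * int d + 2"
    unfolding j_def using sum_list_nat_diff[of as a] a(2) by (simp add: intl sm)
  have "(\<Sum>x\<leftarrow>as. nat (int a + 1 - int x)) \<le> (\<Sum>x\<leftarrow>as. 1)"
    by (rule sum_list_mono) (use a(1) in force)
  then have j: "j \<le> 2 * n - 5" unfolding j_def using len by (simp add: sum_list_triv)
  have 0: "(\<Sum>x\<leftarrow>as. nat (int (a - 1) + 1 - int x)) = 0" if "a \<ge> 1"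
    unfolding sum_list_eq_0_iff using a(1) that by force
  have 2: "(\<Sum>x\<leftarrow>as. nat (int (a + 2) + 1 - int x)) = j + 2 * (2 * n - 5)"
  proof -
    have "\<forall>x\<in>set as. x \<le> a + 2 + 1" using a(2) by force
    from sum_list_nat_diff[OF this]
    have "int (\<Sum>x\<leftarrow>as. nat (int (a + 2) + 1 - int x)) = int j + 2 * (2 * int n - 5)"
      unfolding intl sm jd by (simp add: algebra_simps)
    also have "\<dots> = int (j + 2 * (2 * n - 5))" unfolding of_nat_add of_nat_mult len[symmetric] intl by simp
    finally show ?thesis unfolding of_nat_eq_iff .
  qed
  show ?thesis
  proof (rule for_general_curveI[of n d as "{a - 1, a, a + 2}"])
    show "bounded_curve TYPE('a) n d as {a - 1, a, a + 2}" by (rule mp[OF spec[OF as(2)]]) simp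
    fix f :: "'a \<times> 'a \<Rightarrow> 'a vec set" and e \<sigma>
    assume sc: "split_curve n e \<sigma> f" and e: "e 0 + e 1 = d"
      and le: "\<forall>m\<in>{a - 1, a, a + 2}. split_curve.sections_dim_le n e \<sigma> (int m) (\<Sum>x\<leftarrow>as. nat (int m + 1 - int x))"
    interpret split_curve n e \<sigma> f by (rule sc)
    show "unramified n f \<and> balanced_normal_bundle n f"
    proof (rule balanced_if_section_bounds[OF n _ _ j])
      show "sections_dim_le (int a - 1) 0"
      \<comment> \<open>For \<open>a = 0\<close> the natural number \<open>a - 1\<close> is 0 again,
        so the twist -1 has to be treated apart.\<close>
      proof (cases "a = 0")
        case True
        then show ?thesis by (intro no_sections_of_negative_degree) simp
      next
        case False
        have "sections_dim_le (int (a - 1)) (\<Sum>x\<leftarrow>as. nat (int (a - 1) + 1 - int x))" by (rule bspec[OF le]) simp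
        then show ?thesis using False by (simp only: 0) (simp add: of_nat_diff)
      qed
      have "sections_dim_le (int a) (\<Sum>x\<leftarrow>as. nat (int a + 1 - int x))" by (rule bspec[OF le]) simp
      then show "sections_dim_le (int a) j" unfolding j_def .
      show "int j = (2 * int n - 5) * (int a + 1) - int n * int (e 0 + e 1) + 2" unfolding e by (rule jd)
      have "sections_dim_le (int (a + 2)) (\<Sum>x\<leftarrow>as. nat (int (a + 2) + 1 - int x))" by (rule bspec[OF le]) simp
      then show "sections_dim_le (int a + 2) (j + 2 * (2 * n - 5))" unfolding 2 by (simp add: add.commute)
    qed
  qed simp
qed

section \<open>The unbalanced cases\<close>

lemma form_eq_0_if_ev_0:
  fixes p :: "'a::alg_closed_field poly"
  assumes "p \<in> forms k" "\<And>t. ev k p (1, t) = 0"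
  shows "p = 0"
proof (cases "k < 0")
  case False
  show ?thesis
    by (rule poly_eq_0_if_all_0) (use ev_one[OF assms(1)] assms(2) False in simp)
qed (rule forms_negative[OF assms(1)])

text \<open>Projecting along the last vector of the family, which generates a free direct summand, reduces the rank.\<close>

lemma regular_coefficients:
  fixes G :: "nat \<Rightarrow> 'q \<Rightarrow> 'a::alg_closed_field poly"
  assumes Q: "finite Q"
    and ind: "\<forall>t c. (\<forall>q\<in>Q. (\<Sum>l<r. c l * poly (G l q) t) = 0) \<longrightarrow> (\<forall>l<r. c l = 0)"
    and span: "\<forall>t. \<exists>c. \<forall>q\<in>Q. poly (y q) t = (\<Sum>l<r. c l * poly (G l q) t)"
  shows "\<exists>\<gamma>. \<forall>q\<in>Q. y q = (\<Sum>l<r. \<gamma> l * G l q)"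
  using ind span
proof (induction r arbitrary: G y)
  case 0
  then show ?case by (simp add: poly_eq_0_if_all_0)
next
  case (Suc r)
  let ?g = "G r"
  have "\<exists>q\<in>Q. poly (?g q) t \<noteq> 0" for t
  proof (rule ccontr)
    assume "\<not> (\<exists>q\<in>Q. poly (?g q) t \<noteq> 0)"
    then have "\<forall>q\<in>Q. (\<Sum>l<Suc r. (if l = r then 1 else 0) * poly (G l q) t) = 0" by simp
    from mp[OF spec[OF spec[OF Suc.prems(1)]] this] show False by auto
  qed
  from polynomial_bezout[OF Q this] obtain h where h: "(\<Sum>q\<in>Q. h q * ?g q) = 1" .
  \<comment> \<open>\<open>\<pi>\<close> takes the value 1 on \<open>?g\<close>, so
    \<open>v - \<pi> v * ?g\<close> is the projection along \<open>?g\<close>.\<close>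
  define \<pi> where "\<pi> v = (\<Sum>q\<in>Q. h q * v q)" for v
  define G' where "G' l q = G l q - \<pi> (G l) * ?g q" for l q
  define y' where "y' q = y q - \<pi> y * ?g q" for q
  have ht: "(\<Sum>q\<in>Q. poly (h q) t * poly (?g q) t) = 1" for t
    using arg_cong[OF h, of "\<lambda>p. poly p t"] by (simp add: poly_sum)
  have "\<exists>\<gamma>. \<forall>q\<in>Q. y' q = (\<Sum>l<r. \<gamma> l * G' l q)"
  proof (rule Suc.IH)
    show "\<forall>t c. (\<forall>q\<in>Q. (\<Sum>l<r. c l * poly (G' l q) t) = 0) \<longrightarrow> (\<forall>l<r. c l = 0)"
    proof (intro allI impI)
      fix t c l assume c: "\<forall>q\<in>Q. (\<Sum>l<r. c l * poly (G' l q) t) = 0" and l: "l < r"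
      define c' where "c' k = (if k = r then - (\<Sum>l<r. c l * poly (\<pi> (G l)) t) else c k)" for k
      have "(\<Sum>l<Suc r. c' l * poly (G l q) t) = (\<Sum>l<r. c l * poly (G' l q) t)" for q
        by (simp add: c'_def G'_def right_diff_distrib sum_subtractf sum_distrib_right mult.assoc)
      then have "\<forall>q\<in>Q. (\<Sum>l<Suc r. c' l * poly (G l q) t) = 0" using c by simp
      from mp[OF spec[OF spec[OF Suc.prems(1)]] this] have "c' l = 0" using l by simp
      then show "c l = 0" using l by (simp add: c'_def)
    qed
    show "\<forall>t. \<exists>c. \<forall>q\<in>Q. poly (y' q) t = (\<Sum>l<r. c l * poly (G' l q) t)"
    proof
      fix t
      from Suc.prems(2) obtain c where c: "\<forall>q\<in>Q. poly (y q) t = (\<Sum>l<Suc r. c l * poly (G l q) t)" by blast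
      have "poly (\<pi> y) t = (\<Sum>q\<in>Q. poly (h q) t * (\<Sum>l<Suc r. c l * poly (G l q) t))"
        unfolding \<pi>_def poly_sum poly_mult by (rule sum.cong[OF refl]) (simp only: bspec[OF c])
      also have "\<dots> = (\<Sum>l<Suc r. c l * (\<Sum>q\<in>Q. poly (h q) t * poly (G l q) t))"
        unfolding sum_distrib_left by (subst sum.swap) (simp only: mult.left_commute)
      also have "\<dots> = (\<Sum>l<r. c l * poly (\<pi> (G l)) t) + c r"
        by (simp add: ht) (simp add: \<pi>_def poly_sum)
      finally have py: "poly (\<pi> y) t = (\<Sum>l<r. c l * poly (\<pi> (G l)) t) + c r" .
      have "poly (y' q) t = (\<Sum>l<r. c l * poly (G' l q) t)" if "q \<in> Q" for q
        by (simp add: y'_def G'_def py bspec[OF c that] right_diff_distrib distrib_right sum_subtractf sum_distrib_right mult.assoc)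
      then show "\<exists>c. \<forall>q\<in>Q. poly (y' q) t = (\<Sum>l<r. c l * poly (G' l q) t)" by (intro exI[of _ c] ballI)
    qed
  qed
  then obtain \<gamma> where \<gamma>: "\<forall>q\<in>Q. y' q = (\<Sum>l<r. \<gamma> l * G' l q)" ..
  define \<gamma>' where "\<gamma>' k = (if k = r then \<pi> y - (\<Sum>l<r. \<gamma> l * \<pi> (G l)) else \<gamma> k)" for k
  have "y q = (\<Sum>l<Suc r. \<gamma>' l * G l q)" if "q \<in> Q" for q
  proof -
    have "y q = y' q + \<pi> y * ?g q" by (simp add: y'_def)
    also have "y' q = (\<Sum>l<r. \<gamma> l * G' l q)" using \<gamma> that by blast
    finally show ?thesis
      by (simp add: \<gamma>'_def G'_def right_diff_distrib left_diff_distrib sum_subtractf sum_distrib_right mult.assoc)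
  qed
  then show ?case by (intro exI[of _ \<gamma>'] ballI)
qed

context split_curve
begin

text \<open>The global version of \<open>conormal_if_kills_normal_relations\<close>:
  \<open>section_factor\<close> turns the pointwise expansions of the rows into polynomial ones, and
  the orthogonality and tangency conditions are identities of forms that can be tested at the affine
  points.\<close>

lemma section_if_kills_normal_relations:
  assumes H: "\<And>i j. i < n \<Longrightarrow> j < n \<Longrightarrow> H i j \<in> forms (int m)"
    and kill: "\<And>x M. x \<noteq> (0, 0) \<Longrightarrow> M \<in> normal_relations n f x \<Longrightarrow> (\<Sum>i<n. \<Sum>j<n. ev (int m) (H i j) x * M $$ (i, j)) = 0"
  shows "\<exists>z. conormal_section (int m) z \<and> (\<forall>i<n. \<forall>j<n. H i j = section_mat z i j)"
proof -
  have con: "\<exists>b. conormal (1, t) b \<and> (\<forall>i<n. \<forall>j<n. ev (int m) (H i j) (1, t) = conormal_mat (1, t) b i j)" for t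
    by (rule conormal_if_kills_normal_relations) (simp, rule kill, simp)
  have "\<exists>c. (\<forall>a<2. c a \<in> forms (int m - int (e a))) \<and> (\<forall>j<n. H i j = (\<Sum>a<2. c a * \<sigma> a j))" if i: "i < n" for i
  proof (rule section_factor[of "H i" m])
    show "inW (1, t) (\<lambda>j. ev (int m) (H i j) (1, t))" for t
    proof -
      obtain b where "\<forall>i<n. \<forall>j<n. ev (int m) (H i j) (1, t) = conormal_mat (1, t) b i j" using con by blast
      then show ?thesis
        unfolding curve_span_def conormal_mat_def using i by (intro exI[of _ "\<lambda>a. b a i"]) simp
    qed
  qed (use H i in blast)+
  then have "\<forall>i. \<exists>c. i < n \<longrightarrow> (\<forall>a<2. c a \<in> forms (int m - int (e a))) \<and> (\<forall>j<n. H i j = (\<Sum>a<2. c a * \<sigma> a j))" by blast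
  from choice[OF this] obtain c where c: "\<forall>i. i < n \<longrightarrow> (\<forall>a<2. c i a \<in> forms (int m - int (e a))) \<and> (\<forall>j<n. H i j = (\<Sum>a<2. c i a * \<sigma> a j))" ..
  define z where "z a i = c i a" for a i
  have z: "z a i \<in> forms (int m - int (e a))" if "a < 2" "i < n" for a i using c that by (simp add: z_def)
  have Hz: "H i j = section_mat z i j" if "i < n" "j < n" for i j
    using c that by (simp add: section_mat_def z_def)
  have val: "\<exists>b. conormal (1, t) b \<and> (\<forall>a<2. \<forall>i<n. section_value (int m) z (1, t) a i = b a i)" for t
  proof -
    obtain b where b: "conormal (1, t) b" "\<forall>i<n. \<forall>j<n. ev (int m) (H i j) (1, t) = conormal_mat (1, t) b i j"
      using con[of t] by (elim exE conjE)
    have "section_value (int m) z (1, t) a i - b a i = 0" if a: "a < 2" and i: "i < n" for a i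
    proof (rule S_independent[OF _ _ a, of "(1, t)" "\<lambda>a. section_value (int m) z (1, t) a i - b a i"])
      fix j assume j: "j < n"
      have "ev (int m) (section_mat z i j) (1, t) = (\<Sum>a<2. section_value (int m) z (1, t) a i * S (1, t) a j)"
        unfolding section_mat_def ev_sum section_value_def curve_value_def
        by (intro sum.cong refl ev_mult'[OF z sect]) (use i j in auto)
      moreover have "ev (int m) (section_mat z i j) (1, t) = (\<Sum>a<2. b a i * S (1, t) a j)"
        unfolding Hz[OF i j, symmetric] using b(2) i j by (simp add: conormal_mat_def)
      ultimately show "(\<Sum>a<2. (section_value (int m) z (1, t) a i - b a i) * S (1, t) a j) = 0"
        by (simp add: left_diff_distrib sum_subtractf)
    qed simp
    then show ?thesis using b(1) by auto
  qed
  have perp: "perp_section (int m) z"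
    unfolding perp_section_def
  proof (intro conjI allI impI)
    fix a a' :: nat assume a: "a < 2" "a' < 2"
    show "(\<Sum>i<n. z a i * \<sigma> a' i) = 0"
    proof (rule form_eq_0_if_ev_0)
      show "(\<Sum>i<n. z a i * \<sigma> a' i) \<in> forms (int m - int (e a) + int (e a'))"
        by (intro forms_sum forms_mult[OF z sect]) (use a in auto)
      fix t
      obtain b where b: "conormal (1, t) b" "\<forall>a<2. \<forall>i<n. section_value (int m) z (1, t) a i = b a i"
        using val[of t] by (elim exE conjE)
      have "ev (int m - int (e a) + int (e a')) (\<Sum>i<n. z a i * \<sigma> a' i) (1, t) = (\<Sum>i<n. section_value (int m) z (1, t) a i * S (1, t) a' i)"
        unfolding ev_sum section_value_def curve_value_def
        by (intro sum.cong refl ev_mult'[OF z sect]) (use a in auto)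
      also have "\<dots> = (\<Sum>i<n. b a i * S (1, t) a' i)" using b(2) a by simp
      also have "\<dots> = 0" using conormal_perp[OF b(1) a(1)] a(2) by (simp add: perp_def)
      finally show "ev (int m - int (e a) + int (e a')) (\<Sum>i<n. z a i * \<sigma> a' i) (1, t) = 0" .
    qed
  qed (rule z)
  have "tangent_form z = 0"
  proof (rule form_eq_0_if_ev_0[OF tangent_form_forms_and_pairing(1)[OF perp]])
    fix t
    obtain b where b: "conormal (1, t) b" "\<forall>a<2. \<forall>i<n. section_value (int m) z (1, t) a i = b a i"
      using val[of t] by (elim exE conjE)
    have "ev (int m - 2) (tangent_form z) (1, t) = tangent_pairing (1, t) (0, 1) (section_value (int m) z (1, t))"
      unfolding tangent_form_forms_and_pairing(2)[OF perp] by simp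
    also have "\<dots> = tangent_pairing (1, t) (0, 1) b" unfolding tangent_pairing_def using b(2) by simp
    finally show "ev (int m - 2) (tangent_form z) (1, t) = 0" using conormal_tangent[OF b(1)] by simp
  qed
  with perp have "conormal_section (int m) z" by (simp add: conormal_section_def)
  then show ?thesis using Hz by blast
qed

end

lemma double_sum_swap:
  fixes E :: "nat \<Rightarrow> nat \<Rightarrow> nat \<Rightarrow> 'a::comm_semiring_0"
  shows "(\<Sum>i<n. \<Sum>j<n. h i j * (\<Sum>k<r. c k * E k i j)) = (\<Sum>k<r. c k * (\<Sum>i<n. \<Sum>j<n. h i j * E k i j))"
proof -
  have "(\<Sum>j<n. h i j * (\<Sum>k<r. c k * E k i j)) = (\<Sum>k<r. \<Sum>j<n. c k * (h i j * E k i j))" for i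
    unfolding sum_distrib_left by (subst sum.swap) (simp add: mult.left_commute)
  then have "(\<Sum>i<n. \<Sum>j<n. h i j * (\<Sum>k<r. c k * E k i j)) = (\<Sum>i<n. \<Sum>k<r. \<Sum>j<n. c k * (h i j * E k i j))"
    by simp
  also have "\<dots> = (\<Sum>k<r. \<Sum>i<n. \<Sum>j<n. c k * (h i j * E k i j))" by (rule sum.swap)
  finally show ?thesis by (simp add: sum_distrib_left)
qed

lemma sum_mult_delta:
  fixes c p :: "nat \<Rightarrow> 'a::semiring_1"
  assumes "k < r" "\<And>l. l < r \<Longrightarrow> p l = (if l = k then 1 else 0)"
  shows "(\<Sum>l<r. c l * p l) = c k"
proof -
  have "(\<Sum>l<r. c l * p l) = (\<Sum>l<r. if l = k then c k else 0)"
    by (rule sum.cong[OF refl]) (simp add: assms(2))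
  then show ?thesis using assms(1) by simp
qed

text \<open>A splitting of the normal bundle, given by the homomorphism \<open>g\<close>. Its rows
  will turn out to be conormal sections of the degrees \<open>as ! l\<close> whose values span the
  conormal space at every point.\<close>

locale split_conormal = split_curve +
  fixes as :: "int list" and g :: "nat \<Rightarrow> nat \<Rightarrow> nat \<Rightarrow> 'a poly"
  assumes g_forms: "\<And>l i j. l < length as \<Longrightarrow> i < n \<Longrightarrow> j < n \<Longrightarrow> g l i j \<in> forms (as ! l)"
    and g_surj: "\<And>x. x \<noteq> (0, 0) \<Longrightarrow> matrix_hom n as g x ` carrier_mat n n = carrier_vec (length as)"
    and g_kernel: "\<And>x. x \<noteq> (0, 0) \<Longrightarrow> {M \<in> carrier_mat n n. matrix_hom n as g x M = 0\<^sub>v (length as)} = normal_relations n f x"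
begin

definition row_value :: "'a \<times> 'a \<Rightarrow> nat \<Rightarrow> nat \<Rightarrow> nat \<Rightarrow> 'a" where
  "row_value x l i j = ev (as ! l) (g l i j) x"

lemma matrix_hom_row: "l < length as \<Longrightarrow> matrix_hom n as g x M $ l = (\<Sum>i<n. \<Sum>j<n. row_value x l i j * M $$ (i, j))"
  by (simp add: matrix_hom_def row_value_def ev_def)

lemma dual_matrices:
  assumes x: "x \<noteq> (0, 0)"
  shows "\<exists>E. \<forall>k<length as. \<forall>l<length as. (\<Sum>i<n. \<Sum>j<n. row_value x l i j * E k i j) = (if l = k then 1 else 0)"
proof -
  have "\<exists>M. matrix_hom n as g x M = unit_vec (length as) k" for k
  proof -
    have "unit_vec (length as) k \<in> matrix_hom n as g x ` carrier_mat n n" unfolding g_surj[OF x] by simp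
    then show ?thesis by (metis imageE)
  qed
  then obtain E where E: "\<And>k. matrix_hom n as g x (E k) = unit_vec (length as) k" by metis
  have "(\<Sum>i<n. \<Sum>j<n. row_value x l i j * E k $$ (i, j)) = (if l = k then 1 else 0)" if "k < length as" "l < length as" for k l
    unfolding matrix_hom_row[OF that(2), symmetric] E using that by simp
  then show ?thesis by (intro exI[of _ "\<lambda>k i j. E k $$ (i, j)"]) simp
qed

lemma dual_matricesE:
  assumes x: "x \<noteq> (0, 0)"
  obtains E where "\<And>c k. k < length as \<Longrightarrow> (\<Sum>l<length as. c l * (\<Sum>i<n. \<Sum>j<n. row_value x l i j * E k i j)) = c k"
    "\<And>c l. l < length as \<Longrightarrow> (\<Sum>k<length as. c k * (\<Sum>i<n. \<Sum>j<n. row_value x l i j * E k i j)) = c l"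
proof -
  obtain E where E: "\<forall>k<length as. \<forall>l<length as. (\<Sum>i<n. \<Sum>j<n. row_value x l i j * E k i j) = (if l = k then 1 else 0)"
    using dual_matrices[OF x] ..
  show thesis
  proof (rule that[of E])
    show "(\<Sum>l<length as. c l * (\<Sum>i<n. \<Sum>j<n. row_value x l i j * E k i j)) = c k" if "k < length as" for c k
      by (rule sum_mult_delta[OF that]) (use E that in blast)
    show "(\<Sum>k<length as. c k * (\<Sum>i<n. \<Sum>j<n. row_value x l i j * E k i j)) = c l" if "l < length as" for c l
      by (rule sum_mult_delta[OF that]) (use E that in auto)
  qed
qed

text \<open>A row of negative degree would be 0, contradicting surjectivity.\<close>

lemma degrees_nonneg:
  assumes l: "l < length as"
  shows "as ! l \<ge> 0"
proof (rule ccontr)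
  assume "\<not> as ! l \<ge> 0"
  then have 0: "row_value (1, 0) l i j = 0" if "i < n" "j < n" for i j
    using forms_negative[OF g_forms[OF l that]] by (simp add: row_value_def)
  obtain E where E: "\<forall>k<length as. \<forall>l<length as. (\<Sum>i<n. \<Sum>j<n. row_value (1, 0) l i j * E k i j) = (if l = k then 1 else 0)"
    using dual_matrices[of "(1, 0)"] by auto
  have "(\<Sum>i<n. \<Sum>j<n. row_value (1, 0) l i j * E l i j) = 1" using E l by simp
  then show False by (simp add: 0)
qed

lemma rows_independent:
  assumes x: "x \<noteq> (0, 0)" and c: "\<forall>i<n. \<forall>j<n. (\<Sum>l<length as. c l * row_value x l i j) = 0" and k: "k < length as"
  shows "c k = 0"
proof -
  obtain E where E: "\<And>c k. k < length as \<Longrightarrow> (\<Sum>l<length as. c l * (\<Sum>i<n. \<Sum>j<n. row_value x l i j * E k i j)) = c k"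
    "\<And>c l. l < length as \<Longrightarrow> (\<Sum>k<length as. c k * (\<Sum>i<n. \<Sum>j<n. row_value x l i j * E k i j)) = c l"
    using dual_matricesE[OF x] by blast
  have "c k = (\<Sum>l<length as. c l * (\<Sum>i<n. \<Sum>j<n. row_value x l i j * E k i j))"
    using E(1)[OF k] by simp
  also have "\<dots> = (\<Sum>i<n. \<Sum>j<n. E k i j * (\<Sum>l<length as. c l * row_value x l i j))"
    unfolding double_sum_swap by (simp add: mult.commute)
  also have "\<dots> = 0" using c by simp
  finally show ?thesis .
qed

text \<open>An elementary matrix minus its components along the dual matrices \<open>E\<close> lies
  in the kernel of the homomorphism, where \<open>h\<close> vanishes; this expresses each entry of
  \<open>h\<close> through the rows.\<close>

lemma in_row_span:
  assumes x: "x \<noteq> (0, 0)" and kill: "\<And>M. M \<in> normal_relations n f x \<Longrightarrow> (\<Sum>i<n. \<Sum>j<n. h i j * M $$ (i, j)) = 0"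
  shows "\<exists>c. \<forall>i<n. \<forall>j<n. h i j = (\<Sum>l<length as. c l * row_value x l i j)"
proof -
  obtain E where E: "\<And>c k. k < length as \<Longrightarrow> (\<Sum>l<length as. c l * (\<Sum>i<n. \<Sum>j<n. row_value x l i j * E k i j)) = c k"
    "\<And>c l. l < length as \<Longrightarrow> (\<Sum>k<length as. c k * (\<Sum>i<n. \<Sum>j<n. row_value x l i j * E k i j)) = c l"
    using dual_matricesE[OF x] by blast
  have "h i0 j0 = (\<Sum>l<length as. (\<Sum>i<n. \<Sum>j<n. h i j * E l i j) * row_value x l i0 j0)" if ij: "i0 < n" "j0 < n" for i0 j0
  proof -
    define U where "U i j = (if i = i0 \<and> j = j0 then 1 else 0 :: 'a)" for i j
    have U: "(\<Sum>i<n. \<Sum>j<n. p i j * U i j) = p i0 j0" for p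
    proof -
      have "(\<Sum>j<n. p i j * U i j) = (if i = i0 then p i0 j0 else 0)" for i
        using ij(2) by (cases "i = i0") (simp_all add: U_def if_distrib cong: if_cong)
      then show ?thesis using ij(1) by simp
    qed
    define M where "M = mat n n (\<lambda>(i, j). U i j - (\<Sum>k<length as. row_value x k i0 j0 * E k i j))"
    have M: "(\<Sum>i<n. \<Sum>j<n. p i j * M $$ (i, j)) = p i0 j0 - (\<Sum>k<length as. row_value x k i0 j0 * (\<Sum>i<n. \<Sum>j<n. p i j * E k i j))" for p
    proof -
      have "(\<Sum>i<n. \<Sum>j<n. p i j * M $$ (i, j)) = (\<Sum>i<n. \<Sum>j<n. p i j * U i j) - (\<Sum>i<n. \<Sum>j<n. p i j * (\<Sum>k<length as. row_value x k i0 j0 * E k i j))"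
        by (simp add: M_def right_diff_distrib sum_subtractf)
      then show ?thesis unfolding U double_sum_swap .
    qed
    have "(\<Sum>i<n. \<Sum>j<n. row_value x l i j * M $$ (i, j)) = 0" if "l < length as" for l
      unfolding M E(2)[OF that] by simp
    then have "matrix_hom n as g x M = 0\<^sub>v (length as)"
      by (intro eq_vecI) (simp_all add: matrix_hom_row, simp add: matrix_hom_def)
    then have "M \<in> normal_relations n f x" unfolding g_kernel[OF x, symmetric] by (simp add: M_def)
    from kill[OF this] show ?thesis unfolding M by (simp add: mult.commute)
  qed
  then show ?thesis by (intro exI[of _ "\<lambda>l. \<Sum>i<n. \<Sum>j<n. h i j * E l i j"]) blast
qed

lemma row_section:
  assumes l: "l < length as"
  shows "\<exists>z. conormal_section (as ! l) z \<and> (\<forall>i<n. \<forall>j<n. g l i j = section_mat z i j)"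
proof -
  have nn: "int (nat (as ! l)) = as ! l" using degrees_nonneg[OF l] by simp
  show ?thesis
  proof (rule section_if_kills_normal_relations[of "g l" "nat (as ! l)", unfolded nn])
    fix x M assume x: "x \<noteq> (0, 0)" and M: "M \<in> normal_relations n f x"
    have "matrix_hom n as g x M = 0\<^sub>v (length as)" using M unfolding g_kernel[OF x, symmetric] by simp
    then have "matrix_hom n as g x M $ l = 0" using l by simp
    then show "(\<Sum>i<n. \<Sum>j<n. ev (as ! l) (g l i j) x * M $$ (i, j)) = 0"
      unfolding matrix_hom_row[OF l] row_value_def .
  qed (rule g_forms[OF l])
qed

text \<open>A pair of vectors that annihilate the two-dimensional fibre is subject to four linear conditions,
  to one more by the tangent direction, and to \<open>length as\<close> further ones if the rows do not see it.\<close>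

lemma length_ge: "2 * n - 5 \<le> length as"
proof (rule ccontr)
  assume neg: "\<not> 2 * n - 5 \<le> length as"
  define x :: "'a \<times> 'a" where "x = (1, 0)"
  have x: "x \<noteq> (0, 0)" by (simp add: x_def)
  obtain E where E: "\<And>c k. k < length as \<Longrightarrow> (\<Sum>l<length as. c l * (\<Sum>i<n. \<Sum>j<n. row_value x l i j * E k i j)) = c k"
    "\<And>c l. l < length as \<Longrightarrow> (\<Sum>k<length as. c k * (\<Sum>i<n. \<Sum>j<n. row_value x l i j * E k i j)) = c l"
    using dual_matricesE[OF x] by blast
  define U where "U = {..<2::nat} \<times> {..<n}"
  define Q where "Q = (Inl ` ({..<2::nat} \<times> {..<2::nat}) \<union> {Inr (length as)}) \<union> Inr ` {..<length as}"
  define A where "A q u = (case q of Inl p \<Rightarrow> if fst u = fst p then S x (snd p) (snd u) else 0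
      | Inr l \<Rightarrow> if l = length as then D x (0, 1) (fst u) (snd u) else \<Sum>j<n. E l (snd u) j * S x (fst u) j)"
    for q :: "nat \<times> nat + nat" and u :: "nat \<times> nat"
  have fin: "finite U" "finite Q" by (simp_all add: U_def Q_def)
  have "card Q \<le> card (Inl ` ({..<2::nat} \<times> {..<2::nat}) :: (nat \<times> nat + nat) set) + card {Inr (length as) :: nat \<times> nat + nat}
      + card (Inr ` {..<length as} :: (nat \<times> nat + nat) set)"
    unfolding Q_def by (intro order_trans[OF card_Un_le] add_right_mono card_Un_le)
  also have "\<dots> = 5 + length as" by (simp add: card_image inj_on_def)
  also have "\<dots> < card U" using neg by (simp add: U_def)
  finally have "card Q < card U" .
  from underdetermined_system[OF fin this, of A] obtain y where
    y: "\<forall>q\<in>Q. (\<Sum>u\<in>U. A q u * y u) = 0" "\<exists>u\<in>U. y u \<noteq> 0" by metis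
  have sumU: "(\<Sum>u\<in>U. p u) = (\<Sum>a<2. \<Sum>i<n. p (a, i))" for p :: "nat \<times> nat \<Rightarrow> 'a"
    unfolding U_def by (simp add: sum.cartesian_product)
  define b where "b a i = y (a, i)" for a i
  have perp: "perp x (b a)" if a: "a < 2" for a
    unfolding perp_def
  proof (intro allI impI)
    fix a' :: nat assume a': "a' < 2"
    have "Inl (a, a') \<in> Q" using a a' by (simp add: Q_def)
    from bspec[OF y(1) this] show "(\<Sum>i<n. b a i * S x a' i) = 0"
      using less_2_cases[OF a] by (auto simp: sumU A_def sum_lessThan_2 b_def mult.commute)
  qed
  have "Inr (length as) \<in> Q" by (simp add: Q_def)
  from bspec[OF y(1) this] have t01: "tangent_pairing x (0, 1) b = 0"
    unfolding sumU tangent_pairing_def by (simp add: A_def b_def mult.commute)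
  have t10: "tangent_pairing x x b = 0"
  proof -
    have "(\<Sum>i<n. b a i * D x x a i) = of_nat (e a) * (\<Sum>i<n. b a i * S x a i)" if a: "a < 2" for a
      unfolding sum_distrib_left
      by (intro sum.cong refl) (use dv_euler[OF sect[OF a], of _ x] in \<open>simp add: D_def curve_value_def\<close>)
    then have "(\<Sum>i<n. b a i * D x x a i) = 0" if a: "a < 2" for a
      using perp[OF a] a by (simp add: perp_def)
    then show ?thesis unfolding tangent_pairing_def by simp
  qed
  have "tangent_pairing x w b = 0" for w
  proof -
    let ?u = "(fst w * fst x, fst w * snd x)" and ?v = "(snd w * fst (0 :: 'a, 1 :: 'a), snd w * snd (0 :: 'a, 1 :: 'a))"
    have "tangent_pairing x w b = tangent_pairing x (fst ?u + fst ?v, snd ?u + snd ?v) b"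
      by (simp add: x_def)
    also have "\<dots> = tangent_pairing x ?u b + tangent_pairing x ?v b" by (rule tangent_pairing_add)
    finally show ?thesis unfolding tangent_pairing_scale t10 t01 by simp
  qed
  then have con: "conormal x b" using perp by (simp add: conormal_def)
  obtain c where c: "\<forall>i<n. \<forall>j<n. conormal_mat x b i j = (\<Sum>l<length as. c l * row_value x l i j)"
    using in_row_span[OF x conormal_kills_normal_relations[OF x con]] ..
  have "c k = 0" if k: "k < length as" for k
  proof -
    have "c k = (\<Sum>l<length as. c l * (\<Sum>i<n. \<Sum>j<n. row_value x l i j * E k i j))"
      using E(1)[OF k] by simp
    also have "\<dots> = (\<Sum>i<n. \<Sum>j<n. E k i j * (\<Sum>l<length as. c l * row_value x l i j))"
      unfolding double_sum_swap by (simp add: mult.commute)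
    also have "\<dots> = (\<Sum>i<n. \<Sum>j<n. conormal_mat x b i j * E k i j)"
      using c by (simp add: mult.commute)
    also have "\<dots> = (\<Sum>a<2. \<Sum>i<n. b a i * (\<Sum>j<n. E k i j * S x a j))"
      by (rule conormal_mat_pairing)
    also have "\<dots> = (\<Sum>u\<in>U. A (Inr k) u * y u)"
      unfolding sumU using k by (simp add: A_def b_def mult.commute)
    also have "\<dots> = 0" by (rule bspec[OF y(1)]) (use k in \<open>simp add: Q_def\<close>)
    finally show ?thesis .
  qed
  then have cm: "conormal_mat x b i j = 0" if "i < n" "j < n" for i j using c that by simp
  have "b a i = 0" if "a < 2" "i < n" for a i
    by (rule S_independent[OF x _ that(1), of "\<lambda>a. b a i"]) (use cm[OF that(2)] in \<open>simp add: conormal_mat_def\<close>)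
  then show False using y(2) by (auto simp: b_def U_def)
qed

text \<open>A section is at every point a combination of the rows, hence a combination with
  polynomial coefficients. Independence at infinity makes the coefficient of row \<open>l\<close> a
  form of degree \<open>m - as ! l\<close>, which is negative.\<close>

lemma no_section_of_smaller_degree:
  assumes z: "conormal_section (int m) z" and less: "\<And>l. l < length as \<Longrightarrow> int m < as ! l" and ai: "a < 2" "i < n"
  shows "z a i = 0"
proof (rule section_mat_eq_zero[OF _ ai], intro allI impI)
  define r where "r = length as"
  \<comment> \<open>Matrix positions are numbered by \<open>q = i * n + j\<close>, to fit the
    natural number indices of \<open>combination_degree_bound\<close>.\<close>
  define G where "G l q = g l (q div n) (q mod n)" for l q
  define y where "y q = section_mat z (q div n) (q mod n)" for q
  have qn: "q div n < n" "q mod n < n" if "q < n * n" for q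
    using that by (auto simp: less_mult_imp_div_less intro!: mod_less_divisor) (metis less_nat_zero_code mult_0_right neq0_conv)
  have qij: "i * n + j < n * n" "(i * n + j) div n = i" "(i * n + j) mod n = j" if "i < n" "j < n" for i j
  proof -
    have "i * n + j < Suc i * n" using that by simp
    also have "\<dots> \<le> n * n" using that by (intro mult_right_mono) auto
    finally show "i * n + j < n * n" .
  qed (use that in auto)
  have ind: "c l = 0" if x: "x \<noteq> (0, 0)" and c: "\<forall>q<n * n. (\<Sum>l<r. c l * ev (as ! l) (G l q) x) = 0" and l: "l < r" for c l x
  proof (rule rows_independent[OF x _ l[unfolded r_def]], intro allI impI)
    fix i j assume ij: "i < n" "j < n"
    from c qij(1)[OF ij] have "(\<Sum>l<r. c l * ev (as ! l) (G l (i * n + j)) x) = 0" by blast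
    then show "(\<Sum>l<length as. c l * row_value x l i j) = 0" using ij by (simp add: G_def row_value_def r_def)
  qed
  have Gt: "ev (as ! l) (G l q) (1, t) = poly (G l q) t" if "l < r" "q < n * n" for l q t
    unfolding G_def by (rule ev_one[OF g_forms]) (use that qn degrees_nonneg in \<open>auto simp: r_def\<close>)
  have "\<exists>\<gamma>. \<forall>q\<in>{..<n * n}. y q = (\<Sum>l<r. \<gamma> l * G l q)"
  proof (rule regular_coefficients)
    show "\<forall>t c. (\<forall>q\<in>{..<n * n}. (\<Sum>l<r. c l * poly (G l q) t) = 0) \<longrightarrow> (\<forall>l<r. c l = 0)"
    proof (intro allI impI)
      fix t c l assume "\<forall>q\<in>{..<n * n}. (\<Sum>l<r. c l * poly (G l q) t) = 0" and l: "l < r"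
      then have "\<forall>q<n * n. (\<Sum>l<r. c l * ev (as ! l) (G l q) (1, t)) = 0" by (simp add: Gt)
      then show "c l = 0" by (rule ind[rotated]) (simp_all add: l)
    qed
    show "\<forall>t. \<exists>c. \<forall>q\<in>{..<n * n}. poly (y q) t = (\<Sum>l<r. c l * poly (G l q) t)"
    proof
      fix t :: 'a
      have "\<exists>c. \<forall>i<n. \<forall>j<n. conormal_mat (1, t) (section_value (int m) z (1, t)) i j = (\<Sum>l<length as. c l * row_value (1, t) l i j)"
        by (rule in_row_span[OF _ conormal_kills_normal_relations[OF _ conormal_section_value[OF z]]]) simp_all
      then obtain c where c: "\<forall>i<n. \<forall>j<n. conormal_mat (1, t) (section_value (int m) z (1, t)) i j = (\<Sum>l<length as. c l * row_value (1, t) l i j)" ..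
      have "poly (y q) t = (\<Sum>l<r. c l * poly (G l q) t)" if q: "q < n * n" for q
      proof -
        have "poly (y q) t = ev (int m) (y q) (1, t)"
          unfolding y_def using ev_one[OF section_mat_forms[OF z qn[OF q]]] by simp
        also have "\<dots> = conormal_mat (1, t) (section_value (int m) z (1, t)) (q div n) (q mod n)"
          unfolding y_def by (rule ev_section_mat[OF z qn[OF q]])
        also have "\<dots> = (\<Sum>l<r. c l * row_value (1, t) l (q div n) (q mod n))" using c qn[OF q] by (simp add: r_def)
        also have "\<dots> = (\<Sum>l<r. c l * poly (G l q) t)"
          by (rule sum.cong[OF refl]) (use Gt[OF _ q] in \<open>simp add: row_value_def G_def\<close>)
        finally show ?thesis .
      qed
      then show "\<exists>c. \<forall>q\<in>{..<n * n}. poly (y q) t = (\<Sum>l<r. c l * poly (G l q) t)" by (intro exI[of _ c]) simp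
    qed
  qed simp
  then obtain \<gamma> where \<gamma>: "\<forall>q\<in>{..<n * n}. y q = (\<Sum>l<r. \<gamma> l * G l q)" ..
  have \<gamma>f: "\<forall>l<r. \<gamma> l \<in> forms (int m - int (nat (as ! l)))"
  proof (rule combination_degree_bound[of r "n * n" G "\<lambda>l. nat (as ! l)"])
    show "G l q \<in> forms (int (nat (as ! l)))" if "l < r" "q < n * n" for l q
      unfolding G_def using g_forms[OF _ qn[OF that(2)]] that(1) degrees_nonneg by (simp add: r_def)
    show "b l = 0" if b: "\<And>q. q < n * n \<Longrightarrow> (\<Sum>l<r. b l * coeff (G l q) (nat (as ! l))) = 0" and "l < r" for b l
      by (rule ind[of "(0, 1)"]) (use that in \<open>simp_all add: ev_infinity\<close>)
    show "(\<Sum>l<r. \<gamma> l * G l q) \<in> forms (int m)" if "q < n * n" for q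
    proof -
      have "y q \<in> forms (int m)" unfolding y_def by (rule section_mat_forms[OF z qn[OF that]])
      then show ?thesis using \<gamma> that by simp
    qed
  qed
  have \<gamma>0: "\<gamma> l = 0" if "l < r" for l
    by (rule forms_negative[OF mp[OF spec[OF \<gamma>f] that]]) (use less[of l] that in \<open>simp add: r_def\<close>)
  fix i j assume ij: "i < n" "j < n"
  have "y (i * n + j) = 0" using \<gamma> qij(1)[OF ij] \<gamma>0 by simp
  then show "section_mat z i j = 0" using ij by (simp add: y_def)
qed

text \<open>Every row is also a section of degree \<open>m\<close>, and the row \<open>l0\<close>,
  whose degree is smaller, contributes a second one through its product with
  \<open>X\<close>.\<close>

lemma sections_of_degree_ge:
  assumes le: "sections_dim_le (int m) \<kappa>" and ge: "\<And>l. l < length as \<Longrightarrow> as ! l \<le> int m" and l0: "l0 < length as" "as ! l0 < int m"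
  shows "length as < \<kappa>"
proof -
  define r where "r = length as"
  have "\<forall>l. \<exists>z. l < r \<longrightarrow> conormal_section (as ! l) z \<and> (\<forall>i<n. \<forall>j<n. g l i j = section_mat z i j)"
    using row_section unfolding r_def by blast
  from choice[OF this] obtain Z where Z: "\<forall>l. l < r \<longrightarrow> conormal_section (as ! l) (Z l) \<and> (\<forall>i<n. \<forall>j<n. g l i j = section_mat (Z l) i j)" ..
  have Zs: "conormal_section (as ! l) (Z l)" and Zg: "i < n \<Longrightarrow> j < n \<Longrightarrow> section_mat (Z l) i j = g l i j" if "l < r" for l i j
    using Z that by auto
  have l0r: "l0 < r" using l0 by (simp add: r_def)
  define B where "B k = (if k < r then Z k else (\<lambda>a i. [:0, 1:] * Z l0 a i))" for k
  have Bs: "\<forall>k<Suc r. conormal_section (int m) (B k)"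
  proof (intro allI impI)
    fix k assume "k < Suc r"
    then consider "k < r" | "k = r" by linarith
    then show "conormal_section (int m) (B k)"
    proof cases
      case 1
      have "1 \<in> (forms (int m - as ! k) :: 'a poly set)" using ge 1 by (intro forms_one) (simp add: r_def)
      from conormal_section_mult[OF Zs[OF 1] this] show ?thesis using 1 by (simp add: B_def)
    next
      case 2
      have "[:0, 1:] \<in> (forms (int m - as ! l0) :: 'a poly set)" using l0 by (simp add: forms_def)
      from conormal_section_mult[OF Zs[OF l0r] this] show ?thesis using 2 by (simp add: B_def del: mult_pCons_left)
    qed
  qed
  have "independent_sections (Suc r) B"
    unfolding independent_sections_def
  proof (intro allI impI)
    fix c k assume c: "\<forall>a<2. \<forall>i<n. (\<Sum>k<Suc r. Polynomial.smult (c k) (B k a i)) = 0" and k: "k < Suc r"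
    have main: "c k + (if k = l0 then c r * t else 0) = 0" if k: "k < r" for k t
    proof (rule rows_independent[of "(1, t)" "\<lambda>k. c k + (if k = l0 then c r * t else 0)" k], simp, intro allI impI)
      fix i j assume ij: "i < n" "j < n"
      have gt: "row_value (1, t) l i j = poly (g l i j) t" if "l < r" for l
        unfolding row_value_def by (rule ev_one[OF g_forms[OF _ ij] degrees_nonneg]) (use that in \<open>simp_all add: r_def\<close>)
      have sg: "poly (g l i j) t = (\<Sum>a<2. poly (Z l a i) t * poly (\<sigma> a j) t)" if "l < r" for l
        unfolding Zg[OF that ij, symmetric] section_mat_def by (simp add: poly_sum)
      have pc: "(\<Sum>k<r. c k * poly (Z k a i) t) + c r * t * poly (Z l0 a i) t = 0" if "a < 2" for a
        using arg_cong[of _ _ "\<lambda>p. poly p t", OF mp[OF spec[OF mp[OF spec[OF c] that]] ij(1)]]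
        by (simp add: B_def poly_sum mult_ac)
      have "(\<Sum>l<length as. (c l + (if l = l0 then c r * t else 0)) * row_value (1, t) l i j)
          = (\<Sum>l<r. c l * poly (g l i j) t) + (\<Sum>l<r. if l = l0 then c r * t * poly (g l0 i j) t else 0)"
        unfolding sum.distrib[symmetric] r_def[symmetric] by (rule sum.cong[OF refl]) (simp add: gt distrib_right)
      also have "\<dots> = (\<Sum>l<r. c l * poly (g l i j) t) + c r * t * poly (g l0 i j) t" using l0r by simp
      also have "\<dots> = (\<Sum>a<2. ((\<Sum>k<r. c k * poly (Z k a i) t) + c r * t * poly (Z l0 a i) t) * poly (\<sigma> a j) t)"
        using l0r by (simp add: sg sum_lessThan_2 distrib_left distrib_right sum.distrib sum_distrib_right mult.assoc)
      also have "\<dots> = 0" using pc by simp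
      finally show "(\<Sum>l<length as. (c l + (if l = l0 then c r * t else 0)) * row_value (1, t) l i j) = 0" .
    qed (use k in \<open>simp add: r_def\<close>)
    \<comment> \<open>At \<open>t = 0\<close> the extra term disappears; afterwards
      \<open>t = 1\<close> isolates \<open>c r\<close>.\<close>
    have c0: "c k = 0" if "k < r" for k using main[OF that, of 0] by (simp split: if_splits)
    moreover have "c r = 0" using main[OF l0r, of 1] c0[OF l0r] by simp
    ultimately show "c k = 0" using k by (cases "k = r") auto
  qed
  from sections_dim_leD[OF le Bs this] show ?thesis by (simp add: r_def)
qed

end

context split_curve
begin

text \<open>Conormal sections \<open>z \<otimes> \<sigma>\<^sub>a\<close> for the section \<open>\<sigma>\<^sub>a\<close> of smaller degree: here the unknowns outnumber the equations.\<close>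

lemma exists_low_degree_section:
  assumes n: "n = 6" and d: "e 0 + e 1 = d" "d = 3 \<or> d = 5" "m = d - 2"
  shows "\<exists>z. conormal_section (int m) z \<and> (\<exists>a<2. \<exists>i<n. z a i \<noteq> 0)"
proof -
  obtain a b where ab: "a < 2" "b < 2" "{a, b} = {0, 1}" "2 * e a < d" "e a + e b = d"
  proof (cases "2 * e 0 < d")
    case True
    then show thesis using that[of 0 1] d by simp
  next
    case False
    then have "2 * e 1 < d" "e 1 + e 0 = d" using d(1,2) by presburger+
    then show thesis by (intro that[of 1 0]) auto
  qed
  have am: "e a \<le> m" using ab d by auto
  define p where "p = (\<lambda>c. [\<sigma> a, \<sigma> b, \<lambda>i. pderiv (\<sigma> a i)] ! c)"
  \<comment> \<open>The numbers of coefficients of the products of \<open>z\<close> with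
    \<open>\<sigma> a\<close>, with \<open>\<sigma> b\<close> and with the derivative of
    \<open>\<sigma> a\<close>; the last has degree \<open>m - 2\<close>. For
    \<open>m = d - 2\<close> the unknowns exceed the equations by
    \<open>2 * d - 1 - 4 * e a\<close>, which is positive because
    \<open>2 * e a < d\<close>.\<close>
  define N :: "nat \<Rightarrow> nat" where "N = (\<lambda>c. [m + 1, m - e a + e b + 1, m - 1] ! c)"
  define I where "I = {..<6::nat} \<times> {..m - e a}"
  define Q where "Q = (SIGMA c:{..<3::nat}. {..<N c})"
  define A where "A q u = coeff (monom 1 (snd u) * p (fst q) (fst u)) (snd q)" for q u :: "nat \<times> nat"
  have fin: "finite I" "finite Q" by (simp_all add: I_def Q_def)
  have "card Q = N 0 + N 1 + N 2" unfolding Q_def by (simp add: sum_lessThan_3)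
  also have "\<dots> < card I" using ab d by (auto simp: N_def I_def)
  finally obtain x where x: "\<forall>q\<in>Q. (\<Sum>u\<in>I. A q u * x u) = 0" "\<exists>u\<in>I. x u \<noteq> 0"
    by (rule underdetermined_system[OF fin, of A]) (rule that)
  define z where "z i = (\<Sum>k\<le>m - e a. monom (x (i, k)) k)" for i
  have z: "z i \<in> forms (int m - int (e a))" for i
    unfolding z_def by (intro forms_sum forms_monom) (use am in auto)
  have eq: "coeff (\<Sum>i<n. z i * p c i) k = 0" if "c < 3" "k < N c" for c k
  proof -
    have "(c, k) \<in> Q" using that by (simp add: Q_def)
    from bspec[OF x(1) this] have "(\<Sum>i<n. \<Sum>l\<le>m - e a. coeff (monom 1 l * p c i) k * x (i, l)) = 0"
      by (simp add: I_def A_def n sum.cartesian_product case_prod_unfold)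
    moreover have "coeff (z i * p c i) k = (\<Sum>l\<le>m - e a. coeff (monom 1 l * p c i) k * x (i, l))" for i
    proof -
      have *: "monom (x (i, l)) l * p c i = Polynomial.smult (x (i, l)) (monom 1 l * p c i)" for l
        by (simp only: mult_smult_left[symmetric] smult_monom mult_1_right)
      show ?thesis unfolding z_def sum_distrib_right * coeff_sum by (simp add: mult.commute)
    qed
    ultimately show ?thesis unfolding coeff_sum by (simp only:)
  qed
  define Z where "Z a' i = (if a' = a then z i else 0)" for a' i
  have s: "(\<Sum>i<n. z i * \<sigma> b' i) = 0" if "b' < 2" for b'
  proof -
    have f: "(\<Sum>i<n. z i * \<sigma> b' i) \<in> forms (int m - int (e a) + int (e b'))"
      by (intro forms_sum forms_mult[OF z sect[OF that]]) simp
    have "b' \<in> {a, b}" unfolding ab(3) using that by auto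
    then consider "b' = a" | "b' = b" by blast
    then show ?thesis
    proof cases
      case 1
      show ?thesis
        by (rule forms_eq_0I[OF f]) (use eq[of 0] 1 am in \<open>simp add: p_def N_def\<close>)
    next
      case 2
      show ?thesis
        by (rule forms_eq_0I[OF f]) (use eq[of 1] 2 am in \<open>simp add: p_def N_def\<close>)
    qed
  qed
  have perp: "perp_section (int m) Z"
    unfolding perp_section_def
  proof (intro conjI allI impI)
    fix a' b' assume b': "b' < (2::nat)"
    show "(\<Sum>i<n. Z a' i * \<sigma> b' i) = 0" by (cases "a' = a") (simp_all add: Z_def s[OF b'])
  qed (simp add: Z_def z)
  have tf: "tangent_form Z = (\<Sum>i<n. z i * pderiv (\<sigma> a i))"
    using less_2_cases[OF ab(1)] by (auto simp: tangent_form_def sum_lessThan_2 Z_def)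
  have "tangent_form Z = 0"
    by (rule forms_eq_0I[OF tangent_form_forms_and_pairing(1)[OF perp]])
      (use eq[of 2] in \<open>simp add: tf p_def N_def\<close>)
  then have "conormal_section (int m) Z" using perp by (simp add: conormal_section_def)
  moreover obtain i k where ik: "(i, k) \<in> I" "x (i, k) \<noteq> 0" using x(2) by auto
  have "coeff (z i) k = x (i, k)"
    using ik(1) by (simp add: z_def coeff_sum I_def)
  then have "Z a i \<noteq> 0" using ik(2) by (auto simp: Z_def)
  moreover have "i < n" using ik(1) n by (simp add: I_def)
  ultimately show ?thesis using ab(1) by blast
qed

text \<open>\<open>d + 2\<close> is the Euler characteristic of the twist \<open>d - 1\<close>. The
  section in degree \<open>d - 2\<close> forces a summand of degree at most \<open>d - 2\<close>. In
  a balanced bundle all degrees would then be at most \<open>d - 1\<close>, giving at least 8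
  sections in the twist \<open>d - 1\<close>, but \<open>d + 2\<close> is at most 7.\<close>

theorem unbalanced_if_section_bound:
  assumes n: "n = 6" and d: "e 0 + e 1 = d" "d = 3 \<or> d = 5" and le: "sections_dim_le (int (d - 1)) (d + 2)"
  shows "unramified n f \<and> \<not> balanced_normal_bundle n f"
proof
  show "unramified n f"
    by (rule unramified_if_dim_le[OF _ _ le]) (use n d in auto)
  show "\<not> balanced_normal_bundle n f"
  proof
    assume "balanced_normal_bundle n f"
    then obtain as where sp: "quotient_bundle_splits n (normal_relations n f) as"
      and bal: "\<forall>a\<in>set as. \<forall>b\<in>set as. \<bar>a - b\<bar> \<le> 1"
      unfolding balanced_normal_bundle_def by blast
    from sp obtain g where g: "\<forall>l<length as. \<forall>i<n. \<forall>j<n. g l i j \<in> forms (as ! l)"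
      "\<forall>x. x \<noteq> (0, 0) \<longrightarrow> matrix_hom n as g x ` carrier_mat n n = carrier_vec (length as) \<and>
         {M \<in> carrier_mat n n. matrix_hom n as g x M = 0\<^sub>v (length as)} = normal_relations n f x"
      unfolding quotient_bundle_splits_def by (elim exE conjE)
    interpret split_conormal n e \<sigma> f as g
    proof
      show "g l i j \<in> forms (as ! l)" if "l < length as" "i < n" "j < n" for l i j using g(1) that by simp
      show "matrix_hom n as g x ` carrier_mat n n = carrier_vec (length as)" if "x \<noteq> (0, 0)" for x
        by (rule conjunct1[OF mp[OF spec[OF g(2)] that]])
      show "{M \<in> carrier_mat n n. matrix_hom n as g x M = 0\<^sub>v (length as)} = normal_relations n f x" if "x \<noteq> (0, 0)" for x
        by (rule conjunct2[OF mp[OF spec[OF g(2)] that]])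
    qed
    obtain z a i where z: "conormal_section (int (d - 2)) z" "a < 2" "i < n" "z a i \<noteq> 0"
      using exists_low_degree_section[OF n d refl] by (elim exE conjE)
    have "\<exists>l<length as. as ! l \<le> int (d - 2)"
    proof (rule ccontr)
      assume neg: "\<not> (\<exists>l<length as. as ! l \<le> int (d - 2))"
      have "int (d - 2) < as ! l" if l: "l < length as" for l
      proof (rule ccontr)
        assume "\<not> int (d - 2) < as ! l"
        then have "as ! l \<le> int (d - 2)" by simp
        with neg l show False by blast
      qed
      then have "z a i = 0" by (rule no_section_of_smaller_degree[OF z(1) _ z(2,3)])
      with z(4) show False by contradiction
    qed
    then obtain l0 where l0: "l0 < length as" "as ! l0 \<le> int (d - 2)" by blast
    have "length as < d + 2"
    proof (rule sections_of_degree_ge[OF le _ l0(1)])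
      show "as ! l0 < int (d - 1)" using l0(2) d by auto
      show "as ! l \<le> int (d - 1)" if "l < length as" for l
      proof -
        have "\<bar>as ! l - as ! l0\<bar> \<le> 1" using bal that l0(1) by simp
        then show ?thesis using l0(2) d by auto
      qed
    qed
    then show False using length_ge n d by auto
  qed
qed

end

theorem unbalanced_general:
  assumes d: "d = 3 \<or> d = 5" and char: "CHAR('a) = 0"
  shows "for_general_curve 2 6 d (\<lambda>f :: 'a::alg_closed_field \<times> 'a \<Rightarrow> 'a vec set. unramified 6 f \<and> \<not> balanced_normal_bundle 6 f)"
proof -
  obtain as where as: "length as = 7" "sum_list as + 2 = 6 * d" "\<forall>x\<in>set as. x \<le> d"
    "\<forall>Ms. finite Ms \<longrightarrow> bounded_curve TYPE('a) 6 d as Ms"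
    using unbalanced_example_6[OF assms] by (elim exE conjE)
  have "\<forall>x\<in>set as. x \<le> (d - 1) + 1" using as(3) d by auto
  from sum_list_nat_diff[OF this] have \<kappa>: "(\<Sum>x\<leftarrow>as. nat (int (d - 1) + 1 - int x)) = d + 2"
    using as(1,2) d by auto
  show ?thesis
  proof (rule for_general_curveI[of 6 d as "{d - 1}"])
    show "bounded_curve TYPE('a) 6 d as {d - 1}" by (rule mp[OF spec[OF as(4)]]) simp
    fix f :: "'a \<times> 'a \<Rightarrow> 'a vec set" and e \<sigma>
    assume sc: "split_curve 6 e \<sigma> f" and e: "e 0 + e 1 = d"
      and le: "\<forall>m\<in>{d - 1}. split_curve.sections_dim_le 6 e \<sigma> (int m) (\<Sum>x\<leftarrow>as. nat (int m + 1 - int x))"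
    have "split_curve.sections_dim_le 6 e \<sigma> (int (d - 1)) (\<Sum>x\<leftarrow>as. nat (int (d - 1) + 1 - int x))"
      by (rule bspec[OF le]) simp
    then show "unramified 6 f \<and> \<not> balanced_normal_bundle 6 f"
      unfolding \<kappa> by (intro split_curve.unbalanced_if_section_bound[OF sc refl e d])
  qed simp
qed

section \<open>Arithmetic of the exceptional degrees and the conclusion\<close>

lemma exceptional_4:
  "\<not> (\<exists>q1 r1 q2 r2 :: nat. d = 2 * q1 + r1 \<and> r1 < 2 \<and> d = 2 * q2 + r2 \<and> r2 < 2 \<and>
     d \<noteq> 1 \<and> r1 \<noteq> 0 \<and> r2 \<noteq> 0 \<and> q1 + q2 \<le> (2 - r1) * (2 - r2))"
proof (intro notI, elim exE conjE)
  fix q1 r1 q2 r2 :: nat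
  assume d: "d = 2 * q1 + r1" "d = 2 * q2 + r2" "d \<noteq> 1" and r: "r1 < 2" "r2 < 2" "r1 \<noteq> 0" "r2 \<noteq> 0"
    and q: "q1 + q2 \<le> (2 - r1) * (2 - r2)"
  have "r1 = 1" "r2 = 1" using r by linarith+
  with d q show False by simp
qed

lemma exceptional_5:
  "\<not> (\<exists>q1 r1 q2 r2 :: nat. d = 2 * q1 + r1 \<and> r1 < 2 \<and> d = 3 * q2 + r2 \<and> r2 < 3 \<and>
     d \<noteq> 1 \<and> r1 \<noteq> 0 \<and> r2 \<noteq> 0 \<and> q1 + q2 \<le> (2 - r1) * (3 - r2))"
proof (intro notI, elim exE conjE)
  fix q1 r1 q2 r2 :: nat
  assume d: "d = 2 * q1 + r1" "d = 3 * q2 + r2" "d \<noteq> 1" and r: "r1 < 2" "r2 < 3" "r1 \<noteq> 0" "r2 \<noteq> 0"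
    and q: "q1 + q2 \<le> (2 - r1) * (3 - r2)"
  have r1: "r1 = 1" and "r2 = 1 \<or> r2 = 2" using r by linarith+
  from this(2) show False
  proof
    assume "r2 = 1"
    with d q r1 show False by simp presburger
  next
    assume "r2 = 2"
    with d q r1 show False by simp presburger
  qed
qed

text \<open>The interval contributes \<open>d = 3\<close>. In the second condition
  \<open>r1 = 1\<close> makes \<open>d\<close> odd: \<open>r2 = 1\<close> leaves
  \<open>d = 5\<close> with quotients 2 and 1, and \<open>r2 = 3\<close> leaves \<open>d = 3\<close>
  with quotients 1 and 0.\<close>

lemma exceptional_6:
  "(2 < d \<and> d < 4 \<or> (\<exists>q1 r1 q2 r2 :: nat. d = 2 * q1 + r1 \<and> r1 < 2 \<and> d = 4 * q2 + r2 \<and> r2 < 4 \<and>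
     d \<noteq> 1 \<and> r1 \<noteq> 0 \<and> r2 \<noteq> 0 \<and> q1 + q2 \<le> (2 - r1) * (4 - r2))) \<longleftrightarrow> d = 3 \<or> d = 5" (is "_ \<or> ?ex \<longleftrightarrow> _")
proof
  assume "2 < d \<and> d < 4 \<or> ?ex"
  then show "d = 3 \<or> d = 5"
  proof
    assume ?ex
    then obtain q1 r1 q2 r2 :: nat where d: "d = 2 * q1 + r1" "d = 4 * q2 + r2" "d \<noteq> 1" and r: "r1 < 2" "r2 < 4" "r1 \<noteq> 0" "r2 \<noteq> 0"
      and q: "q1 + q2 \<le> (2 - r1) * (4 - r2)" by (elim exE conjE)
    have r1: "r1 = 1" and "r2 = 1 \<or> r2 = 2 \<or> r2 = 3" using r by linarith+
    from this(2) show ?thesis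
    proof (elim disjE)
      assume "r2 = 1"
      with d q r1 show ?thesis by simp
    next
      assume "r2 = 2"
      with d r1 show ?thesis by presburger
    next
      assume "r2 = 3"
      with d q r1 show ?thesis by simp
    qed
  qed simp
next
  assume "d = 3 \<or> d = 5"
  then show "2 < d \<and> d < 4 \<or> ?ex"
  proof
    assume "d = 5"
    then show ?thesis by (intro disjI2 exI[of _ 2] exI[of _ 1]) simp
  qed simp
qed

theorem theorem1p2:
  fixes k n d :: nat
  assumes "(k = 2 \<and> n = 4 \<and> CHAR('a::alg_closed_field) = 0) \<or>
           (k = 2 \<and> n = 6 \<and> CHAR('a) = 0) \<or>
           (k = 2 \<and> n = 5)"
    and "d \<ge> 1"
  shows "for_general_curve k n d (\<lambda>f :: 'a \<times> 'a \<Rightarrow> 'a vec set.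
    unramified n f \<and>
    (balanced_normal_bundle n f \<longleftrightarrow>
      \<not> ((1 < d \<and> d < min k (n - k) \<or> min k (n - k) < d \<and> d < max k (n - k)) \<or>
         (\<exists>q\<^sub>1 r\<^sub>1 q\<^sub>2 r\<^sub>2. d = k * q\<^sub>1 + r\<^sub>1 \<and> r\<^sub>1 < k \<and> d = (n - k) * q\<^sub>2 + r\<^sub>2 \<and> r\<^sub>2 < n - k \<and>
            d \<noteq> 1 \<and> r\<^sub>1 \<noteq> 0 \<and> r\<^sub>2 \<noteq> 0 \<and> q\<^sub>1 + q\<^sub>2 \<le> (k - r\<^sub>1) * (n - k - r\<^sub>2)) \<or>
         (CHAR('a) = 2 \<and> (k = 1 \<or> k = n - 1) \<and> \<not> [d = 1] (mod (n - 2))))))"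
    (is "for_general_curve k n d (\<lambda>f. unramified n f \<and> (balanced_normal_bundle n f \<longleftrightarrow> \<not> ?exc))")
proof -
  have k: "k = 2" using assms(1) by blast
  have r: "d \<le> Suc 0 \<or> 2 \<le> d" "d \<le> 2 \<or> 2 \<le> d" "d \<le> 2 \<or> 3 \<le> d" by arith+
  consider "n = 4" "CHAR('a) = 0" | "n = 5" | "n = 6" "CHAR('a) = 0" "d \<noteq> 3" "d \<noteq> 5"
    | "n = 6" "CHAR('a) = 0" "d = 3 \<or> d = 5" using assms(1) by (cases "d = 3 \<or> d = 5") auto
  then show ?thesis
  proof cases
    case 1
    have "\<not> ?exc" unfolding k 1(1) using exceptional_4[of d] r by (simp add: not_less)
    then show ?thesis
      using balanced_if_example[OF _ balanced_example_4[OF assms(2) 1(2)]] unfolding k 1(1) by simp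
  next
    case 2
    have "\<not> ?exc" unfolding k 2 using exceptional_5[of d] r by (simp add: not_less)
    then show ?thesis
      using balanced_if_example[OF _ balanced_example_5[OF assms(2), where 'a = 'a]] unfolding k 2 by simp
  next
    case 3
    have "\<not> ?exc" unfolding k 3(1) using exceptional_6[of d] 3(3,4) r by (simp add: not_less)
    then show ?thesis
      using balanced_if_example[OF _ balanced_example_6[OF assms(2) 3(3,4,2)]] unfolding k 3(1) by simp
  next
    case 4
    have "?exc" unfolding k 4(1) using exceptional_6[of d] 4(3) by simp
    then show ?thesis
      using unbalanced_general[OF 4(3,2)] unfolding k 4(1) by simp
  qed
qed

end
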